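(* Let $L_1$ be an analytic Jordan curve with interior $G_1$, let $\{p_n\}_{n\ge 0}$ be the polynomials orthonormal over $G_1$ with respect to $\pi^{-1}dx\,dy$, and let $\Sigma_1\subset G_1$, $\Phi:\Sigma_1\to\mathbb{C}$ and $r:G_1\to[\mu,1)$ be as defined in the context. Then: (a) For every compact set $E\subset\Sigma_1$ there exists a number $0<\delta<1$ such that $$\frac{p_n(z)}{\sqrt{n+1}\,[\Phi(z)]^n}-\Phi'(z)=O(\delta^n)$$ uniformly on $E$ as $n\to\infty$. (b) For every $z\in G_1$, $$\limsup_{n\to\infty}|p_n(z)|^{1/n}=r(z).$$
   Context: $L_1$ is an analytic Jordan curve in $\mathbb{C}$; $G_1$ is the bounded component of $\mathbb{C}\setminus L_1$ and $\Omega_1$ the unbounded component of $\overline{\mathbb{C}}\setminus L_1$. For $n\ge0$, $p_n$ is the polynomial of degree $n$ with positive leading coefficient such that $\frac1\pi\int_{G_1}p_n\overline{p_m}\,dx\,dy=\delta_{nm}$ for all $n,m\ge 0$. For $r\ge 0$: $\Delta_r=\{w: r<|w|\le\infty\}$, $\mathbb{D}_r=\{w:|w|<r\}$. $\psi$ is the conformal map of $\Delta_1$ onto $\Omega_1$ with $\psi(\infty)=\infty$, $\psi'(\infty)>0$. $\rho\in[0,1)$ is the smallest number such that $\psi$ has an analytic and univalent continuation to $\rho<|w|<\infty$ (still denoted $\psi$). For $\rho\le r<\infty$: $\Omega_r=\psi(\Delta_r)$, $G_r=\mathbb{C}\setminus\overline{\Omega_r}$. (Convention: $1/0=\infty$,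 $G_\infty=\mathbb{C}$.) $\varphi$ is a conformal map of $G_1$ onto the unit disk $\mathbb{D}_1$; it has a one-to-one meromorphic continuation (still denoted $\varphi$) to $G_{1/\rho}$, so $\varphi(\psi(w))$ is a one-to-one meromorphic function on $\rho<|w|<1/\rho$, analytic on $\rho<|w|\le1$. $\mu\ge0$ is the smallest number such that $\varphi(\psi(w))$ has a meromorphic continuation, denoted $h_\varphi(w)$, to $\mu<|w|<1/\rho$. $\Sigma$ is the set of $z\in G_1$ for which the equation $h_\varphi(w)=\varphi(z)$ has at least one solution $w$ in $\mu<|w|<1$; $\Sigma_0=G_1\setminus\Sigma$. A solution $\omega$ has multiplicity $\alpha\ge1$ if $h_\varphi^{(j)}(\omega)=0$ for $1\le j<\alpha$ and $h_\varphi^{(\alpha)}(\omega)\ne0$. For $z\in\Sigma$ there are finitely many solutions of largest modulus in $\mu<|w|<1$, denoted $\omega_{z,1},\dots,\omega_{z,s}$. $\Sigma_1$ is the set of $z\in\Sigma$ for which there is exactly one solution of largest modulus and it is simple (multiplicity $1$). $\Phi(z)=\omega_{z,1}$ for $z\in\Sigma_1$ (this is analytic on the open set $\Sigma_1$). $r(z)=|\omega_{z,1}|$ for $z\in\Sigma$ and $r(z)=\mu$ for $z\in\Sigma_0$. All of $\mu,\Sigma,\Sigma_0,\Sigma_1,\Phi,r$ are independent of the choice of $\varphi$. *)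

theory Defs
  imports "HOL-Complex_Analysis.Complex_Analysis"
begin

definition analytic_jordan_curve :: "complex set \<Rightarrow> bool" where
  "analytic_jordan_curve L \<longleftrightarrow>
     (\<exists>U f. open U \<and> sphere 0 1 \<subseteq> U \<and> f holomorphic_on U \<and> inj_on f U \<and> L = f ` sphere 0 1)"

text \<open>\<open>G\<^sub>1\<close> is \<^term>\<open>inside L\<close>, and the finite part of \<open>\<Omega>\<^sub>1\<close> is
  \<^term>\<open>outside L\<close>. Since \<^term>\<open>lborel\<close> on the complex plane is planar Lebesgue measure,
  integration against it is integration with respect to dx dy.\<close>

definition orthonormal_polys :: "complex set \<Rightarrow> (nat \<Rightarrow> complex poly) \<Rightarrow> bool" where
  "orthonormal_polys L p \<longleftrightarrow>
     (\<forall>n. degree (p n) = n \<and> (\<exists>c::real. c > 0 \<and> lead_coeff (p n) = of_real c)) \<and>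
     (\<forall>n m. 1 / of_real pi * (LINT z:inside L|lborel. poly (p n) z * cnj (poly (p m) z))
              = (if n = m then 1 else 0))"

text \<open>The finite points of the ring \<open>a < |w| < b\<close>. Bounds are extended reals, so that
  \<open>1 / 0 = \<infinity>\<close> holds; \<^term>\<open>annulus r \<infinity>\<close> is the finite part of \<open>\<Delta>\<^sub>r\<close>.\<close>

definition annulus :: "ereal \<Rightarrow> ereal \<Rightarrow> complex set" where
  "annulus a b = {w. a < ereal (norm w) \<and> ereal (norm w) < b}"

text \<open>A conformal map of the exterior of the unit disk (with \<open>\<infinity>\<close>) onto the exterior of \<open>L\<close>
  (with \<open>\<infinity>\<close>), described on the finite points. The third conjunct is \<open>\<psi>(\<infinity>) = \<infinity>\<close>; the
  derivative at \<open>\<infinity>\<close> is the coefficient of \<open>w\<close> in the Laurent expansion of \<open>\<psi>\<close> there.\<close>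

definition exterior_map :: "complex set \<Rightarrow> (complex \<Rightarrow> complex) \<Rightarrow> bool" where
  "exterior_map L \<psi> \<longleftrightarrow>
     \<psi> holomorphic_on annulus 1 \<infinity> \<and> bij_betw \<psi> (annulus 1 \<infinity>) (outside L) \<and>
     filterlim \<psi> at_infinity at_infinity \<and>
     (\<exists>c::real. c > 0 \<and> ((\<lambda>w. \<psi> w / w) \<longlongrightarrow> of_real c) at_infinity)"

definition interior_map :: "complex set \<Rightarrow> (complex \<Rightarrow> complex) \<Rightarrow> bool" where
  "interior_map L \<phi> \<longleftrightarrow> \<phi> holomorphic_on inside L \<and> bij_betw \<phi> (inside L) (ball 0 1)"

definition univalent_continuation :: "(complex \<Rightarrow> complex) \<Rightarrow> real \<Rightarrow> (complex \<Rightarrow> complex) \<Rightarrow> bool" where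
  "univalent_continuation \<psi> r g \<longleftrightarrow>
     g holomorphic_on annulus (ereal r) \<infinity> \<and> inj_on g (annulus (ereal r) \<infinity>) \<and>
     (\<forall>w \<in> annulus 1 \<infinity>. g w = \<psi> w)"

definition rho :: "(complex \<Rightarrow> complex) \<Rightarrow> real" where
  "rho \<psi> = (LEAST r. 0 \<le> r \<and> r < 1 \<and> (\<exists>g. univalent_continuation \<psi> r g))"

text \<open>By the identity theorem the continuations chosen by \<open>SOME\<close> here and below are unique
  on the domain in question; their values elsewhere are never used.\<close>

definition psi_ext :: "(complex \<Rightarrow> complex) \<Rightarrow> complex \<Rightarrow> complex" where
  "psi_ext \<psi> = (SOME g. univalent_continuation \<psi> (rho \<psi>) g)"

text \<open>\<open>G\<^sub>r\<close>; for \<open>r = \<infinity>\<close> the removed set is empty and this is the whole plane.\<close>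

definition G_dom :: "(complex \<Rightarrow> complex) \<Rightarrow> ereal \<Rightarrow> complex set" where
  "G_dom \<psi> r = - closure (psi_ext \<psi> ` annulus r \<infinity>)"

text \<open>Using \<^term>\<open>g nicely_meromorphic_on B\<close> removes spurious removable singularities and
  fixes the value at poles to be 0, so that \<open>g\<close> is determined on \<open>B\<close>.\<close>

definition mero_continuation ::
  "(complex \<Rightarrow> complex) \<Rightarrow> complex set \<Rightarrow> (complex \<Rightarrow> complex) \<Rightarrow> complex set \<Rightarrow> bool" where
  "mero_continuation f A g B \<longleftrightarrow>
     A \<subseteq> B \<and> g nicely_meromorphic_on B \<and> (\<forall>w\<in>A. g w = f w)"

definition phi_ext :: "complex set \<Rightarrow> (complex \<Rightarrow> complex) \<Rightarrow> (complex \<Rightarrow> complex) \<Rightarrow> complex \<Rightarrow> complex" where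
  "phi_ext L \<psi> \<phi> = (SOME g. mero_continuation \<phi> (inside L) g (G_dom \<psi> (1 / ereal (rho \<psi>))))"

text \<open>\<open>h\<close> is a meromorphic continuation of \<open>\<phi>(\<psi>(w))\<close>, given on \<open>\<rho> < |w| < 1/\<rho>\<close>,
  to \<open>m < |w| < 1/\<rho>\<close>.\<close>

definition comp_continuation ::
  "complex set \<Rightarrow> (complex \<Rightarrow> complex) \<Rightarrow> (complex \<Rightarrow> complex) \<Rightarrow> real \<Rightarrow> (complex \<Rightarrow> complex) \<Rightarrow> bool" where
  "comp_continuation L \<psi> \<phi> m h \<longleftrightarrow>
     mero_continuation (\<lambda>w. phi_ext L \<psi> \<phi> (psi_ext \<psi> w))
       (annulus (ereal (rho \<psi>)) (1 / ereal (rho \<psi>))) h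
       (annulus (ereal m) (1 / ereal (rho \<psi>)))"

definition mu :: "complex set \<Rightarrow> (complex \<Rightarrow> complex) \<Rightarrow> (complex \<Rightarrow> complex) \<Rightarrow> real" where
  "mu L \<psi> \<phi> = (LEAST m. 0 \<le> m \<and> (\<exists>h. comp_continuation L \<psi> \<phi> m h))"

definition h_phi :: "complex set \<Rightarrow> (complex \<Rightarrow> complex) \<Rightarrow> (complex \<Rightarrow> complex) \<Rightarrow> complex \<Rightarrow> complex" where
  "h_phi L \<psi> \<phi> = (SOME h. comp_continuation L \<psi> \<phi> (mu L \<psi> \<phi>) h)"

text \<open>Poles have to be excluded explicitly because there the HOL value of the function is 0.\<close>

definition solutions ::
  "complex set \<Rightarrow> (complex \<Rightarrow> complex) \<Rightarrow> (complex \<Rightarrow> complex) \<Rightarrow> complex \<Rightarrow> complex set" where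
  "solutions L \<psi> \<phi> z =
     {w \<in> annulus (ereal (mu L \<psi> \<phi>)) 1. \<not> is_pole (h_phi L \<psi> \<phi>) w \<and> h_phi L \<psi> \<phi> w = \<phi> z}"

definition largest_solutions ::
  "complex set \<Rightarrow> (complex \<Rightarrow> complex) \<Rightarrow> (complex \<Rightarrow> complex) \<Rightarrow> complex \<Rightarrow> complex set" where
  "largest_solutions L \<psi> \<phi> z =
     {w \<in> solutions L \<psi> \<phi> z. \<forall>v \<in> solutions L \<psi> \<phi> z. norm v \<le> norm w}"

definition has_multiplicity :: "(complex \<Rightarrow> complex) \<Rightarrow> complex \<Rightarrow> nat \<Rightarrow> bool" where
  "has_multiplicity h \<omega> \<alpha> \<longleftrightarrow>
     \<alpha> \<ge> 1 \<and> (\<forall>j. 1 \<le> j \<and> j < \<alpha> \<longrightarrow> (deriv ^^ j) h \<omega> = 0) \<and> (deriv ^^ \<alpha>) h \<omega> \<noteq> 0"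

definition Sigma_all :: "complex set \<Rightarrow> (complex \<Rightarrow> complex) \<Rightarrow> (complex \<Rightarrow> complex) \<Rightarrow> complex set" where
  "Sigma_all L \<psi> \<phi> = {z \<in> inside L. solutions L \<psi> \<phi> z \<noteq> {}}"

definition Sigma_one :: "complex set \<Rightarrow> (complex \<Rightarrow> complex) \<Rightarrow> (complex \<Rightarrow> complex) \<Rightarrow> complex set" where
  "Sigma_one L \<psi> \<phi> =
     {z \<in> Sigma_all L \<psi> \<phi>. \<exists>\<omega>. largest_solutions L \<psi> \<phi> z = {\<omega>} \<and>
                              has_multiplicity (h_phi L \<psi> \<phi>) \<omega> 1}"

definition Phi :: "complex set \<Rightarrow> (complex \<Rightarrow> complex) \<Rightarrow> (complex \<Rightarrow> complex) \<Rightarrow> complex \<Rightarrow> complex" where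
  "Phi L \<psi> \<phi> z = (THE \<omega>. \<omega> \<in> largest_solutions L \<psi> \<phi> z)"

definition radius :: "complex set \<Rightarrow> (complex \<Rightarrow> complex) \<Rightarrow> (complex \<Rightarrow> complex) \<Rightarrow> complex \<Rightarrow> real" where
  "radius L \<psi> \<phi> z =
     (if z \<in> Sigma_all L \<psi> \<phi> then norm (SOME \<omega>. \<omega> \<in> largest_solutions L \<psi> \<phi> z)
      else mu L \<psi> \<phi>)"

end

theory Submission
  imports Defs
begin

text \<open>
  Since \<open>\<psi>\<close> and \<open>\<phi>\<close> continue across \<open>L\<^sub>1\<close> and \<open>|h| = 1\<close> on the unit circle, Green's formula turns the area
  inner product with a derivative \<open>Q'\<close> into the contour integral of \<open>p(\<psi>) \<psi>'\<close> against the conjugate of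
  \<open>Q(\<psi>)\<close>. Expanding the kernel \<open>u / (1 - u cnj (\<phi> z))\<close>, taken at \<open>u = \<phi>\<close>, in the Faber polynomials
  \<open>F\<^sub>m\<close> of \<open>\<psi>\<close> and using the orthogonality of \<open>p\<^sub>n\<close> to lower degrees yields
  \<open>p\<^sub>n(z) = \<phi>'(z) (\<Sum>j\<ge>n. e\<^sub>j(z) d\<^sub>n\<^sub>j)\<close>, where \<open>e\<^sub>j(z)\<close> is the coefficient of \<open>w\<close> to the power \<open>-j-1\<close> in the
  Laurent expansion of \<open>1 / (h(w) - \<phi>(z))\<close> on the unit circle and \<open>d\<^sub>n\<^sub>j\<close> is the inner product of
  \<open>p\<^sub>n\<close> with the derivative of \<open>F\<close> of index \<open>j + 1\<close>. As \<open>F\<^sub>m(\<psi>(w)) - w\<^sup>m\<close> is exponentially small in \<open>m\<close> on the unit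
  circle, \<open>d\<^sub>n\<^sub>j\<close> is exponentially small in \<open>j\<close> for \<open>j > n\<close> and \<open>d\<^sub>n\<^sub>n\<close> is exponentially close to the square root
  of \<open>n + 1\<close>. So \<open>p\<^sub>n(z)\<close> behaves like \<open>e\<^sub>n(z)\<close>, whose size is governed by the solutions of
  \<open>h(w) = \<phi>(z)\<close> of largest modulus: the residue of a simple one gives (a). In (b), a faster decay of
  \<open>e\<^sub>n(z)\<close> would continue \<open>1 / (h - \<phi>(z))\<close> into a larger ring, which contradicts the presence of a
  solution there or the minimality of \<open>\<mu>\<close>.
\<close>

section \<open>Area integrals over the disc\<close>

text \<open>The hypotheses give \<open>\<psi>\<close> and \<open>\<phi>\<close> only on open sets,
  without boundary values, so regularity at the curve has to be produced first. In an analytic chart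
  of \<open>L\<close> (for \<open>\<psi>\<close>) and on the ring below the unit circle (for
  \<open>\<phi> (\<psi> w)\<close>), both become univalent functions whose modulus tends to 1 at the
  circle, and one reflection lemma continues both. Green's formula is then needed only on the unit
  disc: the inverse \<open>\<kappa>\<close> of \<open>\<phi>\<close> is holomorphic past the closed
  disc, so the formula can be read off Taylor coefficients, and substituting \<open>h\<close>
  carries the boundary integral to the \<open>w\<close>-plane, where every contour is a circle about
  0. The size of the diagonal coefficient comes from two facts: its product with the leading
  coefficient \<open>lc n\<close> of \<open>p_n(\<psi>) \<psi>'\<close> at infinity is exactly n +
  1, and the two numbers differ exponentially little. In the series for \<open>p n\<close> the terms
  after the first carry an extra factor \<open>r ^ n\<close> with \<open>r < 1\<close>, so they stay
  negligible even when \<open>e_coeff\<close> is only estimated with a base slightly above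
  \<open>radius\<close>; this slack makes the lower bound in (b) possible.\<close>

definition to_plane :: "complex \<Rightarrow> real^2" where "to_plane z = vector [Re z, Im z]"
definition of_plane :: "real^2 \<Rightarrow> complex" where "of_plane v = Complex (vec_nth v 1) (vec_nth v 2)"

lemma of_to_plane [simp]: "of_plane (to_plane z) = z"
  by (simp add: complex_eq_iff of_plane_def to_plane_def)

lemma to_of_plane [simp]: "to_plane (of_plane v) = v"
  by (simp add: vec_eq_iff forall_2 of_plane_def to_plane_def)

lemma bounded_linear_to_plane: "bounded_linear to_plane"
proof -
  have "linear to_plane"
    by (intro linearI) (simp_all add: vec_eq_iff forall_2 to_plane_def)
  then show ?thesis by (simp add: linear_conv_bounded_linear)
qed

lemma bounded_linear_of_plane: "bounded_linear of_plane"
proof -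
  have "linear of_plane"
    by (intro linearI) (simp_all add: complex_eq_iff of_plane_def)
  then show ?thesis by (simp add: linear_conv_bounded_linear)
qed

lemma plane_borel [measurable]: "to_plane \<in> borel_measurable borel" "of_plane \<in> borel_measurable borel"
  using bounded_linear_to_plane bounded_linear_of_plane
  by (auto intro!: borel_measurable_continuous_onI linear_continuous_on)

text \<open>\<open>lborel\<close> is the only measure giving each box its volume, so boxes suffice.
  The transfer to \<open>real^2\<close> is made because the change of variables formula with a
  Jacobian determinant is formulated there.\<close>

lemma distr_lborel_to_plane: "distr lborel borel to_plane = lborel"
proof (rule lborel_eqI[symmetric])
  fix l u :: "real^2"
  assume le: "\<And>b. b \<in> Basis \<Longrightarrow> l \<bullet> b \<le> u \<bullet> b"
  have B: "(Basis :: (real^2) set) = {axis 1 1, axis 2 1}"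
    unfolding Basis_vec_def by (auto simp: UNIV_2)
  have ne: "axis 1 (1::real) \<noteq> (axis 2 1 :: real^2)" by (simp add: axis_eq_axis)
  have le': "l$1 \<le> u$1" "l$2 \<le> u$2"
    using le[of "axis 1 1"] le[of "axis 2 1"] by (auto simp: B inner_axis)
  have v: "to_plane -` box l u = box (of_plane l) (of_plane u)"
    by (auto simp: box_def B Basis_complex_def inner_axis to_plane_def of_plane_def)
  have "emeasure (distr lborel borel to_plane) (box l u) = emeasure lborel (to_plane -` box l u)"
    by (subst emeasure_distr) auto
  also have "\<dots> = ennreal (\<Prod>b\<in>Basis. (of_plane u - of_plane l) \<bullet> b)"
    unfolding v by (subst emeasure_lborel_box) (auto simp: Basis_complex_def of_plane_def le')
  also have "(\<Prod>b\<in>Basis. (of_plane u - of_plane l) \<bullet> b) = (\<Prod>b\<in>Basis. (u - l) \<bullet> b)"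
    using ne by (simp add: B Basis_complex_def of_plane_def inner_axis)
  finally show "emeasure (distr lborel borel to_plane) (box l u) = ennreal (\<Prod>b\<in>Basis. (u - l) \<bullet> b)" .
qed simp

text \<open>Two gaps are bridged at once: between \<open>complex\<close> and \<open>real^2\<close>,
  and between \<open>lborel\<close> and its completion, on which absolute integrability is
  formulated. Borel measurability of the cut-off integrand closes the second.\<close>

lemma plane_integral:
  fixes f :: "complex \<Rightarrow> complex"
  assumes [measurable]: "(\<lambda>z. indicator X z *\<^sub>R f z) \<in> borel_measurable borel"
  defines "F \<equiv> \<lambda>v. to_plane (f (of_plane v))"
  shows "set_integrable lborel X f \<longleftrightarrow> F absolutely_integrable_on (to_plane ` X)"
    and "set_integrable lborel X f \<Longrightarrow> (LINT z:X|lborel. f z) = of_plane (integral (to_plane ` X) F)"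
proof -
  have ind: "indicator (to_plane ` X) v = (indicator X (of_plane v) :: real)" for v
    by (auto simp: indicator_def image_iff) (metis to_of_plane)
  define k where "k = (\<lambda>v. indicator X (of_plane v) *\<^sub>R f (of_plane v))"
  have [measurable]: "k \<in> borel_measurable borel"
    unfolding k_def by measurable
  have kF: "indicator (to_plane ` X) v *\<^sub>R F v = to_plane (k v)" for v
    using bounded_linear_to_plane by (simp add: k_def F_def ind linear_simps)
  have 1: "set_integrable lborel X f \<longleftrightarrow> integrable lborel k"
  proof -
    have "integrable lborel k \<longleftrightarrow> integrable (distr lborel borel to_plane) k"
      by (simp add: distr_lborel_to_plane)
    also have "\<dots> \<longleftrightarrow> integrable lborel (\<lambda>z. k (to_plane z))"
      by (rule integrable_distr_eq) auto
    finally show ?thesis by (simp add: k_def set_integrable_def)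
  qed
  have 2: "integrable lborel k \<longleftrightarrow> integrable lborel (\<lambda>v. to_plane (k v))"
  proof
    assume "integrable lborel k"
    then show "integrable lborel (\<lambda>v. to_plane (k v))"
      by (rule integrable_bounded_linear[OF bounded_linear_to_plane])
  next
    assume "integrable lborel (\<lambda>v. to_plane (k v))"
    from integrable_bounded_linear[OF bounded_linear_of_plane this] show "integrable lborel k" by simp
  qed
  have m2 [measurable]: "(\<lambda>v. to_plane (k v)) \<in> borel_measurable lborel" by simp
  have 3: "integrable lborel (\<lambda>v. to_plane (k v)) \<longleftrightarrow> F absolutely_integrable_on (to_plane ` X)"
    unfolding set_integrable_def kF by (rule integrable_completion[OF m2, symmetric])
  show A: "set_integrable lborel X f \<longleftrightarrow> F absolutely_integrable_on (to_plane ` X)"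
    using 1 2 3 by simp
  assume I: "set_integrable lborel X f"
  then have a: "F absolutely_integrable_on (to_plane ` X)" using A by simp
  have "(LINT z:X|lborel. f z) = (LINT z|lborel. k (to_plane z))"
    by (simp add: set_lebesgue_integral_def k_def)
  also have "\<dots> = (LINT v|distr lborel borel to_plane. k v)"
    by (subst integral_distr) auto
  also have "\<dots> = (LINT v|lborel. of_plane (to_plane (k v)))"
    by (simp add: distr_lborel_to_plane)
  also have "\<dots> = of_plane (LINT v|lborel. to_plane (k v))"
    by (rule integral_bounded_linear[OF bounded_linear_of_plane]) (use I 1 2 in simp)
  also have "(LINT v|lborel. to_plane (k v)) = (LINT v|lebesgue. to_plane (k v))"
    by (rule integral_completion[symmetric]) simp
  also have "\<dots> = integral (to_plane ` X) F"
    using set_lebesgue_integral_eq_integral(2)[OF a] by (simp add: set_lebesgue_integral_def kF)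
  finally show "(LINT z:X|lborel. f z) = of_plane (integral (to_plane ` X) F)" .
qed

theorem holomorphic_change_of_variables:
  fixes f :: "complex \<Rightarrow> complex"
  assumes A: "open A" and hol: "\<kappa> holomorphic_on A" and inj: "inj_on \<kappa> A"
    and f: "continuous_on (\<kappa> ` A) f"
    and int: "set_integrable lborel A (\<lambda>u. of_real ((cmod (deriv \<kappa> u))\<^sup>2) * f (\<kappa> u))"
  shows "(LINT z:\<kappa> ` A|lborel. f z) = (LINT u:A|lborel. of_real ((cmod (deriv \<kappa> u))\<^sup>2) * f (\<kappa> u))"
proof -
  have open_im: "open (\<kappa> ` A)" using hol A inj by (rule open_mapping_thm3)
  define S where "S = to_plane ` A"
  define g where "g = (\<lambda>v. to_plane (\<kappa> (of_plane v)))"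
  define g' where "g' = (\<lambda>v h. to_plane (deriv \<kappa> (of_plane v) * of_plane h))"
  define F where "F = (\<lambda>v. to_plane (f (of_plane v)))"
  have gS: "g ` S = to_plane ` (\<kappa> ` A)" by (auto simp: g_def S_def image_iff)
  have S_eq: "S = of_plane -` A" unfolding S_def by (auto simp: image_iff) (metis to_of_plane)
  have "open S" unfolding S_eq
    by (rule continuous_open_vimage) (use A bounded_linear_of_plane in \<open>auto intro: linear_continuous_at\<close>)
  then have S: "S \<in> sets lebesgue" by auto
  have der: "(g has_derivative g' v) (at v within S)" if "v \<in> S" for v
  proof -
    have "of_plane v \<in> A" using that S_eq by auto
    then have "(\<kappa> has_field_derivative deriv \<kappa> (of_plane v)) (at (of_plane v))"
      using A hol holomorphic_derivI by blast
    then have "(\<kappa> has_derivative (\<lambda>h. deriv \<kappa> (of_plane v) * h)) (at (of_plane v))"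
      by (simp add: has_field_derivative_def)
    moreover have "(of_plane has_derivative of_plane) (at v within S)"
      using bounded_linear_of_plane by (rule bounded_linear_imp_has_derivative)
    ultimately have "((\<lambda>v. \<kappa> (of_plane v)) has_derivative (\<lambda>h. deriv \<kappa> (of_plane v) * of_plane h)) (at v within S)"
      using has_derivative_compose by blast
    then show ?thesis unfolding g_def g'_def
      by (rule bounded_linear.has_derivative[OF bounded_linear_to_plane])
  qed
  have injg: "inj_on g S"
    unfolding g_def S_def inj_on_def by (metis (no_types, lifting) image_iff inj inj_on_def of_to_plane)
  \<comment> \<open>Cauchy-Riemann: multiplication by \<open>d\<close> has the real matrix with rows
    (Re d, -Im d) and (Im d, Re d).\<close>
  have det: "\<bar>det (matrix (g' v))\<bar> = (cmod (deriv \<kappa> (of_plane v)))\<^sup>2" for v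
  proof -
    define d where "d = deriv \<kappa> (of_plane v)"
    have "det (matrix (g' v)) = (Re d)\<^sup>2 + (Im d)\<^sup>2"
      unfolding det_2 matrix_def g'_def d_def[symmetric]
      by (simp add: to_plane_def of_plane_def axis_def power2_eq_square)
    then show ?thesis by (simp add: d_def cmod_power2)
  qed
  define k where "k = (\<lambda>u. of_real ((cmod (deriv \<kappa> u))\<^sup>2) * f (\<kappa> u))"
  have kc: "continuous_on A k" unfolding k_def
    by (intro continuous_intros holomorphic_on_imp_continuous_on holomorphic_deriv hol A
        continuous_on_compose2[OF f]) auto
  have mk: "(\<lambda>z. indicator A z *\<^sub>R k z) \<in> borel_measurable borel"
    by (rule borel_measurable_continuous_on_indicator) (use A kc in auto)
  have mf: "(\<lambda>z. indicator (\<kappa> ` A) z *\<^sub>R f z) \<in> borel_measurable borel"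
    by (rule borel_measurable_continuous_on_indicator) (use open_im f in auto)
  have K: "to_plane (k (of_plane v)) = \<bar>det (matrix (g' v))\<bar> *\<^sub>R F (g v)" for v
    unfolding det using bounded_linear_to_plane
    by (simp add: k_def F_def g_def scaleR_conv_of_real[symmetric] linear_simps del: of_real_power)
  have intk: "set_integrable lborel A k" using int by (simp add: k_def)
  have absk: "(\<lambda>v. \<bar>det (matrix (g' v))\<bar> *\<^sub>R F (g v)) absolutely_integrable_on S"
    using intk plane_integral(1)[OF mk] by (simp only: K S_def)
  have cov: "F absolutely_integrable_on (g ` S) \<and>
      integral (g ` S) F = integral S (\<lambda>v. \<bar>det (matrix (g' v))\<bar> *\<^sub>R F (g v))"
    using has_absolute_integral_change_of_variables[OF S der injg] absk by blast
  have "set_integrable lborel (\<kappa> ` A) f"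
    using cov plane_integral(1)[OF mf] by (simp add: gS F_def)
  then have "(LINT z:\<kappa> ` A|lborel. f z) = of_plane (integral (g ` S) F)"
    using plane_integral(2)[OF mf] by (simp add: gS F_def)
  also have "\<dots> = (LINT u:A|lborel. k u)"
    using cov plane_integral(2)[OF mk intk] by (simp only: K S_def)
  finally show ?thesis by (simp add: k_def)
qed

section \<open>Moments of the unit disc\<close>

lemma set_integrable_ball:
  fixes f :: "complex \<Rightarrow> complex"
  assumes "continuous_on (cball 0 r) f"
  shows "set_integrable lborel (ball 0 r) f"
proof -
  have "set_integrable lborel (cball 0 r) f"
    using assms by (rule borel_integrable_compact[OF compact_cball, folded set_integrable_def])
  then show ?thesis by (rule set_integrable_subset) auto
qed

lemma norm_set_integral_ball_le:
  fixes f :: "complex \<Rightarrow> complex"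
  assumes f: "continuous_on (cball 0 1) f" and b: "\<And>u. u \<in> ball 0 1 \<Longrightarrow> cmod (f u) \<le> B"
  shows "cmod (LINT u:ball 0 1|lborel. f u) \<le> pi * B"
proof -
  have m: "measure lborel (ball (0::complex) 1) = pi"
    using content_ball[of 1 "0::complex"] by (simp add: unit_ball_vol_2)
  have "cmod (LINT u:ball 0 1|lborel. f u) \<le> (LINT u:ball 0 1|lborel. cmod (f u))"
    by (rule set_integral_norm_bound) (rule set_integrable_ball[OF f])
  also have "\<dots> \<le> (LINT u:ball (0::complex) 1|lborel. B)"
    by (rule set_integral_mono)
       (use b emeasure_lborel_ball_finite[of "0::complex" 1] set_integrable_norm[OF set_integrable_ball[OF f]]
         in \<open>auto simp: set_integrable_def\<close>)
  also have "\<dots> = pi * B"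
    using m by (simp add: set_lebesgue_integral_def)
  finally show ?thesis .
qed

definition disc_inner :: "(complex \<Rightarrow> complex) \<Rightarrow> (complex \<Rightarrow> complex) \<Rightarrow> complex" where
  "disc_inner f g = (LINT u:ball 0 1|lborel. f u * cnj (g u)) / of_real pi"

text \<open>Rotation by \<open>c\<close> preserves disc and area and multiplies the integrand by
  \<open>c ^ a * cnj c ^ b\<close>; the angle is chosen to make this factor -1.\<close>

lemma disc_moment_offdiag:
  assumes "a \<noteq> b"
  shows "(LINT u:ball 0 1|lborel. u ^ a * cnj u ^ b) = 0"
proof -
  define c where "c = cis (pi / (real a - real b))"
  have nc: "cmod c = 1" by (simp add: c_def)
  have im: "(\<lambda>u. c * u) ` ball 0 1 = ball 0 1"
  proof safe
    fix u :: complex assume "u \<in> ball 0 1"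
    then show "u \<in> (\<lambda>u. c * u) ` ball 0 1"
      using nc by (intro image_eqI[of _ _ "u / c"]) (auto simp: norm_divide)
  qed (auto simp: norm_mult nc)
  have d: "deriv (\<lambda>u. c * u) u = c" for u
    by (rule DERIV_imp_deriv) (auto intro!: derivative_eq_intros)
  have c1: "c ^ a * cnj c ^ b = -1"
  proof -
    define t where "t = pi / (real a - real b)"
    have "c ^ a * cnj c ^ b = cis (real a * t + real b * (- t))"
      unfolding c_def t_def[symmetric] cis_cnj by (simp only: Complex.DeMoivre cis_mult)
    also have "real a * t + real b * (- t) = (real a - real b) * (pi / (real a - real b))"
      unfolding t_def by (simp add: algebra_simps diff_divide_distrib)
    also have "cis \<dots> = -1" using assms by simp
    finally show ?thesis .
  qed
  have "(LINT u:(\<lambda>u. c * u) ` ball 0 1|lborel. u ^ a * cnj u ^ b) =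
        (LINT u:ball 0 1|lborel. of_real ((cmod (deriv (\<lambda>u. c * u) u))\<^sup>2) * ((c * u) ^ a * cnj (c * u) ^ b))"
    by (rule holomorphic_change_of_variables)
       (use nc in \<open>auto intro!: holomorphic_intros set_integrable_ball continuous_intros inj_onI simp: d\<close>)
  also have "(\<lambda>u. of_real ((cmod (deriv (\<lambda>u. c * u) u))\<^sup>2) * ((c * u) ^ a * cnj (c * u) ^ b))
      = (\<lambda>u. (c ^ a * cnj c ^ b) * (u ^ a * cnj u ^ b))"
    by (auto simp: d nc fun_eq_iff power_mult_distrib)
  also have "(LINT u:ball 0 1|lborel. (c ^ a * cnj c ^ b) * (u ^ a * cnj u ^ b))
      = (c ^ a * cnj c ^ b) * (LINT u:ball 0 1|lborel. u ^ a * cnj u ^ b)"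
    by (rule set_integral_mult_right)
  finally show ?thesis unfolding im c1 by simp
qed

text \<open>Instead of polar coordinates: scaling gives the integral over the disc of radius
  \<open>r\<close> as \<open>r ^ (2 * a + 2)\<close> times the whole, hence also the integral over
  the remaining shell, where the integrand lies between \<open>r ^ (2 * a)\<close> and 1. Comparing
  with the area of the shell and letting \<open>r\<close> tend to 1 determines
  \<open>M\<close>.\<close>

lemma disc_moment_diag:
  "(LINT u:ball (0::complex) 1|lborel. (cmod u ^ (2 * a))) = pi / (a + 1)"
proof -
  define M where "M = (LINT u:ball (0::complex) 1|lborel. (cmod u ^ (2 * a)))"
  define J where "J = (\<lambda>r. LINT u:ball (0::complex) r|lborel. complex_of_real (cmod u ^ (2 * a)))"
  have cont: "continuous_on X (\<lambda>u::complex. complex_of_real (cmod u ^ (2 * a)))" for X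
    by (intro continuous_intros)
  have J1: "J 1 = of_real M"
    unfolding J_def M_def set_lebesgue_integral_def
    by (subst integral_complex_of_real[symmetric]) (simp add: scaleR_conv_of_real)
  have scale: "J r = of_real (r ^ (2 * a + 2)) * J 1" if r: "0 < r" "r < 1" for r
  proof -
    have im: "(\<lambda>u::complex. of_real r * u) ` ball 0 1 = ball 0 r"
    proof safe
      fix u :: complex assume "u \<in> ball 0 r"
      then show "u \<in> (\<lambda>u. of_real r * u) ` ball 0 1"
        using r by (intro image_eqI[of _ _ "u / of_real r"]) (auto simp: norm_divide)
    qed (use r in \<open>auto simp: norm_mult\<close>)
    have d: "deriv (\<lambda>u. of_real r * u) u = (of_real r :: complex)" for u
      by (rule DERIV_imp_deriv) (auto intro!: derivative_eq_intros)
    have "J r = (LINT u:(\<lambda>u::complex. of_real r * u) ` ball 0 1|lborel. complex_of_real (cmod u ^ (2 * a)))"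
      unfolding im J_def ..
    also have "\<dots> = (LINT u:ball 0 1|lborel. of_real ((cmod (deriv (\<lambda>u. of_real r * u) u))\<^sup>2) * complex_of_real (cmod (of_real r * u) ^ (2 * a)))"
      by (rule holomorphic_change_of_variables)
         (use r in \<open>auto intro!: holomorphic_intros set_integrable_ball continuous_intros inj_onI simp: d\<close>)
    also have "(\<lambda>u::complex. of_real ((cmod (deriv (\<lambda>u. of_real r * u) u))\<^sup>2) * complex_of_real (cmod (of_real r * u) ^ (2 * a)))
       = (\<lambda>u. of_real (r ^ (2 * a + 2)) * complex_of_real (cmod u ^ (2 * a)))"
      using r by (auto simp: d fun_eq_iff norm_mult power_mult_distrib power_add power2_eq_square)
    finally show ?thesis by (simp add: J_def)
  qed
  \<comment> \<open>The shell estimates divided by \<open>1 - r\<^sup>2\<close>; the quotient of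
    \<open>1 - r ^ (2 * a + 2)\<close> by it is a geometric sum, so the limit can be taken.\<close>
  have bounds: "r ^ (2 * a) * pi \<le> M * (\<Sum>k<Suc a. (r\<^sup>2) ^ k) \<and> M * (\<Sum>k<Suc a. (r\<^sup>2) ^ k) \<le> pi"
    if r: "0 < r" "r < 1" for r
  proof -
    define A where "A = ball (0::complex) 1 - ball 0 r"
    have Un: "ball (0::complex) 1 = ball 0 r \<union> A" and disj: "ball 0 r \<inter> A = {}"
      using r by (auto simp: A_def)
    have A [measurable]: "A \<in> sets borel" by (simp add: A_def)
    have intA: "set_integrable lborel A f" if "continuous_on (cball 0 1) f" for f :: "complex \<Rightarrow> complex"
      by (rule set_integrable_subset[OF set_integrable_ball[OF that]]) (auto simp: A_def)
    have intAr: "set_integrable lborel A f" if "continuous_on (cball 0 1) f" for f :: "complex \<Rightarrow> real"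
    proof -
      have "continuous_on (cball 0 1) (\<lambda>u. complex_of_real (f u))" using that by (intro continuous_intros)
      from intA[OF this] show ?thesis
        unfolding set_integrable_def scaleR_conv_of_real of_real_mult[symmetric] complex_of_real_integrable_eq
        by simp
    qed
    have mA: "measure lborel A = pi * (1 - r\<^sup>2)"
    proof -
      have "measure lborel A = measure lborel (ball (0::complex) 1) - measure lborel (ball (0::complex) r)"
        unfolding A_def by (rule measure_Diff) (use r emeasure_lborel_ball_finite[of "0::complex" 1] in auto)
      then show ?thesis
        using content_ball[of 1 "0::complex"] content_ball[of r "0::complex"] r
        by (simp add: unit_ball_vol_2 algebra_simps)
    qed
    define K where "K = (LINT u:A|lborel. cmod u ^ (2 * a))"
    have "J 1 = J r + (LINT u:A|lborel. complex_of_real (cmod u ^ (2 * a)))"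
      unfolding J_def Un
      by (rule set_integral_Un) (use disj in \<open>auto intro!: intA set_integrable_ball cont simp del: of_real_power\<close>)
    also have "(LINT u:A|lborel. complex_of_real (cmod u ^ (2 * a))) = of_real K"
      unfolding K_def set_lebesgue_integral_def
      by (subst integral_complex_of_real[symmetric]) (simp add: scaleR_conv_of_real)
    finally have "of_real M = of_real (r ^ (2 * a + 2)) * of_real M + complex_of_real K"
      using scale[OF r] by (simp add: J1)
    then have "complex_of_real M = of_real (r ^ (2 * a + 2) * M + K)" by simp
    then have "M = r ^ (2 * a + 2) * M + K" by (simp only: of_real_eq_iff)
    moreover have "r ^ (2 * a + 2) = (r\<^sup>2) ^ Suc a" using power_mult[of r 2 "Suc a"] by simp
    ultimately have KM: "K = M * (1 - (r\<^sup>2) ^ Suc a)" by (simp only: algebra_simps)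
    have cst: "(LINT u:A|lborel. c) = c * (pi * (1 - r\<^sup>2))" for c :: real
      using mA by (simp add: set_lebesgue_integral_def)
    have up: "K \<le> (LINT u:A|lborel. 1)" unfolding K_def
      by (rule set_integral_mono[OF intAr intAr]) (auto intro!: continuous_intros power_le_one simp: A_def)
    have lo: "(LINT u:A|lborel. r ^ (2 * a)) \<le> K" unfolding K_def
      by (rule set_integral_mono[OF intAr intAr]) (use r in \<open>auto intro!: continuous_intros power_mono simp: A_def\<close>)
    have pos: "0 < 1 - r\<^sup>2" using r by (simp add: power_less_one_iff)
    have fac: "1 - (r\<^sup>2) ^ Suc a = (1 - r\<^sup>2) * (\<Sum>k<Suc a. (r\<^sup>2) ^ k)"
      by (rule one_diff_power_eq)
    have "r ^ (2 * a) * pi * (1 - r\<^sup>2) \<le> M * (\<Sum>k<Suc a. (r\<^sup>2) ^ k) * (1 - r\<^sup>2)"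
      using lo unfolding cst KM fac by (simp only: mult_ac)
    moreover have "M * (\<Sum>k<Suc a. (r\<^sup>2) ^ k) * (1 - r\<^sup>2) \<le> pi * (1 - r\<^sup>2)"
      using up unfolding cst KM fac by (simp only: mult_ac mult_1)
    ultimately show ?thesis using pos by (metis mult_le_cancel_right_pos)
  qed
  have l: "((\<lambda>r. M * (\<Sum>k<Suc a. (r\<^sup>2) ^ k)) \<longlongrightarrow> M * (\<Sum>k<Suc a. (1\<^sup>2) ^ k)) (at_left (1::real))"
    by (intro tendsto_intros)
  have l2: "((\<lambda>r. r ^ (2 * a) * pi) \<longlongrightarrow> 1 ^ (2 * a) * pi) (at_left (1::real))"
    by (intro tendsto_intros)
  have ev: "eventually (\<lambda>r. 0 < r \<and> r < 1) (at_left (1::real))"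
    by (subst eventually_at_left[of 0]) (auto intro: exI[of _ 0])
  have "M * (\<Sum>k<Suc a. (1\<^sup>2) ^ k) \<le> pi"
    by (rule tendsto_upperbound[OF l]) (use ev bounds in \<open>auto elim!: eventually_mono\<close>)
  moreover have "1 ^ (2 * a) * pi \<le> M * (\<Sum>k<Suc a. (1\<^sup>2) ^ k)"
    by (rule tendsto_le[OF _ l l2]) (use ev bounds in \<open>auto elim!: eventually_mono\<close>)
  ultimately have "M * (a + 1) = pi" by simp
  then show ?thesis unfolding M_def[symmetric] by (simp add: field_simps)
qed

lemma disc_inner_monomials:
  "disc_inner (\<lambda>u. u ^ a) (\<lambda>u. u ^ b) = (if a = b then 1 / of_nat (a + 1) else 0)"
proof (cases "a = b")
  case True
  have "(LINT u:ball 0 1|lborel. u ^ a * cnj (u ^ a)) = (LINT u:ball 0 1|lborel. complex_of_real (cmod u ^ (2 * a)))"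
    by (intro set_lebesgue_integral_cong) (auto simp: power_mult_distrib[symmetric] complex_norm_square[symmetric] power_mult)
  also have "\<dots> = of_real (LINT u:ball (0::complex) 1|lborel. (cmod u ^ (2 * a)))"
    unfolding set_lebesgue_integral_def
    by (subst integral_complex_of_real[symmetric]) (simp add: scaleR_conv_of_real)
  finally show ?thesis using True by (simp add: disc_moment_diag disc_inner_def)
next
  case False
  then show ?thesis using disc_moment_offdiag[OF False] by (simp add: disc_inner_def)
qed

section \<open>Normalised contour integrals over circles\<close>

text \<open>With this normalisation the value is the coefficient of \<open>1 / w\<close> in a
  Laurent expansion valid on the circle.\<close>

definition cint :: "real \<Rightarrow> (complex \<Rightarrow> complex) \<Rightarrow> complex" where
  "cint r f = contour_integral (circlepath 0 r) f / (2 * of_real pi * \<i>)"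

lemma integrable_circlepath:
  assumes "continuous_on (sphere 0 r) f" "0 < r"
  shows "f contour_integrable_on (circlepath 0 r)"
  using assms by (intro contour_integrable_continuous_circlepath) simp

lemma cint_cong:
  assumes "\<And>w. cmod w = r \<Longrightarrow> f w = g w" "0 < r"
  shows "cint r f = cint r g"
  unfolding cint_def using assms by (intro arg_cong2[of _ _ _ _ "(/)"] contour_integral_cong) auto

lemma cint_add:
  assumes "continuous_on (sphere 0 r) f" "continuous_on (sphere 0 r) g" "0 < r"
  shows "cint r (\<lambda>w. f w + g w) = cint r f + cint r g"
  unfolding cint_def using assms by (simp add: contour_integral_add integrable_circlepath add_divide_distrib)

lemma cint_diff:
  assumes "continuous_on (sphere 0 r) f" "continuous_on (sphere 0 r) g" "0 < r"
  shows "cint r (\<lambda>w. f w - g w) = cint r f - cint r g"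
  unfolding cint_def using assms by (simp add: contour_integral_diff integrable_circlepath diff_divide_distrib)

lemma cint_cmult:
  assumes "continuous_on (sphere 0 r) f" "0 < r"
  shows "cint r (\<lambda>w. c * f w) = c * cint r f"
  unfolding cint_def using assms by (simp add: contour_integral_lmul integrable_circlepath)

lemma cint_sum:
  assumes "\<And>i. i \<in> A \<Longrightarrow> continuous_on (sphere 0 r) (f i)" "0 < r"
  shows "cint r (\<lambda>w. \<Sum>i\<in>A. f i w) = (\<Sum>i\<in>A. cint r (f i))"
proof (cases "finite A")
  case True
  then show ?thesis unfolding cint_def using assms
    by (simp add: contour_integral_sum integrable_circlepath sum_divide_distrib)
qed (simp add: cint_def)

lemma cint_bound:
  assumes f: "continuous_on (sphere 0 r) f" and r: "0 < r"
    and B: "\<And>w. cmod w = r \<Longrightarrow> cmod (f w) \<le> B"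
  shows "cmod (cint r f) \<le> B * r"
proof -
  have "cmod (f (of_real r)) \<le> B" using B r by simp
  then have "0 \<le> B" using norm_ge_zero order_trans by blast
  then have "cmod (contour_integral (circlepath 0 r) f) \<le> B * (2 * pi * r)"
    using has_contour_integral_bound_circlepath[OF
        has_contour_integral_integral[OF integrable_circlepath[OF f r]]] r B by simp
  then show ?thesis using pi_gt_zero
    by (simp add: cint_def norm_divide norm_mult field_simps)
qed

lemma cint_uniform_limit:
  assumes "\<forall>\<^sub>F n in F. continuous_on (sphere 0 r) (f n)"
    and "uniform_limit (sphere 0 r) f l F" "F \<noteq> bot" "0 < r"
  shows "((\<lambda>n. cint r (f n)) \<longlongrightarrow> cint r l) F"
  unfolding cint_def
proof (intro tendsto_intros)
  show "((\<lambda>n. contour_integral (circlepath 0 r) (f n)) \<longlongrightarrow> contour_integral (circlepath 0 r) l) F"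
    using assms by (intro contour_integral_uniform_limit_circlepath)
      (auto elim!: eventually_mono intro: integrable_circlepath)
qed auto

lemma cint_suminf:
  assumes c: "\<And>n. continuous_on (sphere 0 r) (f n)"
    and M: "\<And>n w. cmod w = r \<Longrightarrow> cmod (f n w) \<le> M n" "summable M" and r: "0 < r"
  shows "(\<lambda>n. cint r (f n)) sums cint r (\<lambda>w. \<Sum>n. f n w)"
proof -
  have "uniform_limit (sphere 0 r) (\<lambda>n w. \<Sum>i<n. f i w) (\<lambda>w. \<Sum>n. f n w) sequentially"
    using M by (intro Weierstrass_m_test) auto
  then have "((\<lambda>n. cint r (\<lambda>w. \<Sum>i<n. f i w)) \<longlongrightarrow> cint r (\<lambda>w. \<Sum>n. f n w)) sequentially"
    using c r by (intro cint_uniform_limit) (auto intro!: always_eventually continuous_on_sum)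
  then show ?thesis using c r by (simp add: cint_sum sums_def)
qed

text \<open>Corresponding points of the two circles lie on one ray, and the segment between them has
  moduli between \<open>r\<close> and \<open>s\<close>, so the straight homotopy stays in
  \<open>S\<close>.\<close>

lemma cint_eq:
  assumes S: "open S" "f holomorphic_on S" and r: "0 < r" "r \<le> s"
    and sub: "\<And>w. r \<le> cmod w \<Longrightarrow> cmod w \<le> s \<Longrightarrow> w \<in> S"
  shows "cint s f = cint r f"
proof -
  have "homotopic_loops S (circlepath 0 s) (circlepath 0 r)"
  proof (rule homotopic_loops_linear)
    fix t :: real
    define e where "e = exp (2 * of_real pi * \<i> * of_real t)"
    have e: "cmod e = 1" by (simp add: e_def)
    show "closed_segment (circlepath 0 s t) (circlepath 0 r t) \<subseteq> S"
    proof
      fix x assume "x \<in> closed_segment (circlepath 0 s t) (circlepath 0 r t)"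
      then obtain u where u: "0 \<le> u" "u \<le> 1" "x = (1 - u) *\<^sub>R (s * e) + u *\<^sub>R (r * e)"
        by (auto simp: in_segment circlepath e_def)
      then have "x = of_real ((1 - u) * s + u * r) * e" by (simp add: algebra_simps scaleR_conv_of_real)
      moreover have "0 \<le> (1 - u) * s + u * r" using u r by auto
      ultimately have "cmod x = (1 - u) * s + u * r" by (simp add: norm_mult e del: of_real_add of_real_mult)
      moreover have "r \<le> (1 - u) * s + u * r" "(1 - u) * s + u * r \<le> s"
      proof -
        have "0 \<le> (1 - u) * (s - r)" "0 \<le> u * (s - r)" using u r by auto
        then show "r \<le> (1 - u) * s + u * r" "(1 - u) * s + u * r \<le> s" by (auto simp: algebra_simps)
      qed
      ultimately show "x \<in> S" using sub by simp
    qed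
  qed auto
  then show ?thesis unfolding cint_def
    using Cauchy_theorem_homotopic_loops[OF _ S] by simp
qed

lemma cint_holomorphic:
  assumes f: "f holomorphic_on S" and sub: "cball 0 r \<subseteq> S" and r: "0 < r"
  shows "cint r f = 0"
proof -
  have "(f has_contour_integral 0) (circlepath 0 r)"
    by (rule Cauchy_theorem_convex_simple[of _ "cball 0 r"])
       (use f sub r in \<open>auto intro: holomorphic_on_subset\<close>)
  then show ?thesis by (simp add: cint_def contour_integral_unique)
qed

lemma cint_Cauchy:
  assumes f: "f holomorphic_on S" and sub: "cball 0 r \<subseteq> S" and w: "cmod w < r"
  shows "cint r (\<lambda>t. f t / (t - w)) = f w"
proof -
  have "((\<lambda>u. f u / (u - w)) has_contour_integral 2 * of_real pi * \<i> * f w) (circlepath 0 r)"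
    by (rule Cauchy_integral_circlepath_simple) (use assms in \<open>auto intro: holomorphic_on_subset\<close>)
  then show ?thesis by (simp add: cint_def contour_integral_unique)
qed

text \<open>The circle is pushed outwards: on a large radius \<open>s\<close>, \<open>f w\<close>
  differs from \<open>l / w\<close> by less than \<open>(e / 2) / s\<close>, and integration only
  multiplies this by \<open>s\<close>.\<close>

lemma cint_at_infinity:
  assumes f: "f holomorphic_on {w. a < cmod w}" and r: "a < r" "0 < r"
    and lim: "((\<lambda>w. w * f w) \<longlongrightarrow> l) at_infinity"
  shows "cint r f = l"
proof -
  have S: "open {w::complex. a < cmod w}" by (intro open_Collect_less continuous_intros)
  have c: "continuous_on (sphere 0 s) f" if "s \<ge> r" for s
    using holomorphic_on_imp_continuous_on[OF f] by (rule continuous_on_subset) (use that r in auto)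
  have l: "cint s (\<lambda>w. l * (1 / w)) = l" if "s > 0" for s
  proof -
    have "cint s (\<lambda>w. l * (1 / w)) = l * cint s (\<lambda>w. 1 / w)"
      by (rule cint_cmult) (use that in \<open>auto intro!: continuous_intros\<close>)
    then show ?thesis using contour_integral_circlepath[OF that, of 0] by (simp add: cint_def)
  qed
  have "cmod (cint r f - l) < e" if e: "0 < e" for e
  proof -
    have "\<forall>\<^sub>F w in at_infinity. dist (w * f w) l < e / 2" using lim e by (auto dest: tendstoD[where e = "e / 2"])
    then obtain b where b: "\<And>w. b \<le> cmod w \<Longrightarrow> cmod (w * f w - l) < e / 2"
      by (auto simp: eventually_at_infinity dist_norm)
    define s where "s = max r (max b 1)"
    have s: "r \<le> s" "b \<le> s" "0 < s" using r by (auto simp: s_def)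
    have "cint r f - l = cint s f - cint s (\<lambda>w. l * (1 / w))"
      using cint_eq[OF S f r(2) s(1)] r l s by auto
    also have "\<dots> = cint s (\<lambda>w. f w - l * (1 / w))"
      using s c by (intro cint_diff[symmetric]) (auto intro!: continuous_intros)
    finally have "cmod (cint r f - l) = cmod (cint s (\<lambda>w. f w - l * (1 / w)))" by simp
    also have "\<dots> \<le> (e / 2 / s) * s"
    proof (rule cint_bound)
      fix w :: complex assume w: "cmod w = s"
      have nz: "w \<noteq> 0" using w s by auto
      then have eq: "f w - l * (1 / w) = (w * f w - l) / w" by (simp add: field_simps)
      show "cmod (f w - l * (1 / w)) \<le> e / 2 / s"
        unfolding eq norm_divide w using b[of w] w s by (intro divide_right_mono) auto
    qed (use s c in \<open>auto intro!: continuous_intros\<close>)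
    also have "\<dots> < e" using s e by simp
    finally show ?thesis .
  qed
  then have "cmod (cint r f - l) \<le> 0" by (metis dense_ge_bounded less_irrefl linorder_not_le)
  then show ?thesis by simp
qed

lemma cint_powi:
  assumes "0 < r"
  shows "cint r (\<lambda>w. w powi k) = (if k = -1 then 1 else 0)"
proof (cases "k = -1")
  case True
  then show ?thesis using contour_integral_circlepath[OF assms, of 0]
    by (simp add: cint_def power_int_minus divide_inverse)
next
  case False
  then have nz: "of_int (k + 1) \<noteq> (0::complex)" by (metis add.commute add_eq_0_iff of_int_eq_0_iff)
  have "((\<lambda>w. w powi k) has_contour_integral
      (pathfinish (circlepath 0 r) powi (k + 1) / of_int (k + 1) - pathstart (circlepath 0 r) powi (k + 1) / of_int (k + 1))) (circlepath 0 r)"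
  proof (rule contour_integral_primitive[of "- {0}"])
    fix x :: complex assume "x \<in> - {0}"
    then show "((\<lambda>w. w powi (k + 1) / of_int (k + 1)) has_field_derivative x powi k) (at x within - {0})"
      using nz by (auto intro!: derivative_eq_intros)
  qed (use assms in auto)
  then show ?thesis using False by (simp add: cint_def contour_integral_unique)
qed

text \<open>On the circle \<open>cnj w = r\<^sup>2 / w\<close>, so conjugation turns
  \<open>dw\<close> into \<open>- r\<^sup>2 / w\<^sup>2 dw\<close>; the sign cancels against the
  conjugate of \<open>2 * pi * \<i>\<close>.\<close>

lemma cnj_cint:
  assumes "0 < r"
  shows "cnj (cint r f) = cint r (\<lambda>w. cnj (f w) * of_real (r\<^sup>2) / w\<^sup>2)"
proof -
  define c where "c = (\<lambda>t. circlepath 0 r t)"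
  define v where "v = (\<lambda>t. 2 * of_real pi * \<i> * of_real r * exp (2 * of_real pi * \<i> * of_real t))"
  have I: "contour_integral (circlepath 0 r) g = integral {0..1} (\<lambda>t. g (c t) * v t)" for g
    unfolding contour_integral_integral
    by (rule integral_cong) (simp add: c_def v_def vector_derivative_circlepath)
  have "cnj (v t) = - (of_real (r\<^sup>2) / (c t)\<^sup>2 * v t)" for t
  proof -
    have "cnj (exp (2 * of_real pi * \<i> * of_real t)) = inverse (exp (2 * of_real pi * \<i> * of_real t))"
      by (simp add: exp_cnj exp_minus[symmetric])
    then show ?thesis using assms
      by (simp add: v_def c_def circlepath power2_eq_square field_simps)
  qed
  then have "cnj (contour_integral (circlepath 0 r) f)
     = integral {0..1} (\<lambda>t. - (cnj (f (c t)) * of_real (r\<^sup>2) / (c t)\<^sup>2 * v t))"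
    unfolding I integral_cnj by (simp add: mult_ac)
  also have "\<dots> = - contour_integral (circlepath 0 r) (\<lambda>w. cnj (f w) * of_real (r\<^sup>2) / w\<^sup>2)"
    unfolding I by simp
  finally show ?thesis by (simp add: cint_def)
qed

section \<open>Green's formula on the unit disc through Taylor series\<close>

lemma taylor_uniform_limit:
  assumes f: "f holomorphic_on ball 0 R" and R: "1 < R"
  shows "uniform_limit (cball 0 1) (\<lambda>N u. \<Sum>k<N. (deriv ^^ k) f 0 / fact k * u ^ k) f sequentially"
proof -
  \<comment> \<open>A circle strictly between 1 and \<open>R\<close>: Cauchy's inequality on it
    gives the summable majorant \<open>B * (1 / s) ^ k\<close>.\<close>
  define s where "s = (1 + R) / 2"
  have s: "1 < s" "s < R" using R by (auto simp: s_def)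
  have c: "continuous_on (cball 0 s) f"
    by (rule holomorphic_on_imp_continuous_on, rule holomorphic_on_subset[OF f]) (use s in auto)
  have "bounded (f ` cball 0 s)" by (intro compact_imp_bounded compact_continuous_image c) auto
  then obtain B where B: "\<And>u. cmod u \<le> s \<Longrightarrow> cmod (f u) \<le> B"
    unfolding bounded_iff by (metis image_eqI mem_cball_0)
  have ci: "cmod ((deriv ^^ k) f 0) \<le> fact k * B / s ^ k" for k
    by (rule Cauchy_inequality[of f 0 s B])
       (use s c B in \<open>auto intro!: holomorphic_on_subset[OF f]\<close>)
  have "uniform_limit (cball 0 1) (\<lambda>N u. \<Sum>k<N. (deriv ^^ k) f 0 / fact k * u ^ k)
     (\<lambda>u. \<Sum>k. (deriv ^^ k) f 0 / fact k * u ^ k) sequentially"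
  proof (rule Weierstrass_m_test)
    fix k and u :: complex assume u: "u \<in> cball 0 1"
    have "cmod ((deriv ^^ k) f 0 / fact k) \<le> B * (1 / s) ^ k"
      using ci[of k] by (simp add: norm_divide field_simps)
    moreover have "cmod u ^ k \<le> 1" using u by (intro power_le_one) auto
    ultimately have "cmod ((deriv ^^ k) f 0 / fact k) * cmod u ^ k \<le> (B * (1 / s) ^ k) * 1"
      by (intro mult_mono) (auto intro: order_trans[OF norm_ge_zero])
    then show "norm ((deriv ^^ k) f 0 / fact k * u ^ k) \<le> B * (1 / s) ^ k"
      by (simp only: norm_mult norm_power)
  next
    show "summable (\<lambda>k. B * (1 / s) ^ k)"
      by (intro summable_mult summable_geometric) (use s in auto)
  qed
  moreover have "(\<Sum>k. (deriv ^^ k) f 0 / fact k * u ^ k) = f u" if "u \<in> cball 0 1" for u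
    using holomorphic_power_series[OF f, of u] that R by (simp add: sums_unique[symmetric])
  then have "uniform_limit (cball 0 1) (\<lambda>N u. \<Sum>k<N. (deriv ^^ k) f 0 / fact k * u ^ k)
       (\<lambda>u. \<Sum>k. (deriv ^^ k) f 0 / fact k * u ^ k) sequentially \<longleftrightarrow> ?thesis"
    by (intro uniform_limit_cong') auto
  ultimately show ?thesis by blast
qed

lemma disc_inner_tendsto:
  assumes F: "uniform_limit (cball 0 1) F f sequentially" and G: "uniform_limit (cball 0 1) G g sequentially"
    and cF: "\<And>n. continuous_on (cball 0 1) (F n)" and cG: "\<And>n. continuous_on (cball 0 1) (G n)"
  shows "(\<lambda>n. disc_inner (F n) (G n)) \<longlonglongrightarrow> disc_inner f g"
proof -
  have cf: "continuous_on (cball 0 1) f" and cg: "continuous_on (cball 0 1) g"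
    using uniform_limit_theorem[OF _ F] uniform_limit_theorem[OF _ G] cF cG by (simp_all add: always_eventually)
  have G': "uniform_limit (cball 0 1) (\<lambda>n u. cnj (G n u)) (\<lambda>u. cnj (g u)) sequentially"
    using G by (intro bounded_linear.uniform_limit[OF bounded_linear_cnj])
  have bd: "bounded (f ` cball 0 1)" "bounded ((\<lambda>u. cnj (g u)) ` cball 0 1)"
    by (intro compact_imp_bounded compact_continuous_image continuous_intros cf cg compact_cball)+
  have u: "uniform_limit (cball 0 1) (\<lambda>n u. F n u * cnj (G n u)) (\<lambda>u. f u * cnj (g u)) sequentially"
    by (rule uniform_lim_mult[OF F G' bd])
  have "(\<lambda>n. LINT u:ball 0 1|lborel. F n u * cnj (G n u)) \<longlonglongrightarrow> (LINT u:ball 0 1|lborel. f u * cnj (g u))"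
  proof (rule tendstoI)
    fix e :: real assume e: "0 < e"
    have "\<forall>\<^sub>F n in sequentially. \<forall>u\<in>cball 0 1. dist (F n u * cnj (G n u)) (f u * cnj (g u)) < e / (2 * pi)"
      using uniform_limitD[OF u, of "e / (2 * pi)"] e by simp
    then show "\<forall>\<^sub>F n in sequentially. dist (LINT u:ball 0 1|lborel. F n u * cnj (G n u)) (LINT u:ball 0 1|lborel. f u * cnj (g u)) < e"
    proof (rule eventually_mono)
      fix n assume n: "\<forall>u\<in>cball 0 1. dist (F n u * cnj (G n u)) (f u * cnj (g u)) < e / (2 * pi)"
      have "cmod (LINT u:ball 0 1|lborel. F n u * cnj (G n u) - f u * cnj (g u)) \<le> pi * (e / (2 * pi))"
        by (rule norm_set_integral_ball_le)
           (use n in \<open>auto intro!: continuous_intros cf cg cF cG less_imp_le simp: dist_norm\<close>)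
      also have "\<dots> < e" using e by simp
      also have "(LINT u:ball 0 1|lborel. F n u * cnj (G n u) - f u * cnj (g u))
          = (LINT u:ball 0 1|lborel. F n u * cnj (G n u)) - (LINT u:ball 0 1|lborel. f u * cnj (g u))"
        by (rule set_integral_diff) (auto intro!: set_integrable_ball continuous_intros cf cg cF cG)
      finally show "dist (LINT u:ball 0 1|lborel. F n u * cnj (G n u)) (LINT u:ball 0 1|lborel. f u * cnj (g u)) < e"
        by (simp add: dist_norm)
    qed
  qed
  then show ?thesis unfolding disc_inner_def by (intro tendsto_divide) auto
qed

lemma set_integral_sum:
  fixes h :: "'i \<Rightarrow> 'a \<Rightarrow> 'b::{banach, second_countable_topology}"
  assumes "finite I" "\<And>i. i \<in> I \<Longrightarrow> set_integrable M A (h i)"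
  shows "(LINT x:A|M. \<Sum>i\<in>I. h i x) = (\<Sum>i\<in>I. LINT x:A|M. h i x)"
  using assms(2) unfolding set_lebesgue_integral_def set_integrable_def scaleR_sum_right
  by (rule Bochner_Integration.integral_sum)

lemma disc_inner_polynomials:
  "disc_inner (\<lambda>u. \<Sum>i<N. a i * u ^ i) (\<lambda>u. \<Sum>i<N. b i * u ^ i) = (\<Sum>i<N. a i * cnj (b i) / of_nat (i + 1))"
proof -
  have c: "set_integrable lborel (ball 0 1) (\<lambda>u. c * (u ^ i * cnj (u ^ j)))" for c i j
    by (intro set_integrable_ball continuous_intros)
  have "(LINT u:ball 0 1|lborel. (\<Sum>i<N. a i * u ^ i) * cnj (\<Sum>j<N. b j * u ^ j))
      = (LINT u:ball 0 1|lborel. (\<Sum>i<N. \<Sum>j<N. (a i * cnj (b j)) * (u ^ i * cnj (u ^ j))))"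
    by (simp add: sum_product mult_ac)
  also have "\<dots> = (\<Sum>i<N. \<Sum>j<N. (LINT u:ball 0 1|lborel. (a i * cnj (b j)) * (u ^ i * cnj (u ^ j))))"
    by (subst set_integral_sum; (subst set_integral_sum)?)
       (auto intro!: set_integrable_ball continuous_intros simp del: complex_cnj_power)
  also have "\<dots> = (\<Sum>i<N. \<Sum>j<N. (a i * cnj (b j)) * (LINT u:ball 0 1|lborel. u ^ i * cnj (u ^ j)))"
    by (intro sum.cong refl set_integral_mult_right)
  finally have "disc_inner (\<lambda>u. \<Sum>i<N. a i * u ^ i) (\<lambda>u. \<Sum>i<N. b i * u ^ i)
      = (\<Sum>i<N. \<Sum>j<N. (a i * cnj (b j)) * disc_inner (\<lambda>u. u ^ i) (\<lambda>u. u ^ j))"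
    unfolding disc_inner_def by (simp add: sum_divide_distrib)
  also have "\<dots> = (\<Sum>i<N. \<Sum>j<N. if i = j then a i * cnj (b i) / of_nat (i + 1) else 0)"
    unfolding disc_inner_monomials by (intro sum.cong refl) auto
  also have "\<dots> = (\<Sum>i<N. a i * cnj (b i) / of_nat (i + 1))"
    by (intro sum.cong refl) auto
  finally show ?thesis .
qed

lemma cint_monomials: "cint 1 (\<lambda>u. u ^ i * cnj (u ^ j)) = (if j = i + 1 then 1 else 0)"
proof -
  have "cint 1 (\<lambda>u. u ^ i * cnj (u ^ j)) = cint 1 (\<lambda>u. u powi (int i - int j))"
  proof (rule cint_cong)
    fix u :: complex assume u: "cmod u = 1"
    then have "cnj u = inverse u"
      by (metis complex_cnj_mult complex_div_cnj complex_mod_cnj complex_norm_square divide_inverse inverse_unique mult.commute of_real_1 power_one)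
    moreover have "u \<noteq> 0" using u by auto
    ultimately show "u ^ i * cnj (u ^ j) = u powi (int i - int j)"
      by (simp add: power_int_diff divide_inverse power_inverse)
  qed simp
  then show ?thesis by (simp add: cint_powi)
qed

text \<open>For monomials: \<open>u ^ i\<close> against the derivative of \<open>u ^ (i + 1)\<close>
  over the area gives 1, the same as \<open>u ^ i\<close> against \<open>u ^ (i + 1)\<close> on the
  circle by \<open>cint_monomials\<close>; all other pairings vanish on both sides. Uniform
  convergence of the Taylor sums does the rest.\<close>

lemma disc_inner_deriv:
  assumes f: "f holomorphic_on ball 0 R" and g: "g holomorphic_on ball 0 R" and R: "1 < R"
  shows "disc_inner f (deriv g) = cint 1 (\<lambda>u. f u * cnj (g u))"
proof -
  define a where "a = (\<lambda>k. (deriv ^^ k) f 0 / fact k)"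
  define b where "b = (\<lambda>k. (deriv ^^ k) g 0 / fact k)"
  define b' where "b' = (\<lambda>k. (deriv ^^ k) (deriv g) 0 / fact k)"
  have b': "b' k = of_nat (k + 1) * b (k + 1)" for k
    unfolding b_def b'_def by (simp add: funpow_swap1 field_simps del: of_nat_Suc)
  have g': "deriv g holomorphic_on ball 0 R" using g by (intro holomorphic_deriv) auto
  define F where "F = (\<lambda>N u. \<Sum>k<N. a k * u ^ k)"
  define G' where "G' = (\<lambda>N u. \<Sum>k<N. b' k * u ^ k)"
  \<comment> \<open>One more term than \<open>G'\<close>, because differentiation lowers the degree
    by one.\<close>
  define G where "G = (\<lambda>N u. \<Sum>k<Suc N. b k * u ^ k)"
  have uF: "uniform_limit (cball 0 1) F f sequentially"
    unfolding F_def a_def by (rule taylor_uniform_limit[OF f R])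
  have uG': "uniform_limit (cball 0 1) G' (deriv g) sequentially"
    unfolding G'_def b'_def by (rule taylor_uniform_limit[OF g' R])
  have uG: "uniform_limit (cball 0 1) G g sequentially"
  proof -
    have "uniform_limit (cball 0 1) (\<lambda>N u. \<Sum>k<N. b k * u ^ k) g sequentially"
      unfolding b_def by (rule taylor_uniform_limit[OF g R])
    from filterlim_compose[OF this filterlim_Suc] show ?thesis unfolding G_def .
  qed
  have "(\<lambda>N. disc_inner (F N) (G' N)) \<longlonglongrightarrow> disc_inner f (deriv g)"
    by (rule disc_inner_tendsto[OF uF uG']) (auto simp: F_def G'_def intro!: continuous_intros)
  moreover have "disc_inner (F N) (G' N) = cint 1 (\<lambda>u. F N u * cnj (G N u))" for N
  proof -
    have "disc_inner (F N) (G' N) = (\<Sum>i<N. a i * cnj (b' i) / of_nat (i + 1))"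
      unfolding F_def G'_def by (rule disc_inner_polynomials)
    also have "\<dots> = (\<Sum>i<N. a i * cnj (b (i + 1)))" by (intro sum.cong) (auto simp: b' simp del: of_nat_Suc)
    also have "\<dots> = (\<Sum>i<N. \<Sum>j<Suc N. (a i * cnj (b j)) * (if j = i + 1 then 1 else 0))"
    proof (intro sum.cong refl)
      fix i assume "i \<in> {..<N}"
      then show "a i * cnj (b (i + 1)) = (\<Sum>j<Suc N. (a i * cnj (b j)) * (if j = i + 1 then 1 else 0))"
        by (subst sum.mono_neutral_right[of _ "{i + 1}"]) auto
    qed
    also have "\<dots> = (\<Sum>i<N. \<Sum>j<Suc N. cint 1 (\<lambda>u. (a i * cnj (b j)) * (u ^ i * cnj (u ^ j))))"
      by (subst cint_cmult) (auto intro!: continuous_intros simp only: cint_monomials)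
    also have "\<dots> = cint 1 (\<lambda>u. \<Sum>i<N. \<Sum>j<Suc N. (a i * cnj (b j)) * (u ^ i * cnj (u ^ j)))"
      by (subst cint_sum; (subst cint_sum)?) (auto intro!: continuous_intros)
    also have "\<dots> = cint 1 (\<lambda>u. F N u * cnj (G N u))"
      unfolding F_def G_def by (simp only: sum_product cnj_sum complex_cnj_mult mult_ac)
    finally show ?thesis .
  qed
  moreover have "(\<lambda>N. cint 1 (\<lambda>u. F N u * cnj (G N u))) \<longlonglongrightarrow> cint 1 (\<lambda>u. f u * cnj (g u))"
  proof (rule cint_uniform_limit)
    have cf: "continuous_on (cball 0 1) f" and cg: "continuous_on (cball 0 1) g"
      using R by (auto intro!: holomorphic_on_imp_continuous_on holomorphic_on_subset[OF f] holomorphic_on_subset[OF g])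
    have bd: "bounded (f ` cball 0 1)" "bounded ((\<lambda>u. cnj (g u)) ` cball 0 1)"
      by (intro compact_imp_bounded compact_continuous_image continuous_intros cf cg compact_cball)+
    have "uniform_limit (cball 0 1) (\<lambda>N u. F N u * cnj (G N u)) (\<lambda>u. f u * cnj (g u)) sequentially"
      by (intro uniform_lim_mult uF bd bounded_linear.uniform_limit[OF bounded_linear_cnj] uG)
    then show "uniform_limit (sphere 0 1) (\<lambda>N u. F N u * cnj (G N u)) (\<lambda>u. f u * cnj (g u)) sequentially"
      by (rule uniform_limit_on_subset) auto
  qed (auto intro!: continuous_intros always_eventually simp: F_def G_def)
  ultimately show ?thesis using LIMSEQ_unique by simp
qed

text \<open>One term of Parseval's sum. It bounds each Taylor coefficient of a function of norm 1,
  which later gives a locally uniform bound on all \<open>p n\<close>.\<close>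

lemma disc_inner_coeff_le:
  assumes f: "f holomorphic_on ball 0 R" and R: "1 < R"
  shows "(cmod ((deriv ^^ k) f 0 / fact k))\<^sup>2 / (k + 1) \<le> Re (disc_inner f f)"
proof -
  define a where "a = (\<lambda>k. (deriv ^^ k) f 0 / fact k)"
  define F where "F = (\<lambda>N u. \<Sum>k<N. a k * u ^ k)"
  have uF: "uniform_limit (cball 0 1) F f sequentially"
    unfolding F_def a_def by (rule taylor_uniform_limit[OF f R])
  have "(\<lambda>N. disc_inner (F N) (F N)) \<longlonglongrightarrow> disc_inner f f"
    by (rule disc_inner_tendsto[OF uF uF]) (auto simp: F_def intro!: continuous_intros)
  then have "(\<lambda>N. Re (disc_inner (F N) (F N))) \<longlonglongrightarrow> Re (disc_inner f f)" by (rule tendsto_Re)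
  moreover have "(cmod (a k))\<^sup>2 / (k + 1) \<le> Re (disc_inner (F N) (F N))" if "k < N" for N
  proof -
    have "disc_inner (F N) (F N) = (\<Sum>i<N. a i * cnj (a i) / of_nat (i + 1))"
      unfolding F_def by (rule disc_inner_polynomials)
    also have "\<dots> = of_real (\<Sum>i<N. (cmod (a i))\<^sup>2 / (i + 1))"
      by (simp add: complex_norm_square[symmetric])
    finally have "Re (disc_inner (F N) (F N)) = (\<Sum>i<N. (cmod (a i))\<^sup>2 / (i + 1))" by simp
    moreover have "(\<Sum>i\<in>{k}. (cmod (a i))\<^sup>2 / (i + 1)) \<le> (\<Sum>i<N. (cmod (a i))\<^sup>2 / (i + 1))"
      using that by (intro sum_mono2) auto
    ultimately show ?thesis by simp
  qed
  then have "\<forall>\<^sub>F N in sequentially. (cmod (a k))\<^sup>2 / (k + 1) \<le> Re (disc_inner (F N) (F N))"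
    using eventually_gt_at_top[of k] by (rule eventually_mono[rotated])
  ultimately have "(cmod (a k))\<^sup>2 / (k + 1) \<le> Re (disc_inner f f)" by (intro tendsto_lowerbound) auto
  then show ?thesis unfolding a_def .
qed

section \<open>Cauchy transforms and the negative Laurent part\<close>

lemma open_ring: "open {w::complex. a < cmod w}" "open {w::complex. a < cmod w \<and> cmod w < b}"
  by (auto intro!: open_Collect_less open_Collect_conj continuous_intros)

lemma cint_kernel_holomorphic:
  assumes f: "continuous_on (sphere 0 r) f" and r: "0 < r"
  shows "(\<lambda>w. cint r (\<lambda>t. f t / (t - w))) holomorphic_on - sphere 0 r"
proof -
  \<comment> \<open>Written with exponent 1 to match the family of kernels in
    \<open>Cauchy_next_derivative\<close>.\<close>
  have "(\<lambda>w. contour_integral (circlepath 0 r) (\<lambda>t. f t / (t - w) ^ 1)) holomorphic_on - sphere 0 r"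
    unfolding holomorphic_on_def
  proof
    fix w assume w: "w \<in> - sphere (0::complex) r"
    have "((\<lambda>w. contour_integral (circlepath 0 r) (\<lambda>t. f t / (t - w) ^ 1)) has_field_derivative
        (of_nat 1 * contour_integral (circlepath 0 r) (\<lambda>u. f u / (u - w) ^ Suc 1))) (at w)"
    proof (rule Cauchy_next_derivative(2)[where S = "- sphere (0::complex) r" and B = "2 * pi * r"])
      show "((\<lambda>u. f u / (u - x) ^ 1) has_contour_integral
           contour_integral (circlepath 0 r) (\<lambda>t. f t / (t - x) ^ 1)) (circlepath 0 r)"
        if "x \<in> - sphere 0 r - path_image (circlepath 0 r)" for x
        by (rule has_contour_integral_integral, rule integrable_circlepath)
           (use that f r in \<open>auto intro!: continuous_intros\<close>)
    qed (use f r w in \<open>auto simp: vector_derivative_circlepath norm_mult\<close>)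
    then show "(\<lambda>w. contour_integral (circlepath 0 r) (\<lambda>t. f t / (t - w) ^ 1)) field_differentiable at w within - sphere 0 r"
      using field_differentiable_def has_field_derivative_at_within by blast
  qed
  then show ?thesis unfolding cint_def by (intro holomorphic_intros) auto
qed

text \<open>The difference quotient \<open>F\<close> fills the singularity at \<open>w\<close>, so
  it has equal integrals over both circles. What remains is \<open>f w\<close> times the integral of
  \<open>1 / (t - w)\<close>, which is 1 on the outer and 0 on the inner circle.\<close>

lemma cint_annulus_Cauchy:
  assumes f: "f holomorphic_on {w. a < cmod w \<and> cmod w < b}" and a: "0 \<le> a"
    and r: "a < r" "r < cmod w" and s: "cmod w < s" "s < b"
  shows "f w = cint s (\<lambda>t. f t / (t - w)) - cint r (\<lambda>t. f t / (t - w))"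
proof -
  define A where "A = {w. a < cmod w \<and> cmod w < b}"
  have A: "open A" "w \<in> A" using open_ring r s by (auto simp: A_def)
  define F where "F = (\<lambda>t. if t = w then deriv f w else (f t - f w) / (t - w))"
  have F: "F holomorphic_on A"
    unfolding F_def by (rule pole_lemma_open[OF f[folded A_def] A(1)])
  have c: "continuous_on (sphere 0 x) f" if "a < x" "x < b" for x
    using f by (intro holomorphic_on_imp_continuous_on[OF holomorphic_on_subset]) (use that in auto)
  have k: "cint x (\<lambda>t. f t / (t - w)) = cint x F + f w * cint x (\<lambda>t. 1 / (t - w))"
    if "a < x" "x < b" "x \<noteq> cmod w" for x
  proof -
    have "cint x (\<lambda>t. f t / (t - w)) = cint x (\<lambda>t. F t + f w * (1 / (t - w)))"
    proof (rule cint_cong)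
      fix t assume t: "cmod t = x"
      then have "t \<noteq> w" using that by auto
      then show "f t / (t - w) = F t + f w * (1 / (t - w))" by (simp add: F_def diff_divide_distrib)
    qed (use that a in auto)
    also have "\<dots> = cint x F + cint x (\<lambda>t. f w * (1 / (t - w)))"
      by (rule cint_add)
         (use that a in \<open>auto intro!: continuous_intros holomorphic_on_imp_continuous_on[OF holomorphic_on_subset[OF F]] simp: A_def\<close>)
    also have "cint x (\<lambda>t. f w * (1 / (t - w))) = f w * cint x (\<lambda>t. 1 / (t - w))"
      by (rule cint_cmult) (use that a in \<open>auto intro!: continuous_intros\<close>)
    finally show ?thesis .
  qed
  have "cint s F = cint r F"
    by (rule cint_eq[OF A(1) F]) (use r s a in \<open>auto simp: A_def\<close>)
  moreover have "cint s (\<lambda>t. 1 / (t - w)) = 1"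
    using cint_Cauchy[of "\<lambda>_. 1" UNIV s w] s by (simp add: divide_inverse)
  moreover have "cint r (\<lambda>t. 1 / (t - w)) = 0"
    by (rule cint_holomorphic[of _ "cball 0 r"]) (use r a in \<open>auto intro!: holomorphic_intros\<close>)
  ultimately show ?thesis using k[of s] k[of r] r s a by simp
qed

text \<open>The integral does not depend on the radius as long as this stays in the ring and below
  \<open>|w|\<close>. Choosing it halfway between \<open>a\<close> and the minimum of
  \<open>|w|\<close> and \<open>b\<close> defines \<open>m\<close> everywhere; near a given point
  one fixed radius serves, whence holomorphy.\<close>

lemma laurent_negative_part:
  assumes f: "f holomorphic_on {w. a < cmod w \<and> cmod w < b}" and a: "0 \<le> a" "a < b"
  obtains m where "m holomorphic_on {w. a < cmod w}"
    and "\<And>r w. a < r \<Longrightarrow> r < b \<Longrightarrow> r < cmod w \<Longrightarrow> m w = - cint r (\<lambda>t. f t / (t - w))"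
proof -
  define m where "m = (\<lambda>w. - cint ((a + min (cmod w) b) / 2) (\<lambda>t. f t / (t - w)))"
  have c: "continuous_on (sphere 0 x) f" if "a < x" "x < b" for x
    using f by (intro holomorphic_on_imp_continuous_on[OF holomorphic_on_subset]) (use that in auto)
  have eq: "cint s (\<lambda>t. f t / (t - w)) = cint r (\<lambda>t. f t / (t - w))"
    if "a < r" "r \<le> s" "s < b" "s < cmod w" for r s w
  proof (rule cint_eq)
    show "open {t. a < cmod t \<and> cmod t < min b (cmod w)}" by (rule open_ring)
    show "(\<lambda>t. f t / (t - w)) holomorphic_on {t. a < cmod t \<and> cmod t < min b (cmod w)}"
      by (intro holomorphic_intros holomorphic_on_subset[OF f]) auto
  qed (use that a in auto)
  have m: "m w = - cint r (\<lambda>t. f t / (t - w))" if "a < r" "r < b" "r < cmod w" for r w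
    using eq[of r "(a + min (cmod w) b) / 2" w] eq[of "(a + min (cmod w) b) / 2" r w] that a
    unfolding m_def by (cases "r \<le> (a + min (cmod w) b) / 2") (auto simp: min_def)
  have "m holomorphic_on {w. a < cmod w}"
    unfolding holomorphic_on_def
  proof
    fix w assume w: "w \<in> {w. a < cmod w}"
    define r where "r = (a + min (cmod w) b) / 2"
    have r: "a < r" "r < b" "r < cmod w" "0 < r" using w a by (auto simp: r_def min_def)
    have O: "open {w. r < cmod w}" by (rule open_ring)
    have "(\<lambda>w. - cint r (\<lambda>t. f t / (t - w))) holomorphic_on {w. r < cmod w}"
      by (intro holomorphic_intros holomorphic_on_subset[OF cint_kernel_holomorphic]) (use c r in auto)
    then have "m holomorphic_on {w. r < cmod w}"
      by (rule holomorphic_transform) (use m r in auto)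
    then show "m field_differentiable at w within {w. a < cmod w}"
      using O r by (metis (mono_tags) field_differentiable_at_within holomorphic_on_imp_differentiable_at mem_Collect_eq)
  qed
  then show thesis using m that by blast
qed

section \<open>Reflection in the unit circle\<close>

lemma holomorphic_inversion_cnj:
  assumes f: "f holomorphic_on S" "open S" and T: "\<And>w. w \<in> T \<Longrightarrow> w \<noteq> 0 \<and> 1 / cnj w \<in> S"
  shows "(\<lambda>w. cnj (f (1 / cnj w))) holomorphic_on T"
proof -
  have "cnj ` cnj ` S = S" by (force simp: image_image)
  moreover have eqS: "cnj ` S = cnj -` S" by (force simp: image_iff)
  have opS: "open (cnj ` S)" unfolding eqS
    by (rule continuous_open_vimage) (use f in \<open>auto intro!: continuous_intros\<close>)
  ultimately have "(cnj \<circ> f \<circ> cnj) holomorphic_on (cnj ` S)"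
    by (intro holomorphic_on_compose_cnj_cnj) (use f opS in auto)
  moreover have H: "(\<lambda>w. 1 / w) holomorphic_on T" using T by (intro holomorphic_intros) auto
  moreover have "(\<lambda>w. 1 / w) ` T \<subseteq> cnj ` S"
    using T by (auto simp: image_iff intro!: bexI[of _ "1 / cnj _"])
  ultimately have "((cnj \<circ> f \<circ> cnj) \<circ> (\<lambda>w. 1 / w)) holomorphic_on T"
    using holomorphic_on_compose_gen[OF H] by blast
  then show ?thesis by (simp add: o_def)
qed

text \<open>In the strip \<open>S\<close> over the ring, \<open>v (exp z)\<close> has a logarithm
  \<open>F\<close>. Its increment under the period \<open>p\<close> is a constant, a multiple
  \<open>k\<close> of \<open>p\<close> (the winding number of \<open>v\<close>), so
  \<open>F z - of_int k * z\<close> is periodic and descends to the ring.\<close>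

lemma ring_logarithm:
  assumes v: "v holomorphic_on {w. a < cmod w \<and> cmod w < 1}" and a: "0 < a" "a < 1"
    and nz: "\<And>w. a < cmod w \<Longrightarrow> cmod w < 1 \<Longrightarrow> v w \<noteq> 0"
  obtains q k where "q holomorphic_on {w. a < cmod w \<and> cmod w < 1}"
    and "\<And>w. a < cmod w \<Longrightarrow> cmod w < 1 \<Longrightarrow> v w = w powi k * exp (q w)"
proof -
  define A where "A = {w. a < cmod w \<and> cmod w < 1}"
  define S where "S = {z. ln a < Re z \<and> Re z < 0}"
  have S: "convex S" "open S"
  proof -
    have "S = {z. ln a < Re z} \<inter> {z. Re z < 0}" by (auto simp: S_def)
    then show "convex S" "open S"
      by (auto simp: convex_halfspace_Re_gt convex_halfspace_Re_lt open_halfspace_Re_gt open_halfspace_Re_lt intro!: convex_Int open_Int)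
  qed
  have expS: "exp z \<in> A \<longleftrightarrow> z \<in> S" for z
    using a ln_less_cancel_iff[of a "exp (Re z)"] by (auto simp: A_def S_def)
  have LnS: "Ln w \<in> S" if "w \<in> A" for w
  proof -
    have "w \<noteq> 0" using that a by (auto simp: A_def)
    then show ?thesis using that expS[of "Ln w"] by simp
  qed
  have vh: "(\<lambda>z. v (exp z)) holomorphic_on S"
    using holomorphic_on_compose_gen[of exp S v A] v expS[THEN iffD2] holomorphic_on_exp'[of "\<lambda>z. z"]
    by (auto simp: o_def A_def[symmetric] image_subset_iff)
  define z0 where "z0 = complex_of_real (ln a / 2)"
  have z0: "z0 \<in> S" using a by (auto simp: S_def z0_def)
  have nzS: "v (exp z) \<noteq> 0" if "z \<in> S" for z
    using nz[of "exp z"] expS[THEN iffD2, OF that] unfolding A_def by blast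
  obtain F where F: "F holomorphic_on S" and expF: "\<And>z. z \<in> S \<Longrightarrow> exp (F z) = v (exp z)"
    using holomorphic_logarithm_exists[OF S vh nzS z0] by blast
  define p where "p = 2 * of_real pi * \<i>"
  have shift: "z + p \<in> S \<longleftrightarrow> z \<in> S" for z by (simp add: S_def p_def)
  have "\<exists>c. \<forall>z\<in>S. F (z + p) - F z = c"
  proof (rule has_field_derivative_zero_constant[OF S(1)])
    fix z assume z: "z \<in> S"
    \<comment> \<open>The logarithmic derivative of \<open>v (exp y)\<close>, which has period
      \<open>p\<close>; hence so does \<open>deriv F\<close>.\<close>
    have D: "deriv F y * v (exp y) = deriv v (exp y) * exp y" if y: "y \<in> S" for y
    proof -
      have "((\<lambda>z. exp (F z)) has_field_derivative exp (F y) * deriv F y) (at y)"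
        using holomorphic_derivI[OF F S(2) y] by (auto intro!: derivative_eq_intros)
      then have 1: "((\<lambda>z. v (exp z)) has_field_derivative exp (F y) * deriv F y) (at y)"
        by (rule has_field_derivative_transform_within_open[OF _ S(2) y]) (use expF in auto)
      have "exp y \<in> A" using y expS by auto
      then have "(v has_field_derivative deriv v (exp y)) (at (exp y))"
        using v open_ring(2) by (intro holomorphic_derivI) (auto simp: A_def)
      then have 2: "((\<lambda>z. v (exp z)) has_field_derivative deriv v (exp y) * exp y) (at y)"
        by (intro DERIV_chain2[of v] DERIV_exp)
      show ?thesis using DERIV_unique[OF 1 2] expF[OF y] by (simp add: mult.commute)
    qed
    have e: "exp (z + p) = exp z" by (simp add: exp_add p_def)
    have "v (exp z) \<noteq> 0" using nzS z .
    moreover have "deriv F (z + p) * v (exp z) = deriv F z * v (exp z)"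
      using D[OF z] D[of "z + p"] shift z e by simp
    ultimately have eqd: "deriv F (z + p) = deriv F z" by simp
    have "((\<lambda>z. F (z + p)) has_field_derivative deriv F (z + p)) (at z)"
      using holomorphic_derivI[OF F S(2), of "z + p" UNIV] shift z by (intro DERIV_shift[THEN iffD1]) auto
    then have "((\<lambda>z. F (z + p) - F z) has_field_derivative deriv F (z + p) - deriv F z) (at z)"
      using holomorphic_derivI[OF F S(2) z] by (rule DERIV_diff)
    then show "((\<lambda>z. F (z + p) - F z) has_field_derivative 0) (at z within S)"
      by (simp add: eqd has_field_derivative_at_within)
  qed
  then obtain c where c: "\<And>z. z \<in> S \<Longrightarrow> F (z + p) = F z + c" by (metis diff_add_cancel add.commute)
  have "exp (F z0 + c) = exp (F z0)"
    using expF[OF z0] expF[of "z0 + p"] c[OF z0] shift z0 by (simp add: exp_add p_def)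
  then obtain k :: int where k: "c = of_int k * p"
    by (auto simp: exp_eq p_def algebra_simps)
  define Q where "Q = (\<lambda>z. F z - of_int k * z)"
  have Qp: "Q (z + p) = Q z" if "z \<in> S" for z
    using c[OF that] by (simp add: Q_def k algebra_simps)
  have Qn: "Q (z + of_nat n * p) = Q z \<and> z + of_nat n * p \<in> S" if "z \<in> S" for z n
    using that by (induction n) (auto simp: algebra_simps shift Qp dest: Qp, metis Qp add.assoc add.commute shift)
  have Qi: "Q (z + of_int n * p) = Q z" if "z \<in> S" for z n
  proof (cases n)
    case (nonneg m)
    then show ?thesis using Qn[OF that, of m] by simp
  next
    case (neg m)
    have "z + of_int n * p \<in> S" using that by (simp add: S_def p_def)
    moreover have "of_int n = - (of_nat (Suc m) :: complex)" unfolding neg by simp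
    then have "z + of_int n * p + of_nat (Suc m) * p = z" by (simp only:) (simp add: algebra_simps)
    ultimately show ?thesis using Qn[of "z + of_int n * p" "Suc m"] by metis
  qed
  define q where "q = (\<lambda>w. Q (Ln w))"
  \<comment> \<open>\<open>Ln (exp z)\<close> differs from \<open>z\<close> by a multiple of the
    period, so the choice of branch in \<open>q\<close> is immaterial.\<close>
  have q: "q (exp z) = Q z" if "z \<in> S" for z
  proof -
    obtain n :: int where "Ln (exp z) = z + of_int n * p"
      using exp_Ln[of "exp z"] unfolding exp_eq by (auto simp: p_def algebra_simps)
    then show ?thesis using Qi[OF that] by (simp add: q_def)
  qed
  have "q holomorphic_on A"
    unfolding holomorphic_on_def
  proof
    fix w assume w: "w \<in> A"
    then have w0: "w \<noteq> 0" using a by (auto simp: A_def)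
    \<comment> \<open>A branch of the logarithm that is holomorphic near \<open>w\<close> even when
      \<open>w\<close> lies on the cut of \<open>Ln\<close>.\<close>
    define l where "l = (\<lambda>x. Ln w + Ln (x / w))"
    have l0: "l w = Ln w" using w0 by (simp add: l_def)
    have "(l has_field_derivative 1 / w) (at w)"
      unfolding l_def using w0 by (auto intro!: derivative_eq_intros)
    moreover have "Q field_differentiable at (l w)"
      unfolding Q_def l0 using F S(2) LnS[OF w]
      by (intro derivative_intros) (auto simp: holomorphic_on_imp_differentiable_at)
    ultimately have "(\<lambda>x. Q (l x)) field_differentiable at w"
      using field_differentiable_compose[of l w Q] by (auto simp: o_def field_differentiable_def)
    moreover have "\<forall>\<^sub>F x in nhds w. x \<in> A"
      using w open_ring(2) unfolding A_def by (rule eventually_nhds_in_open[rotated])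
    then have "\<forall>\<^sub>F x in nhds w. Q (l x) = q x"
    proof (rule eventually_mono)
      fix x assume x: "x \<in> A"
      then have "x \<noteq> 0" using a by (auto simp: A_def)
      then have "exp (l x) = x" using w0 by (simp add: l_def exp_add)
      then show "Q (l x) = q x" using q[of "l x"] expS[of "l x"] x by simp
    qed
    ultimately have "q field_differentiable at w"
      unfolding field_differentiable_def by (metis DERIV_cong_ev)
    then show "q field_differentiable at w within A" by (rule field_differentiable_at_within)
  qed
  moreover have "v w = w powi k * exp (q w)" if "a < cmod w" "cmod w < 1" for w
  proof -
    have w0: "w \<noteq> 0" using that a by auto
    have z: "Ln w \<in> S" using LnS that by (simp add: A_def)
    have "v w = exp (F (Ln w))" using expF[OF z] w0 by simp
    also have "\<dots> = exp (Q (Ln w)) * exp (of_int k * Ln w)" by (simp add: Q_def exp_add[symmetric])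
    also have "exp (of_int k * Ln w) = w powi k" using w0 exp_power_int[of "Ln w" k] by simp
    finally show ?thesis by (simp add: q_def mult.commute)
  qed
  ultimately show thesis using that unfolding A_def by blast
qed

text \<open>All that is known at the circle is that \<open>|v|\<close> tends to 1. For a logarithm
  \<open>q\<close> of \<open>v w / w powi k\<close> the real part tends to 0, so in the Cauchy
  formula over circles of radius tending to 1 one may trade \<open>q\<close> for
  \<open>- cnj q\<close>. This expresses the positive Laurent part of \<open>q\<close> through the
  reflected negative part \<open>m\<close>, which is defined beyond the circle.\<close>

lemma reflection_principle:
  assumes v: "v holomorphic_on {w. a < cmod w \<and> cmod w < 1}" and a: "0 < a" "a < 1"
    and nz: "\<And>w. a < cmod w \<Longrightarrow> cmod w < 1 \<Longrightarrow> v w \<noteq> 0"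
    and lim: "\<And>e. e > 0 \<Longrightarrow> \<exists>d<1. \<forall>w. d < cmod w \<and> cmod w < 1 \<longrightarrow> \<bar>cmod (v w) - 1\<bar> < e"
  obtains V where "V holomorphic_on {w. a < cmod w \<and> cmod w < 1 / a}"
    and "\<And>w. a < cmod w \<Longrightarrow> cmod w < 1 \<Longrightarrow> V w = v w"
    and "\<And>w. a < cmod w \<Longrightarrow> cmod w < 1 / a \<Longrightarrow> V w * cnj (V (1 / cnj w)) = 1"
proof -
  obtain q k where q: "q holomorphic_on {w. a < cmod w \<and> cmod w < 1}"
    and vq: "\<And>w. a < cmod w \<Longrightarrow> cmod w < 1 \<Longrightarrow> v w = w powi k * exp (q w)"
    using ring_logarithm[OF v a nz] by metis
  have Req: "Re (q w) = ln (cmod (v w)) - k * ln (cmod w)" if "a < cmod w" "cmod w < 1" for w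
  proof -
    have "cmod (v w) = cmod w powi k * exp (Re (q w))"
      by (simp add: vq[OF that] norm_mult norm_power_int)
    moreover have "cmod w > 0" using that a by linarith
    moreover from this have "cmod w powi k = cmod w powr k" by (simp add: powr_real_of_int')
    ultimately have "ln (cmod (v w)) = k * ln (cmod w) + Re (q w)"
      by (simp add: ln_mult ln_powr)
    then show ?thesis by simp
  qed
  have small: "\<exists>d. a < d \<and> d < 1 \<and> (\<forall>w. d < cmod w \<and> cmod w < 1 \<longrightarrow> \<bar>2 * Re (q w)\<bar> < e)" if e: "e > 0" for e
  proof -
    have "isCont ln (1::real)" by (intro isCont_ln) auto
    then obtain e1 where e1: "e1 > 0" "\<And>x::real. \<bar>x - 1\<bar> < e1 \<Longrightarrow> \<bar>ln x\<bar> < e / 4"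
      using e unfolding continuous_at_eps_delta by (metis divide_pos_pos dist_real_def ln_one diff_zero zero_less_numeral)
    define K where "K = \<bar>real_of_int k\<bar> + 1"
    have K: "K > 0" by (simp add: K_def)
    obtain d1 where d1: "d1 < 1" "\<forall>w. d1 < cmod w \<and> cmod w < 1 \<longrightarrow> \<bar>cmod (v w) - 1\<bar> < e1"
      using lim[OF e1(1)] by blast
    obtain e2 where e2: "e2 > 0" "\<And>x::real. \<bar>x - 1\<bar> < e2 \<Longrightarrow> \<bar>ln x\<bar> < e / (4 * K)"
      using \<open>isCont ln (1::real)\<close> e K unfolding continuous_at_eps_delta
      by (metis divide_pos_pos dist_real_def ln_one diff_zero zero_less_numeral mult_pos_pos)
    define d where "d = max ((1 + a) / 2) (max d1 (1 - e2))"
    have "\<bar>2 * Re (q w)\<bar> < e" if w: "d < cmod w" "cmod w < 1" for w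
    proof -
      have "a < cmod w" using w a by (auto simp: d_def)
      then have R: "Re (q w) = ln (cmod (v w)) - k * ln (cmod w)" using Req w by blast
      have "\<bar>ln (cmod (v w))\<bar> < e / 4" using e1(2) d1(2) w by (auto simp: d_def)
      moreover have "\<bar>ln (cmod w)\<bar> < e / (4 * K)" using e2(2)[of "cmod w"] w by (auto simp: d_def)
      then have "K * \<bar>ln (cmod w)\<bar> < e / 4" using K by (simp add: field_simps)
      then have "\<bar>real_of_int k\<bar> * \<bar>ln (cmod w)\<bar> < e / 4"
        by (rule order.strict_trans1[rotated]) (simp add: K_def mult_right_mono)
      then have "\<bar>k * ln (cmod w)\<bar> < e / 4" by (simp add: abs_mult)
      moreover have "\<bar>2 * (x - y)\<bar> < e" if "\<bar>x\<bar> < e / 4" "\<bar>y\<bar> < e / 4" for x y :: real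
        using that by (auto simp: abs_less_iff)
      ultimately show ?thesis unfolding R by blast
    qed
    moreover have "a < (1 + a) / 2" "(1 + a) / 2 \<le> d" using a by (auto simp: d_def)
    moreover have "d < 1" using a d1 e2 by (auto simp: d_def)
    ultimately show ?thesis by (meson less_le_trans)
  qed
  obtain m where m: "m holomorphic_on {w. a < cmod w}"
    and m_eq: "\<And>r w. a < r \<Longrightarrow> r < 1 \<Longrightarrow> r < cmod w \<Longrightarrow> m w = - cint r (\<lambda>t. q t / (t - w))"
    using laurent_negative_part[OF q less_imp_le[OF a(1)] a(2)] by blast
  have cq: "continuous_on (sphere 0 x) q" if "a < x" "x < 1" for x
    using q by (intro holomorphic_on_imp_continuous_on[OF holomorphic_on_subset]) (use that in auto)
  \<comment> \<open>The constant Laurent coefficient of \<open>q\<close>. Its real part is the mean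
    of \<open>Re q\<close> over any circle of the ring, which tends to 0.\<close>
  define q0 where "q0 = cint ((1 + a) / 2) (\<lambda>t. q t / t)"
  have q0: "cint s (\<lambda>t. q t / t) = q0" if s: "a < s" "s < 1" for s
  proof -
    have h: "(\<lambda>t. q t / t) holomorphic_on {w. a < cmod w \<and> cmod w < 1}"
      using q a by (intro holomorphic_intros) auto
    show ?thesis unfolding q0_def
      using cint_eq[OF open_ring(2) h, of "(1 + a) / 2" s] cint_eq[OF open_ring(2) h, of s "(1 + a) / 2"] s a
      by (cases "s \<le> (1 + a) / 2") auto
  qed
  have Re_int: "(\<lambda>w. 2 * of_real (Re (q w))) = (\<lambda>w. q w + cnj (q w))"
    by (simp add: fun_eq_iff complex_add_cnj)
  have "Re q0 = 0"
  proof -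
    have "\<bar>2 * Re q0\<bar> \<le> e" if e: "e > 0" for e
    proof -
      obtain d where d: "a < d" "d < 1" "\<forall>w. d < cmod w \<and> cmod w < 1 \<longrightarrow> \<bar>2 * Re (q w)\<bar> < e"
        using small[OF e] by blast
      define s where "s = (1 + d) / 2"
      have s: "d < s" "s < 1" "a < s" "0 < s" using d a by (auto simp: s_def)
      have "cint s (\<lambda>t. q t / t + cnj (q t) / t) = cint s (\<lambda>t. q t / t) + cint s (\<lambda>t. cnj (q t) / t)"
        by (rule cint_add) (use s cq in \<open>auto intro!: continuous_intros\<close>)
      also have "cint s (\<lambda>t. cnj (q t) / t) = cnj (cint s (\<lambda>t. q t / t))"
        unfolding cnj_cint[OF s(4)]
      proof (rule cint_cong)
        fix t assume t: "cmod t = s"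
        have "cnj t * t = of_real (s\<^sup>2)" using t by (metis complex_norm_square mult.commute)
        moreover have "t \<noteq> 0" using t s by auto
        ultimately have "of_real (s\<^sup>2) / t\<^sup>2 = cnj t / t" by (simp add: power2_eq_square field_simps)
        moreover have "cnj (q t / t) * complex_of_real (s\<^sup>2) / t\<^sup>2 = cnj (q t) / cnj t * (of_real (s\<^sup>2) / t\<^sup>2)"
          by simp
        ultimately show "cnj (q t) / t = cnj (q t / t) * complex_of_real (s\<^sup>2) / t\<^sup>2"
          using \<open>t \<noteq> 0\<close> by simp
      qed (use s in auto)
      finally have "cint s (\<lambda>t. q t / t + cnj (q t) / t) = of_real (2 * Re q0)"
        using q0[of s] s by (simp add: complex_add_cnj)
      then have "\<bar>2 * Re q0\<bar> = cmod (cint s (\<lambda>t. q t / t + cnj (q t) / t))" by (metis norm_of_real)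
      also have "\<dots> \<le> (e / s) * s"
      proof (rule cint_bound)
        fix t assume t: "cmod t = s"
        have "q t / t + cnj (q t) / t = of_real (2 * Re (q t)) / t"
          by (simp add: add_divide_distrib[symmetric] complex_add_cnj)
        then have "cmod (q t / t + cnj (q t) / t) = \<bar>2 * Re (q t)\<bar> / s"
          by (simp only: norm_divide norm_of_real t)
        also have "\<dots> \<le> e / s" using d t s by (intro divide_right_mono less_imp_le) auto
        finally show "cmod (q t / t + cnj (q t) / t) \<le> e / s" .
      qed (use s cq in \<open>auto intro!: continuous_intros\<close>)
      finally show ?thesis using s by simp
    qed
    then have "\<bar>2 * Re q0\<bar> \<le> 0" by (metis dense_ge)
    then show ?thesis by simp
  qed
  have qm: "q w = m w - cnj q0 - cnj (m (1 / cnj w))" if w: "a < cmod w" "cmod w < 1" for w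
  proof -
    have w0: "w \<noteq> 0" using w a by auto
    define X where "X = q w - m w"
    have Xs: "X = cint s (\<lambda>t. q t / (t - w))" if "cmod w < s" "s < 1" for s
      using cint_annulus_Cauchy[OF q, of "(a + cmod w) / 2" w s] m_eq[of "(a + cmod w) / 2" w] that w a
      by (simp add: X_def)
    \<comment> \<open>Conjugating the integral replaces \<open>w\<close> by its mirror image
      \<open>W\<close> in the circle of radius \<open>s\<close>. This lies outside the circle, where
      the integral is given by the negative part \<open>m\<close>.\<close>
    have conj: "cint s (\<lambda>t. cnj (q t) / (t - w)) = cnj (q0 + m (of_real (s\<^sup>2) / cnj w))"
      if s: "cmod w < s" "s < 1" for s
    proof -
      have s0: "0 < s" "a < s" using s w a by auto
      define W where "W = of_real (s\<^sup>2) / cnj w"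
      have nW: "cmod W = s\<^sup>2 / cmod w" by (simp add: W_def norm_divide norm_power)
      have sW: "s < cmod W" unfolding nW using s s0 w0 by (simp add: field_simps power2_eq_square)
      have "cint s (\<lambda>t. cnj (q t) / (t - w)) = cnj (cnj (cint s (\<lambda>t. cnj (q t) / (t - w))))" by simp
      also have "cnj (cint s (\<lambda>t. cnj (q t) / (t - w))) = cint s (\<lambda>t. q t / t - q t / (t - W))"
        unfolding cnj_cint[OF s0(1)]
      proof (rule cint_cong)
        fix t assume t: "cmod t = s"
        have t0: "t \<noteq> 0" using t s0 by auto
        have ct: "cnj t = of_real (s\<^sup>2) / t"
          using t t0 by (simp add: field_simps) (metis complex_norm_square mult.commute of_real_power)
        have tW: "t - W \<noteq> 0" using t sW by auto
        have S: "of_real (s\<^sup>2) = W * cnj w" using w0 by (simp add: W_def)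
        have cw: "cnj w \<noteq> 0" using w0 by simp
        have "cnj t - cnj w = cnj w * (W - t) / t"
          unfolding ct S using t0 by (simp add: field_simps)
        then have "cnj (cnj (q t) / (t - w)) * of_real (s\<^sup>2) / t\<^sup>2 = q t / (cnj w * (W - t) / t) * (W * cnj w) / t\<^sup>2"
          by (simp add: S[symmetric])
        also have "\<dots> = q t * W / (t * (W - t))"
          using t0 cw tW by (simp add: power2_eq_square divide_simps)
        also have "\<dots> = q t / t - q t / (t - W)"
        proof -
          have "W - t \<noteq> 0" using tW by auto
          then show ?thesis using t0 tW by (simp add: divide_simps) (simp add: algebra_simps)
        qed
        finally show "cnj (cnj (q t) / (t - w)) * complex_of_real (s\<^sup>2) / t\<^sup>2 = q t / t - q t / (t - W)" .
      qed (use s0 in auto)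
      also have "\<dots> = cint s (\<lambda>t. q t / t) - cint s (\<lambda>t. q t / (t - W))"
        by (rule cint_diff) (use s s0 sW cq in \<open>auto intro!: continuous_intros\<close>)
      also have "\<dots> = q0 + m W" using q0[OF s0(2) s(2)] m_eq[OF s0(2) s(2) sW] by simp
      finally show ?thesis unfolding W_def .
    qed
    have "a * cmod w < 1 * 1" using w a by (intro mult_strict_mono) auto
    then have cm: "isCont m (1 / cnj w)"
      using open_ring(1) w0
      by (intro continuous_on_interior[OF holomorphic_on_imp_continuous_on[OF m]])
         (auto simp: interior_open norm_divide field_simps)
    have "((\<lambda>s. complex_of_real (s\<^sup>2) / cnj w) \<longlongrightarrow> of_real (1\<^sup>2) / cnj w) (at_left 1)"
      using w0 by (intro tendsto_intros) auto
    then have "((\<lambda>s. complex_of_real (s\<^sup>2) / cnj w) \<longlongrightarrow> 1 / cnj w) (at_left 1)" by simp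
    from isCont_tendsto_compose[OF cm this]
    have "((\<lambda>s. m (of_real (s\<^sup>2) / cnj w)) \<longlongrightarrow> m (1 / cnj w)) (at_left 1)" .
    then have L: "((\<lambda>s. X + cnj (q0 + m (of_real (s\<^sup>2) / cnj w))) \<longlongrightarrow> X + cnj (q0 + m (1 / cnj w))) (at_left 1)"
      by (intro tendsto_intros)
    \<comment> \<open>The two integrands add up to \<open>2 * Re (q t) / (t - w)\<close>, and
      \<open>|t - w|\<close> stays above \<open>(1 - |w|) / 2\<close>; the choice of
      \<open>e'\<close> compensates for this denominator.\<close>
    have "((\<lambda>s. X + cnj (q0 + m (of_real (s\<^sup>2) / cnj w))) \<longlongrightarrow> 0) (at_left 1)"
    proof (rule tendstoI)
      fix e :: real assume e: "e > 0"
      define e' where "e' = e * ((1 - cmod w) / 2) / 2"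
      have e': "e' > 0" using e w by (simp add: e'_def)
      obtain d where d: "a < d" "d < 1" "\<forall>w. d < cmod w \<and> cmod w < 1 \<longrightarrow> \<bar>2 * Re (q w)\<bar> < e'"
        using small[OF e'] by blast
      have "\<forall>\<^sub>F s in at_left 1. max d ((1 + cmod w) / 2) < s \<and> s < 1"
        by (subst eventually_at_left[of "max d ((1 + cmod w) / 2)"])
           (use d w in \<open>auto intro!: exI[of _ "max d ((1 + cmod w) / 2)"]\<close>)
      then show "\<forall>\<^sub>F s in at_left 1. dist (X + cnj (q0 + m (of_real (s\<^sup>2) / cnj w))) 0 < e"
      proof (rule eventually_mono)
        fix s assume s: "max d ((1 + cmod w) / 2) < s \<and> s < 1"
        then have s': "cmod w < s" "s < 1" "d < s" "(1 - cmod w) / 2 < s - cmod w" "0 < s" "a < s"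
          using w a d by (auto simp: field_simps)
        have "X + cnj (q0 + m (of_real (s\<^sup>2) / cnj w)) = cint s (\<lambda>t. q t / (t - w)) + cint s (\<lambda>t. cnj (q t) / (t - w))"
          using Xs[OF s'(1,2)] conj[OF s'(1,2)] by simp
        also have "\<dots> = cint s (\<lambda>t. q t / (t - w) + cnj (q t) / (t - w))"
          by (rule cint_add[symmetric]) (use s' cq in \<open>auto intro!: continuous_intros\<close>)
        also have "cmod \<dots> \<le> (e' / (s - cmod w)) * s"
        proof (rule cint_bound)
          fix t assume t: "cmod t = s"
          have "q t / (t - w) + cnj (q t) / (t - w) = of_real (2 * Re (q t)) / (t - w)"
            by (simp add: add_divide_distrib[symmetric] complex_add_cnj)
          then have "cmod (q t / (t - w) + cnj (q t) / (t - w)) = \<bar>2 * Re (q t)\<bar> / cmod (t - w)"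
            by (simp only: norm_divide norm_of_real)
          also have "\<dots> \<le> e' / (s - cmod w)"
            using d t s' norm_triangle_ineq2[of t w] by (intro frac_le) (auto intro!: less_imp_le)
          finally show "cmod (q t / (t - w) + cnj (q t) / (t - w)) \<le> e' / (s - cmod w)" .
        qed (use s' cq in \<open>auto intro!: continuous_intros\<close>)
        also have "\<dots> \<le> (e' / ((1 - cmod w) / 2)) * 1"
          using s' w e' by (intro mult_mono divide_left_mono) auto
        also have "\<dots> = e / 2"
        proof -
          have K: "e * k / 2 / k * 1 = e / 2" if "k \<noteq> 0" for k :: real using that by simp
          have "(1 - cmod w) / 2 \<noteq> 0" using w by simp
          from K[OF this] show ?thesis unfolding e'_def .
        qed
        also have "\<dots> < e" using e by simp
        finally show "dist (X + cnj (q0 + m (of_real (s\<^sup>2) / cnj w))) 0 < e" by (simp add: dist_norm)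
      qed
    qed
    then have "X + cnj (q0 + m (1 / cnj w)) = 0"
      using L tendsto_unique trivial_limit_at_left_real by blast
    then show ?thesis by (simp add: X_def algebra_simps add_eq_0_iff)
  qed
  \<comment> \<open>Because \<open>Re q0 = 0\<close>, reflecting the argument and conjugating the
    value changes \<open>Q\<close> into \<open>- Q\<close>; after exponentiation this is the
    identity claimed for \<open>V\<close>.\<close>
  define Q where "Q = (\<lambda>w. m w - cnj q0 - cnj (m (1 / cnj w)))"
  define B where "B = {w. a < cmod w \<and> cmod w < 1 / a}"
  have B0: "w \<noteq> 0" if "w \<in> B" for w using that a by (auto simp: B_def)
  have Binv: "1 / cnj w \<in> B" if "w \<in> B" for w
    using that a B0[OF that] by (auto simp: B_def norm_divide field_simps)
  have Qh: "Q holomorphic_on B" unfolding Q_def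
    by (intro holomorphic_intros holomorphic_on_subset[OF m] holomorphic_inversion_cnj[OF m open_ring(1)])
       (use B0 Binv in \<open>auto simp: B_def\<close>)
  define V where "V = (\<lambda>w. w powi k * exp (Q w))"
  have "V holomorphic_on B" unfolding V_def
    using Qh B0 by (intro holomorphic_intros) auto
  moreover have "V w = v w" if "a < cmod w" "cmod w < 1" for w
    using vq[OF that] qm[OF that] by (simp add: V_def Q_def)
  moreover have "V w * cnj (V (1 / cnj w)) = 1" if w: "w \<in> B" for w
  proof -
    have "cnj (Q (1 / cnj w)) = - Q w - (q0 + cnj q0)"
      by (simp add: Q_def)
    then have "cnj (Q (1 / cnj w)) = - Q w" using \<open>Re q0 = 0\<close> by (simp add: complex_add_cnj)
    then show ?thesis using B0[OF w]
      by (simp add: V_def exp_cnj exp_minus power_int_divide_distrib complex_cnj_power_int divide_simps)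
  qed
  ultimately show thesis using that unfolding B_def by blast
qed

section \<open>Reflection of univalent functions\<close>

lemma connected_ring: "connected {w::complex. a < cmod w \<and> cmod w < b}"
  using connected_annulus(1)[of a "0::complex" b] by (simp add: dist_norm conj_commute)

text \<open>Parametrised by the angle, \<open>dw = \<i> w d\<theta>\<close>, so
  \<open>cint 1 g\<close> is the mean of \<open>w * g w\<close> over the circle.\<close>

lemma Re_cint_nonneg:
  assumes g: "continuous_on (sphere 0 1) g" and nn: "\<And>w. cmod w = 1 \<Longrightarrow> 0 \<le> Re (w * g w)"
  shows "0 \<le> Re (cint 1 g)"
proof -
  define c where "c = (\<lambda>t. circlepath 0 1 t)"
  have c: "cmod (c t) = 1" for t by (simp add: c_def circlepath)
  have vd: "vector_derivative (circlepath 0 1) (at t) = 2 * of_real pi * \<i> * c t" for t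
    unfolding c_def vector_derivative_circlepath by (simp add: circlepath)
  have "contour_integral (circlepath 0 1) g = integral {0..1} (\<lambda>t. (2 * of_real pi * \<i>) * (c t * g (c t)))"
    unfolding contour_integral_integral
    by (rule integral_cong) (simp add: vd, simp add: c_def mult_ac)
  then have eq: "cint 1 g = integral {0..1} (\<lambda>t. c t * g (c t))"
    by (simp add: cint_def)
  have cc: "continuous_on {0..1} c" using path_circlepath[of 0 1] by (simp add: path_def c_def)
  have int: "(\<lambda>t. c t * g (c t)) integrable_on {0..1}"
    by (intro integrable_continuous_interval continuous_intros cc continuous_on_compose2[OF g cc]) (use c in auto)
  have "Re (cint 1 g) = integral {0..1} (\<lambda>t. Re (c t * g (c t)))"
    unfolding eq using integral_linear[OF int bounded_linear_Re] by (simp add: o_def)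
  also have "\<dots> \<ge> 0"
    using integrable_linear[OF int bounded_linear_Re] nn c by (intro integral_nonneg) (auto simp: o_def)
  finally show ?thesis .
qed

text \<open>The last clause says that \<open>V\<close> runs once positively around the unit circle,
  in the form in which it is used: as a substitution rule for circle integrals.\<close>

definition circle_reflection :: "real \<Rightarrow> (complex \<Rightarrow> complex) \<Rightarrow> (complex \<Rightarrow> complex) \<Rightarrow> bool" where
  "circle_reflection a v V \<longleftrightarrow> 0 < a \<and> a < 1 \<and>
     V holomorphic_on {w. a < cmod w \<and> cmod w < 1 / a} \<and>
     inj_on V {w. a < cmod w \<and> cmod w < 1 / a} \<and>
     (\<forall>w. a < cmod w \<and> cmod w < 1 \<longrightarrow> V w = v w) \<and>
     (\<forall>w. a < cmod w \<and> cmod w < 1 / a \<longrightarrow> V w * cnj (V (1 / cnj w)) = 1) \<and>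
     (\<forall>w. a < cmod w \<and> cmod w < 1 / a \<longrightarrow> (cmod (V w) = 1 \<longleftrightarrow> cmod w = 1)) \<and>
     (\<forall>w. a < cmod w \<and> cmod w < 1 / a \<longrightarrow> (cmod (V w) < 1 \<longleftrightarrow> cmod w < 1)) \<and>
     V ` sphere 0 1 = sphere 0 1 \<and>
     (\<forall>F S. open S \<and> sphere 0 1 \<subseteq> S \<and> F holomorphic_on S
        \<longrightarrow> cint 1 (\<lambda>w. F (V w) * deriv V w) = cint 1 F)"

text \<open>\<open>reflection_principle\<close> supplies \<open>V\<close>; its identity forces
  \<open>|V| > 1\<close> beyond the circle and \<open>|V| = 1\<close> on it. The rest is topology:
  injectivity on the circle follows from the open mapping theorem, surjectivity onto it from
  connectedness, and positive orientation from the growth of \<open>|V|\<close> across it.\<close>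

lemma univalent_reflection:
  assumes v: "v holomorphic_on {w. b < cmod w \<and> cmod w < 1}" and b: "0 \<le> b" "b < 1"
    and inj: "inj_on v {w. b < cmod w \<and> cmod w < 1}"
    and v1: "\<And>w. b < cmod w \<Longrightarrow> cmod w < 1 \<Longrightarrow> cmod (v w) < 1"
    and lim: "\<And>e. e > 0 \<Longrightarrow> \<exists>d<1. \<forall>w. d < cmod w \<and> cmod w < 1 \<longrightarrow> \<bar>cmod (v w) - 1\<bar> < e"
  obtains a V where "b < a" "circle_reflection a v V"
proof -
  obtain d where d: "d < 1" "\<forall>w. d < cmod w \<and> cmod w < 1 \<longrightarrow> \<bar>cmod (v w) - 1\<bar> < 1 / 2"
    using lim[of "1 / 2"] by auto
  \<comment> \<open>Large enough that \<open>b < a\<close> and that \<open>v\<close> is zero-free on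
    the ring, as the reflection requires.\<close>
  define a where "a = max ((1 + b) / 2) d"
  have "(1 + b) / 2 \<le> a" "d \<le> a" "a < 1" using b d by (auto simp: a_def)
  then have a: "b < a" "a < 1" "0 < a" "d \<le> a" using b by auto
  have nz: "v w \<noteq> 0" if "a < cmod w" "cmod w < 1" for w
  proof
    assume "v w = 0"
    moreover have "\<bar>cmod (v w) - 1\<bar> < 1 / 2" using d(2) that a by auto
    ultimately show False by simp
  qed
  have va: "v holomorphic_on {w. a < cmod w \<and> cmod w < 1}"
    by (rule holomorphic_on_subset[OF v]) (use a in auto)
  obtain V where V: "V holomorphic_on {w. a < cmod w \<and> cmod w < 1 / a}"
    and Vv: "\<And>w. a < cmod w \<Longrightarrow> cmod w < 1 \<Longrightarrow> V w = v w"
    and Vr: "\<And>w. a < cmod w \<Longrightarrow> cmod w < 1 / a \<Longrightarrow> V w * cnj (V (1 / cnj w)) = 1"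
    using reflection_principle[OF va a(3,2) nz lim] by blast
  define A where "A = {w. a < cmod w \<and> cmod w < 1 / a}"
  have A: "open A" "connected A" unfolding A_def by (rule open_ring connected_ring)+
  have a1: "1 < 1 / a" using a by simp
  have A0: "w \<noteq> 0" if "w \<in> A" for w using that a by (auto simp: A_def)
  have Ainv: "1 / cnj w \<in> A" if "w \<in> A" for w
    using that a A0[OF that] by (auto simp: A_def norm_divide field_simps)
  have lt: "cmod (V w) < 1" if "a < cmod w" "cmod w < 1" for w
    using Vv[OF that] v1[of w] that a by auto
  have nrm: "cmod (V w) * cmod (V (1 / cnj w)) = 1" if "w \<in> A" for w
    using Vr[of w] that by (metis (mono_tags, lifting) A_def complex_mod_cnj mem_Collect_eq norm_mult norm_one)
  have gt: "cmod (V w) > 1" if "w \<in> A" "cmod w > 1" for w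
  proof -
    have "cmod (1 / cnj w) < 1" using that by (auto simp: norm_divide divide_less_eq_1)
    moreover have "a < cmod (1 / cnj w)" using Ainv[OF that(1)] by (simp add: A_def)
    ultimately have l: "cmod (V (1 / cnj w)) < 1" using lt by blast
    show ?thesis
    proof (rule ccontr)
      assume "\<not> cmod (V w) > 1"
      then have "cmod (V w) * cmod (V (1 / cnj w)) \<le> 1 * cmod (V (1 / cnj w))" by (intro mult_right_mono) auto
      then show False using l nrm[OF that(1)] by simp
    qed
  qed
  have eq1: "cmod (V w) = 1" if "cmod w = 1" for w
  proof -
    have wA: "w \<in> A" using that a a1 by (simp add: A_def)
    have "cnj w * w = 1" using that by (metis complex_norm_square mult.commute of_real_1 power_one)
    then have "1 / cnj w = w" by (metis divide_eq_eq mult_zero_left zero_neq_one mult.commute)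
    then have "cmod (V w) * cmod (V w) = 1" using nrm[OF wA] by simp
    then show ?thesis by (simp add: square_eq_1_iff) (metis norm_ge_zero not_one_le_zero neg_0_le_iff_le zero_neq_one abs_norm_cancel abs_minus_cancel abs_one)
  qed
  have iff1: "cmod (V w) = 1 \<longleftrightarrow> cmod w = 1" and iff2: "cmod (V w) < 1 \<longleftrightarrow> cmod w < 1" if "w \<in> A" for w
    using lt[of w] gt[of w] eq1[of w] that by (force simp: A_def)+
  have oneA: "w \<in> A" if "cmod w = 1" for w using that a a1 by (simp add: A_def)
  have sA: "sphere 0 1 \<subseteq> A" using oneA by auto
  have V0: "V w \<noteq> 0" if "cmod w = 1" for w using eq1[OF that] by auto
  have nc: "\<not> V constant_on A"
  proof
    assume "V constant_on A"
    then obtain c where c: "\<And>w. w \<in> A \<Longrightarrow> V w = c" by (auto simp: constant_on_def)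
    define x where "x = complex_of_real ((1 + a) / 2)"
    have nx: "cmod x = (1 + a) / 2" unfolding x_def norm_of_real using a by simp
    have x1: "cmod x < 1" "a < cmod x" using nx a by auto
    then have "x \<in> A" using a1 unfolding A_def by (auto intro: less_trans)
    then show False using c[of x] c[of 1] oneA[of 1] iff2[of x] iff2[of 1] x1 by simp
  qed
  have om: "open (V ` U)" if "open U" "U \<subseteq> A" for U
    using open_mapping_thm[OF V[folded A_def] A that nc] .
  have injV: "inj_on V A"
  proof (rule inj_onI, rule ccontr)
    fix x y assume xy: "x \<in> A" "y \<in> A" "V x = V y" and ne: "x \<noteq> y"
    have inj': "p = q" if "p \<in> A" "q \<in> A" "cmod p < 1" "V p = V q" for p q
    proof -
      have "cmod q < 1" using iff2[OF that(1)] iff2[OF that(2)] that by simp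
      then have "v p = v q" using Vv[of p] Vv[of q] that by (simp add: A_def)
      then show ?thesis using inj that a \<open>cmod q < 1\<close> by (auto simp: A_def inj_on_def)
    qed
    have rec: "b = 1 / a" if "a * b = 1" for a b :: complex
    proof -
      have "a \<noteq> 0" using that by auto
      then show ?thesis using that by (simp add: field_simps)
    qed
    consider "cmod x < 1" | "cmod x > 1" | "cmod x = 1" by linarith
    then show False
    proof cases
      case 1 then show ?thesis using inj' xy ne by blast
    next
      case 2
      have "cnj (V (1 / cnj x)) = 1 / V x" "cnj (V (1 / cnj y)) = 1 / V y"
        using rec[OF Vr[of x]] rec[OF Vr[of y]] xy unfolding A_def mem_Collect_eq by blast+
      then have "V (1 / cnj x) = V (1 / cnj y)" using xy(3) by (metis complex_cnj_cnj)
      moreover have "cmod (1 / cnj x) < 1" using 2 by (auto simp: norm_divide divide_less_eq_1)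
      ultimately have "1 / cnj x = 1 / cnj y" using inj' Ainv xy by blast
      then show ?thesis using ne by (simp add: A0 xy)
    next
      case 3
      \<comment> \<open>If a point of the circle shared its value with another point, disjoint
        neighbourhoods would have overlapping open images; a common value \<open>u\<close> of
        modulus below 1 then contradicts injectivity in the inner ring.\<close>
      define e where "e = dist x y / 2"
      have e: "e > 0" using ne by (simp add: e_def)
      define B1 where "B1 = ball x e \<inter> A"
      define B2 where "B2 = ball y e \<inter> A"
      have "ball x e \<inter> ball y e = {}" by (rule disjoint_ballI) (simp add: e_def)
      then have disj: "B1 \<inter> B2 = {}" unfolding B1_def B2_def by blast
      have "open (V ` B1 \<inter> V ` B2)" by (intro open_Int om) (auto simp: B1_def B2_def A)
      moreover have "x \<in> B1" "y \<in> B2" using xy e by (auto simp: B1_def B2_def)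
      then have "V x \<in> V ` B1 \<inter> V ` B2" by (metis IntI imageI xy(3))
      ultimately obtain \<epsilon> where \<epsilon>: "\<epsilon> > 0" "ball (V x) \<epsilon> \<subseteq> V ` B1 \<inter> V ` B2" by (meson openE)
      define s where "s = 1 - min (\<epsilon> / 2) (1 / 2)"
      have s: "0 < s" "s < 1" "1 - s < \<epsilon>" using \<epsilon> by (auto simp: s_def min_def)
      define u where "u = of_real s * V x"
      have nV: "cmod (V x) = 1" using 3 eq1 by blast
      have "dist (V x) u = cmod (of_real (1 - s) * V x)" by (simp add: u_def dist_norm algebra_simps)
      also have "\<dots> = 1 - s" using s by (simp only: norm_mult nV norm_of_real) simp
      finally have "u \<in> ball (V x) \<epsilon>" using s by simp
      then have "u \<in> V ` B1" "u \<in> V ` B2" using \<epsilon> by blast+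
      then obtain p q where p: "p \<in> B1" "V p = u" and q: "q \<in> B2" "V q = u" by auto
      have "cmod u < 1" unfolding u_def norm_mult nV norm_of_real using s by simp
      then have "cmod p < 1" using iff2[of p] p by (auto simp: B1_def)
      then have "p = q" using inj'[of p q] p q by (auto simp: B1_def B2_def)
      then show ?thesis using p q disj by auto
    qed
  qed
  have surj: "V ` sphere 0 1 = sphere 0 1"
  proof -
    \<comment> \<open>As \<open>|V w| = 1\<close> only for \<open>|w| = 1\<close>, the image of the
      circle is relatively open in the circle; being compact, it is also closed.\<close>
    have eqT: "V ` sphere 0 1 = sphere 0 1 \<inter> V ` A"
      using iff1 oneA by auto
    have "continuous_on (sphere 0 1) V"
      by (rule continuous_on_subset[OF holomorphic_on_imp_continuous_on[OF V]]) (use oneA in \<open>auto simp: A_def\<close>)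
    then have "compact (V ` sphere 0 1)" by (intro compact_continuous_image) auto
    then have "closedin (top_of_set (sphere 0 1)) (V ` sphere 0 1)"
      using eqT by (intro closed_subset compact_imp_closed) auto
    moreover have "openin (top_of_set (sphere 0 1)) (V ` sphere 0 1)"
      unfolding eqT using om[OF A(1) subset_refl] by (simp add: openin_open_Int)
    moreover have "connected (sphere (0::complex) 1)" by (rule connected_sphere) simp
    ultimately show ?thesis unfolding connected_clopen by (metis image_is_empty sphere_eq_empty not_one_less_zero)
  qed
  define \<gamma> where "\<gamma> = circlepath (0::complex) 1"
  have \<gamma>: "cmod (\<gamma> t) = 1" for t by (simp add: \<gamma>_def circlepath)
  have im\<gamma>: "path_image \<gamma> = sphere 0 1" by (simp add: \<gamma>_def)
  have VA: "V analytic_on A" using V A by (simp add: A_def analytic_on_open)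
  have vp: "valid_path (V \<circ> \<gamma>)"
    by (rule valid_path_compose_holomorphic[OF _ V[folded A_def] A(1)]) (use oneA im\<gamma> in \<open>auto simp: \<gamma>_def\<close>)
  have "path_image (V \<circ> \<gamma>) = V ` path_image \<gamma>" by (rule path_image_compose)
  then have imV: "path_image (V \<circ> \<gamma>) = sphere 0 1" using surj im\<gamma> by simp
  have sub: "contour_integral (V \<circ> \<gamma>) F = contour_integral \<gamma> (\<lambda>w. F (V w) * deriv V w)" for F
    using contour_integral_comp_analyticW[OF VA _ , of \<gamma> F] sA im\<gamma>
    by (auto simp: \<gamma>_def mult.commute)
  have wn: "winding_number (V \<circ> \<gamma>) 0 = 1"
  proof -
    have "inj_on V (path_image \<gamma>)" using inj_on_subset[OF injV sA] im\<gamma> by simp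
    then have sp: "simple_path (V \<circ> \<gamma>)"
      by (intro simple_path_continuous_image)
         (use im\<gamma> oneA V in \<open>auto simp: \<gamma>_def simple_path_circlepath A_def intro!: continuous_on_subset[OF holomorphic_on_imp_continuous_on[OF V]]\<close>)
    have in0: "0 \<in> inside (path_image (V \<circ> \<gamma>))"
      unfolding imV by (simp add: inside_frontier_eq_interior[of "ball (0::complex) 1", simplified frontier_ball])
    have pm: "winding_number (V \<circ> \<gamma>) 0 = 1 \<or> winding_number (V \<circ> \<gamma>) 0 = -1"
      by (rule simple_closed_path_winding_number_inside[OF sp]) (use in0 in blast)+
    have "winding_number (V \<circ> \<gamma>) 0 = 1 / (2 * pi * \<i>) * contour_integral (V \<circ> \<gamma>) (\<lambda>w. 1 / (w - 0))"
      by (rule winding_number_valid_path[OF vp]) (simp add: imV)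
    also have "\<dots> = cint 1 (\<lambda>w. deriv V w / V w)"
      unfolding sub by (simp add: cint_def \<gamma>_def)
    finally have wc: "winding_number (V \<circ> \<gamma>) 0 = cint 1 (\<lambda>w. deriv V w / V w)" .
    \<comment> \<open>A simple closed curve has winding number 1 or -1 about an inner point;
      nonnegativity of the real part of the logarithmic integral selects 1.\<close>
    have "0 \<le> Re (cint 1 (\<lambda>w. deriv V w / V w))"
    proof (rule Re_cint_nonneg)
      have "deriv V holomorphic_on A" using V A by (simp add: A_def holomorphic_deriv)
      then show "continuous_on (sphere 0 1) (\<lambda>w. deriv V w / V w)"
        using V[folded A_def] V0 sA
        by (intro continuous_intros)
           (auto intro: continuous_on_subset[OF holomorphic_on_imp_continuous_on])
      fix w assume w: "cmod w = 1"
      have Dw: "(V has_field_derivative deriv V w) (at w)"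
        using V[folded A_def] A(1) oneA[OF w] by (rule holomorphic_derivI)
      \<comment> \<open>\<open>f\<close> equals 1 at \<open>r = 1\<close> and is smaller just
        before, so its derivative \<open>l\<close> at 1 cannot be negative.\<close>
      define f where "f = (\<lambda>r. Re (V (of_real r * w) * cnj (V w)))"
      define l where "l = Re (w * deriv V w * cnj (V w))"
      have "((\<lambda>r. V (of_real r * w)) has_vector_derivative w * deriv V w) (at (1::real))"
      proof -
        have "((\<lambda>r. of_real r * w) has_vector_derivative w) (at (1::real))"
          by (auto intro!: derivative_eq_intros)
        from field_vector_diff_chain_at[OF this, of V "deriv V w"] Dw show ?thesis by (simp add: o_def)
      qed
      then have "((\<lambda>r. V (of_real r * w) * cnj (V w)) has_vector_derivative w * deriv V w * cnj (V w)) (at (1::real))"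
        by (rule has_vector_derivative_mult_left)
      then have "(f has_real_derivative l) (at 1)"
        unfolding f_def l_def has_real_derivative_iff_has_vector_derivative
        by (rule bounded_linear.has_vector_derivative[OF bounded_linear_Re])
      have f1: "f 1 = 1"
      proof -
        have "V w * cnj (V w) = 1" using eq1[OF w] by (metis complex_norm_square of_real_1 power_one)
        then show ?thesis by (simp add: f_def del: times_complex.sel)
      qed
      have "0 \<le> l"
      proof (rule ccontr)
        assume "\<not> 0 \<le> l"
        then obtain d where dd: "d > 0" "\<And>h. h > 0 \<Longrightarrow> h < d \<Longrightarrow> f 1 < f (1 - h)"
          using DERIV_neg_dec_left[OF \<open>(f has_real_derivative l) (at 1)\<close>] by auto
        define h where "h = min (d / 2) ((1 - a) / 2)"
        have h: "h > 0" "h < d" "h < 1 - a" using dd a by (auto simp: h_def min_def)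
        have nw: "cmod (of_real (1 - h) * w) = 1 - h" using w h a by (simp add: norm_mult del: of_real_diff)
        have "cmod (V (of_real (1 - h) * w)) < 1" using lt nw h by simp
        then have "cmod (V (of_real (1 - h) * w) * cnj (V w)) < 1" using eq1[OF w] by (simp add: norm_mult)
        then have "f (1 - h) < 1" unfolding f_def by (rule order.strict_trans1[OF complex_Re_le_cmod])
        then show False using dd(2)[OF h(1,2)] f1 by simp
      qed
      moreover have "cnj (V w) = 1 / V w"
        using eq1[OF w] by (metis complex_norm_square divide_eq_eq mult.commute mult_zero_left of_real_1 power_one zero_neq_one)
      ultimately show "0 \<le> Re (w * (deriv V w / V w))" by (simp add: l_def)
    qed
    then show ?thesis using pm wc by auto
  qed
  have sb: "cint 1 (\<lambda>w. F (V w) * deriv V w) = cint 1 F" if S: "open S" "sphere 0 1 \<subseteq> S" "F holomorphic_on S" for F S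
  proof -
    \<comment> \<open>Equal winding numbers give a homotopy in the punctured plane only; the radial
      retraction pushes it onto the circle and thereby into \<open>S\<close>.\<close>
    define R where "R = (\<lambda>z::complex. z / of_real (cmod z))"
    have "winding_number (V \<circ> \<gamma>) 0 = winding_number \<gamma> 0"
      using wn winding_number_circlepath_centre[of 1 0] by (simp add: \<gamma>_def)
    then have "homotopic_loops (- {0}) (V \<circ> \<gamma>) \<gamma>"
      using winding_number_homotopic_loops_eq[of "V \<circ> \<gamma>" 0 \<gamma>] vp imV im\<gamma>
      by (auto simp: \<gamma>_def valid_path_imp_path pathfinish_compose pathstart_compose)
    then have "homotopic_loops (sphere 0 1) (R \<circ> (V \<circ> \<gamma>)) (R \<circ> \<gamma>)"
      by (rule homotopic_loops_continuous_image) (auto simp: R_def norm_divide intro!: continuous_intros)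
    moreover have "R \<circ> (V \<circ> \<gamma>) = V \<circ> \<gamma>" "R \<circ> \<gamma> = \<gamma>"
      using \<gamma> eq1 by (auto simp: R_def fun_eq_iff)
    ultimately have "homotopic_loops S (V \<circ> \<gamma>) \<gamma>" using S(2) homotopic_loops_subset by fastforce
    then have "contour_integral (V \<circ> \<gamma>) F = contour_integral \<gamma> F"
      using S vp by (intro Cauchy_theorem_homotopic_loops[of S]) (auto simp: \<gamma>_def)
    then show ?thesis unfolding sub by (simp add: cint_def \<gamma>_def)
  qed
  show thesis
    unfolding A_def[symmetric]
    by (rule that[OF a(1)]) (use a V injV Vv Vr iff1 iff2 surj sb in \<open>auto simp: circle_reflection_def A_def\<close>)
qed

section \<open>Univalent continuation of the exterior map\<close>

lemma annulus_ereal_infinity [simp]: "annulus (ereal a) \<infinity> = {w. a < cmod w}"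
  and annulus_one_infinity [simp]: "annulus 1 \<infinity> = {w. 1 < cmod w}"
  and annulus_ereal_one [simp]: "annulus (ereal a) 1 = {w. a < cmod w \<and> cmod w < 1}"
  by (auto simp: annulus_def one_ereal_def)

lemma ring_in_open:
  assumes "open U" "sphere (0::complex) 1 \<subseteq> U"
  obtains a where "0 < a" "a < 1" "{w. a < cmod w \<and> cmod w < 1 / a} \<subseteq> U"
proof -
  obtain e where e: "e > 0" "{w. infdist w (sphere (0::complex) 1) \<le> e} \<subseteq> U"
    using compact_in_open_separated[OF _ _ assms] by auto
  define R where "R = 1 + min e 1"
  have R: "R > 1" "R - 1 \<le> e" using e by (auto simp: R_def)
  have "w \<in> U" if w: "1 / R < cmod w" "cmod w < 1 / (1 / R)" for w
  proof -
    have w0: "cmod w > 0" using w R by (smt (verit) divide_nonneg_nonneg)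
    have "1 - cmod w < (R - 1) / R" using w R by (simp add: field_simps)
    also have "(R - 1) / R \<le> (R - 1) / 1" using R by (intro divide_left_mono) auto
    finally have d: "\<bar>cmod w - 1\<bar> < e" using w R by (simp add: abs_less_iff)
    define x where "x = w / of_real (cmod w)"
    have x: "x \<in> sphere 0 1" using w0 by (simp add: x_def norm_divide)
    have "w = of_real (cmod w) * x" using w0 by (simp add: x_def)
    then have "w - x = of_real (cmod w - 1) * x" by (simp add: algebra_simps)
    then have "cmod (w - x) = \<bar>cmod w - 1\<bar> * cmod x" by (metis norm_mult norm_of_real)
    then have "dist w x \<le> e" using d x by (simp add: dist_norm)
    then have "infdist w (sphere 0 1) \<le> e" using infdist_le[OF x, of w] by linarith
    then show ?thesis using e by blast
  qed
  then show thesis using R that[of "1 / R"] by auto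
qed

definition jordan_chart :: "complex set \<Rightarrow> real \<Rightarrow> (complex \<Rightarrow> complex) \<Rightarrow> bool" where
  "jordan_chart L a f \<longleftrightarrow> 0 < a \<and> a < 1 \<and> f holomorphic_on {w. a < cmod w \<and> cmod w < 1 / a} \<and>
     inj_on f {w. a < cmod w \<and> cmod w < 1 / a} \<and> f ` sphere 0 1 = L \<and>
     (\<forall>w. a < cmod w \<and> cmod w < 1 \<longrightarrow> f w \<in> inside L) \<and>
     (\<forall>w. 1 < cmod w \<and> cmod w < 1 / a \<longrightarrow> f w \<in> outside L)"

text \<open>Each half of the ring is connected and its image misses \<open>L\<close>, so the image
  lies on one side; since \<open>L\<close> is the frontier of both sides and \<open>f\<close> is
  open, the halves go to different sides. If they come in the wrong order, \<open>f (1 / w)\<close>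
  is used.\<close>

lemma analytic_jordan_curveE:
  assumes "analytic_jordan_curve L"
  obtains a f where "jordan_chart L a f"
    and "compact L" "L \<noteq> {}" "inside L \<noteq> {}" "open (inside L)" "connected (inside L)" "bounded (inside L)"
    and "open (outside L)" "connected (outside L)" "frontier (inside L) = L" "frontier (outside L) = L"
    and "inside L \<inter> outside L = {}" "inside L \<union> outside L = - L"
proof -
  obtain U f where U: "open U" "sphere 0 1 \<subseteq> U" and f: "f holomorphic_on U" "inj_on f U" and L: "L = f ` sphere 0 1"
    using assms unfolding analytic_jordan_curve_def by blast
  define c where "c = f \<circ> circlepath 0 1"
  have imc: "path_image c = L" by (simp add: c_def path_image_compose L)
  have cont: "continuous_on (sphere 0 1) f"
    using continuous_on_subset[OF holomorphic_on_imp_continuous_on[OF f(1)] U(2)] .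
  have sp: "simple_path c" unfolding c_def
    by (rule simple_path_continuous_image)
       (use cont inj_on_subset[OF f(2) U(2)] in \<open>auto simp: simple_path_circlepath\<close>)
  have loop: "pathfinish c = pathstart c" by (simp add: c_def pathfinish_compose pathstart_compose)
  note J = Jordan_inside_outside[OF sp loop, unfolded imc]
  have Jo: "open (inside L)" "open (outside L)" and Jd: "inside L \<inter> outside L = {}"
    and Ju: "inside L \<union> outside L = - L" and fi: "frontier (inside L) = L" and fo: "frontier (outside L) = L"
    using J by auto
  have Lin: "L \<inter> inside L = {}" "L \<inter> outside L = {}" using Ju by blast+
  obtain a where a: "0 < a" "a < 1" and aU: "{w. a < cmod w \<and> cmod w < 1 / a} \<subseteq> U"
    using ring_in_open[OF U] by blast
  define A where "A = {w. a < cmod w \<and> cmod w < 1 / a}"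
  define Ai where "Ai = {w. a < cmod w \<and> cmod w < 1}"
  define Ao where "Ao = {w. 1 < cmod w \<and> cmod w < 1 / a}"
  have a1: "1 < 1 / a" using a by simp
  have lt1: "x < 1 / a" if "x < 1" for x using that a1 by linarith
  have sub: "Ai \<subseteq> A" "Ao \<subseteq> A" "sphere 0 1 \<subseteq> A" "A = Ai \<union> Ao \<union> sphere 0 1"
    using a a1 by (auto simp: A_def Ai_def Ao_def intro: lt1)
  have fA: "f holomorphic_on A" "inj_on f A"
    using f aU by (auto simp: A_def intro: holomorphic_on_subset inj_on_subset)
  have notL: "f w \<notin> L" if "w \<in> A" "cmod w \<noteq> 1" for w
  proof
    assume "f w \<in> L"
    then obtain x where "x \<in> sphere 0 1" "f w = f x" using L by auto
    then show False using fA(2) that sub(3) by (metis inj_onD mem_sphere_0 subsetD)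
  qed
  have side: "f ` B \<subseteq> inside L \<or> f ` B \<subseteq> outside L" if "connected B" "B \<subseteq> A" "\<And>w. w \<in> B \<Longrightarrow> cmod w \<noteq> 1" for B
  proof -
    have "connected (f ` B)"
      using that fA(1) by (intro connected_continuous_image holomorphic_on_imp_continuous_on) (auto intro: holomorphic_on_subset)
    moreover have "f ` B \<subseteq> inside L \<union> outside L" using Ju notL that by auto
    ultimately show ?thesis
      using connectedD[of "f ` B" "inside L" "outside L"] Jo Jd by blast
  qed
  have si: "f ` Ai \<subseteq> inside L \<or> f ` Ai \<subseteq> outside L"
    by (rule side[OF _ sub(1)]) (auto simp: Ai_def connected_ring)
  have so: "f ` Ao \<subseteq> inside L \<or> f ` Ao \<subseteq> outside L"
    by (rule side[OF _ sub(2)]) (auto simp: Ao_def connected_ring)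
  have opA: "open (f ` A)"
    using open_mapping_thm3[OF fA(1) _ fA(2)] open_ring(2) by (simp add: A_def)
  have meets: "f ` A \<inter> X \<noteq> {}" if "frontier X = L" for X
  proof -
    obtain z where "z \<in> L" using L by fastforce
    then have "z \<in> closure X" "z \<in> f ` A" using that sub(3) L by (auto simp: frontier_def)
    then show ?thesis using opA by (metis IntI closure_iff_nhds_not_empty emptyE inf_commute order_refl)
  qed
  have fAeq: "f ` A = f ` Ai \<union> f ` Ao \<union> L" using sub(4) L by auto
  then have h: "(f ` Ai \<union> f ` Ao) \<inter> inside L \<noteq> {}" "(f ` Ai \<union> f ` Ao) \<inter> outside L \<noteq> {}"
    using meets[OF fi] meets[OF fo] unfolding fAeq by (simp_all add: Int_Un_distrib2 Lin)
  have "\<not> (f ` Ai \<subseteq> outside L \<and> f ` Ao \<subseteq> outside L)" using h(1) Jd by blast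
  moreover have "\<not> (f ` Ai \<subseteq> inside L \<and> f ` Ao \<subseteq> inside L)" using h(2) Jd by blast
  ultimately have cases: "f ` Ai \<subseteq> inside L \<and> f ` Ao \<subseteq> outside L \<or> f ` Ai \<subseteq> outside L \<and> f ` Ao \<subseteq> inside L"
    using si so by argo
  have "\<exists>f. jordan_chart L a f"
  proof (cases "f ` Ai \<subseteq> inside L \<and> f ` Ao \<subseteq> outside L")
    case True
    then show ?thesis using fA a L
      by (intro exI[of _ f]) (auto simp: jordan_chart_def A_def Ai_def Ao_def)
  next
    case False
    then have c2: "f ` Ai \<subseteq> outside L" "f ` Ao \<subseteq> inside L" using cases by auto
    define f' where "f' = (\<lambda>w. f (1 / w))"
    have inv: "1 / w \<in> A" if "w \<in> A" for w
    proof -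
      have "w \<noteq> 0" using that a by (auto simp: A_def)
      then show ?thesis using that a by (auto simp: A_def norm_divide field_simps)
    qed
    have n0: "w \<noteq> 0" if "w \<in> A" for w using that a by (auto simp: A_def)
    have "(f \<circ> (\<lambda>w. 1 / w)) holomorphic_on A"
      by (rule holomorphic_on_compose_gen[OF _ fA(1)]) (use n0 inv in \<open>auto intro!: holomorphic_intros\<close>)
    then have h: "f' holomorphic_on A" by (simp add: f'_def o_def)
    have i: "inj_on f' A"
    proof (rule inj_onI)
      fix x y assume xy: "x \<in> A" "y \<in> A" "f' x = f' y"
      have "f (1 / x) = f (1 / y)" using xy(3) by (simp add: f'_def)
      then have "1 / x = 1 / y" using inj_onD[OF fA(2) _ inv[OF xy(1)] inv[OF xy(2)]] by blast
      then show "x = y" by simp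
    qed
    have "(\<lambda>w::complex. 1 / w) ` sphere 0 1 = sphere 0 1"
    proof safe
      fix x :: complex assume "x \<in> sphere 0 1"
      then show "x \<in> (\<lambda>w. 1 / w) ` sphere 0 1" by (intro image_eqI[of _ _ "1 / x"]) (auto simp: norm_divide)
    qed (auto simp: norm_divide)
    then have s: "f' ` sphere 0 1 = L" unfolding f'_def L by (metis image_image)
    have "f' w \<in> inside L" if "w \<in> Ai" for w
    proof -
      have "1 / w \<in> Ao"
        using that a by (auto simp: Ai_def Ao_def norm_divide divide_simps)
      then show ?thesis using c2 by (auto simp: f'_def)
    qed
    moreover have "f' w \<in> outside L" if "w \<in> Ao" for w
    proof -
      have "1 / w \<in> Ai"
        using that a by (auto simp: Ai_def Ao_def norm_divide divide_simps mult.commute)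
      then show ?thesis using c2 by (auto simp: f'_def)
    qed
    ultimately show ?thesis using h i s a
      by (intro exI[of _ f']) (auto simp: jordan_chart_def A_def Ai_def Ao_def)
  qed
  moreover have "compact L" unfolding L using cont by (rule compact_continuous_image) simp
  moreover have "L \<noteq> {}" using L by auto
  ultimately show thesis using that J Jo Jd Ju fi fo by metis
qed

text \<open>No boundary extension of \<open>\<psi>\<close> is available yet. The part of the closed
  exterior off \<open>N\<close> and of bounded size is compact, hence so is its preimage, which
  therefore stays away from the unit circle; what remains is that \<open>\<psi>\<close> is bounded
  near the circle.\<close>

lemma exterior_map_near_curve:
  assumes psi: "\<psi> holomorphic_on {w. 1 < cmod w}" "bij_betw \<psi> {w. 1 < cmod w} (outside L)"
      "filterlim \<psi> at_infinity at_infinity"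
    and L: "compact L" "frontier (outside L) = L" "open (outside L)"
    and N: "open N" "L \<subseteq> N"
  obtains r where "1 < r" "\<And>w. 1 < cmod w \<Longrightarrow> cmod w < r \<Longrightarrow> \<psi> w \<in> N"
proof -
  define D where "D = {w::complex. 1 < cmod w}"
  have D: "open D" unfolding D_def by (rule open_ring)
  have inj: "inj_on \<psi> D" and im: "\<psi> ` D = outside L" using psi(2) by (auto simp: bij_betw_def D_def)
  have cont: "continuous_on D \<psi>" using psi(1) holomorphic_on_imp_continuous_on by (auto simp: D_def)
  have "bounded (\<psi> ` sphere 0 2 \<union> L)"
    using L(1) by (auto intro!: compact_imp_bounded compact_continuous_image continuous_on_subset[OF cont] simp: D_def)
  then obtain M where M: "\<And>z. z \<in> \<psi> ` sphere 0 2 \<union> L \<Longrightarrow> cmod z \<le> M" and M0: "M > 0" by (metis bounded_pos)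
  \<comment> \<open>The points of modulus above \<open>M\<close> form a connected set, covered by
    the disjoint open images of \<open>|w| > 2\<close> and \<open>1 < |w| < 2\<close>. As
    \<open>\<psi>\<close> tends to infinity the first image meets it, so the second cannot.\<close>
  have bd: "cmod (\<psi> w) \<le> M" if w: "1 < cmod w" "cmod w < 2" for w
  proof (rule ccontr)
    assume c: "\<not> cmod (\<psi> w) \<le> M"
    define X where "X = - cball (0::complex) M"
    have X: "connected X" unfolding X_def by (intro connected_complement_bounded_convex) auto
    have "\<not> bounded X" unfolding X_def by (metis bounded_cball cobounded_imp_unbounded double_complement)
    moreover have "X \<inter> L = {}" using M by (force simp: X_def)
    ultimately have "X \<subseteq> outside L" using X by (simp add: outside_def) (smt (verit, best) Compl_disjoint2 bounded_subset connected_component_maximal disjoint_eq_subset_Compl mem_Collect_eq subsetI)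
    then have Xim: "X \<subseteq> \<psi> ` D" using im by simp
    define P where "P = \<psi> ` {w. 2 < cmod w}"
    define Q where "Q = \<psi> ` {w. 1 < cmod w \<and> cmod w < 2}"
    have oP: "open P" "open Q" unfolding P_def Q_def
      by (rule open_mapping_thm3[OF holomorphic_on_subset[OF psi(1)]]; use open_ring inj in \<open>auto simp: D_def intro: inj_on_subset\<close>)+
    have disj: "P \<inter> Q = {}"
    proof (rule ccontr)
      assume "P \<inter> Q \<noteq> {}"
      then obtain x y where "2 < cmod x" "1 < cmod y" "cmod y < 2" "\<psi> x = \<psi> y" by (auto simp: P_def Q_def)
      then show False using inj_onD[OF inj, of x y] by (auto simp: D_def)
    qed
    have cov: "X \<subseteq> P \<union> Q"
    proof
      fix z assume z: "z \<in> X"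
      then obtain x where x: "x \<in> D" "z = \<psi> x" using Xim by auto
      have "cmod x \<noteq> 2"
      proof
        assume "cmod x = 2"
        then have "z \<in> \<psi> ` sphere 0 2 \<union> L" using x by auto
        then show False using M z by (force simp: X_def)
      qed
      then show "z \<in> P \<union> Q" using x by (auto simp: P_def Q_def D_def neq_iff)
    qed
    have "\<forall>\<^sub>F w in at_infinity. M + 1 \<le> cmod (\<psi> w)"
      using psi(3) M0 unfolding filterlim_at_infinity[OF order_refl] by (metis add_pos_pos zero_less_one)
    then obtain b where b: "\<And>w. b \<le> cmod w \<Longrightarrow> M + 1 \<le> cmod (\<psi> w)" by (auto simp: eventually_at_infinity)
    define x where "x = complex_of_real (max b 3)"
    have "cmod x = max b 3" unfolding x_def norm_of_real by simp
    then have "\<psi> x \<in> P \<inter> X" using b[of x] by (auto simp: P_def X_def)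
    moreover have "\<psi> w \<in> Q \<inter> X" using w c by (auto simp: Q_def X_def)
    ultimately show False using connectedD[OF X oP] disj cov by blast
  qed
  obtain g where g: "continuous_on (\<psi> ` D) g" "\<And>w. w \<in> D \<Longrightarrow> g (\<psi> w) = w"
    using holomorphic_has_inverse[OF psi(1)[folded D_def] D inj] holomorphic_on_imp_continuous_on by metis
  define K where "K = (closure (outside L) - N) \<inter> cball 0 M"
  have "K \<subseteq> outside L" using L N by (auto simp: K_def closure_Un_frontier)
  then have KD: "K \<subseteq> \<psi> ` D" using im by simp
  have cK: "compact K" unfolding K_def using N by (intro closed_Int_compact closed_Diff) auto
  have cg: "compact (g ` K)" by (intro compact_continuous_image cK continuous_on_subset[OF g(1) KD])
  have gK: "g ` K \<subseteq> D" using KD g(2) by auto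
  obtain r where r: "1 < r" "\<And>w. w \<in> g ` K \<Longrightarrow> r \<le> cmod w"
  proof (cases "K = {}")
    case True then show ?thesis using that[of 2] by auto
  next
    case False
    then obtain x where "x \<in> g ` K" "\<And>w. w \<in> g ` K \<Longrightarrow> cmod x \<le> cmod w"
      using continuous_attains_inf[OF cg, of cmod] by (auto intro: continuous_intros)
    then show ?thesis using that[of "cmod x"] gK by (auto simp: D_def)
  qed
  show thesis
  proof (rule that[of "min r 2"])
    show "1 < min r 2" using r by simp
    fix w assume w: "1 < cmod w" "cmod w < min r 2"
    then have wD: "w \<in> D" by (simp add: D_def)
    then have zo: "\<psi> w \<in> closure (outside L)" using im closure_subset by blast
    show "\<psi> w \<in> N"
    proof (rule ccontr)
      assume "\<psi> w \<notin> N"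
      then have "\<psi> w \<in> K" using bd[of w] w zo by (auto simp: K_def)
      then have "w \<in> g ` K" using g(2)[OF wD] by (metis imageI)
      then show False using r(2) w by fastforce
    qed
  qed
qed

lemma reflection_ne0:
  assumes "V w * cnj (V (1 / cnj w)) = (1::complex)" shows "V w \<noteq> 0"
  using assms by auto

text \<open>Read in the chart \<open>f\<close>, \<open>\<psi>\<close> is a univalent function near
  the unit circle whose modulus tends to 1, so it can be reflected. The result is carried back by
  \<open>f\<close> and glued to \<open>\<psi>\<close>.\<close>

lemma univalent_continuation_exists:
  assumes L: "analytic_jordan_curve L" and psi: "exterior_map L \<psi>"
  obtains r g where "0 \<le> r" "r < 1" "univalent_continuation \<psi> r g"
proof -
  obtain a0 f where chart: "jordan_chart L a0 f" and cL: "compact L" "frontier (outside L) = L" "open (outside L)"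
    and dj: "inside L \<inter> outside L = {}" "inside L \<union> outside L = - L"
    using analytic_jordan_curveE[OF L] by metis
  have a0: "0 < a0" "a0 < 1" and f: "f holomorphic_on {w. a0 < cmod w \<and> cmod w < 1 / a0}"
    "inj_on f {w. a0 < cmod w \<and> cmod w < 1 / a0}" and fL: "f ` sphere 0 1 = L"
    and fin: "\<And>w. a0 < cmod w \<Longrightarrow> cmod w < 1 \<Longrightarrow> f w \<in> inside L"
    and fout: "\<And>w. 1 < cmod w \<Longrightarrow> cmod w < 1 / a0 \<Longrightarrow> f w \<in> outside L"
    using chart by (auto simp: jordan_chart_def)
  define A where "A = {w. a0 < cmod w \<and> cmod w < 1 / a0}"
  have oA: "open A" unfolding A_def by (rule open_ring)
  have a01: "1 < 1 / a0" using a0 by simp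
  have sA: "sphere 0 1 \<subseteq> A" using a0 a01 by (auto simp: A_def)
  obtain fi where fi: "fi holomorphic_on (f ` A)" "\<And>w. w \<in> A \<Longrightarrow> fi (f w) = w"
    using holomorphic_has_inverse[OF f(1)[folded A_def] oA f(2)[folded A_def]] by metis
  have psiD: "\<psi> holomorphic_on {w. 1 < cmod w}" "bij_betw \<psi> {w. 1 < cmod w} (outside L)"
      "filterlim \<psi> at_infinity at_infinity"
    using psi by (auto simp: exterior_map_def)
  have inj\<psi>: "inj_on \<psi> {w. 1 < cmod w}" and im\<psi>: "\<psi> ` {w. 1 < cmod w} = outside L"
    using psiD(2) by (auto simp: bij_betw_def)
  have near: "\<exists>r>1. \<forall>w. 1 < cmod w \<and> cmod w < r \<longrightarrow> \<psi> w \<in> f ` {w. 1 < cmod w \<and> cmod w < s}"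
    if s: "1 < s" "s \<le> 1 / a0" for s
  proof -
    define B where "B = {w. a0 < cmod w \<and> cmod w < s}"
    have B: "B \<subseteq> A" "open B" using s open_ring by (auto simp: A_def B_def)
    have "open (f ` B)"
      using B f by (intro open_mapping_thm3[of f]) (auto intro: holomorphic_on_subset inj_on_subset simp: A_def)
    moreover have "L \<subseteq> f ` B" using fL a0 s by (force simp: B_def)
    ultimately obtain r where r: "1 < r" "\<And>w. 1 < cmod w \<Longrightarrow> cmod w < r \<Longrightarrow> \<psi> w \<in> f ` B"
      using exterior_map_near_curve[OF psiD cL] by metis
    have "\<psi> w \<in> f ` {w. 1 < cmod w \<and> cmod w < s}" if w: "1 < cmod w" "cmod w < r" for w
    proof -
      obtain x where x: "x \<in> B" "\<psi> w = f x" using r(2)[OF w] by auto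
      have "\<psi> w \<in> outside L" using im\<psi> w by auto
      then have "f x \<notin> inside L" "f x \<notin> L" using dj x(2) by (metis ComplD IntI UnI2 emptyE)+
      then have "\<not> cmod x < 1" "cmod x \<noteq> 1" using fin[of x] x fL by (auto simp: B_def)
      then show ?thesis using x by (auto simp: B_def)
    qed
    then show ?thesis using r(1) by blast
  qed
  obtain r0 where r0: "1 < r0" "\<And>w. 1 < cmod w \<Longrightarrow> cmod w < r0 \<Longrightarrow> \<psi> w \<in> f ` {w. 1 < cmod w \<and> cmod w < 1 / a0}"
    using near[OF a01 order_refl] by blast
  define b where "b = 1 / r0"
  have b: "0 \<le> b" "b < 1" using r0 by (auto simp: b_def)
  define Y where "Y = {w. b < cmod w \<and> cmod w < 1}"
  have Yinv: "1 < cmod (1 / w) \<and> cmod (1 / w) < r0 \<and> w \<noteq> 0" if "w \<in> Y" for w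
  proof -
    have "w \<noteq> 0" using that b by (auto simp: Y_def)
    moreover have "1 / r0 < cmod w" "cmod w < 1" using that by (auto simp: Y_def b_def)
    ultimately show ?thesis using r0(1) by (auto simp: norm_divide divide_simps mult.commute)
  qed
  \<comment> \<open>The two inversions turn the exterior picture into one below the unit circle, the
    form expected by \<open>univalent_reflection\<close>.\<close>
  define v where "v = (\<lambda>w. 1 / fi (\<psi> (1 / w)))"
  have fi': "1 < cmod (fi (\<psi> (1 / w))) \<and> fi (\<psi> (1 / w)) \<in> A \<and> f (fi (\<psi> (1 / w))) = \<psi> (1 / w)
       \<and> \<psi> (1 / w) \<in> f ` A" if "w \<in> Y" for w
  proof -
    have "\<psi> (1 / w) \<in> f ` {w. 1 < cmod w \<and> cmod w < 1 / a0}" using r0(2) Yinv[OF that] by blast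
    then obtain x where x: "1 < cmod x" "cmod x < 1 / a0" "\<psi> (1 / w) = f x" by auto
    then have "x \<in> A" using a0 by (auto simp: A_def)
    then show ?thesis using fi(2) x by auto
  qed
  have fine0: "fi (\<psi> (1 / w)) \<noteq> 0" if "w \<in> Y" for w using fi'[OF that] by auto
  have vh: "v holomorphic_on Y"
  proof -
    have "(\<psi> \<circ> (\<lambda>w. 1 / w)) holomorphic_on Y"
      by (rule holomorphic_on_compose_gen[OF _ psiD(1)]) (use Yinv in \<open>auto intro!: holomorphic_intros\<close>)
    moreover have "(\<psi> \<circ> (\<lambda>w. 1 / w)) ` Y \<subseteq> f ` A" using fi' by auto
    ultimately have "(fi \<circ> (\<psi> \<circ> (\<lambda>w. 1 / w))) holomorphic_on Y"
      using holomorphic_on_compose_gen[OF _ fi(1)] by blast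
    then have "(\<lambda>w. fi (\<psi> (1 / w))) holomorphic_on Y" by (simp add: o_def)
    then show ?thesis unfolding v_def using fine0 by (intro holomorphic_intros) auto
  qed
  have vinj: "inj_on v Y"
  proof (rule inj_onI)
    fix x y assume xy: "x \<in> Y" "y \<in> Y" "v x = v y"
    then have "fi (\<psi> (1 / x)) = fi (\<psi> (1 / y))" by (simp add: v_def)
    then have "\<psi> (1 / x) = \<psi> (1 / y)" using fi' xy by metis
    then have "1 / x = 1 / y" using inj_onD[OF inj\<psi>] Yinv xy by blast
    then show "x = y" by simp
  qed
  have v1: "cmod (v w) < 1" if "b < cmod w" "cmod w < 1" for w
    using fi'[of w] that by (auto simp: v_def Y_def norm_divide divide_less_eq_1)
  have vlim: "\<exists>d<1. \<forall>w. d < cmod w \<and> cmod w < 1 \<longrightarrow> \<bar>cmod (v w) - 1\<bar> < e" if e: "e > 0" for e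
  proof -
    define s where "s = min (1 / a0) (1 + e)"
    have s: "1 < s" "s \<le> 1 / a0" "s \<le> 1 + e" using e a01 by (auto simp: s_def)
    obtain r where r: "1 < r" "\<And>w. 1 < cmod w \<Longrightarrow> cmod w < r \<Longrightarrow> \<psi> w \<in> f ` {w. 1 < cmod w \<and> cmod w < s}"
      using near[OF s(1,2)] by blast
    have "\<bar>cmod (v w) - 1\<bar> < e" if w: "max b (1 / r) < cmod w" "cmod w < 1" for w
    proof -
      have wY: "w \<in> Y" using w by (simp add: Y_def)
      have "cmod (1 / w) < r" using w r(1) Yinv[OF wY] by (auto simp: norm_divide divide_simps mult.commute)
      then have "\<psi> (1 / w) \<in> f ` {w. 1 < cmod w \<and> cmod w < s}" using r(2) Yinv[OF wY] by blast
      then obtain x where x: "1 < cmod x" "cmod x < s" "\<psi> (1 / w) = f x" by auto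
      then have "x \<in> A" using a0 s by (auto simp: A_def)
      then have "v w = 1 / x" using fi(2) x by (simp add: v_def)
      then have "cmod (v w) = 1 / cmod x" by (simp add: norm_divide)
      moreover have x0: "cmod x > 0" using x by linarith
      have "1 - 1 / cmod x < e"
      proof -
        have "1 - 1 / cmod x = (cmod x - 1) / cmod x" using x0 by (simp add: diff_divide_distrib)
        also have "\<dots> \<le> (cmod x - 1) / 1" using x by (intro divide_left_mono) auto
        finally show ?thesis using x s by simp
      qed
      moreover have "1 / cmod x \<le> 1" using x x0 by (simp add: divide_le_eq_1)
      ultimately show ?thesis by simp
    qed
    then show ?thesis using b r(1) by (intro exI[of _ "max b (1 / r)"]) auto
  qed
  obtain a V where a: "b < a" and refl: "circle_reflection a v V"
    using univalent_reflection[OF vh[unfolded Y_def] b vinj[unfolded Y_def] v1 vlim] by blast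
  have a1: "a < 1" and V: "V holomorphic_on {w. a < cmod w \<and> cmod w < 1 / a}"
    "inj_on V {w. a < cmod w \<and> cmod w < 1 / a}"
    and Vv: "\<And>w. a < cmod w \<Longrightarrow> cmod w < 1 \<Longrightarrow> V w = v w"
    and Vr: "\<And>w. a < cmod w \<Longrightarrow> cmod w < 1 / a \<Longrightarrow> V w * cnj (V (1 / cnj w)) = 1"
    and V2: "\<And>w. a < cmod w \<Longrightarrow> cmod w < 1 / a \<Longrightarrow> cmod (V w) < 1 \<longleftrightarrow> cmod w < 1"
    and Vs: "V ` sphere 0 1 = sphere 0 1"
    using refl by (auto simp: circle_reflection_def)
  define B where "B = {w. a < cmod w \<and> cmod w < 1 / a}"
  have oB: "open B" unfolding B_def by (rule open_ring)
  have a': "0 < a" "1 < 1 / a" using a a1 b by auto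
  have sB: "sphere 0 1 \<subseteq> B" using a1 a' by (auto simp: B_def)
  have "open (B \<inter> V -` A)"
    using continuous_open_preimage[OF holomorphic_on_imp_continuous_on[OF V(1)]] oB oA by (simp add: B_def)
  moreover have "sphere 0 1 \<subseteq> B \<inter> V -` A" using sB sA Vs by blast
  ultimately obtain c where c: "0 < c" "c < 1" and cB: "{w. c < cmod w \<and> cmod w < 1 / c} \<subseteq> B \<inter> V -` A"
    using ring_in_open by metis
  define C where "C = {w. c < cmod w \<and> cmod w < 1 / c}"
  have oC: "open C" unfolding C_def by (rule open_ring)
  have CB: "w \<in> B" "V w \<in> A" if "w \<in> C" for w using cB that by (auto simp: C_def)
  have C0: "w \<noteq> 0" if "w \<in> C" for w using that c by (auto simp: C_def)
  have Cinv: "1 / w \<in> C" if "w \<in> C" for w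
    using that C0[OF that] c by (auto simp: C_def norm_divide field_simps)
  have Ainv: "1 / w \<in> A" if "w \<in> A" for w
  proof -
    have "w \<noteq> 0" using that a0 by (auto simp: A_def)
    then show ?thesis using that a0 by (auto simp: A_def norm_divide field_simps)
  qed
  have Vne: "V w \<noteq> 0" if "w \<in> C" for w
    using reflection_ne0[OF Vr[of w]] CB[OF that] by (auto simp: B_def)
  define G where "G = (\<lambda>w. f (1 / V (1 / w)))"
  have Gh: "G holomorphic_on C"
  proof -
    have "(V \<circ> (\<lambda>w. 1 / w)) holomorphic_on C"
      by (rule holomorphic_on_compose_gen[OF _ V(1)]) (use C0 Cinv CB in \<open>auto intro!: holomorphic_intros simp: B_def\<close>)
    then have "(\<lambda>w. 1 / V (1 / w)) holomorphic_on C"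
      using Vne Cinv by (intro holomorphic_intros) (auto simp: o_def)
    moreover have "(\<lambda>w. 1 / V (1 / w)) ` C \<subseteq> A" using Ainv CB Cinv by auto
    ultimately have "(f \<circ> (\<lambda>w. 1 / V (1 / w))) holomorphic_on C"
      using holomorphic_on_compose_gen[OF _ f(1)[folded A_def]] by blast
    then show ?thesis by (simp add: G_def o_def)
  qed
  have Ginj: "inj_on G C"
  proof (rule inj_onI)
    fix x y assume xy: "x \<in> C" "y \<in> C" "G x = G y"
    then have "1 / V (1 / x) = 1 / V (1 / y)"
      using inj_onD[OF f(2)[folded A_def]] Ainv CB Cinv unfolding G_def by blast
    then have "V (1 / x) = V (1 / y)" by simp
    then have "1 / x = 1 / y" using inj_onD[OF V(2)[folded B_def]] CB Cinv xy by blast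
    then show "x = y" by simp
  qed
  have G\<psi>: "G w = \<psi> w" if "w \<in> C" "1 < cmod w" for w
  proof -
    have i: "1 / w \<in> B" "cmod (1 / w) < 1" using CB Cinv that by (auto simp: norm_divide divide_less_eq_1)
    then have "V (1 / w) = v (1 / w)" using Vv by (auto simp: B_def)
    moreover have "1 / w \<in> Y" using i a by (auto simp: Y_def B_def)
    ultimately show ?thesis using fi'[of "1 / w"] by (simp add: G_def v_def)
  qed
  \<comment> \<open>On and below the circle the continuation avoids the exterior of
    \<open>L\<close>, so the glued function cannot repeat a value of \<open>\<psi>\<close>.\<close>
  have Gin: "G w \<notin> outside L" if "w \<in> C" "cmod w \<le> 1" for w
  proof -
    have w0: "w \<noteq> 0" using C0 that by auto
    have i: "1 / w \<in> C" "1 / w \<in> B" "1 \<le> cmod (1 / w)" using CB Cinv that w0 by (auto simp: norm_divide)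
    then have "1 \<le> cmod (V (1 / w))" using V2[of "1 / w"] by (auto simp: B_def)
    then have n: "cmod (1 / V (1 / w)) \<le> 1" by (simp add: norm_divide divide_le_eq_1)
    have "1 / V (1 / w) \<in> A" using Ainv CB i by auto
    then have "G w \<in> inside L \<union> f ` sphere 0 1" using fin[of "1 / V (1 / w)"] n
      by (cases "cmod (1 / V (1 / w)) = 1") (auto simp: G_def A_def)
    then show ?thesis unfolding fL using dj by blast
  qed
  define g where "g = (\<lambda>w. if 1 < cmod w then \<psi> w else G w)"
  define E where "E = {w. c < cmod w}"
  have Esplit: "E = {w. 1 < cmod w} \<union> C"
  proof -
    have "w \<in> C" if "c < cmod w" "\<not> 1 < cmod w" for w
    proof -
      have "1 < 1 / c" using c by simp
      then have "cmod w < 1 / c" using that by linarith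
      then show ?thesis using that by (simp add: C_def)
    qed
    then show ?thesis using c by (auto simp: E_def C_def)
  qed
  have "g holomorphic_on {w. 1 < cmod w} \<union> C"
  proof (rule holomorphic_on_Un)
    show "g holomorphic_on {w. 1 < cmod w}"
      by (rule holomorphic_transform[OF psiD(1)]) (auto simp: g_def)
    show "g holomorphic_on C"
      by (rule holomorphic_transform[OF Gh]) (auto simp: g_def G\<psi>)
  qed (use open_ring oC in auto)
  moreover have "inj_on g E"
  proof (rule inj_onI)
    fix x y assume xy: "x \<in> E" "y \<in> E" "g x = g y"
    have cx: "x \<in> C" if "\<not> 1 < cmod x" using Esplit xy that by auto
    have cy: "y \<in> C" if "\<not> 1 < cmod y" using Esplit xy that by auto
    have o: "g z \<in> outside L \<longleftrightarrow> 1 < cmod z" if "z \<in> E" for z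
      using Gin[of z] im\<psi> Esplit that by (auto simp: g_def not_less)
    show "x = y"
    proof (cases "1 < cmod x")
      case True
      then have "1 < cmod y" using o xy by metis
      then show ?thesis using True xy inj_onD[OF inj\<psi>] by (auto simp: g_def)
    next
      case False
      then have "\<not> 1 < cmod y" using o xy by metis
      then show ?thesis using False xy cx cy inj_onD[OF Ginj] by (auto simp: g_def)
    qed
  qed
  moreover have "\<forall>w\<in>annulus 1 \<infinity>. g w = \<psi> w" by (simp add: g_def)
  ultimately have "univalent_continuation \<psi> c g"
    using Esplit unfolding univalent_continuation_def by (simp add: E_def)
  then show thesis using c that[of c g] by auto
qed

section \<open>The smallest radius of univalent continuation\<close>

lemma connected_exterior: "connected {w::complex. a < cmod w}"
proof (cases "0 \<le> a")
  case True
  have "{w::complex. a < cmod w} = - cball 0 a" by auto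
  then show ?thesis by (simp add: connected_complement_bounded_convex)
next
  case False
  then have "{w::complex. a < cmod w} = UNIV" by (auto intro: less_le_trans[OF _ norm_ge_zero])
  then show ?thesis by (simp add: convex_connected)
qed

lemma univalent_continuation_unique:
  assumes "univalent_continuation \<psi> r g" "univalent_continuation \<psi> s h" "r \<le> s" "s < 1" "s < cmod w"
  shows "g w = h w"
proof -
  have "g holomorphic_on {w. r < cmod w}" "h holomorphic_on {w. s < cmod w}"
    and eq: "\<And>w. 1 < cmod w \<Longrightarrow> g w = h w"
    using assms by (auto simp: univalent_continuation_def)
  then have gh: "g holomorphic_on {w. s < cmod w}" "h holomorphic_on {w. s < cmod w}"
    using assms by (auto intro: holomorphic_on_subset)
  show ?thesis
    by (rule analytic_continuation_open[of "{w. 1 < cmod w}" "{w. s < cmod w}" g h w])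
       (use gh eq assms open_ring connected_exterior in \<open>auto intro!: exI[of _ 2]\<close>)
qed

text \<open>The \<open>LEAST\<close> in \<open>rho\<close> is an infimum that has to be attained:
  continuations to radii approaching it agree by the identity theorem and together cover the
  limiting domain.\<close>

lemma
  assumes "analytic_jordan_curve L" "exterior_map L \<psi>"
  shows rho_nonneg: "0 \<le> rho \<psi>" and rho_less_one: "rho \<psi> < 1"
    and psi_ext: "univalent_continuation \<psi> (rho \<psi>) (psi_ext \<psi>)"
proof -
  define S where "S = {r. 0 \<le> r \<and> r < 1 \<and> (\<exists>g. univalent_continuation \<psi> r g)}"
  obtain r0 g0 where "0 \<le> r0" "r0 < 1" "univalent_continuation \<psi> r0 g0"
    using univalent_continuation_exists[OF assms] .
  then have ne: "S \<noteq> {}" by (auto simp: S_def)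
  have bdd: "bdd_below S" by (rule bdd_belowI[of _ 0]) (auto simp: S_def)
  define m where "m = Inf S"
  have m0: "0 \<le> m" unfolding m_def using ne by (rule cInf_greatest) (auto simp: S_def)
  have lower: "m \<le> r" if "r \<in> S" for r unfolding m_def using that bdd by (rule cInf_lower)
  have m1: "m < 1" using ne lower by (force simp: S_def)
  have "\<forall>t. m < t \<longrightarrow> (\<exists>r\<in>S. r < t)" unfolding m_def using ne bdd cInf_less_iff by blast
  then obtain s where s: "\<And>t. m < t \<Longrightarrow> s t \<in> S \<and> s t < t" by metis
  then have "\<forall>t. \<exists>g. m < t \<longrightarrow> univalent_continuation \<psi> (s t) g" by (auto simp: S_def)
  then obtain h where h: "\<And>t. m < t \<Longrightarrow> univalent_continuation \<psi> (s t) (h t)" by metis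
  \<comment> \<open>At \<open>w\<close> the continuation chosen for the threshold \<open>|w|\<close>
    is used; its own radius lies below \<open>|w|\<close>, so it is defined there.\<close>
  define g where "g = (\<lambda>w. h (cmod w) w)"
  have gh: "g w = h t w" if t: "m < t" "s t < cmod w" and w: "m < cmod w" for t w
    unfolding g_def
    using univalent_continuation_unique[OF h[OF t(1)] h[OF w], of w]
          univalent_continuation_unique[OF h[OF w] h[OF t(1)], of w] s[OF t(1)] s[OF w] t w
    by (cases "s t \<le> s (cmod w)") (auto simp: S_def)
  have "univalent_continuation \<psi> m g"
    unfolding univalent_continuation_def
  proof (intro conjI ballI)
    show "g holomorphic_on annulus (ereal m) \<infinity>"
      unfolding holomorphic_on_def
    proof
      fix w assume w: "w \<in> annulus (ereal m) \<infinity>"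
      then have mw: "m < cmod w" by simp
      define t where "t = cmod w"
      have t: "m < t" "s t < t" using mw s[of t] by (auto simp: t_def)
      have "h t holomorphic_on {x. max m (s t) < cmod x}"
        using h[OF t(1)] by (auto simp: univalent_continuation_def intro: holomorphic_on_subset)
      then have "g holomorphic_on {x. max m (s t) < cmod x}"
        by (rule holomorphic_transform) (use gh t in auto)
      then have "g field_differentiable at w"
        by (rule holomorphic_on_imp_differentiable_at)
           (use open_ring(1)[of "max m (s t)"] mw t t_def in auto)
      then show "g field_differentiable at w within annulus (ereal m) \<infinity>"
        by (rule field_differentiable_at_within)
    qed
    show "inj_on g (annulus (ereal m) \<infinity>)"
    proof (rule inj_onI)
      fix x y assume xy: "x \<in> annulus (ereal m) \<infinity>" "y \<in> annulus (ereal m) \<infinity>" "g x = g y"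
      define t where "t = min (cmod x) (cmod y)"
      have t: "m < t" "s t < t" using xy s[of t] by (auto simp: t_def)
      then have "h t x = h t y" using gh[of t x] gh[of t y] xy by (auto simp: t_def)
      then show "x = y" using h[OF t(1)] t(2)
        by (auto simp: univalent_continuation_def inj_on_def t_def)
    qed
    fix w assume "w \<in> annulus 1 \<infinity>"
    then have "m < cmod w" "1 < cmod w" using m1 by auto
    then show "g w = \<psi> w" using h[of "cmod w"] by (auto simp: g_def univalent_continuation_def)
  qed
  then have r: "rho \<psi> = m" unfolding rho_def
    by (intro Least_equality) (use m0 m1 lower in \<open>auto simp: S_def\<close>)
  show "0 \<le> rho \<psi>" "rho \<psi> < 1" using m0 m1 r by auto
  show "univalent_continuation \<psi> (rho \<psi>) (psi_ext \<psi>)"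
    unfolding psi_ext_def r using \<open>univalent_continuation \<psi> m g\<close> by (rule someI[of "univalent_continuation \<psi> m"])
qed

section \<open>Meromorphic continuation of the interior map\<close>

text \<open>Being nicely meromorphic is a local property; this is what allows the gluing arguments
  below.\<close>

lemma nicely_meromorphic_on_pointwise:
  "f nicely_meromorphic_on A \<longleftrightarrow> (\<forall>z\<in>A. f nicely_meromorphic_on {z})"
  unfolding nicely_meromorphic_on_def by (subst meromorphic_on_meromorphic_at) auto

lemma nicely_meromorphic_at_cong:
  assumes "\<forall>\<^sub>F x in nhds z. f x = g x"
  shows "f nicely_meromorphic_on {z} \<longleftrightarrow> g nicely_meromorphic_on {z}"
proof -
  have at: "\<forall>\<^sub>F x in at z. f x = g x" and z: "f z = g z"
    using assms eventually_nhds_x_imp_x[OF assms] by (simp_all add: eventually_nhds_conv_at)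
  have "f meromorphic_on {z} \<longleftrightarrow> g meromorphic_on {z}"
    by (rule meromorphic_on_cong) (use at in auto)
  moreover have "is_pole f z \<longleftrightarrow> is_pole g z" by (rule is_pole_cong[OF at refl])
  moreover have "(f \<midarrow>z\<rightarrow> f z) \<longleftrightarrow> (g \<midarrow>z\<rightarrow> f z)" by (rule tendsto_cong[OF at])
  ultimately show ?thesis by (simp add: nicely_meromorphic_on_def z)
qed

lemma nicely_meromorphic_glue:
  assumes "\<And>z. z \<in> A \<Longrightarrow> \<exists>U g. open U \<and> z \<in> U \<and> g nicely_meromorphic_on {z} \<and> (\<forall>x\<in>U. f x = g x)"
  shows "f nicely_meromorphic_on A"
  unfolding nicely_meromorphic_on_pointwise[of f A]
proof
  fix z assume "z \<in> A"
  then obtain U g where U: "open U" "z \<in> U" "g nicely_meromorphic_on {z}" "\<forall>x\<in>U. f x = g x"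
    using assms by blast
  have "\<forall>\<^sub>F x in nhds z. f x = g x"
    using eventually_nhds_in_open[OF U(1,2)] by (rule eventually_mono) (use U in auto)
  then show "f nicely_meromorphic_on {z}" using nicely_meromorphic_at_cong U(3) by blast
qed

text \<open>Injectivity keeps \<open>f x\<close> away from the value \<open>f z\<close> for
  \<open>x\<close> near \<open>z\<close>, so punctured limits and poles of \<open>g\<close> at
  \<open>f z\<close> pull back to \<open>z\<close>.\<close>

lemma nicely_meromorphic_compose:
  assumes g: "g nicely_meromorphic_on {f z}" and f: "f holomorphic_on U" "open U" "inj_on f U" "z \<in> U"
  shows "(\<lambda>x. g (f x)) nicely_meromorphic_on {z}"
proof -
  have an: "f analytic_on {z}" unfolding analytic_at using f by blast
  then have m: "(\<lambda>x. g (f x)) meromorphic_on {z}"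
    by (rule meromorphic_on_compose[rotated, of _ _ "{f z}"]) (use g in \<open>simp_all add: nicely_meromorphic_on_def\<close>)
  have "f \<midarrow>z\<rightarrow> f z" using an by (simp add: analytic_at_imp_isCont isContD)
  moreover have "\<forall>\<^sub>F x in at z. f x \<noteq> f z"
    using eventually_at_in_open[OF f(2,4)]
    by (rule eventually_mono) (use f in \<open>auto dest: inj_onD\<close>)
  ultimately have lim: "filterlim f (at (f z)) (at z)" by (simp add: filterlim_at)
  have "is_pole g (f z) \<and> g (f z) = 0 \<or> g \<midarrow>f z\<rightarrow> g (f z)"
    using g by (auto simp: nicely_meromorphic_on_def)
  then have "is_pole (\<lambda>x. g (f x)) z \<and> g (f z) = 0 \<or> (\<lambda>x. g (f x)) \<midarrow>z\<rightarrow> g (f z)"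
    unfolding is_pole_def using filterlim_compose[OF _ lim] by blast
  then show ?thesis using m by (simp add: nicely_meromorphic_on_def)
qed

text \<open>The identity theorem gives equality off a sparse set; the convention that values are
  limits, and 0 at poles, extends it to every point.\<close>

lemma nicely_meromorphic_unique:
  assumes f: "f nicely_meromorphic_on A" and g: "g nicely_meromorphic_on A"
    and A: "open A" "connected A" and U: "open U" "U \<subseteq> A" "U \<noteq> {}" "\<And>x. x \<in> U \<Longrightarrow> f x = g x"
    and z: "z \<in> A"
  shows "f z = g z"
proof -
  define d where "d = (\<lambda>x. f x - g x)"
  have dm: "d meromorphic_on A"
    using f g unfolding d_def nicely_meromorphic_on_def by (intro meromorphic_intros) auto
  obtain u where u: "u \<in> U" "u \<in> A" using U by auto
  have "\<forall>\<^sub>F x in at u. d x = 0"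
    using eventually_at_in_open'[OF U(1) u(1)] by (rule eventually_mono) (use U(4) in \<open>simp add: d_def\<close>)
  then have "\<not> (\<forall>\<^sub>F x in at u. d x \<noteq> 0)"
    using eventually_conj[of "\<lambda>x. d x = 0" "at u" "\<lambda>x. d x \<noteq> 0"] by auto
  then have "\<not> (\<forall>\<^sub>\<approx>x\<in>A. d x \<noteq> 0)" using A u by (auto simp: eventually_cosparse_open_eq)
  then have "\<forall>\<^sub>\<approx>x\<in>A. d x = 0" using meromorphic_imp_constant_or_avoid[OF dm A] by blast
  then have ev: "\<forall>\<^sub>F x in at z. f x = g x"
    using A z by (auto simp: eventually_cosparse_open_eq d_def)
  have p: "is_pole f z \<longleftrightarrow> is_pole g z" by (rule is_pole_cong[OF ev refl])
  show ?thesis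
  proof (cases "is_pole f z")
    case True
    then show ?thesis using p is_pole_zero_at_nicely_mero[OF f _ z] is_pole_zero_at_nicely_mero[OF g _ z] by simp
  next
    case False
    then have "f \<midarrow>z\<rightarrow> f z" "g \<midarrow>z\<rightarrow> g z"
      using p f g z by (auto simp: nicely_meromorphic_on_def)
    then have "f \<midarrow>z\<rightarrow> f z" "f \<midarrow>z\<rightarrow> g z" using tendsto_cong[OF ev] by auto
    then show ?thesis using LIM_unique by blast
  qed
qed

lemma open_annulus: "open (annulus a b)"
proof -
  have "annulus a b = {w. a < ereal (cmod w)} \<inter> {w. ereal (cmod w) < b}" by (auto simp: annulus_def)
  then show ?thesis by (auto intro!: open_Int open_Collect_less continuous_intros)
qed

lemma connected_annulus_ereal: "connected (annulus (ereal a) b)"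
proof (cases b)
  case (real r)
  then show ?thesis using connected_ring[of a r] by (simp add: annulus_def)
next
  case PInf
  then show ?thesis using connected_exterior by simp
next
  case MInf
  then show ?thesis by (simp add: annulus_def)
qed

lemma one_divide_ereal_zero: "1 / ereal 0 = \<infinity>"
  by (simp add: divide_ereal_def)

text \<open>The product form also covers \<open>\<rho> = 0\<close>, where the upper bound of the
  ring is infinite.\<close>

lemma mem_symmetric_annulus:
  assumes "0 \<le> \<rho>"
  shows "w \<in> annulus (ereal m) (1 / ereal \<rho>) \<longleftrightarrow> m < cmod w \<and> \<rho> * cmod w < 1"
proof (cases "\<rho> = 0")
  case True
  then show ?thesis unfolding True one_divide_ereal_zero by (simp add: annulus_def)
next
  case False
  then have "1 / ereal \<rho> = ereal (1 / \<rho>)" by (simp add: one_ereal_def)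
  then show ?thesis using False assms by (simp add: annulus_def field_simps)
qed

section \<open>Boundary behaviour of the two conformal maps\<close>

locale curve =
  fixes L :: "complex set" and \<psi> \<phi> :: "complex \<Rightarrow> complex"
  assumes curve: "analytic_jordan_curve L" and ext: "exterior_map L \<psi>" and int: "interior_map L \<phi>"
begin

abbreviation "\<rho> \<equiv> rho \<psi>"
abbreviation "\<Psi> \<equiv> psi_ext \<psi>"
abbreviation "\<mu> \<equiv> mu L \<psi> \<phi>"
abbreviation "h \<equiv> h_phi L \<psi> \<phi>"
abbreviation "G \<equiv> inside L"

lemma rho: "0 \<le> \<rho>" "\<rho> < 1"
  using rho_nonneg rho_less_one curve ext by auto

lemma Psi: "\<Psi> holomorphic_on {w. \<rho> < cmod w}" "inj_on \<Psi> {w. \<rho> < cmod w}"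
    "\<And>w. 1 < cmod w \<Longrightarrow> \<Psi> w = \<psi> w"
  using psi_ext[OF curve ext] by (auto simp: univalent_continuation_def)

lemma curve_facts:
  "compact L" "L \<noteq> {}" "G \<noteq> {}" "open G" "connected G" "bounded G"
  "open (outside L)" "connected (outside L)" "frontier G = L" "frontier (outside L) = L"
  "G \<inter> outside L = {}" "G \<union> outside L = - L"
  using analytic_jordan_curveE[OF curve] by metis+

lemma sides: "z \<in> L \<Longrightarrow> z \<notin> G" "z \<in> L \<Longrightarrow> z \<notin> outside L" "z \<in> outside L \<Longrightarrow> z \<notin> G"
    "z \<notin> G \<Longrightarrow> z \<notin> outside L \<Longrightarrow> z \<in> L"
  using curve_facts(11,12) by blast+

lemma Psi_outside: "\<Psi> ` {w. 1 < cmod w} = outside L"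
proof -
  have "\<psi> ` {w. 1 < cmod w} = outside L" using ext by (auto simp: exterior_map_def bij_betw_def)
  then show ?thesis using Psi(3) by (metis (mono_tags, lifting) image_cong mem_Collect_eq)
qed

lemma filterlim_Psi: "filterlim \<Psi> at_infinity at_infinity"
proof -
  have "\<forall>\<^sub>F w in at_infinity. \<psi> w = \<Psi> w"
    unfolding eventually_at_infinity by (rule exI[of _ 2]) (use Psi(3) in auto)
  then show ?thesis using ext filterlim_cong[OF refl refl, of \<psi> \<Psi>] by (auto simp: exterior_map_def)
qed

lemma Psi_not_outside:
  assumes "\<rho> < cmod w" "cmod w \<le> 1"
  shows "\<Psi> w \<notin> outside L"
proof
  assume "\<Psi> w \<in> outside L"
  then obtain x where "1 < cmod x" "\<Psi> w = \<Psi> x" using Psi_outside by auto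
  then show False using inj_onD[OF Psi(2), of w x] assms rho by auto
qed

lemma isCont_Psi: "\<rho> < cmod w \<Longrightarrow> isCont \<Psi> w"
  using holomorphic_on_imp_continuous_on[OF Psi(1)] open_ring(1) continuous_on_eq_continuous_at by blast

text \<open>One inclusion takes radial limits from outside. For the other, exterior points near
  \<open>z \<in> L\<close> come from a bounded set of \<open>w\<close>, because
  \<open>\<Psi>\<close> tends to infinity, so \<open>z\<close> lies in the compact image
  \<open>K\<close>.\<close>

lemma Psi_sphere: "\<Psi> ` sphere 0 1 = L"
proof
  show "\<Psi> ` sphere 0 1 \<subseteq> L"
  proof safe
    fix w :: complex assume w: "w \<in> sphere 0 1"
    have "((\<lambda>t. \<Psi> (of_real t * w)) \<longlongrightarrow> \<Psi> (of_real 1 * w)) (at_right 1)"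
      by (intro isCont_tendsto_compose[OF isCont_Psi] tendsto_intros) (use w rho in auto)
    moreover have "\<forall>\<^sub>F t in at_right 1. \<Psi> (of_real t * w) \<in> closure (outside L)"
      using eventually_at_right_less[of 1]
      by (rule eventually_mono) (use w closure_subset[of "outside L"] in \<open>force simp: Psi_outside[symmetric] norm_mult\<close>)
    ultimately have "\<Psi> w \<in> closure (outside L)"
      by (intro Lim_in_closed_set[of "closure (outside L)" "\<lambda>t. \<Psi> (of_real t * w)" "at_right (1::real)"]) auto
    moreover have "\<Psi> w \<notin> outside L" using Psi_not_outside w rho by auto
    ultimately show "\<Psi> w \<in> L" using curve_facts(7,10) by (auto simp: frontier_def interior_open)
  qed
next
  show "L \<subseteq> \<Psi> ` sphere 0 1"
  proof
    fix z assume z: "z \<in> L"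
    have "\<forall>\<^sub>F w in at_infinity. cmod z + 2 \<le> cmod (\<Psi> w)"
    proof -
      have "0 < cmod z + 2" by (simp add: add_nonneg_pos)
      then show ?thesis using filterlim_Psi unfolding filterlim_at_infinity[OF order_refl] by blast
    qed
    then obtain M where M: "\<And>w. M \<le> cmod w \<Longrightarrow> cmod z + 2 \<le> cmod (\<Psi> w)"
      by (auto simp: eventually_at_infinity)
    define K where "K = \<Psi> ` (cball 0 M - ball 0 1)"
    have "compact K" unfolding K_def
      by (intro compact_continuous_image compact_diff continuous_at_imp_continuous_on)
         (use rho in \<open>auto intro!: isCont_Psi\<close>)
    have "outside L \<inter> ball z 1 \<subseteq> K"
    proof
      fix x assume x: "x \<in> outside L \<inter> ball z 1"
      then obtain w where w: "1 < cmod w" "x = \<Psi> w" using Psi_outside by auto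
      have "cmod x < cmod z + 2"
        using x norm_triangle_ineq2[of x z] by (simp add: dist_norm norm_minus_commute)
      then have "cmod w \<le> M" using M[of w] w by force
      then show "x \<in> K" using w by (auto simp: K_def)
    qed
    moreover have "z \<in> closure (outside L \<inter> ball z 1)"
    proof -
      have "z \<in> closure (outside L)" using z curve_facts(10) by (auto simp: frontier_def)
      then have "z \<in> ball z 1 \<inter> closure (outside L)" by auto
      then show ?thesis using open_Int_closure_subset[of "ball z 1" "outside L"] by (auto simp: Int_commute)
    qed
    ultimately have "z \<in> K" using \<open>compact K\<close> by (meson closure_minimal compact_imp_closed subsetD)
    then obtain w where w: "1 \<le> cmod w" "z = \<Psi> w" by (auto simp: K_def not_less)
    moreover have "\<not> 1 < cmod w" using w z Psi_outside curve_facts(12) by blast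
    ultimately show "z \<in> \<Psi> ` sphere 0 1" by auto
  qed
qed

lemma Psi_inside: "\<rho> < cmod w \<Longrightarrow> cmod w < 1 \<Longrightarrow> \<Psi> w \<in> G"
proof -
  assume w: "\<rho> < cmod w" "cmod w < 1"
  have "\<Psi> w \<notin> L"
  proof
    assume "\<Psi> w \<in> L"
    then obtain x where "cmod x = 1" "\<Psi> w = \<Psi> x" unfolding Psi_sphere[symmetric] by auto
    then show False using inj_onD[OF Psi(2), of w x] w rho by auto
  qed
  then show "\<Psi> w \<in> G" using Psi_not_outside w curve_facts(12) by (metis ComplI UnE less_imp_le)
qed

lemma Psi_inside_iff: "\<rho> < cmod w \<Longrightarrow> \<Psi> w \<in> G \<longleftrightarrow> cmod w < 1"
proof -
  assume w: "\<rho> < cmod w"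
  consider "cmod w < 1" | "cmod w = 1" | "cmod w > 1" by linarith
  then show ?thesis
  proof cases
    case 1 then show ?thesis using Psi_inside w by blast
  next
    case 2
    then have "\<Psi> w \<in> L" unfolding Psi_sphere[symmetric] by auto
    from sides(1)[OF this] show ?thesis using 2 by simp
  next
    case 3
    then have "\<Psi> w \<in> outside L" unfolding Psi_outside[symmetric] by auto
    from sides(3)[OF this] show ?thesis using 3 by simp
  qed
qed

lemma phi: "\<phi> holomorphic_on G" "inj_on \<phi> G" "\<phi> ` G = ball 0 1"
  using int by (auto simp: interior_map_def bij_betw_def)

lemma Psi_cases:
  obtains "z \<in> G" | w where "1 \<le> cmod w" "z = \<Psi> w"
proof (cases "z \<in> G")
  case False
  then have "z \<in> L \<union> outside L" using sides by blast
  then show ?thesis using that(2) Psi_sphere Psi_outside by (auto simp: image_iff) force+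
qed (use that in auto)

lemma phi_Psi: "(\<lambda>w. \<phi> (\<Psi> w)) holomorphic_on {w. \<rho> < cmod w \<and> cmod w < 1}"
  "inj_on (\<lambda>w. \<phi> (\<Psi> w)) {w. \<rho> < cmod w \<and> cmod w < 1}"
  "\<And>w. \<rho> < cmod w \<Longrightarrow> cmod w < 1 \<Longrightarrow> cmod (\<phi> (\<Psi> w)) < 1"
proof -
  have "(\<phi> \<circ> \<Psi>) holomorphic_on {w. \<rho> < cmod w \<and> cmod w < 1}"
    by (rule holomorphic_on_compose_gen[OF _ phi(1)])
       (use Psi_inside in \<open>auto intro: holomorphic_on_subset[OF Psi(1)]\<close>)
  then show "(\<lambda>w. \<phi> (\<Psi> w)) holomorphic_on {w. \<rho> < cmod w \<and> cmod w < 1}" by (simp add: o_def)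
  show "inj_on (\<lambda>w. \<phi> (\<Psi> w)) {w. \<rho> < cmod w \<and> cmod w < 1}"
  proof (rule inj_onI)
    fix x y assume xy: "x \<in> {w. \<rho> < cmod w \<and> cmod w < 1}" "y \<in> {w. \<rho> < cmod w \<and> cmod w < 1}" "\<phi> (\<Psi> x) = \<phi> (\<Psi> y)"
    then have "\<Psi> x = \<Psi> y" using inj_onD[OF phi(2)] Psi_inside by auto
    then show "x = y" using inj_onD[OF Psi(2)] xy by auto
  qed
  show "cmod (\<phi> (\<Psi> w)) < 1" if "\<rho> < cmod w" "cmod w < 1" for w
    using phi(3) Psi_inside[OF that] by (metis image_eqI mem_ball_0)
qed

text \<open>\<open>K\<close>, the preimage of a smaller closed disc under \<open>\<phi>\<close>, is
  a compact part of \<open>G\<close>. As \<open>\<Psi>\<close> maps the unit circle to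
  \<open>L\<close>, it maps a whole ring around the circle off \<open>K\<close>.\<close>

lemma phi_near_curve:
  assumes "e > 0"
  obtains d where "\<rho> \<le> d" "d < 1" "\<And>w. d < cmod w \<Longrightarrow> cmod w < 1 \<Longrightarrow> 1 - e < cmod (\<phi> (\<Psi> w))"
proof -
  obtain k where k: "k holomorphic_on (\<phi> ` G)" "\<And>z. z \<in> G \<Longrightarrow> k (\<phi> z) = z"
    using holomorphic_has_inverse[OF phi(1) curve_facts(4) phi(2)] by metis
  define K where "K = k ` cball 0 (1 - e)"
  have sub: "cball 0 (1 - e) \<subseteq> \<phi> ` G" using phi(3) assms by auto
  have "compact K" unfolding K_def
    by (intro compact_continuous_image continuous_on_subset[OF holomorphic_on_imp_continuous_on[OF k(1)] sub]) auto
  have KG: "K \<subseteq> G"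
  proof -
    have "k u \<in> G" if "u \<in> \<phi> ` G" for u using that k(2) by auto
    then show ?thesis using sub by (auto simp: K_def)
  qed
  define D where "D = {w. \<rho> < cmod w}"
  have "open (D \<inter> \<Psi> -` (- K))"
    using \<open>compact K\<close> open_ring(1) holomorphic_on_imp_continuous_on[OF Psi(1)] unfolding D_def
    by (intro continuous_open_preimage) (auto intro: compact_imp_closed)
  moreover have "sphere 0 1 \<subseteq> D \<inter> \<Psi> -` (- K)"
  proof
    fix w :: complex assume w: "w \<in> sphere 0 1"
    then have "\<Psi> w \<in> L" using Psi_sphere by blast
    from sides(1)[OF this] have "\<Psi> w \<notin> K" using KG by blast
    then show "w \<in> D \<inter> \<Psi> -` (- K)" using w rho by (auto simp: D_def)
  qed
  ultimately obtain a where a: "0 < a" "a < 1" "{w. a < cmod w \<and> cmod w < 1 / a} \<subseteq> D \<inter> \<Psi> -` (- K)"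
    using ring_in_open by metis
  have a1: "1 < 1 / a" using a by simp
  show thesis
  proof (rule that[of "max \<rho> a"])
    fix w assume w: "max \<rho> a < cmod w" "cmod w < 1"
    then have "w \<in> {w. a < cmod w \<and> cmod w < 1 / a}" using a1 by auto
    then have "\<Psi> w \<notin> K" using a by blast
    moreover have "\<Psi> w \<in> G" using Psi_inside w by auto
    ultimately have "\<phi> (\<Psi> w) \<notin> cball 0 (1 - e)" using k(2) unfolding K_def by (metis imageI)
    then show "1 - e < cmod (\<phi> (\<Psi> w))" by simp
  qed (use a rho in auto)
qed

lemma reflection_phi_Psi:
  obtains a H where "\<rho> < a" "circle_reflection a (\<lambda>w. \<phi> (\<Psi> w)) H"
proof -
  have lim: "\<exists>d<1. \<forall>w. d < cmod w \<and> cmod w < 1 \<longrightarrow> \<bar>cmod (\<phi> (\<Psi> w)) - 1\<bar> < e" if e: "e > 0" for e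
  proof -
    obtain d where d: "\<rho> \<le> d" "d < 1" "\<And>w. d < cmod w \<Longrightarrow> cmod w < 1 \<Longrightarrow> 1 - e < cmod (\<phi> (\<Psi> w))"
      using phi_near_curve[OF e] by metis
    have "\<bar>cmod (\<phi> (\<Psi> w)) - 1\<bar> < e" if "d < cmod w" "cmod w < 1" for w
    proof -
      have "1 - e < cmod (\<phi> (\<Psi> w))" using d(3)[OF that] .
      moreover have "cmod (\<phi> (\<Psi> w)) < 1" using phi_Psi(3)[of w] d that by auto
      ultimately show ?thesis by linarith
    qed
    then show ?thesis using d by blast
  qed
  show thesis using univalent_reflection[OF phi_Psi(1) rho phi_Psi(2,3) lim] that by blast
qed

text \<open>In the coordinate \<open>w\<close> the continuation is pieced together:
  \<open>\<phi> (\<Psi> w)\<close> below the circle, the reflection \<open>H\<close> near it, and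
  further out the reciprocal of \<open>k w\<close>, whose poles are the zeros of \<open>k\<close>.
  The inverse \<open>q\<close> of \<open>\<Psi>\<close> carries it to the
  \<open>z\<close>-plane.\<close>

lemma phi_continuation_exists:
  "\<exists>g. mero_continuation \<phi> G g (G_dom \<psi> (1 / ereal \<rho>))"
proof -
  obtain a H where a: "\<rho> < a" and refl: "circle_reflection a (\<lambda>w. \<phi> (\<Psi> w)) H"
    using reflection_phi_Psi by blast
  have a1: "0 < a" "a < 1" and H: "H holomorphic_on {w. a < cmod w \<and> cmod w < 1 / a}"
    and Hv: "\<And>w. a < cmod w \<Longrightarrow> cmod w < 1 \<Longrightarrow> H w = \<phi> (\<Psi> w)"
    and Hr: "\<And>w. a < cmod w \<Longrightarrow> cmod w < 1 / a \<Longrightarrow> H w * cnj (H (1 / cnj w)) = 1"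
    using refl by (auto simp: circle_reflection_def)
  have a2: "1 < 1 / a" using a1 by simp
  define k where "k = (\<lambda>w. cnj (\<phi> (\<Psi> (1 / cnj w))))"
  define S where "S = {w. 1 < cmod w \<and> \<rho> * cmod w < 1}"
  have oS: "open S" unfolding S_def by (intro open_Collect_conj open_Collect_less continuous_intros)
  have kh: "k holomorphic_on S"
    unfolding k_def
  proof (rule holomorphic_inversion_cnj[OF phi_Psi(1) open_ring(2)])
    fix w assume w: "w \<in> S"
    then have "w \<noteq> 0" by (auto simp: S_def)
    moreover have "\<rho> < 1 / cmod w" "1 / cmod w < 1"
      using w less_trans[OF zero_less_one, of "cmod w"]
      by (simp_all add: S_def pos_less_divide_eq pos_divide_less_eq)
    ultimately show "w \<noteq> 0 \<and> 1 / cnj w \<in> {w. \<rho> < cmod w \<and> cmod w < 1}" by (simp add: norm_divide)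
  qed
  have Hk: "H w = inverse (k w)" if "1 < cmod w" "cmod w < 1 / a" for w
  proof -
    have "a < 1 / cmod w" "1 / cmod w < 1" using that a1 less_trans[OF zero_less_one that(1)]
      by (simp_all add: pos_less_divide_eq pos_divide_less_eq mult.commute)
    then have "H (1 / cnj w) = \<phi> (\<Psi> (1 / cnj w))" by (intro Hv) (auto simp: norm_divide)
    then have "H w * k w = 1" using Hr[of w] that a1 by (simp add: k_def)
    then show ?thesis by (metis inverse_unique mult.commute)
  qed
  define Hs where "Hs = (\<lambda>w. if cmod w < 1 then \<phi> (\<Psi> w) else if cmod w < 1 / a then H w else inverse (k w))"
  have inv_nice: "(\<lambda>w. inverse (k w)) nicely_meromorphic_on S"
    by (intro nicely_meromorphic_on_inverse analytic_on_imp_nicely_meromorphic_on)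
       (use kh oS in \<open>simp add: analytic_on_open\<close>)
  have Hs: "\<exists>U g. open U \<and> w \<in> U \<and> g nicely_meromorphic_on {w} \<and> (\<forall>x\<in>U. Hs x = g x)"
    if w: "1 \<le> cmod w" "\<rho> * cmod w < 1" for w
  proof (cases "cmod w = 1")
    case True
    define U where "U = {w. a < cmod w \<and> cmod w < 1 / a}"
    have U: "open U" "w \<in> U" unfolding U_def using open_ring True a1 a2 by auto
    have "H nicely_meromorphic_on {w}"
      using U H by (intro analytic_on_imp_nicely_meromorphic_on) (auto simp: analytic_at U_def)
    moreover have "Hs x = H x" if "x \<in> U" for x using that Hv by (auto simp: Hs_def U_def)
    ultimately show ?thesis using U by blast
  next
    case False
    then have "w \<in> S" using w by (simp add: S_def)
    moreover have "Hs x = inverse (k x)" if "x \<in> S" for x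
      using that Hk[of x] by (auto simp: Hs_def S_def)
    moreover have "(\<lambda>w. inverse (k w)) nicely_meromorphic_on {w}"
      using inv_nice \<open>w \<in> S\<close> nicely_meromorphic_on_pointwise by blast
    ultimately show ?thesis using oS by blast
  qed
  define R where "R = {w. \<rho> < cmod w}"
  have oR: "open R" unfolding R_def by (rule open_ring)
  have PR: "\<Psi> holomorphic_on R" "inj_on \<Psi> R" using Psi by (auto simp: R_def)
  obtain q where q: "q holomorphic_on (\<Psi> ` R)" "\<And>w. w \<in> R \<Longrightarrow> q (\<Psi> w) = w"
    using holomorphic_has_inverse[OF PR(1) oR PR(2)] by metis
  have oPR: "open (\<Psi> ` R)" using open_mapping_thm3[OF PR(1) oR PR(2)] .
  define g where "g = (\<lambda>z. if z \<in> G then \<phi> z else Hs (q z))"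
  have "g nicely_meromorphic_on G_dom \<psi> (1 / ereal \<rho>)"
  proof (rule nicely_meromorphic_glue)
    fix z assume z: "z \<in> G_dom \<psi> (1 / ereal \<rho>)"
    show "\<exists>U f. open U \<and> z \<in> U \<and> f nicely_meromorphic_on {z} \<and> (\<forall>x\<in>U. g x = f x)"
    proof (cases rule: Psi_cases[of z])
      case 1
      have "\<phi> nicely_meromorphic_on {z}"
        using 1 phi(1) curve_facts(4) by (intro analytic_on_imp_nicely_meromorphic_on) (auto simp: analytic_at)
      then show ?thesis using 1 curve_facts(4)
        by (intro exI[of _ G] exI[of _ \<phi>]) (auto simp: g_def)
    next
      case (2 w)
      have wR: "w \<in> R" using 2 rho by (simp add: R_def)
      \<comment> \<open>Otherwise \<open>\<Psi> w\<close> is the limit of points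
        \<open>\<Psi> (t * w)\<close> with \<open>t\<close> decreasing to 1, and these belong to the
        image whose closure \<open>G_dom\<close> removes.\<close>
      have "\<rho> * cmod w < 1"
      proof (rule ccontr)
        assume c: "\<not> \<rho> * cmod w < 1"
        then have r0: "\<rho> > 0" using rho by (metis less_eq_real_def mult_zero_left zero_less_one)
        have "((\<lambda>t. \<Psi> (of_real t * w)) \<longlongrightarrow> \<Psi> (of_real 1 * w)) (at_right 1)"
          by (intro isCont_tendsto_compose[OF isCont_Psi] tendsto_intros) (use wR in \<open>auto simp: R_def\<close>)
        moreover have "\<forall>\<^sub>F t in at_right 1. \<Psi> (of_real t * w) \<in> closure (\<Psi> ` annulus (1 / ereal \<rho>) \<infinity>)"
          using eventually_at_right_less[of 1]
        proof (rule eventually_mono)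
          fix t :: real assume t: "1 < t"
          have "1 / \<rho> \<le> cmod w" using c r0 by (simp add: field_simps)
          also have "cmod w < t * cmod w" using t 2 mult_strict_right_mono[OF t, of "cmod w"] by linarith
          finally have "of_real t * w \<in> annulus (1 / ereal \<rho>) \<infinity>"
          proof -
            assume "1 / \<rho> < t * cmod w"
            moreover have "1 / ereal \<rho> = ereal (1 / \<rho>)" using r0 by (simp add: one_ereal_def)
            ultimately show ?thesis using t by (simp add: annulus_def norm_mult)
          qed
          then show "\<Psi> (of_real t * w) \<in> closure (\<Psi> ` annulus (1 / ereal \<rho>) \<infinity>)"
            by (intro subsetD[OF closure_subset] imageI)
        qed
        ultimately have "\<Psi> w \<in> closure (\<Psi> ` annulus (1 / ereal \<rho>) \<infinity>)"
          by (intro Lim_in_closed_set[of _ "\<lambda>t. \<Psi> (of_real t * w)" "at_right (1::real)"]) auto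
        then show False using z 2 by (simp add: G_dom_def)
      qed
      then obtain U f where U: "open U" "w \<in> U" "f nicely_meromorphic_on {w}" "\<forall>x\<in>U. Hs x = f x"
        using Hs[of w] 2 by blast
      have qz: "q z = w" using q(2) wR 2 by simp
      have zPR: "z \<in> \<Psi> ` R" using 2 wR by auto
      have qinj: "inj_on q (\<Psi> ` R)" using q(2) by (auto intro!: inj_onI)
      have "(\<lambda>x. f (q x)) nicely_meromorphic_on {z}"
        by (rule nicely_meromorphic_compose[OF _ q(1) oPR qinj zPR]) (use U qz in simp)
      moreover have "open (\<Psi> ` R \<inter> q -` U)"
        using continuous_open_preimage[OF holomorphic_on_imp_continuous_on[OF q(1)] oPR U(1)] .
      moreover have "g x = f (q x)" if "x \<in> \<Psi> ` R \<inter> q -` U" for x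
      proof -
        have "x \<in> \<Psi> ` R" using that by blast
        then obtain y where y: "y \<in> R" "x = \<Psi> y" by blast
        then have qy: "q x = y" using q(2) by simp
        have "Hs y = g x"
        proof (cases "x \<in> G")
          case True
          then have "cmod y < 1" using Psi_inside_iff[of y] y by (simp add: R_def)
          then show ?thesis using True y by (simp add: g_def Hs_def)
        next
          case False
          then show ?thesis using qy by (simp add: g_def)
        qed
        then show ?thesis using that U qy by auto
      qed
      ultimately show ?thesis using zPR qz U(2) by (intro exI[of _ "\<Psi> ` R \<inter> q -` U"]) auto
    qed
  qed
  moreover have "G \<subseteq> G_dom \<psi> (1 / ereal \<rho>)"
  proof -
    have "annulus (1 / ereal \<rho>) \<infinity> \<subseteq> {w. 1 < cmod w}"
    proof (cases "\<rho> = 0")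
      case True then show ?thesis unfolding True one_divide_ereal_zero by (simp add: annulus_def)
    next
      case False
      then have "1 < 1 / \<rho>" using rho by simp
      then show ?thesis using False by (auto simp: annulus_def one_ereal_def)
    qed
    then have "\<Psi> ` annulus (1 / ereal \<rho>) \<infinity> \<subseteq> outside L" using Psi_outside by auto
    then have "G \<inter> \<Psi> ` annulus (1 / ereal \<rho>) \<infinity> = {}" using curve_facts(11) by blast
    then have "G \<inter> closure (\<Psi> ` annulus (1 / ereal \<rho>) \<infinity>) = {}"
      using open_Int_closure_eq_empty[OF curve_facts(4)] by blast
    then show ?thesis by (auto simp: G_dom_def)
  qed
  ultimately show ?thesis unfolding mero_continuation_def
    by (intro exI[of _ g]) (auto simp: g_def)
qed

lemma Psi_G_dom:
  assumes w: "\<rho> < cmod w" "\<rho> * cmod w < 1"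
  shows "\<Psi> w \<in> G_dom \<psi> (1 / ereal \<rho>)"
proof -
  define R where "R = {w. \<rho> < cmod w \<and> \<rho> * cmod w < 1}"
  have "open R" unfolding R_def by (intro open_Collect_conj open_Collect_less continuous_intros)
  moreover have "R \<subseteq> {w. \<rho> < cmod w}" by (auto simp: R_def)
  ultimately have oR: "open (\<Psi> ` R)"
    using open_mapping_thm3[OF holomorphic_on_subset[OF Psi(1)], of R] inj_on_subset[OF Psi(2)] by blast
  have far: "\<rho> < cmod x \<and> \<not> \<rho> * cmod x < 1" if "x \<in> annulus (1 / ereal \<rho>) \<infinity>" for x
  proof (cases "\<rho> = 0")
    case True then show ?thesis using that unfolding True one_divide_ereal_zero by (simp add: annulus_def)
  next
    case False
    then have r: "\<rho> > 0" using rho by simp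
    have "1 / ereal \<rho> = ereal (1 / \<rho>)" using r by (simp add: one_ereal_def)
    then have x: "1 / \<rho> < cmod x" using that by (simp add: annulus_def)
    have "\<rho> < 1 / \<rho>" using r rho mult_strict_mono[of \<rho> 1 \<rho> 1] by (simp add: field_simps)
    then have "\<rho> < cmod x" using x by linarith
    then show ?thesis using x r by (auto simp: field_simps)
  qed
  have "\<Psi> ` R \<inter> \<Psi> ` annulus (1 / ereal \<rho>) \<infinity> = {}"
  proof (rule ccontr)
    assume "\<Psi> ` R \<inter> \<Psi> ` annulus (1 / ereal \<rho>) \<infinity> \<noteq> {}"
    then obtain x y where xy: "x \<in> R" "y \<in> annulus (1 / ereal \<rho>) \<infinity>" "\<Psi> x = \<Psi> y" by auto
    then have "x = y" using inj_onD[OF Psi(2) xy(3)] far[OF xy(2)] by (auto simp: R_def)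
    then show False using xy far[OF xy(2)] by (auto simp: R_def)
  qed
  then have "\<Psi> ` R \<inter> closure (\<Psi> ` annulus (1 / ereal \<rho>) \<infinity>) = {}"
    using open_Int_closure_eq_empty[OF oR] by blast
  moreover have "\<Psi> w \<in> \<Psi> ` R" using w by (auto simp: R_def)
  ultimately show ?thesis unfolding G_dom_def by blast
qed

section \<open>The smallest radius of meromorphic continuation\<close>

lemma phi_ext: "mero_continuation \<phi> G (phi_ext L \<psi> \<phi>) (G_dom \<psi> (1 / ereal \<rho>))"
  unfolding phi_ext_def using phi_continuation_exists by (rule someI_ex)

lemma phi_ext_Psi: "\<rho> < cmod w \<Longrightarrow> cmod w < 1 \<Longrightarrow> phi_ext L \<psi> \<phi> (\<Psi> w) = \<phi> (\<Psi> w)"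
  using phi_ext Psi_inside by (auto simp: mero_continuation_def)

text \<open>The inclusion of domains demanded by \<open>mero_continuation\<close> is encoded as
  \<open>m \<le> \<rho>\<close>, which \<open>annulus_subset_iff\<close> justifies.\<close>

definition continues :: "real \<Rightarrow> (complex \<Rightarrow> complex) \<Rightarrow> bool" where
  "continues m k \<longleftrightarrow> m \<le> \<rho> \<and> k nicely_meromorphic_on annulus (ereal m) (1 / ereal \<rho>) \<and>
     (\<forall>w\<in>annulus (ereal \<rho>) (1 / ereal \<rho>). k w = phi_ext L \<psi> \<phi> (\<Psi> w))"

lemma rho_mult_less: "cmod w \<le> 1 \<Longrightarrow> \<rho> * cmod w < 1"
  using rho mult_left_mono[of "cmod w" 1 \<rho>] by linarith

lemma annulus_subset_iff:
  "annulus (ereal \<rho>) (1 / ereal \<rho>) \<subseteq> annulus (ereal m) (1 / ereal \<rho>) \<longleftrightarrow> m \<le> \<rho>"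
proof
  assume sub: "annulus (ereal \<rho>) (1 / ereal \<rho>) \<subseteq> annulus (ereal m) (1 / ereal \<rho>)"
  show "m \<le> \<rho>"
  proof (rule ccontr)
    assume c: "\<not> m \<le> \<rho>"
    define t where "t = (\<rho> + min m 1) / 2"
    have t: "\<rho> < t" "t < m" "t < 1" "0 < t" using c rho by (auto simp: t_def min_def field_simps)
    have "complex_of_real t \<in> annulus (ereal \<rho>) (1 / ereal \<rho>)"
      using t rho_mult_less[of "of_real t"] by (simp add: mem_symmetric_annulus[OF rho(1)])
    then have "complex_of_real t \<in> annulus (ereal m) (1 / ereal \<rho>)" using sub by blast
    then show False using t by (simp add: mem_symmetric_annulus[OF rho(1)])
  qed
qed (auto simp: mem_symmetric_annulus[OF rho(1)])

lemma comp_continuation_iff: "comp_continuation L \<psi> \<phi> m k \<longleftrightarrow> continues m k"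
  by (simp add: comp_continuation_def mero_continuation_def continues_def annulus_subset_iff)

lemma continues_rho: "continues \<rho> (\<lambda>w. phi_ext L \<psi> \<phi> (\<Psi> w))"
proof -
  have "(\<lambda>w. phi_ext L \<psi> \<phi> (\<Psi> w)) nicely_meromorphic_on annulus (ereal \<rho>) (1 / ereal \<rho>)"
    unfolding nicely_meromorphic_on_pointwise[of _ "annulus (ereal \<rho>) (1 / ereal \<rho>)"]
  proof
    fix w assume "w \<in> annulus (ereal \<rho>) (1 / ereal \<rho>)"
    then have w: "\<rho> < cmod w" "\<rho> * cmod w < 1" by (auto simp: mem_symmetric_annulus[OF rho(1)])
    have "phi_ext L \<psi> \<phi> nicely_meromorphic_on {\<Psi> w}"
      using phi_ext Psi_G_dom[OF w] unfolding mero_continuation_def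
      by (metis nicely_meromorphic_on_pointwise)
    then show "(\<lambda>w. phi_ext L \<psi> \<phi> (\<Psi> w)) nicely_meromorphic_on {w}"
      by (rule nicely_meromorphic_compose[OF _ Psi(1) open_ring(1) Psi(2)]) (use w in simp)
  qed
  then show ?thesis by (simp add: continues_def)
qed

lemma continues_unique:
  assumes f: "continues m f" and g: "continues n g" and w: "m < cmod w" "n < cmod w" "\<rho> * cmod w < 1"
  shows "f w = g w"
proof -
  define M where "M = max m n"
  have M: "M \<le> x \<longleftrightarrow> m \<le> x \<and> n \<le> x" "M < x \<longleftrightarrow> m < x \<and> n < x" for x by (auto simp: M_def)
  define A where "A = annulus (ereal M) (1 / ereal \<rho>)"
  have sub: "A \<subseteq> annulus (ereal m) (1 / ereal \<rho>)" "A \<subseteq> annulus (ereal n) (1 / ereal \<rho>)"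
    by (auto simp: A_def mem_symmetric_annulus[OF rho(1)] M)
  have le: "M \<le> \<rho>" using f g by (simp add: continues_def M)
  define t where "t = (1 + \<rho>) / 2"
  have t: "\<rho> < t" "t < 1" "0 < t" using rho by (auto simp: t_def)
  have ne: "complex_of_real t \<in> annulus (ereal \<rho>) (1 / ereal \<rho>)"
    using t rho_mult_less[of "of_real t"] by (simp add: mem_symmetric_annulus[OF rho(1)])
  show ?thesis
  proof (rule nicely_meromorphic_unique[of f A g "annulus (ereal \<rho>) (1 / ereal \<rho>)"])
    show "f nicely_meromorphic_on A" "g nicely_meromorphic_on A"
      using f g sub nicely_meromorphic_on_subset by (auto simp: continues_def)
    show "open A" "open (annulus (ereal \<rho>) (1 / ereal \<rho>))" "connected A"
      unfolding A_def by (rule open_annulus connected_annulus_ereal)+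
    show "annulus (ereal \<rho>) (1 / ereal \<rho>) \<subseteq> A" unfolding A_def using le by (simp add: annulus_subset_iff)
    show "w \<in> A" using w by (simp add: A_def mem_symmetric_annulus[OF rho(1)] M)
  qed (use ne f g in \<open>auto simp: continues_def\<close>)
qed

text \<open>Attainment of the infimum by the same gluing as for \<open>rho\<close>, with
  \<open>continues_unique\<close> as the identity theorem.\<close>

lemma
  shows mu_nonneg: "0 \<le> \<mu>" and mu_le_rho: "\<mu> \<le> \<rho>" and h_continues: "continues \<mu> h"
    and mu_least: "\<And>m k. 0 \<le> m \<Longrightarrow> continues m k \<Longrightarrow> \<mu> \<le> m"
proof -
  define S where "S = {m. 0 \<le> m \<and> (\<exists>k. continues m k)}"
  have ne: "\<rho> \<in> S" using rho continues_rho by (auto simp: S_def)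
  have bdd: "bdd_below S" by (rule bdd_belowI[of _ 0]) (auto simp: S_def)
  define m where "m = Inf S"
  have m0: "0 \<le> m" unfolding m_def using ne by (intro cInf_greatest) (auto simp: S_def)
  have lower: "m \<le> r" if "r \<in> S" for r unfolding m_def using that bdd by (rule cInf_lower)
  have mr: "m \<le> \<rho>" using ne lower by blast
  have "\<forall>t. m < t \<longrightarrow> (\<exists>r\<in>S. r < t)"
    unfolding m_def using ne bdd cInf_less_iff[of S] by blast
  then obtain s where s: "\<And>t. m < t \<Longrightarrow> s t \<in> S \<and> s t < t" by metis
  then have "\<forall>t. \<exists>k. m < t \<longrightarrow> continues (s t) k" by (auto simp: S_def)
  then obtain k where k: "\<And>t. m < t \<Longrightarrow> continues (s t) (k t)" by metis
  define g where "g = (\<lambda>w. k (cmod w) w)"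
  have gk: "g w = k t w" if t: "m < t" "s t < cmod w" and w: "m < cmod w" "\<rho> * cmod w < 1" for t w
    unfolding g_def
    using continues_unique[OF k[OF w(1)] k[OF t(1)], of w] s[OF w(1)] t w by auto
  have "continues m g"
    unfolding continues_def
  proof (intro conjI ballI mr)
    show "g nicely_meromorphic_on annulus (ereal m) (1 / ereal \<rho>)"
    proof (rule nicely_meromorphic_glue)
      fix w assume "w \<in> annulus (ereal m) (1 / ereal \<rho>)"
      then have w: "m < cmod w" "\<rho> * cmod w < 1" by (auto simp: mem_symmetric_annulus[OF rho(1)])
      define t where "t = cmod w"
      have t: "m < t" "s t < t" using w s[of t] by (auto simp: t_def)
      define M where "M = max m (s t)"
      have M: "M < x \<longleftrightarrow> m < x \<and> s t < x" for x by (auto simp: M_def)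
      define U where "U = annulus (ereal M) (1 / ereal \<rho>)"
      have U: "open U" "w \<in> U"
        unfolding U_def using open_annulus w t(2) by (auto simp: mem_symmetric_annulus[OF rho(1)] M t_def)
      have "k t nicely_meromorphic_on annulus (ereal (s t)) (1 / ereal \<rho>)"
        using k[OF t(1)] by (simp add: continues_def)
      then have "k t nicely_meromorphic_on {w}"
        by (rule nicely_meromorphic_on_subset) (use w t in \<open>auto simp: mem_symmetric_annulus[OF rho(1)] t_def\<close>)
      moreover have "\<forall>x\<in>U. g x = k t x"
        using gk[OF t(1)] by (auto simp: U_def mem_symmetric_annulus[OF rho(1)] M)
      ultimately show "\<exists>U f. open U \<and> w \<in> U \<and> f nicely_meromorphic_on {w} \<and> (\<forall>x\<in>U. g x = f x)"
        using U by blast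
    qed
    fix w assume w: "w \<in> annulus (ereal \<rho>) (1 / ereal \<rho>)"
    then have "m < cmod w" using mr by (auto simp: mem_symmetric_annulus[OF rho(1)])
    then show "g w = phi_ext L \<psi> \<phi> (\<Psi> w)" using k[of "cmod w"] w by (simp add: g_def continues_def)
  qed
  then have r: "\<mu> = m" unfolding mu_def comp_continuation_iff
    by (intro Least_equality) (use m0 lower in \<open>auto simp: S_def\<close>)
  show "0 \<le> \<mu>" "\<mu> \<le> \<rho>" using m0 mr r by auto
  show "continues \<mu> h" unfolding h_phi_def comp_continuation_iff r
    using \<open>continues m g\<close> by (rule someI[of "continues m"])
  show "\<mu> \<le> n" if "0 \<le> n" "continues n f" for n f unfolding r using lower that by (auto simp: S_def)
qed

lemma h_Psi: "\<rho> < cmod w \<Longrightarrow> cmod w < 1 \<Longrightarrow> h w = \<phi> (\<Psi> w)"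
  using h_continues phi_ext_Psi rho_mult_less[of w]
  by (auto simp: continues_def mem_symmetric_annulus[OF rho(1)])

lemma h_nice: "h nicely_meromorphic_on {w. \<mu> < cmod w \<and> \<rho> * cmod w < 1}"
proof -
  have "annulus (ereal \<mu>) (1 / ereal \<rho>) = {w. \<mu> < cmod w \<and> \<rho> * cmod w < 1}"
    by (auto simp: mem_symmetric_annulus[OF rho(1)])
  then show ?thesis using h_continues by (simp add: continues_def)
qed

text \<open>The criterion by which the lower bound in part (b) contradicts the minimality of \<open>\<mu>\<close>.\<close>

lemma mu_least_inner:
  assumes m: "0 \<le> m" "m \<le> \<mu>" and k: "k nicely_meromorphic_on {w. m < cmod w \<and> cmod w < 1}"
    and eq: "\<And>w. \<rho> < cmod w \<Longrightarrow> cmod w < 1 \<Longrightarrow> k w = h w"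
  shows "\<mu> \<le> m"
proof -
  define A where "A = {w. \<mu> < cmod w \<and> cmod w < 1}"
  have A: "open A" "connected A" unfolding A_def by (rule open_ring connected_ring)+
  have hA: "h nicely_meromorphic_on A"
    by (rule nicely_meromorphic_on_subset[OF h_nice]) (auto simp: A_def intro: rho_mult_less)
  have kA: "k nicely_meromorphic_on A"
    by (rule nicely_meromorphic_on_subset[OF k]) (use m in \<open>auto simp: A_def\<close>)
  define t where "t = (1 + \<rho>) / 2"
  have t: "\<rho> < t" "t < 1" "0 < t" using rho by (auto simp: t_def)
  have hk: "k w = h w" if "w \<in> A" for w
    by (rule nicely_meromorphic_unique[OF kA hA A open_ring(2)[of \<rho> 1]])
       (use that eq mu_le_rho t in \<open>auto simp: A_def intro!: exI[of _ "of_real t"]\<close>)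
  \<comment> \<open>\<open>k\<close> is only given below the unit circle; \<open>h\<close> supplies
    the rest of the ring up to \<open>1 / \<rho>\<close>.\<close>
  define g where "g = (\<lambda>w. if cmod w < 1 then k w else h w)"
  have "continues m g"
    unfolding continues_def
  proof (intro conjI ballI)
    show "m \<le> \<rho>" using m mu_le_rho by simp
    show "g nicely_meromorphic_on annulus (ereal m) (1 / ereal \<rho>)"
    proof (rule nicely_meromorphic_glue)
      fix w assume "w \<in> annulus (ereal m) (1 / ereal \<rho>)"
      then have w: "m < cmod w" "\<rho> * cmod w < 1" by (auto simp: mem_symmetric_annulus[OF rho(1)])
      show "\<exists>U f. open U \<and> w \<in> U \<and> f nicely_meromorphic_on {w} \<and> (\<forall>x\<in>U. g x = f x)"
      proof (cases "cmod w < 1")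
        case True
        have "k nicely_meromorphic_on {w}" by (rule nicely_meromorphic_on_subset[OF k]) (use w True in auto)
        then show ?thesis using w True open_ring(2)[of m 1]
          by (intro exI[of _ "{w. m < cmod w \<and> cmod w < 1}"] exI[of _ k]) (auto simp: g_def)
      next
        case False
        have "h nicely_meromorphic_on {w}"
          by (rule nicely_meromorphic_on_subset[OF h_nice]) (use w False mu_le_rho rho in auto)
        moreover have "g x = h x" if "\<mu> < cmod x" for x using hk[of x] that by (auto simp: g_def A_def)
        ultimately show ?thesis using False open_ring(1)[of \<mu>] mu_le_rho rho
          by (intro exI[of _ "{w. \<mu> < cmod w}"] exI[of _ h]) auto
      qed
    qed
    fix w assume w: "w \<in> annulus (ereal \<rho>) (1 / ereal \<rho>)"
    then show "g w = phi_ext L \<psi> \<phi> (\<Psi> w)"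
      using h_continues eq[of w] by (auto simp: g_def continues_def mem_symmetric_annulus[OF rho(1)])
  qed
  then show ?thesis using mu_least m by blast
qed

end

section \<open>The area inner product as a boundary integral\<close>

definition area_inner :: "complex set \<Rightarrow> complex poly \<Rightarrow> complex poly \<Rightarrow> complex" where
  "area_inner D p q = 1 / of_real pi * (LINT z:D|lborel. poly p z * cnj (poly q z))"

lemma disc_inner_cong:
  assumes "\<And>u. cmod u < 1 \<Longrightarrow> f u = f' u" "\<And>u. cmod u < 1 \<Longrightarrow> g u = g' u"
  shows "disc_inner f g = disc_inner f' g'"
  unfolding disc_inner_def using assms
  by (intro arg_cong2[of _ _ _ _ "(/)"] set_lebesgue_integral_cong) auto

lemma ball_in_open:
  assumes "open U" "cball (0::complex) 1 \<subseteq> U"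
  obtains R where "1 < R" "ball 0 R \<subseteq> U"
proof -
  obtain e where e: "e > 0" "{w. infdist w (cball (0::complex) 1) \<le> e} \<subseteq> U"
    using compact_in_open_separated[OF _ _ assms] by auto
  have "u \<in> U" if u: "cmod u < 1 + e" for u
  proof (cases "cmod u \<le> 1")
    case True then show ?thesis using assms by auto
  next
    case False
    then have u0: "u \<noteq> 0" by auto
    define x where "x = u / of_real (cmod u)"
    have x: "cmod x = 1" using u0 by (simp add: x_def norm_divide)
    have "u - x = of_real (cmod u - 1) * x" using u0 by (simp add: x_def field_simps)
    then have "cmod (u - x) = \<bar>cmod u - 1\<bar> * cmod x" by (metis norm_mult norm_of_real)
    then have "dist u x \<le> e" using u False x by (simp add: dist_norm)
    then have "infdist u (cball 0 1) \<le> e" using infdist_le[of x "cball 0 1" u] x by simp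
    then show ?thesis using e by blast
  qed
  then have "ball 0 (1 + e) \<subseteq> U" by auto
  then show thesis using e that[of "1 + e"] by simp
qed

lemma holomorphic_inverse_exists:
  assumes "f holomorphic_on S" "open S" "inj_on f S"
  shows "\<exists>g. g holomorphic_on f ` S \<and> (\<forall>z\<in>S. g (f z) = z)"
  using holomorphic_has_inverse[OF assms] by metis

context curve
begin

text \<open>\<open>h\<close> and the reflection \<open>H\<close> agree below the circle, so by the
  identity theorem on the whole ring, and \<open>h\<close> inherits every property recorded in
  \<open>circle_reflection\<close>.\<close>

lemma h_reflection:
  obtains a where "\<rho> < a" "circle_reflection a (\<lambda>w. \<phi> (\<Psi> w)) h"
proof -
  obtain a H where a: "\<rho> < a" and rfl: "circle_reflection a (\<lambda>w. \<phi> (\<Psi> w)) H"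
    using reflection_phi_Psi by blast
  define A where "A = {w. a < cmod w \<and> cmod w < 1 / a}"
  have A: "open A" "connected A" unfolding A_def by (rule open_ring connected_ring)+
  have a1: "0 < a" "a < 1" and H: "H holomorphic_on A"
    and Hv: "\<And>w. a < cmod w \<Longrightarrow> cmod w < 1 \<Longrightarrow> H w = \<phi> (\<Psi> w)"
    using rfl by (auto simp: circle_reflection_def A_def)
  have a2: "1 < 1 / a" using a1 by simp
  have sub: "\<rho> * cmod w < 1" if "cmod w < 1 / a" for w
  proof -
    have "\<rho> * cmod w \<le> a * cmod w" using a by (intro mult_right_mono) auto
    also have "\<dots> < 1" using that a1 by (simp add: field_simps)
    finally show ?thesis .
  qed
  have hA: "h nicely_meromorphic_on A"
    by (rule nicely_meromorphic_on_subset[OF h_nice]) (use a mu_le_rho sub in \<open>auto simp: A_def\<close>)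
  have HA: "H nicely_meromorphic_on A"
    using H A by (intro analytic_on_imp_nicely_meromorphic_on) (simp add: analytic_on_open)
  define t where "t = (1 + a) / 2"
  have t: "a < t" "t < 1" "0 < t" using a1 by (auto simp: t_def)
  have eq: "h w = H w" if "w \<in> A" for w
  proof (rule nicely_meromorphic_unique[OF hA HA A open_ring(2)[of a 1]])
    show "{w. a < cmod w \<and> cmod w < 1} \<subseteq> A" using a2 by (auto simp: A_def)
    show "{w. a < cmod w \<and> cmod w < 1} \<noteq> {}" using t by (auto intro!: exI[of _ "of_real t"])
    show "h x = H x" if "x \<in> {w. a < cmod w \<and> cmod w < 1}" for x
      using that h_Psi[of x] Hv[of x] a by auto
  qed (use that in auto)
  have deq: "deriv h w = deriv H w" if "w \<in> A" for w
  proof (rule deriv_cong_ev[OF _ refl])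
    show "\<forall>\<^sub>F x in nhds w. h x = H x"
      using eventually_nhds_in_open[OF A(1) that] by (rule eventually_mono) (rule eq)
  qed
  have inA: "w \<in> A" if "cmod w = 1" for w using that a1 a2 by (simp add: A_def)
  have inA': "1 / cnj w \<in> A" if "w \<in> A" for w
  proof -
    have "cmod w > 0" "a < cmod w" "cmod w * a < 1" using that a1 by (auto simp: A_def field_simps)
    then show ?thesis using a1 by (simp add: A_def norm_divide field_simps)
  qed
  have "circle_reflection a (\<lambda>w. \<phi> (\<Psi> w)) h"
    unfolding circle_reflection_def A_def[symmetric]
  proof (intro conjI allI impI)
    show "h holomorphic_on A" by (rule holomorphic_transform[OF H]) (simp add: eq)
    show "inj_on h A" using rfl eq by (auto simp: circle_reflection_def A_def[symmetric] inj_on_def)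
    show "h ` sphere 0 1 = sphere 0 1"
    proof -
      have "h ` sphere 0 1 = H ` sphere 0 1" using eq inA by (intro image_cong) auto
      then show ?thesis using rfl by (simp add: circle_reflection_def)
    qed
    fix F S assume F: "open S \<and> sphere 0 1 \<subseteq> S \<and> F holomorphic_on S"
    have "cint 1 (\<lambda>w. F (h w) * deriv h w) = cint 1 (\<lambda>w. F (H w) * deriv H w)"
      by (rule cint_cong) (use eq deq inA in auto)
    also have "\<dots> = cint 1 F" using rfl F unfolding circle_reflection_def by blast
    finally show "cint 1 (\<lambda>w. F (h w) * deriv h w) = cint 1 F" .
  next
    fix w assume w: "a < cmod w \<and> cmod w < 1 / a"
    then have wA: "w \<in> A" by (simp add: A_def)
    show "h w * cnj (h (1 / cnj w)) = 1"
      unfolding eq[OF wA] eq[OF inA'[OF wA]] using rfl w by (auto simp: circle_reflection_def)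
    show "(cmod (h w) = 1) = (cmod w = 1)" "(cmod (h w) < 1) = (cmod w < 1)"
      unfolding eq[OF wA] using rfl w by (auto simp: circle_reflection_def)
  next
    fix w assume w: "a < cmod w \<and> cmod w < 1"
    then show "h w = \<phi> (\<Psi> w)" using h_Psi a by auto
  qed (use a1 in auto)
  then show thesis using that a by blast
qed

definition "ring_radius = (SOME a. \<rho> < a \<and> circle_reflection a (\<lambda>w. \<phi> (\<Psi> w)) h)"

abbreviation "\<alpha> \<equiv> ring_radius"
abbreviation "A \<equiv> {w. \<alpha> < cmod w \<and> cmod w < 1 / \<alpha>}"

lemma alpha_raw: "\<rho> < \<alpha> \<and> circle_reflection \<alpha> (\<lambda>w. \<phi> (\<Psi> w)) h"
  unfolding ring_radius_def by (rule someI_ex) (use h_reflection in blast)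

lemma alpha: "\<rho> < \<alpha>" "0 < \<alpha>" "\<alpha> < 1" "1 < 1 / \<alpha>"
  using alpha_raw by (auto simp: circle_reflection_def)

lemma hA: "h holomorphic_on A" "inj_on h A"
  and h_norm: "\<And>w. w \<in> A \<Longrightarrow> cmod (h w) = 1 \<longleftrightarrow> cmod w = 1" "\<And>w. w \<in> A \<Longrightarrow> cmod (h w) < 1 \<longleftrightarrow> cmod w < 1"
  and h_sphere: "h ` sphere 0 1 = sphere 0 1"
  using alpha_raw by (auto simp: circle_reflection_def)

lemma h_subst:
  assumes "open S" "sphere 0 1 \<subseteq> S" "F holomorphic_on S"
  shows "cint 1 (\<lambda>w. F (h w) * deriv h w) = cint 1 F"
  using alpha_raw assms unfolding circle_reflection_def by blast

lemma A_open: "open A" by (rule open_ring)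

lemma in_A: "cmod w = 1 \<Longrightarrow> w \<in> A" "\<alpha> < cmod w \<Longrightarrow> cmod w \<le> 1 \<Longrightarrow> w \<in> A"
  using alpha by (auto intro: le_less_trans)

lemma A_rho: "w \<in> A \<Longrightarrow> \<rho> < cmod w" using alpha by auto

lemma cnj_h: assumes "cmod w = 1" shows "cnj (h w) = 1 / h w" "h w \<noteq> 0"
proof -
  have n: "cmod (h w) = 1" using h_norm(1) in_A(1)[OF assms] assms by simp
  then show "h w \<noteq> 0" by auto
  then show "cnj (h w) = 1 / h w" using n by (metis complex_norm_square nonzero_eq_divide_eq mult.commute of_real_1 power_one)
qed

text \<open>The inverse of \<open>\<phi>\<close> lives on the open disc; \<open>\<Psi>\<close>
  composed with the inverse of \<open>h\<close> agrees with it near the circle and continues it past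
  the closed disc. By the last clause, points added beyond the disc are not mapped back into
  \<open>G\<close>.\<close>

lemma inverse_map_exists:
  "\<exists>\<kappa> R. 1 < R \<and> \<kappa> holomorphic_on ball 0 R \<and> (\<forall>z\<in>G. \<kappa> (\<phi> z) = z) \<and>
     (\<forall>w\<in>A. \<kappa> (h w) = \<Psi> w) \<and> (\<forall>u. cmod u < R \<and> \<kappa> u \<in> G \<longrightarrow> cmod u < 1)"
proof -
  obtain k where k: "k holomorphic_on (ball 0 1)" "\<And>z. z \<in> G \<Longrightarrow> k (\<phi> z) = z"
    using holomorphic_inverse_exists[OF phi(1) curve_facts(4) phi(2)] unfolding phi(3) by blast
  obtain j where j: "j holomorphic_on (h ` A)" "\<And>w. w \<in> A \<Longrightarrow> j (h w) = w"
    using holomorphic_inverse_exists[OF hA(1) A_open hA(2)] by blast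
  have ohA: "open (h ` A)" using open_mapping_thm3[OF hA(1) A_open hA(2)] .
  define \<kappa> where "\<kappa> = (\<lambda>u. if cmod u < 1 then k u else \<Psi> (j u))"
  have kh: "\<kappa> (h w) = \<Psi> w" if w: "w \<in> A" for w
  proof (cases "cmod w < 1")
    case True
    then have "cmod (h w) < 1" using h_norm(2)[OF w] by simp
    moreover have "h w = \<phi> (\<Psi> w)" using h_Psi A_rho w True by auto
    moreover have "\<Psi> w \<in> G" using Psi_inside A_rho w True by auto
    ultimately show ?thesis using k(2) by (simp add: \<kappa>_def)
  next
    case False
    then show ?thesis using h_norm(2)[OF w] j(2)[OF w] by (simp add: \<kappa>_def)
  qed
  have "(\<Psi> \<circ> j) holomorphic_on (h ` A)"
    by (rule holomorphic_on_compose_gen[OF j(1) Psi(1)]) (use j(2) A_rho in auto)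
  then have h1: "\<kappa> holomorphic_on (h ` A)"
    by (rule holomorphic_transform) (use kh j(2) in auto)
  have h2: "\<kappa> holomorphic_on ball 0 1"
    by (rule holomorphic_transform[OF k(1)]) (auto simp: \<kappa>_def)
  have "\<kappa> holomorphic_on ball 0 1 \<union> h ` A"
    using h1 h2 ohA by (intro holomorphic_on_Un) auto
  moreover have sub: "cball 0 1 \<subseteq> ball 0 1 \<union> h ` A"
  proof
    fix u :: complex assume "u \<in> cball 0 1"
    then consider "cmod u < 1" | "u \<in> sphere 0 1" by fastforce
    then show "u \<in> ball 0 1 \<union> h ` A"
    proof cases
      case 2
      then have "u \<in> h ` sphere 0 1" unfolding h_sphere .
      moreover have "sphere 0 1 \<subseteq> A" using in_A(1) by auto
      ultimately show ?thesis by blast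
    qed simp
  qed
  then obtain R where R: "1 < R" "ball 0 R \<subseteq> ball 0 1 \<union> h ` A"
    using ball_in_open[OF open_Un[OF open_ball ohA] sub] by blast
  ultimately have k1: "\<kappa> holomorphic_on ball 0 R" using holomorphic_on_subset by blast
  have k2: "\<kappa> (\<phi> z) = z" if "z \<in> G" for z
  proof -
    have "cmod (\<phi> z) < 1" using phi(3) that by (metis image_eqI mem_ball_0)
    then show ?thesis using k(2) that by (simp add: \<kappa>_def)
  qed
  have k3: "cmod u < 1" if u: "cmod u < R" "\<kappa> u \<in> G" for u
  proof (rule ccontr)
    assume c: "\<not> cmod u < 1"
    then have "u \<in> h ` A" using R u by (auto simp: subset_iff)
    then obtain w where w: "w \<in> A" "u = h w" by blast
    then have "\<Psi> w \<in> G" using u kh by simp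
    then have "cmod w < 1" using Psi_inside_iff A_rho w by blast
    then show False using c w h_norm(2) by blast
  qed
  show ?thesis
  proof (rule exI[of _ \<kappa>], rule exI[of _ R], intro conjI ballI allI impI)
    show "1 < R" "\<kappa> holomorphic_on ball 0 R" by (rule R(1) k1)+
    show "\<kappa> (\<phi> z) = z" if "z \<in> G" for z using that by (rule k2)
    show "\<kappa> (h w) = \<Psi> w" if "w \<in> A" for w using that by (rule kh)
    show "cmod u < 1" if "cmod u < R \<and> \<kappa> u \<in> G" for u
      using k3[OF conjunct1[OF that] conjunct2[OF that]] .
  qed
qed

text \<open>A pair, because the map and the radius of its domain have to be chosen together.\<close>

definition "kR = (SOME x. 1 < snd x \<and> fst x holomorphic_on ball 0 (snd x) \<and> (\<forall>z\<in>G. fst x (\<phi> z) = z) \<and>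
     (\<forall>w\<in>A. fst x (h w) = \<Psi> w) \<and> (\<forall>u. cmod u < snd x \<and> fst x u \<in> G \<longrightarrow> cmod u < 1))"
abbreviation "\<kappa> \<equiv> fst kR"
abbreviation "R \<equiv> snd kR"

lemma kappa: "1 < R" "\<kappa> holomorphic_on ball 0 R" "\<And>z. z \<in> G \<Longrightarrow> \<kappa> (\<phi> z) = z"
  "\<And>w. w \<in> A \<Longrightarrow> \<kappa> (h w) = \<Psi> w" "\<And>u. cmod u < R \<Longrightarrow> \<kappa> u \<in> G \<Longrightarrow> cmod u < 1"
proof -
  have "1 < R \<and> \<kappa> holomorphic_on ball 0 R \<and> (\<forall>z\<in>G. \<kappa> (\<phi> z) = z) \<and>
     (\<forall>w\<in>A. \<kappa> (h w) = \<Psi> w) \<and> (\<forall>u. cmod u < R \<and> \<kappa> u \<in> G \<longrightarrow> cmod u < 1)"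
    unfolding kR_def by (rule someI_ex) (use inverse_map_exists in auto)
  then show "1 < R" "\<kappa> holomorphic_on ball 0 R" "\<And>z. z \<in> G \<Longrightarrow> \<kappa> (\<phi> z) = z"
  "\<And>w. w \<in> A \<Longrightarrow> \<kappa> (h w) = \<Psi> w" "\<And>u. cmod u < R \<Longrightarrow> \<kappa> u \<in> G \<Longrightarrow> cmod u < 1" by blast+
qed

lemma phi_ball: "z \<in> G \<Longrightarrow> cmod (\<phi> z) < 1"
  using phi(3) by (metis image_eqI mem_ball_0)

lemma kappa_ball: "\<kappa> ` ball 0 1 = G" "inj_on \<kappa> (ball 0 1)"
proof -
  show "\<kappa> ` ball 0 1 = G"
    unfolding phi(3)[symmetric] using kappa(3) by (auto simp: image_image)
  show "inj_on \<kappa> (ball 0 1)"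
    unfolding phi(3)[symmetric] using kappa(3) by (auto intro!: inj_onI)
qed

lemma deriv_kappa: "z \<in> G \<Longrightarrow> deriv \<kappa> (\<phi> z) * deriv \<phi> z = 1"
proof -
  assume z: "z \<in> G"
  have "(\<phi> has_field_derivative deriv \<phi> z) (at z)" using holomorphic_derivI[OF phi(1) curve_facts(4) z] .
  moreover have "(\<kappa> has_field_derivative deriv \<kappa> (\<phi> z)) (at (\<phi> z))"
    using holomorphic_derivI[OF kappa(2), of "\<phi> z"] phi_ball[OF z] kappa(1) by auto
  ultimately have 1: "((\<lambda>x. \<kappa> (\<phi> x)) has_field_derivative deriv \<kappa> (\<phi> z) * deriv \<phi> z) (at z)"
    by (intro DERIV_chain2)
  have "((\<lambda>x. x) has_field_derivative deriv \<kappa> (\<phi> z) * deriv \<phi> z) (at z)"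
    by (rule has_field_derivative_transform_within_open[OF 1 curve_facts(4) z]) (use kappa(3) in auto)
  then show ?thesis using DERIV_unique[OF _ DERIV_ident] by blast
qed

lemma deriv_phi_nonzero: "z \<in> G \<Longrightarrow> deriv \<phi> z \<noteq> 0"
  using deriv_kappa by fastforce

lemma deriv_kappa_h: assumes w: "cmod w = 1" shows "deriv \<kappa> (h w) * deriv h w = deriv \<Psi> w"
proof -
  have wA: "w \<in> A" using in_A(1)[OF w] .
  have "(h has_field_derivative deriv h w) (at w)" using holomorphic_derivI[OF hA(1) A_open wA] .
  moreover have "cmod (h w) = 1" using h_norm(1)[OF wA] w by simp
  then have "(\<kappa> has_field_derivative deriv \<kappa> (h w)) (at (h w))"
    using holomorphic_derivI[OF kappa(2), of "h w"] kappa(1) by auto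
  ultimately have 1: "((\<lambda>x. \<kappa> (h x)) has_field_derivative deriv \<kappa> (h w) * deriv h w) (at w)"
    by (intro DERIV_chain2)
  have 2: "(\<Psi> has_field_derivative deriv \<kappa> (h w) * deriv h w) (at w)"
    by (rule has_field_derivative_transform_within_open[OF 1 A_open wA]) (use kappa(4) in auto)
  then show ?thesis by (metis DERIV_imp_deriv)
qed

section \<open>Transfer of area integrals to the unit circle\<close>

definition "pull p = (\<lambda>u. poly p (\<kappa> u) * deriv \<kappa> u)"

lemma pull_holomorphic: "pull p holomorphic_on ball 0 R"
  unfolding pull_def using kappa(2) by (intro holomorphic_intros holomorphic_deriv) auto

lemma cball_R: "cball 0 1 \<subseteq> ball (0::complex) R" using kappa(1) by auto

lemma continuous_pull: "continuous_on (cball 0 1) (pull p)"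
  using holomorphic_on_imp_continuous_on[OF holomorphic_on_subset[OF pull_holomorphic cball_R]] .

lemma area_inner_pull: "area_inner G p q = disc_inner (pull p) (pull q)"
proof -
  have eq: "of_real ((cmod (deriv \<kappa> u))\<^sup>2) * (poly p (\<kappa> u) * cnj (poly q (\<kappa> u))) = pull p u * cnj (pull q u)" for u
  proof -
    have n: "of_real ((cmod (deriv \<kappa> u))\<^sup>2) = deriv \<kappa> u * cnj (deriv \<kappa> u)" by (rule complex_norm_square)
    show ?thesis unfolding n pull_def by (simp add: mult_ac)
  qed
  have "(LINT z:\<kappa> ` ball 0 1|lborel. poly p z * cnj (poly q z)) =
        (LINT u:ball 0 1|lborel. of_real ((cmod (deriv \<kappa> u))\<^sup>2) * (poly p (\<kappa> u) * cnj (poly q (\<kappa> u))))"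
  proof (rule holomorphic_change_of_variables)
    show "\<kappa> holomorphic_on ball 0 1" by (rule holomorphic_on_subset[OF kappa(2)]) (use kappa(1) in auto)
    show "set_integrable lborel (ball 0 1) (\<lambda>u. of_real ((cmod (deriv \<kappa> u))\<^sup>2) * (poly p (\<kappa> u) * cnj (poly q (\<kappa> u))))"
      unfolding eq by (intro set_integrable_ball continuous_intros continuous_pull)
  qed (auto intro!: kappa_ball continuous_intros)
  then show ?thesis unfolding eq kappa_ball(1) by (simp add: area_inner_def disc_inner_def)
qed

text \<open>The pullback of \<open>pderiv q\<close> is the derivative of
  \<open>poly q (\<kappa> u)\<close>, so \<open>disc_inner_deriv\<close> applies; substituting
  \<open>u = h w\<close> then brings back \<open>\<Psi>\<close>.\<close>

lemma area_inner_pderiv: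
  "area_inner G p (pderiv q) = cint 1 (\<lambda>w. poly p (\<Psi> w) * deriv \<Psi> w * cnj (poly q (\<Psi> w)))"
proof -
  define g where "g = (\<lambda>u. poly q (\<kappa> u))"
  have g: "g holomorphic_on ball 0 R" unfolding g_def using kappa(2) by (intro holomorphic_intros)
  have dg: "pull (pderiv q) u = deriv g u" if "u \<in> ball 0 R" for u
  proof -
    have "(\<kappa> has_field_derivative deriv \<kappa> u) (at u)" using holomorphic_derivI[OF kappa(2) _ that] by simp
    then have "(g has_field_derivative poly (pderiv q) (\<kappa> u) * deriv \<kappa> u) (at u)"
      unfolding g_def by (intro DERIV_chain2[of "poly q"] poly_DERIV)
    then show ?thesis by (simp add: pull_def DERIV_imp_deriv)
  qed
  have "area_inner G p (pderiv q) = disc_inner (pull p) (deriv g)"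
    unfolding area_inner_pull by (rule disc_inner_cong) (use dg kappa(1) in auto)
  also have "\<dots> = cint 1 (\<lambda>u. pull p u * cnj (g u))"
    by (rule disc_inner_deriv[OF pull_holomorphic g kappa(1)])
  \<comment> \<open>On the circle \<open>1 / cnj u = u\<close>. In this form the integrand is
    holomorphic near the circle, as the substitution rule demands.\<close>
  also have "\<dots> = cint 1 (\<lambda>u. pull p u * cnj (g (1 / cnj u)))"
  proof (rule cint_cong)
    fix u :: complex assume "cmod u = 1"
    then have "cnj u * u = 1" by (metis complex_norm_square mult.commute of_real_1 power_one)
    then have "1 / cnj u = u" by (metis divide_eq_eq mult_zero_left zero_neq_one mult.commute)
    then show "pull p u * cnj (g u) = pull p u * cnj (g (1 / cnj u))" by simp
  qed simp
  also have "\<dots> = cint 1 (\<lambda>w. (pull p (h w) * cnj (g (1 / cnj (h w)))) * deriv h w)"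
  proof (rule h_subst[symmetric])
    show "open {u. 1 / R < cmod u \<and> cmod u < R}" by (rule open_ring)
    show "sphere 0 1 \<subseteq> {u. 1 / R < cmod u \<and> cmod u < R}" using kappa(1) by auto
    have inv: "u \<noteq> 0 \<and> 1 / cnj u \<in> ball 0 R" if "u \<in> {u. 1 / R < cmod u \<and> cmod u < R}" for u
    proof -
      have "1 / R < cmod u" "0 < 1 / R" using that kappa(1) by auto
      then have "0 < cmod u" "1 / R < cmod u" by linarith+
      then show ?thesis using kappa(1) by (auto simp: norm_divide field_simps)
    qed
    show "(\<lambda>u. pull p u * cnj (g (1 / cnj u))) holomorphic_on {u. 1 / R < cmod u \<and> cmod u < R}"
      by (intro holomorphic_on_mult holomorphic_on_subset[OF pull_holomorphic]
           holomorphic_inversion_cnj[OF g open_ball inv]) auto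
  qed
  also have "\<dots> = cint 1 (\<lambda>w. poly p (\<Psi> w) * deriv \<Psi> w * cnj (poly q (\<Psi> w)))"
  proof (rule cint_cong)
    fix w :: complex assume w: "cmod w = 1"
    have k: "\<kappa> (h w) = \<Psi> w" using kappa(4) in_A(1)[OF w] by blast
    have "1 / cnj (h w) = h w" using cnj_h[OF w] by simp
    then show "(pull p (h w) * cnj (g (1 / cnj (h w)))) * deriv h w = poly p (\<Psi> w) * deriv \<Psi> w * cnj (poly q (\<Psi> w))"
      using deriv_kappa_h[OF w] by (simp add: pull_def g_def k mult_ac)
  qed simp
  finally show ?thesis .
qed

text \<open>Cauchy's formula for \<open>pull p\<close> at \<open>\<phi> z\<close>, moved by
  \<open>u = h w\<close>. The factor \<open>deriv \<phi> z\<close> undoes the factor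
  \<open>deriv \<kappa>\<close> in \<open>pull\<close>.\<close>

lemma poly_eq_cint:
  assumes z: "z \<in> G"
  shows "poly p z = deriv \<phi> z * cint 1 (\<lambda>w. poly p (\<Psi> w) * deriv \<Psi> w / (h w - \<phi> z))"
proof -
  define b where "b = \<phi> z"
  have b: "cmod b < 1" using phi_ball[OF z] by (simp add: b_def)
  have "cint 1 (\<lambda>w. poly p (\<Psi> w) * deriv \<Psi> w / (h w - b)) = cint 1 (\<lambda>w. (pull p (h w) / (h w - b)) * deriv h w)"
  proof (rule cint_cong)
    fix w :: complex assume w: "cmod w = 1"
    have k: "\<kappa> (h w) = \<Psi> w" using kappa(4) in_A(1)[OF w] by blast
    show "poly p (\<Psi> w) * deriv \<Psi> w / (h w - b) = (pull p (h w) / (h w - b)) * deriv h w"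
      using deriv_kappa_h[OF w] by (simp add: pull_def k mult_ac)
  qed simp
  also have "\<dots> = cint 1 (\<lambda>u. pull p u / (u - b))"
    by (rule h_subst[where S = "ball 0 R - {b}"])
       (use b kappa(1) in \<open>auto intro!: holomorphic_intros holomorphic_on_subset[OF pull_holomorphic]\<close>)
  also have "\<dots> = pull p b" by (rule cint_Cauchy[OF pull_holomorphic cball_R b])
  also have "\<dots> = poly p z * deriv \<kappa> (\<phi> z)" using kappa(3)[OF z] by (simp add: pull_def b_def)
  finally show ?thesis using deriv_kappa[OF z] by (simp add: b_def mult.commute mult.left_commute)
qed

text \<open>In the variable \<open>u = h t\<close> the kernel becomes
  \<open>deriv \<kappa> u / (\<kappa> u - z)\<close>, whose only singularity in the closed disc is a
  simple pole with residue 1 at \<open>\<phi> z\<close>.\<close>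

lemma interior_Cauchy:
  assumes z: "z \<in> G" and X: "X holomorphic_on ball 0 s" "1 < s"
  shows "cint 1 (\<lambda>t. X (h t) * (deriv \<Psi> t / (\<Psi> t - z))) = X (\<phi> z)"
proof -
  define b where "b = \<phi> z"
  have b: "cmod b < 1" using phi_ball[OF z] by (simp add: b_def)
  have kb: "\<kappa> b = z" using kappa(3)[OF z] by (simp add: b_def)
  define B where "B = ball (0::complex) (min s R)"
  have B: "open B" "b \<in> B" "cball 0 1 \<subseteq> B" using b X(2) kappa(1) by (auto simp: B_def)
  have kB: "\<kappa> holomorphic_on B" by (rule holomorphic_on_subset[OF kappa(2)]) (auto simp: B_def)
  define D where "D = (\<lambda>u. if u = b then deriv \<kappa> b else (\<kappa> u - \<kappa> b) / (u - b))"
  have D: "D holomorphic_on B" unfolding D_def by (rule pole_lemma_open[OF kB B(1)])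
  have ne: "\<kappa> u \<noteq> z" if "u \<in> B" "u \<noteq> b" for u
  proof
    assume e: "\<kappa> u = z"
    then have "cmod u < 1" using kappa(5)[of u] that z by (auto simp: B_def)
    then show False using inj_onD[OF kappa_ball(2), of u b] e kb b that by auto
  qed
  have Db: "deriv \<kappa> b \<noteq> 0" using deriv_kappa[OF z] by (auto simp: b_def)
  have D0: "D u \<noteq> 0" if "u \<in> B" for u using ne[OF that] Db kb by (auto simp: D_def)
  \<comment> \<open>Dividing by the zero-free difference quotient \<open>D\<close> leaves a plain
    Cauchy kernel.\<close>
  define Y where "Y = (\<lambda>u. X u * deriv \<kappa> u / D u)"
  have Y: "Y holomorphic_on B" unfolding Y_def
    using D0 D B(1) kB X by (intro holomorphic_intros holomorphic_deriv holomorphic_on_subset[OF X(1)]) (auto simp: B_def)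
  have "cint 1 (\<lambda>t. X (h t) * (deriv \<Psi> t / (\<Psi> t - z))) = cint 1 (\<lambda>t. (Y (h t) / (h t - b)) * deriv h t)"
  proof (rule cint_cong)
    fix w :: complex assume w: "cmod w = 1"
    have k: "\<kappa> (h w) = \<Psi> w" using kappa(4) in_A(1)[OF w] by blast
    have "cmod (h w) = 1" using h_norm(1) in_A(1)[OF w] w by simp
    then have "h w \<noteq> b" using b by auto
    then show "X (h w) * (deriv \<Psi> w / (\<Psi> w - z)) = (Y (h w) / (h w - b)) * deriv h w"
      using deriv_kappa_h[OF w] kb by (simp add: Y_def D_def k mult_ac)
  qed simp
  also have "\<dots> = cint 1 (\<lambda>u. Y u / (u - b))"
    by (rule h_subst[where S = "B - {b}"])
       (use b B in \<open>auto intro!: holomorphic_intros holomorphic_on_subset[OF Y]\<close>)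
  also have "\<dots> = Y b" by (rule cint_Cauchy[OF Y B(3) b])
  also have "\<dots> = X b" using Db by (simp add: Y_def D_def)
  finally show ?thesis by (simp add: b_def)
qed

text \<open>The Taylor coefficients of \<open>pull p\<close> are at most \<open>sqrt (k + 1)\<close>
  by \<open>disc_inner_coeff_le\<close>, and \<open>\<phi>\<close> maps \<open>K\<close> into a
  smaller disc, so the power series is bounded independently of \<open>p\<close>.\<close>

lemma pointwise_bound:
  assumes K: "compact K" "K \<subseteq> G"
  obtains C where "\<And>p z. area_inner G p p = 1 \<Longrightarrow> z \<in> K \<Longrightarrow> cmod (poly p z) \<le> C"
proof (cases "K = {}")
  case True then show thesis using that by blast
next
  case False
  have cphi: "continuous_on K \<phi>" "continuous_on K (deriv \<phi>)"
    using K(2) phi(1) curve_facts(4)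
    by (auto intro!: continuous_on_subset[OF holomorphic_on_imp_continuous_on[OF phi(1)]]
         continuous_on_subset[OF holomorphic_on_imp_continuous_on[OF holomorphic_deriv[OF phi(1)]]])
  obtain z0 where z0: "z0 \<in> K" "\<And>z. z \<in> K \<Longrightarrow> cmod (\<phi> z) \<le> cmod (\<phi> z0)"
    using continuous_attains_sup[OF K(1) False, of "\<lambda>z. cmod (\<phi> z)"] cphi by (auto intro: continuous_intros)
  obtain z1 where z1: "z1 \<in> K" "\<And>z. z \<in> K \<Longrightarrow> cmod (deriv \<phi> z) \<le> cmod (deriv \<phi> z1)"
    using continuous_attains_sup[OF K(1) False, of "\<lambda>z. cmod (deriv \<phi> z)"] cphi by (auto intro: continuous_intros)
  define s where "s = cmod (\<phi> z0)"
  have s: "0 \<le> s" "s < 1" using phi_ball z0 K by (auto simp: s_def)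
  have sm: "summable (\<lambda>k. (real k + 1) * s ^ k)"
    using geometric_deriv_sums[of s] s by (auto simp: sums_iff add.commute)
  define C where "C = (\<Sum>k. (real k + 1) * s ^ k) * cmod (deriv \<phi> z1)"
  show thesis
  proof (rule that[of C])
    fix p z assume p: "area_inner G p p = 1" and z: "z \<in> K"
    have zG: "z \<in> G" using z K by blast
    define b where "b = \<phi> z"
    have b: "cmod b \<le> s" using z0(2)[OF z] by (simp add: b_def s_def)
    define c where "c = (\<lambda>k. (deriv ^^ k) (pull p) 0 / fact k)"
    have ck: "cmod (c k) \<le> real k + 1" for k
    proof -
      have "(cmod (c k))\<^sup>2 / (k + 1) \<le> Re (disc_inner (pull p) (pull p))"
        unfolding c_def by (rule disc_inner_coeff_le[OF pull_holomorphic kappa(1)])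
      then have "(cmod (c k))\<^sup>2 \<le> real k + 1" using p by (simp add: area_inner_pull field_simps)
      also have "\<dots> \<le> (real k + 1)\<^sup>2" by (simp add: power2_eq_square)
      finally show ?thesis by (rule power2_le_imp_le) simp
    qed
    have "(\<lambda>k. c k * (b - 0) ^ k) sums pull p b"
      unfolding c_def by (rule holomorphic_power_series[OF pull_holomorphic]) (use b s kappa(1) in auto)
    then have sums: "(\<lambda>k. c k * b ^ k) sums pull p b" by simp
    have le: "cmod (c k * b ^ k) \<le> (real k + 1) * s ^ k" for k
      unfolding norm_mult norm_power using ck b by (intro mult_mono power_mono) auto
    have "cmod (pull p b) \<le> (\<Sum>k. (real k + 1) * s ^ k)"
      unfolding sums_unique[OF sums] by (rule norm_suminf_le[OF le sm])
    moreover have "poly p z = pull p b * deriv \<phi> z"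
      using deriv_kappa[OF zG] kappa(3)[OF zG] by (simp add: pull_def b_def mult.assoc)
    ultimately show "cmod (poly p z) \<le> C"
      unfolding C_def using z1(2)[OF z] by (simp add: norm_mult mult_mono')
  qed
qed

end

section \<open>Faber polynomials\<close>

text \<open>The inversion \<open>x = 1 / w\<close> turns a zero at infinity into a removable
  singularity at 0.\<close>

lemma expansion_at_infinity:
  assumes k: "k holomorphic_on {w. b < cmod w}" and lim: "(k \<longlongrightarrow> 0) at_infinity"
  shows "\<exists>K r. 0 < r \<and> K holomorphic_on ball 0 r \<and> K 0 = 0 \<and> (\<forall>w. 1 / r < cmod w \<longrightarrow> k w = K (1 / w))"
proof -
  define r where "r = 1 / max b 1"
  have r: "0 < r" "1 / r = max b 1" by (auto simp: r_def)
  have far: "b < cmod (1 / x)" if "x \<in> ball 0 r - {0}" for x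
  proof -
    have "cmod x > 0" "cmod x < r" using that by auto
    then have "1 / r < 1 / cmod x" using r by (intro divide_strict_left_mono) auto
    then show ?thesis using r by (simp add: norm_divide)
  qed
  define K where "K = (\<lambda>x. if x = 0 then 0 else k (1 / x))"
  have "(k \<circ> (\<lambda>x. 1 / x)) holomorphic_on ball 0 r - {0}"
    by (rule holomorphic_on_compose_gen[OF _ k]) (use far in \<open>auto intro!: holomorphic_intros\<close>)
  then have h1: "(\<lambda>x. k (1 / x)) holomorphic_on ball 0 r - {0}" by (simp add: o_def)
  have l0: "((\<lambda>x. k (1 / x)) \<longlongrightarrow> 0) (at 0)"
    using lim unfolding lim_at_infinity_0 by (simp add: o_def inverse_eq_divide)
  have "K holomorphic_on ball 0 r"
    unfolding K_def by (rule removable_singularity[OF h1 _ l0]) simp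
  moreover have "k w = K (1 / w)" if "1 / r < cmod w" for w
  proof -
    have "w \<noteq> 0" using that r by auto
    then show ?thesis by (simp add: K_def)
  qed
  moreover have "K 0 = 0" by (simp add: K_def)
  ultimately show ?thesis using r(1) by blast
qed

lemma tendsto_inverse_at_infinity: "((\<lambda>w::complex. 1 / w) \<longlongrightarrow> 0) at_infinity"
  unfolding inverse_eq_divide[symmetric] by (rule tendsto_inverse_0)

lemma filterlim_inverse_at0: "filterlim (\<lambda>w::complex. 1 / w) (at 0) at_infinity"
  unfolding filterlim_at using tendsto_inverse_at_infinity
  by (auto simp: eventually_at_infinity intro!: exI[of _ 1])

lemma eventually_norm_gt: "\<forall>\<^sub>F w in at_infinity. b < cmod (w::complex)"
  unfolding eventually_at_infinity by (rule exI[of _ "b + 1"]) auto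

lemma decay_at_infinity:
  assumes k: "k holomorphic_on {w. b < cmod w}" and lim: "(k \<longlongrightarrow> 0) at_infinity"
  obtains l where "((\<lambda>w. w * k w) \<longlongrightarrow> l) at_infinity"
proof -
  obtain K r where K: "0 < r" "K holomorphic_on ball 0 r" "K 0 = 0" "\<And>w. 1 / r < cmod w \<Longrightarrow> k w = K (1 / w)"
    using expansion_at_infinity[OF assms] by blast
  have "(K has_field_derivative deriv K 0) (at 0)"
    using holomorphic_derivI[OF K(2)] K(1) by auto
  then have "((\<lambda>x. K x / x) \<longlongrightarrow> deriv K 0) (at 0)"
    using K(3) by (simp add: has_field_derivative_iff)
  from filterlim_compose[OF this filterlim_inverse_at0]
  have 1: "((\<lambda>w. K (1 / w) / (1 / w)) \<longlongrightarrow> deriv K 0) at_infinity" .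
  have "((\<lambda>w. w * k w) \<longlongrightarrow> deriv K 0) at_infinity"
    by (rule Lim_transform_eventually[OF 1], rule eventually_mono[OF eventually_norm_gt[of "1 / r"]])
       (simp add: K(4))
  then show thesis by (rule that)
qed

lemma deriv_decay_at_infinity:
  assumes k: "k holomorphic_on {w. b < cmod w}" and lim: "(k \<longlongrightarrow> 0) at_infinity"
  shows "(deriv k \<longlongrightarrow> 0) at_infinity"
proof -
  obtain K r where K: "0 < r" "K holomorphic_on ball 0 r" "K 0 = 0" "\<And>w. 1 / r < cmod w \<Longrightarrow> k w = K (1 / w)"
    using expansion_at_infinity[OF assms] by blast
  have D: "deriv k w = deriv K (1 / w) * (- (1 / w) * (1 / w))" if w: "1 / r < cmod w" for w
  proof -
    have "0 < 1 / r" using K(1) by simp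
    then have "cmod w > 0" using w by linarith
    then have w0: "w \<noteq> 0" by simp
    have "cmod (1 / w) < r" using w \<open>cmod w > 0\<close> K(1) by (simp add: norm_divide field_simps)
    then have d: "(K has_field_derivative deriv K (1 / w)) (at (1 / w))"
      using holomorphic_derivI[OF K(2), of "1 / w"] by auto
    have "((\<lambda>w. 1 / w) has_field_derivative - (1 / w) * (1 / w)) (at w)"
      using w0 by (auto intro!: derivative_eq_intros simp: power2_eq_square)
    from DERIV_chain2[OF d this]
    have 1: "((\<lambda>x. K (1 / x)) has_field_derivative deriv K (1 / w) * (- (1 / w) * (1 / w))) (at w)" .
    have "(k has_field_derivative deriv K (1 / w) * (- (1 / w) * (1 / w))) (at w)"
      by (rule has_field_derivative_transform_within_open[OF 1 open_ring(1)[of "1 / r"]]) (use w K(4) in auto)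
    then show ?thesis by (rule DERIV_imp_deriv)
  qed
  have "isCont (deriv K) 0"
    using holomorphic_on_imp_continuous_on[OF holomorphic_deriv[OF K(2)]] K(1)
    by (simp add: continuous_on_eq_continuous_at)
  then have 1: "((\<lambda>w. deriv K (1 / w)) \<longlongrightarrow> deriv K 0) at_infinity"
    by (rule isCont_tendsto_compose[OF _ tendsto_inverse_at_infinity])
  have "((\<lambda>w. deriv K (1 / w) * (- (1 / w) * (1 / w))) \<longlongrightarrow> deriv K 0 * (- 0 * 0)) at_infinity"
    by (intro tendsto_mult tendsto_minus 1 tendsto_inverse_at_infinity)
  then have 2: "((\<lambda>w. deriv K (1 / w) * (- (1 / w) * (1 / w))) \<longlongrightarrow> 0) at_infinity" by simp
  show ?thesis
    by (rule Lim_transform_eventually[OF 2], rule eventually_mono[OF eventually_norm_gt[of "1 / r"]])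
       (simp add: D)
qed

lemma cint_derivative:
  assumes "\<And>x. cmod x = r \<Longrightarrow> (f has_field_derivative f' x) (at x)" "0 < r"
  shows "cint r f' = 0"
proof -
  have "(f' has_contour_integral (f (pathfinish (circlepath 0 r)) - f (pathstart (circlepath 0 r)))) (circlepath 0 r)"
    by (rule contour_integral_primitive[of "sphere 0 r"])
       (use assms in \<open>auto intro: has_field_derivative_at_within\<close>)
  then show ?thesis by (simp add: cint_def contour_integral_unique)
qed

lemma poly_antiderivative: "\<exists>Q. pderiv Q = (p :: complex poly)"
proof
  have ps: "pderiv (sum f A) = (\<Sum>x\<in>A. pderiv (f x))" for f :: "nat \<Rightarrow> complex poly" and A
    using higher_pderiv_sum[of 1 f A] by simp
  show "pderiv (\<Sum>i\<le>degree p. monom (coeff p i / of_nat (Suc i)) (Suc i)) = p"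

    by (simp add: ps pderiv_monom poly_as_sum_of_monoms del: of_nat_Suc)
qed

context curve
begin

section \<open>Normalisation at infinity and construction of the Faber polynomials\<close>

lemma capacity_exists: "\<exists>c::real. c > 0 \<and> ((\<lambda>w. \<Psi> w / w) \<longlongrightarrow> of_real c) at_infinity"
proof -
  obtain c :: real where c: "c > 0" "((\<lambda>w. \<psi> w / w) \<longlongrightarrow> of_real c) at_infinity"
    using ext by (auto simp: exterior_map_def)
  have "((\<lambda>w. \<Psi> w / w) \<longlongrightarrow> of_real c) at_infinity"
    by (rule Lim_transform_eventually[OF c(2)], rule eventually_mono[OF eventually_norm_gt[of 1]])
       (simp add: Psi(3))
  then show ?thesis using c by blast
qed

text \<open>The derivative of \<open>\<psi>\<close> at infinity, i.e. the logarithmic capacity of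
  \<open>L\<close>.\<close>

definition "cap = (SOME c::real. c > 0 \<and> ((\<lambda>w. \<Psi> w / w) \<longlongrightarrow> of_real c) at_infinity)"

lemma cap: "cap > 0" "((\<lambda>w. \<Psi> w / w) \<longlongrightarrow> of_real cap) at_infinity"
  unfolding cap_def using someI_ex[OF capacity_exists] by auto

text \<open>Splitting off the linear part of \<open>\<Psi>\<close> at infinity leaves a holomorphic
  function \<open>E\<close> that vanishes there, and its derivative decays by
  \<open>deriv_decay_at_infinity\<close>.\<close>

lemma deriv_Psi_lim: "(deriv \<Psi> \<longlongrightarrow> of_real cap) at_infinity"
proof -
  have k: "(\<lambda>w. \<Psi> w / w - of_real cap) holomorphic_on {w. \<rho> < cmod w}"
    using rho by (intro holomorphic_intros Psi) auto
  have "((\<lambda>w. \<Psi> w / w - of_real cap) \<longlongrightarrow> 0) at_infinity"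
    using tendsto_diff[OF cap(2) tendsto_const[of "of_real cap"]] by simp
  then obtain l where l: "((\<lambda>w. w * (\<Psi> w / w - of_real cap)) \<longlongrightarrow> l) at_infinity"
    using decay_at_infinity[OF k] by blast
  define E where "E = (\<lambda>w. \<Psi> w - of_real cap * w - l)"
  have E: "E holomorphic_on {w. \<rho> < cmod w}" unfolding E_def by (intro holomorphic_intros Psi)
  have l': "((\<lambda>w. w * (\<Psi> w / w - of_real cap) - l) \<longlongrightarrow> 0) at_infinity"
    using tendsto_diff[OF l tendsto_const[of l]] by simp
  have "(E \<longlongrightarrow> 0) at_infinity"
    by (rule Lim_transform_eventually[OF l'], rule eventually_mono[OF eventually_norm_gt[of 0]])
       (auto simp: E_def algebra_simps)
  then have dE: "(deriv E \<longlongrightarrow> 0) at_infinity" by (rule deriv_decay_at_infinity[OF E])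
  have "deriv E w = deriv \<Psi> w - of_real cap" if "\<rho> < cmod w" for w
  proof -
    have "(\<Psi> has_field_derivative deriv \<Psi> w) (at w)"
      using holomorphic_derivI[OF Psi(1) open_ring(1)] that by auto
    then have "(E has_field_derivative deriv \<Psi> w - of_real cap) (at w)"
      unfolding E_def by (auto intro!: derivative_eq_intros)
    then show ?thesis by (rule DERIV_imp_deriv)
  qed
  then have ev: "\<forall>\<^sub>F w in at_infinity. deriv E w + of_real cap = deriv \<Psi> w"
    using eventually_norm_gt[of \<rho>] by (auto elim: eventually_mono)
  have "((\<lambda>w. deriv E w + of_real cap) \<longlongrightarrow> 0 + of_real cap) at_infinity" by (intro tendsto_intros dE)
  then show ?thesis using Lim_transform_eventually[OF _ ev] by simp
qed

text \<open>The generating function of the Faber polynomials: \<open>ker z t = (\<Sum>m. F\<^sub>m(z) / t^(m+1))\<close>.\<close>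

definition "ker z t = deriv \<Psi> t / (\<Psi> t - z)"

lemma ker_lim: "((\<lambda>t. t * ker z t) \<longlongrightarrow> 1) at_infinity"
proof -
  have "((\<lambda>t. deriv \<Psi> t / (\<Psi> t / t - z * (1 / t))) \<longlongrightarrow> of_real cap / (of_real cap - z * 0)) at_infinity"
    using cap by (intro tendsto_intros deriv_Psi_lim tendsto_inverse_at_infinity) auto
  then have 1: "((\<lambda>t. deriv \<Psi> t / (\<Psi> t / t - z * (1 / t))) \<longlongrightarrow> 1) at_infinity" using cap by simp
  show ?thesis
  proof (rule Lim_transform_eventually[OF 1], rule eventually_mono[OF eventually_norm_gt[of 0]])
    fix t :: complex assume "0 < cmod t"
    then show "deriv \<Psi> t / (\<Psi> t / t - z * (1 / t)) = t * ker z t"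
      by (simp add: ker_def diff_divide_distrib[symmetric])
  qed
qed

lemma deriv_Psi_holomorphic: "deriv \<Psi> holomorphic_on {w. \<rho> < cmod w}"
  by (intro holomorphic_deriv Psi open_ring)

lemma ker_holomorphic:
  assumes "\<rho> \<le> b" "\<And>t. b < cmod t \<Longrightarrow> t \<in> S \<Longrightarrow> \<Psi> t \<noteq> z"
  shows "ker z holomorphic_on ({t. b < cmod t} \<inter> S)"
  unfolding ker_def using assms
  by (intro holomorphic_intros holomorphic_on_subset[OF deriv_Psi_holomorphic] holomorphic_on_subset[OF Psi(1)]) auto

text \<open>Powers of \<open>\<Psi>\<close> have poles of the same orders at infinity as powers of
  \<open>w\<close>, so the principal part of \<open>g\<close> is removed from the top;
  \<open>decay_at_infinity\<close> provides the next coefficient \<open>l\<close>. The top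
  coefficient is recorded because \<open>d_diagonal\<close> compares leading coefficients.\<close>

lemma polynomial_part:
  assumes g: "g holomorphic_on {w. 1 < cmod w}" and lim: "((\<lambda>w. g w / w ^ m) \<longlongrightarrow> a) at_infinity"
  shows "\<exists>Q. degree Q \<le> m \<and> coeff Q m = a / of_real cap ^ m \<and> ((\<lambda>w. g w - poly Q (\<Psi> w)) \<longlongrightarrow> 0) at_infinity"
  using assms
proof (induction m arbitrary: g a)
  case 0
  have "((\<lambda>w. g w - a) \<longlongrightarrow> a - a) at_infinity" using 0 by (intro tendsto_diff) auto
  then show ?case by (intro exI[of _ "[:a:]"]) simp
next
  case (Suc m)
  define q where "q = a / of_real cap ^ Suc m"
  define g1 where "g1 = (\<lambda>w. g w - q * \<Psi> w ^ Suc m)"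
  have P1: "\<Psi> holomorphic_on {w. 1 < cmod w}" by (rule holomorphic_on_subset[OF Psi(1)]) (use rho in auto)
  have g1: "g1 holomorphic_on {w. 1 < cmod w}" unfolding g1_def by (intro holomorphic_intros Suc.prems P1)
  have k: "(\<lambda>w. g1 w / w ^ Suc m) holomorphic_on {w. 1 < cmod w}" by (intro holomorphic_intros g1) auto
  have "((\<lambda>w. g w / w ^ Suc m - q * (\<Psi> w / w) ^ Suc m) \<longlongrightarrow> a - q * of_real cap ^ Suc m) at_infinity"
    by (intro tendsto_intros Suc.prems cap)
  then have "((\<lambda>w. g1 w / w ^ Suc m) \<longlongrightarrow> 0) at_infinity"
    using cap(1) by (simp add: g1_def q_def diff_divide_distrib power_divide del: power_Suc)
  then obtain l where l: "((\<lambda>w. w * (g1 w / w ^ Suc m)) \<longlongrightarrow> l) at_infinity"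
    using decay_at_infinity[OF k] by blast
  have "((\<lambda>w. g1 w / w ^ m) \<longlongrightarrow> l) at_infinity"
    by (rule Lim_transform_eventually[OF l], rule eventually_mono[OF eventually_norm_gt[of 0]]) auto
  from Suc.IH[OF g1 this] obtain Q where Q: "degree Q \<le> m" "((\<lambda>w. g1 w - poly Q (\<Psi> w)) \<longlongrightarrow> 0) at_infinity"
    by blast
  show ?case
  proof (intro exI[of _ "monom q (Suc m) + Q"] conjI)
    show "degree (monom q (Suc m) + Q) \<le> Suc m"
      using Q(1) by (intro degree_add_le degree_monom_le) auto
    show "coeff (monom q (Suc m) + Q) (Suc m) = a / of_real cap ^ Suc m"
      using Q(1) by (simp add: q_def coeff_eq_0)
    show "((\<lambda>w. g w - poly (monom q (Suc m) + Q) (\<Psi> w)) \<longlongrightarrow> 0) at_infinity"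
      using Q(2) by (simp add: g1_def poly_monom algebra_simps)
  qed
qed

lemma faber_exists:
  "\<exists>Q. degree Q = m \<and> lead_coeff Q = 1 / of_real cap ^ m \<and> ((\<lambda>w. poly Q (\<Psi> w) - w ^ m) \<longlongrightarrow> 0) at_infinity"
proof -
  have 1: "((\<lambda>w. w ^ m / w ^ m) \<longlongrightarrow> (1::complex)) at_infinity"
    by (rule Lim_transform_eventually[OF tendsto_const], rule eventually_mono[OF eventually_norm_gt[of 0]]) auto
  obtain Q where Q: "degree Q \<le> m" "coeff Q m = 1 / of_real cap ^ m" "((\<lambda>w. w ^ m - poly Q (\<Psi> w)) \<longlongrightarrow> 0) at_infinity"
  proof -
    have hol: "(\<lambda>w::complex. w ^ m) holomorphic_on {w. 1 < cmod w}" by (intro holomorphic_intros)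
    show ?thesis using polynomial_part[OF hol 1] that by blast
  qed
  have "coeff Q m \<noteq> 0" using Q(2) cap(1) by simp
  then have "degree Q = m" using Q(1) le_degree by (metis le_antisym)
  moreover have "((\<lambda>w. poly Q (\<Psi> w) - w ^ m) \<longlongrightarrow> 0) at_infinity"
    using tendsto_minus[OF Q(3)] by simp
  ultimately show ?thesis using Q(2) by blast
qed

definition "faber m = (SOME Q. degree Q = m \<and> lead_coeff Q = 1 / of_real cap ^ m \<and>
   ((\<lambda>w. poly Q (\<Psi> w) - w ^ m) \<longlongrightarrow> 0) at_infinity)"

lemma faber: "degree (faber m) = m" "lead_coeff (faber m) = 1 / of_real cap ^ m"
    "((\<lambda>w. poly (faber m) (\<Psi> w) - w ^ m) \<longlongrightarrow> 0) at_infinity"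
  unfolding faber_def using someI_ex[OF faber_exists[of m]] by auto

text \<open>Dividing the Faber polynomial by the linear factor at \<open>z\<close> gives three
  integrals: its value at \<open>z\<close> times \<open>ker\<close>, which has integral 1; a
  derivative, which has integral 0; and the remainder \<open>Rm\<close> times \<open>ker\<close>,
  which decays too fast at infinity to contribute.\<close>

lemma faber_eq_cint:
  assumes b: "\<rho> \<le> b" "b < s" and ne: "\<And>t. b < cmod t \<Longrightarrow> \<Psi> t \<noteq> z"
  shows "poly (faber m) z = cint s (\<lambda>t. t ^ m * ker z t)"
proof -
  have s0: "0 < s" using b rho by linarith
  have kh: "ker z holomorphic_on {t. b < cmod t}" using ker_holomorphic[of b UNIV z] b ne by simp
  have Ph: "\<Psi> holomorphic_on {t. b < cmod t}" by (rule holomorphic_on_subset[OF Psi(1)]) (use b in auto)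
  have cont: "continuous_on (sphere 0 s) f" if "f holomorphic_on {t. b < cmod t}" for f
    by (rule continuous_on_subset[OF holomorphic_on_imp_continuous_on[OF that]]) (use b in auto)
  define Rm where "Rm = (\<lambda>t. poly (faber m) (\<Psi> t) - t ^ m)"
  have Rm: "Rm holomorphic_on {t. b < cmod t}" unfolding Rm_def by (intro holomorphic_intros Ph)
  obtain Q where Q: "faber m = [:poly (faber m) z:] + [:-z, 1:] * Q"
  proof -
    have "poly (faber m - [:poly (faber m) z:]) z = 0" by simp
    then obtain Q where "faber m - [:poly (faber m) z:] = [:-z, 1:] * Q"
      using poly_eq_0_iff_dvd unfolding dvd_def by blast
    then show ?thesis using that by (metis diff_eq_eq add.commute)
  qed
  obtain P where P: "pderiv P = Q" using poly_antiderivative by blast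
  have R0: "cint s (\<lambda>t. Rm t * ker z t) = 0"
  proof (rule cint_at_infinity[of _ b])
    have "((\<lambda>t. Rm t * (t * ker z t)) \<longlongrightarrow> 0 * 1) at_infinity"
      using faber(3)[of m] unfolding Rm_def by (intro tendsto_mult ker_lim)
    then show "((\<lambda>t. t * (Rm t * ker z t)) \<longlongrightarrow> 0) at_infinity" by (simp add: mult_ac)
  qed (use b s0 Rm kh in \<open>auto intro!: holomorphic_intros\<close>)
  have k1: "cint s (ker z) = 1"
    by (rule cint_at_infinity[OF kh b(2) s0 ker_lim])
  have Q0: "cint s (\<lambda>t. poly Q (\<Psi> t) * deriv \<Psi> t) = 0"
  proof (rule cint_derivative[OF _ s0])
    fix x assume "cmod x = s"
    then have "(\<Psi> has_field_derivative deriv \<Psi> x) (at x)"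
      using holomorphic_derivI[OF Psi(1) open_ring(1)] b by auto
    then show "((\<lambda>t. poly P (\<Psi> t)) has_field_derivative poly Q (\<Psi> x) * deriv \<Psi> x) (at x)"
      unfolding P[symmetric] by (intro DERIV_chain2[of "poly P"] poly_DERIV)
  qed
  have "cint s (\<lambda>t. t ^ m * ker z t) = cint s (\<lambda>t. (poly Q (\<Psi> t) * deriv \<Psi> t + poly (faber m) z * ker z t) - Rm t * ker z t)"
  proof (rule cint_cong)
    fix t assume t: "cmod t = s"
    have "\<Psi> t - z \<noteq> 0" using ne[of t] b t by simp
    then have e: "(\<Psi> t - z) * ker z t = deriv \<Psi> t" by (simp add: ker_def)
    have E: "poly (faber m) (\<Psi> t) = poly (faber m) z + (\<Psi> t - z) * poly Q (\<Psi> t)"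
      by (subst Q) (simp add: algebra_simps)
    have "poly (faber m) (\<Psi> t) * ker z t = poly (faber m) z * ker z t + poly Q (\<Psi> t) * ((\<Psi> t - z) * ker z t)"
      unfolding E by (simp add: algebra_simps)
    then show "t ^ m * ker z t = (poly Q (\<Psi> t) * deriv \<Psi> t + poly (faber m) z * ker z t) - Rm t * ker z t"
      unfolding e by (simp add: Rm_def algebra_simps)
  qed (rule s0)
  also have "\<dots> = cint s (\<lambda>t. poly Q (\<Psi> t) * deriv \<Psi> t + poly (faber m) z * ker z t) - cint s (\<lambda>t. Rm t * ker z t)"
    using Ph kh Rm by (intro cint_diff cont s0 holomorphic_intros holomorphic_deriv open_ring)
  also have "cint s (\<lambda>t. poly Q (\<Psi> t) * deriv \<Psi> t + poly (faber m) z * ker z t)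
      = cint s (\<lambda>t. poly Q (\<Psi> t) * deriv \<Psi> t) + cint s (\<lambda>t. poly (faber m) z * ker z t)"
    using Ph kh Rm by (intro cint_add cont s0 holomorphic_intros holomorphic_deriv open_ring)
  also have "cint s (\<lambda>t. poly (faber m) z * ker z t) = poly (faber m) z * cint s (ker z)"
    by (intro cint_cmult cont kh s0)
  finally show ?thesis using R0 k1 Q0 by simp
qed

lemma deriv_Psi_nonzero: "\<rho> < cmod w \<Longrightarrow> deriv \<Psi> w \<noteq> 0"
  using holomorphic_injective_imp_regular[OF Psi(1) open_ring(1) Psi(2)] by auto

lemma Psi_eq_iff: "\<rho> < cmod t \<Longrightarrow> \<rho> < cmod w \<Longrightarrow> \<Psi> t = \<Psi> w \<longleftrightarrow> t = w"
  using inj_onD[OF Psi(2)] by auto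

text \<open>As a function of \<open>t\<close> the integrand has a simple pole at
  \<open>t = w\<close> with residue \<open>w ^ m\<close>, so integrals over circles outside and
  inside \<open>|w|\<close> differ by it; the outer one is the Faber polynomial at
  \<open>\<Psi> w\<close>.\<close>

lemma faber_remainder:
  assumes r: "\<rho> < r" "r < cmod w"
  shows "poly (faber m) (\<Psi> w) - w ^ m = cint r (\<lambda>t. t ^ m * ker (\<Psi> w) t)"
proof -
  define S where "S = {t. \<rho> < cmod t}"
  have S: "open S" "w \<in> S" unfolding S_def using open_ring r by auto
  define D where "D = (\<lambda>t. if t = w then deriv \<Psi> w else (\<Psi> t - \<Psi> w) / (t - w))"
  have D: "D holomorphic_on S" unfolding D_def by (rule pole_lemma_open[OF Psi(1)[folded S_def] S(1)])
  have D0: "D t \<noteq> 0" if "t \<in> S" for t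
    using that S(2) deriv_Psi_nonzero[of w] Psi_eq_iff[of t w] by (auto simp: D_def S_def)
  define f where "f = (\<lambda>t. t ^ m * (deriv \<Psi> t / D t))"
  have fS: "f holomorphic_on S" unfolding f_def
    using D0 by (intro holomorphic_intros deriv_Psi_holomorphic[folded S_def] D)
  have fw: "f w = w ^ m" using deriv_Psi_nonzero[of w] r by (simp add: f_def D_def)
  have fk: "f t / (t - w) = t ^ m * ker (\<Psi> w) t" if "t \<noteq> w" for t
    using that by (simp add: f_def D_def ker_def)
  define s where "s = cmod w + 1"
  have "f w = cint s (\<lambda>t. f t / (t - w)) - cint r (\<lambda>t. f t / (t - w))"
    by (rule cint_annulus_Cauchy[of f \<rho> "s + 1" r w s])
       (use r rho in \<open>auto simp: s_def S_def intro!: holomorphic_on_subset[OF fS]\<close>)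
  also have "cint s (\<lambda>t. f t / (t - w)) = cint s (\<lambda>t. t ^ m * ker (\<Psi> w) t)"
    by (rule cint_cong, rule fk) (use r rho in \<open>auto simp: s_def add_nonneg_pos\<close>)
  also have "\<dots> = poly (faber m) (\<Psi> w)"
    by (rule faber_eq_cint[symmetric, of "cmod w"]) (use r Psi_eq_iff[of _ w] in \<open>force simp: s_def\<close>)+
  also have "cint r (\<lambda>t. f t / (t - w)) = cint r (\<lambda>t. t ^ m * ker (\<Psi> w) t)"
    by (rule cint_cong, rule fk) (use r rho in auto)
  finally show ?thesis using fw by simp
qed

lemma ker_continuous_bounded:
  assumes K: "compact K" and r: "\<rho> < r" and ne: "\<And>z t. z \<in> K \<Longrightarrow> cmod t = r \<Longrightarrow> \<Psi> t \<noteq> z"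
  obtains B where "0 \<le> B" "\<And>z t. z \<in> K \<Longrightarrow> cmod t = r \<Longrightarrow> cmod (ker z t) \<le> B"
proof -
  have cP: "continuous_on (sphere 0 r) \<Psi>" "continuous_on (sphere 0 r) (deriv \<Psi>)"
    using r by (auto intro!: continuous_on_subset[OF holomorphic_on_imp_continuous_on[OF Psi(1)]]
       continuous_on_subset[OF holomorphic_on_imp_continuous_on[OF deriv_Psi_holomorphic]])
  have "continuous_on (K \<times> sphere 0 r) (\<lambda>x. deriv \<Psi> (snd x) / (\<Psi> (snd x) - fst x))"
    by (intro continuous_intros continuous_on_compose2[OF cP(1)] continuous_on_compose2[OF cP(2)]) (use ne in auto)
  then have "bounded ((\<lambda>x. deriv \<Psi> (snd x) / (\<Psi> (snd x) - fst x)) ` (K \<times> sphere 0 r))"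
    by (intro compact_imp_bounded compact_continuous_image compact_Times K compact_sphere)
  then obtain B where B: "B > 0" "\<And>x. x \<in> (\<lambda>x. deriv \<Psi> (snd x) / (\<Psi> (snd x) - fst x)) ` (K \<times> sphere 0 r) \<Longrightarrow> cmod x \<le> B"
    unfolding bounded_pos by blast
  show thesis
  proof (rule that[of B])
    fix z t assume "z \<in> K" "cmod t = r"
    then show "cmod (ker z t) \<le> B"
      using B(2)[of "ker z t"] by (force simp: ker_def)
  qed (use B in auto)
qed

text \<open>The base \<open>r\<close> can be any number between \<open>\<rho>\<close> and
  \<open>r'\<close>, in particular one below 1 while \<open>r'\<close> is above 1; this is the
  source of the exponential estimates for \<open>d\<close>.\<close>

lemma faber_remainder_bound:
  assumes r: "\<rho> < r" "r < r'"
  obtains C where "0 \<le> C" "\<And>m w. cmod w = r' \<Longrightarrow> cmod (poly (faber m) (\<Psi> w) - w ^ m) \<le> C * r ^ m"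
proof -
  have r0: "0 < r" using r rho by linarith
  have "continuous_on (sphere 0 r') \<Psi>"
    by (rule continuous_on_subset[OF holomorphic_on_imp_continuous_on[OF Psi(1)]]) (use r in auto)
  then have K: "compact (\<Psi> ` sphere 0 r')" by (rule compact_continuous_image) simp
  have ne: "\<Psi> t \<noteq> z" if "z \<in> \<Psi> ` sphere 0 r'" "cmod t = r" for z t
    using that r Psi_eq_iff by auto
  obtain B where B: "0 \<le> B" "\<And>z t. z \<in> \<Psi> ` sphere 0 r' \<Longrightarrow> cmod t = r \<Longrightarrow> cmod (ker z t) \<le> B"
    using ker_continuous_bounded[OF K r(1) ne] by blast
  show thesis
  proof (rule that[of "B * r"])
    show "0 \<le> B * r" using B r0 by simp
    fix m w assume w: "cmod w = r'"
    have "cmod (cint r (\<lambda>t. t ^ m * ker (\<Psi> w) t)) \<le> (r ^ m * B) * r"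
    proof (rule cint_bound[OF _ r0])
      have "ker (\<Psi> w) holomorphic_on ({t. \<rho> < cmod t} \<inter> {t. t \<noteq> w})"
        by (rule ker_holomorphic) (use r w Psi_eq_iff in auto)
      then show "continuous_on (sphere 0 r) (\<lambda>t. t ^ m * ker (\<Psi> w) t)"
        by (intro continuous_intros continuous_on_subset[OF holomorphic_on_imp_continuous_on]) (use r w in auto)
      fix t assume t: "cmod t = r"
      then show "cmod (t ^ m * ker (\<Psi> w) t) \<le> r ^ m * B"
        using B(2)[of "\<Psi> w" t] w r0 by (auto simp: norm_mult norm_power intro!: mult_left_mono)
    qed
    then show "cmod (poly (faber m) (\<Psi> w) - w ^ m) \<le> B * r * r ^ m"
      using faber_remainder[of r w m] r w by (simp add: mult_ac)
  qed
qed

end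

text \<open>The geometric series of \<open>1 / (w - t)\<close> in powers of \<open>t / w\<close>,
  integrated term by term.\<close>

lemma cint_geometric:
  assumes f: "continuous_on (sphere 0 r) f" and r: "0 < r" "r < cmod w"
  shows "(\<lambda>m. cint r (\<lambda>t. t ^ m * f t) / w ^ Suc m) sums (- cint r (\<lambda>t. f t / (t - w)))"
proof -
  have w0: "w \<noteq> 0" using r by auto
  have "bounded (f ` sphere 0 r)" by (intro compact_imp_bounded compact_continuous_image f compact_sphere)
  then obtain B where B: "\<And>t. cmod t = r \<Longrightarrow> cmod (f t) \<le> B"
    unfolding bounded_iff by (metis image_eqI mem_sphere_0)
  have "(\<lambda>m. cint r (\<lambda>t. (1 / w ^ Suc m) * (t ^ m * f t))) sums cint r (\<lambda>t. \<Sum>m. (1 / w ^ Suc m) * (t ^ m * f t))"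
  proof (rule cint_suminf[OF _ _ _ r(1)])
    show "continuous_on (sphere 0 r) (\<lambda>t. (1 / w ^ Suc m) * (t ^ m * f t))" for m
      using w0 by (intro continuous_intros f) auto
    show "cmod ((1 / w ^ Suc m) * (t ^ m * f t)) \<le> B / cmod w * (r / cmod w) ^ m" if t: "cmod t = r" for m t
    proof -
      have "cmod ((1 / w ^ Suc m) * (t ^ m * f t)) = cmod (f t) / cmod w * (r / cmod w) ^ m"
        using t by (simp add: norm_mult norm_divide norm_power power_divide)
      also have "\<dots> \<le> B / cmod w * (r / cmod w) ^ m"
        using B[OF t] r by (intro mult_right_mono divide_right_mono) auto
      finally show ?thesis .
    qed
    show "summable (\<lambda>m. B / cmod w * (r / cmod w) ^ m)"
      by (intro summable_mult summable_geometric) (use r w0 in \<open>simp add: divide_less_eq\<close>)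
  qed
  also have "(\<lambda>m. cint r (\<lambda>t. (1 / w ^ Suc m) * (t ^ m * f t))) = (\<lambda>m. cint r (\<lambda>t. t ^ m * f t) / w ^ Suc m)"
    by (intro ext, subst cint_cmult) (use f r in \<open>auto intro!: continuous_intros\<close>)
  also have "cint r (\<lambda>t. \<Sum>m. (1 / w ^ Suc m) * (t ^ m * f t)) = cint r (\<lambda>t. (-1) * (f t / (t - w)))"
  proof (rule cint_cong[OF _ r(1)])
    fix t assume t: "cmod t = r"
    have tw: "t \<noteq> w" using t r by auto
    have "cmod (t / w) < 1" using t r w0 by (simp add: norm_divide)
    then have "(\<lambda>m. (f t / w) * (t / w) ^ m) sums ((f t / w) * (1 / (1 - t / w)))"
      by (intro sums_mult geometric_sums) auto
    also have "(f t / w) * (1 / (1 - t / w)) = (-1) * (f t / (t - w))"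
      using tw w0 by (simp add: divide_simps) (simp add: algebra_simps)
    also have "(\<lambda>m. (f t / w) * (t / w) ^ m) = (\<lambda>m. (1 / w ^ Suc m) * (t ^ m * f t))"
      by (simp add: fun_eq_iff power_divide)
    finally show "(\<Sum>m. (1 / w ^ Suc m) * (t ^ m * f t)) = (-1) * (f t / (t - w))" by (rule sums_unique[symmetric])
  qed
  also have "\<dots> = - cint r (\<lambda>t. f t / (t - w))"
    by (subst cint_cmult) (use f r in \<open>auto intro!: continuous_intros\<close>)
  finally show ?thesis .
qed

section \<open>Faber expansion of the Cauchy kernel\<close>

context curve
begin

text \<open>\<open>ker z\<close> is its own negative Laurent part: in the Cauchy formula the outer
  circle contributes nothing, because \<open>ker z x / (x - t)\<close> decays like
  \<open>1 / x ^ 2\<close>. The Laurent coefficients are then given by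
  \<open>faber_eq_cint\<close>.\<close>

lemma ker_expansion:
  assumes ne: "\<And>t. 1 < cmod t \<Longrightarrow> \<Psi> t \<noteq> z" and t: "1 < cmod t"
  shows "(\<lambda>m. poly (faber m) z / t ^ Suc m) sums ker z t"
proof -
  define r where "r = (1 + cmod t) / 2"
  define s where "s = cmod t + 1"
  have r: "1 < r" "r < cmod t" using t by (auto simp: r_def)
  have kh: "ker z holomorphic_on {t. 1 < cmod t}" using ker_holomorphic[of 1 UNIV z] ne rho by simp
  have "ker z t = cint s (\<lambda>x. ker z x / (x - t)) - cint r (\<lambda>x. ker z x / (x - t))"
    by (rule cint_annulus_Cauchy[of _ 1 "s + 1"])
       (use r in \<open>auto simp: s_def intro: holomorphic_on_subset[OF kh]\<close>)
  also have "cint s (\<lambda>x. ker z x / (x - t)) = 0"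
  proof (rule cint_at_infinity[of _ "cmod t"])
    show "(\<lambda>x. ker z x / (x - t)) holomorphic_on {x. cmod t < cmod x}"
      by (intro holomorphic_intros holomorphic_on_subset[OF kh]) (use t in auto)
    have "((\<lambda>x. (x * ker z x) * (1 / x * (1 / (1 - t * (1 / x))))) \<longlongrightarrow> 1 * (0 * (1 / (1 - t * 0)))) at_infinity"
      by (intro tendsto_intros ker_lim tendsto_inverse_at_infinity) auto
    then have 1: "((\<lambda>x. (x * ker z x) * (1 / x * (1 / (1 - t * (1 / x))))) \<longlongrightarrow> 0) at_infinity" by simp
    show "((\<lambda>x. x * (ker z x / (x - t))) \<longlongrightarrow> 0) at_infinity"
    proof (rule Lim_transform_eventually[OF 1], rule eventually_mono[OF eventually_norm_gt[of "cmod t"]])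
      fix x assume x: "cmod t < cmod x"
      have x0: "x \<noteq> 0" "x \<noteq> t" using x t by auto
      then have "1 / x * (1 / (1 - t * (1 / x))) = 1 / (x - t)" by (simp add: divide_simps)
      then show "(x * ker z x) * (1 / x * (1 / (1 - t * (1 / x)))) = x * (ker z x / (x - t))" by simp
    qed
  qed (use t in \<open>auto simp: s_def add_pos_pos\<close>)
  finally have "ker z t = - cint r (\<lambda>x. ker z x / (x - t))" by simp
  moreover have "(\<lambda>m. cint r (\<lambda>x. x ^ m * ker z x) / t ^ Suc m) sums (- cint r (\<lambda>x. ker z x / (x - t)))"
    by (rule cint_geometric)
       (use r in \<open>auto intro!: continuous_on_subset[OF holomorphic_on_imp_continuous_on[OF kh]]\<close>)
  moreover have "cint r (\<lambda>x. x ^ m * ker z x) = poly (faber m) z" for m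
    by (rule faber_eq_cint[symmetric, of 1]) (use r ne rho in auto)
  ultimately show ?thesis by simp
qed

definition "clG = G \<union> L"

lemma clG: "compact clG" "\<And>z t. z \<in> clG \<Longrightarrow> 1 < cmod t \<Longrightarrow> \<Psi> t \<noteq> z"
proof -
  have "clG = closure G" using curve_facts(9) closure_Un_frontier[of G] by (simp add: clG_def)
  then show "compact clG" using curve_facts(6) by simp
  show "\<Psi> t \<noteq> z" if "z \<in> clG" "1 < cmod t" for z t
  proof
    assume "\<Psi> t = z"
    then have "z \<in> outside L" using that(2) Psi_outside by blast
    then show False using that(1) sides unfolding clG_def by blast
  qed
qed

text \<open>Needed to carry an integral representation from \<open>G\<close> to its boundary. The
  difference of two kernels is \<open>z - z'\<close> times their product divided by
  \<open>deriv \<Psi>\<close>, which gives a Lipschitz bound.\<close>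

lemma ker_integral_continuous:
  assumes s: "1 < s" and Y: "continuous_on (sphere 0 s) Y"
  shows "continuous_on clG (\<lambda>z. cint s (\<lambda>t. Y t * ker z t))"
proof -
  have s0: "0 < s" "\<rho> < s" using s rho by auto
  obtain B where B: "0 \<le> B" "\<And>z t. z \<in> clG \<Longrightarrow> cmod t = s \<Longrightarrow> cmod (ker z t) \<le> B"
    using ker_continuous_bounded[OF clG(1) s0(2)] clG(2) s by metis
  have cd: "continuous_on (sphere 0 s) (\<lambda>t. Y t / deriv \<Psi> t)"
    using s0 deriv_Psi_nonzero
    by (intro continuous_intros Y continuous_on_subset[OF holomorphic_on_imp_continuous_on[OF deriv_Psi_holomorphic]]) auto
  then have "bounded ((\<lambda>t. Y t / deriv \<Psi> t) ` sphere 0 s)"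
    by (intro compact_imp_bounded compact_continuous_image compact_sphere)
  then obtain C where C: "C > 0" "\<And>t. cmod t = s \<Longrightarrow> cmod (Y t / deriv \<Psi> t) \<le> C"
    unfolding bounded_pos by (metis image_eqI mem_sphere_0)
  have ck: "continuous_on (sphere 0 s) (ker z)" if "z \<in> clG" for z
  proof -
    have "ker z holomorphic_on {t. 1 < cmod t}" using ker_holomorphic[of 1 UNIV z] clG(2)[OF that] rho by simp
    then show ?thesis by (rule continuous_on_subset[OF holomorphic_on_imp_continuous_on]) (use s in auto)
  qed
  have lip: "dist (cint s (\<lambda>t. Y t * ker z t)) (cint s (\<lambda>t. Y t * ker z' t)) \<le> (C * B * B * s) * dist z z'"
    if z: "z \<in> clG" "z' \<in> clG" for z z'
  proof -
    have "cint s (\<lambda>t. Y t * ker z t) - cint s (\<lambda>t. Y t * ker z' t) = cint s (\<lambda>t. Y t * ker z t - Y t * ker z' t)"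
      by (rule cint_diff[symmetric]) (use s0 Y ck z in \<open>auto intro!: continuous_intros\<close>)
    also have "cmod \<dots> \<le> (C * B * B * dist z z') * s"
    proof (rule cint_bound[OF _ s0(1)])
      fix t assume t: "cmod t = s"
      have n: "\<Psi> t \<noteq> z" "\<Psi> t \<noteq> z'" "deriv \<Psi> t \<noteq> 0" using clG(2) z t s deriv_Psi_nonzero[of t] s0 by auto
      have "Y t * ker z t - Y t * ker z' t = (z - z') * (Y t / deriv \<Psi> t * (ker z t * ker z' t))"
        using n by (simp add: ker_def divide_simps) (simp add: algebra_simps)
      also have "cmod \<dots> \<le> dist z z' * (C * (B * B))"
        unfolding norm_mult dist_norm using C(2)[OF t] B(2)[OF z(1) t] B(2)[OF z(2) t] B(1) C(1)
        by (intro mult_left_mono mult_mono) (auto simp: norm_divide)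
      finally show "cmod (Y t * ker z t - Y t * ker z' t) \<le> C * B * B * dist z z'" by (simp add: mult_ac)
    qed (use Y ck z in \<open>auto intro!: continuous_intros\<close>)
    finally show ?thesis by (simp add: dist_norm mult_ac)
  qed
  have "(C * B * B * s)-lipschitz_on clG (\<lambda>z. cint s (\<lambda>t. Y t * ker z t))"
    by (rule lipschitz_onI) (use lip B C s0 in auto)
  then show ?thesis by (rule lipschitz_on_continuous_on)
qed

lemma faber_bound_clG:
  assumes r: "1 < r"
  obtains C where "0 \<le> C" "\<And>z m. z \<in> clG \<Longrightarrow> cmod (poly (faber m) z) \<le> C * r ^ m"
proof -
  obtain B where B: "0 \<le> B" "\<And>z t. z \<in> clG \<Longrightarrow> cmod t = r \<Longrightarrow> cmod (ker z t) \<le> B"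
    using ker_continuous_bounded[OF clG(1), of r] clG(2) r rho by (metis less_trans)
  show thesis
  proof (rule that[of "B * r"])
    show "0 \<le> B * r" using B r by simp
    fix z m assume z: "z \<in> clG"
    have kh: "ker z holomorphic_on {t. 1 < cmod t}" using ker_holomorphic[of 1 UNIV z] clG(2)[OF z] rho by simp
    have "poly (faber m) z = cint r (\<lambda>t. t ^ m * ker z t)"
      by (rule faber_eq_cint[of 1]) (use r clG(2)[OF z] rho in auto)
    also have "cmod \<dots> \<le> (r ^ m * B) * r"
    proof (rule cint_bound)
      show "continuous_on (sphere 0 r) (\<lambda>t. t ^ m * ker z t)"
        by (intro continuous_intros continuous_on_subset[OF holomorphic_on_imp_continuous_on[OF kh]]) (use r in auto)
      show "cmod (t ^ m * ker z t) \<le> r ^ m * B" if "cmod t = r" for t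
        using B(2)[OF z that] that r by (auto simp: norm_mult norm_power intro!: mult_left_mono)
    qed (use r in auto)
    finally show "cmod (poly (faber m) z) \<le> B * r * r ^ m" by (simp add: mult_ac)
  qed
qed

text \<open>On the unit circle the conjugate of \<open>X b (h w)\<close> is \<open>1 / (h w - b)\<close>.\<close>

definition "X b u = u / (1 - u * cnj b)"
text \<open>The Faber coefficients of the function \<open>X b (\<phi> z)\<close> on
  \<open>G\<close>.\<close>

definition "x_coeff b m = cint 1 (\<lambda>t. X b (h t) / t ^ Suc m)"

text \<open>The radius \<open>2 / (1 + |b|)\<close> lies between 1 and \<open>1 / |b|\<close>, the
  modulus of the pole of \<open>X b\<close>.\<close>

lemma X_holomorphic:
  assumes "cmod b < 1" shows "X b holomorphic_on ball 0 (2 / (1 + cmod b))" "1 < 2 / (1 + cmod b)"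
proof -
  have p: "1 + cmod b > 0" by (simp add: add_pos_nonneg)
  show "1 < 2 / (1 + cmod b)" using assms p by (simp add: field_simps)
  have "1 - u * cnj b \<noteq> 0" if "u \<in> ball 0 (2 / (1 + cmod b))" for u
  proof
    assume "1 - u * cnj b = 0"
    then have "cmod (u * cnj b) = 1" by (metis eq_iff_diff_eq_0 norm_one)
    then have "cmod u * cmod b = 1" by (simp add: norm_mult)
    moreover have "cmod u * cmod b \<le> 2 / (1 + cmod b) * cmod b" using that by (intro mult_right_mono) auto
    moreover have "2 / (1 + cmod b) * cmod b < 1" using assms p by (simp add: field_simps)
    ultimately show False by linarith
  qed
  then show "X b holomorphic_on ball 0 (2 / (1 + cmod b))"
    unfolding X_def by (intro holomorphic_intros) auto
qed

text \<open>A Faber series converging up to the boundary. \<open>interior_Cauchy\<close> represents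
  \<open>X b (h w)\<close> for \<open>w\<close> just inside the circle, continuity extends the
  formula to the circle itself, and \<open>ker_expansion\<close> expands the kernel. The geometric
  majorant allows termwise integration later.\<close>

lemma X_expansion:
  assumes b: "cmod b < 1"
  shows "\<exists>C q. 0 \<le> q \<and> q < 1 \<and>
    (\<forall>w. cmod w = 1 \<longrightarrow> (\<lambda>m. x_coeff b m * poly (faber m) (\<Psi> w)) sums X b (h w) \<and>
        (\<forall>m. cmod (x_coeff b m * poly (faber m) (\<Psi> w)) \<le> C * q ^ m))"
proof -
  define s0 where "s0 = 2 / (1 + cmod b)"
  have Xh: "X b holomorphic_on ball 0 s0" and s0: "1 < s0" using X_holomorphic[OF b] by (auto simp: s0_def)
  have oAh: "open (A \<inter> h -` ball 0 s0)"
    by (rule continuous_open_preimage[OF holomorphic_on_imp_continuous_on[OF hA(1)] A_open open_ball])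
  have sAh: "sphere 0 1 \<subseteq> A \<inter> h -` ball 0 s0"
  proof
    fix w :: complex assume w: "w \<in> sphere 0 1"
    then have wA: "w \<in> A" using in_A(1) by auto
    have "cmod (h w) = 1" using h_norm(1)[OF wA] w by simp
    then show "w \<in> A \<inter> h -` ball 0 s0" using wA s0 by auto
  qed
  obtain a where a: "0 < a" "a < 1" and asub: "{w. a < cmod w \<and> cmod w < 1 / a} \<subseteq> A \<inter> h -` ball 0 s0"
    using ring_in_open[OF oAh sAh] by blast
  define S where "S = {w. a < cmod w \<and> cmod w < 1 / a}"
  have S: "open S" unfolding S_def by (rule open_ring)
  have SA: "w \<in> A" "cmod (h w) < s0" if "w \<in> S" for w using asub that by (auto simp: S_def)
  have a1: "1 < 1 / a" using a by simp
  define Y where "Y = (\<lambda>t. X b (h t))"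
  have "(X b \<circ> h) holomorphic_on S"
    by (rule holomorphic_on_compose_gen[OF holomorphic_on_subset[OF hA(1)] Xh]) (use SA in auto)
  then have Yh: "Y holomorphic_on S" by (simp add: Y_def o_def)
  \<comment> \<open>\<open>s\<close> is the radius of the contour and \<open>1 < r < s\<close>: the
    coefficients are \<open>O(1 / s ^ m)\<close> and the Faber polynomials \<open>O(r ^ m)\<close>,
    so the terms decay like \<open>(r / s) ^ m\<close>.\<close>
  define s where "s = (1 + 1 / a) / 2"
  define r where "r = (1 + s) / 2"
  have mid: "1 < (1 + x) / 2 \<and> (1 + x) / 2 < x" if "1 < x" for x :: real using that by auto
  have s: "1 < s" "s < 1 / a" using mid[OF a1] unfolding s_def by blast+
  have r: "1 < r" "r < s" using s by (auto simp: r_def)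
  have sS: "w \<in> S" if "1 \<le> cmod w" "cmod w \<le> s" for w using that s a by (auto simp: S_def)
  have Yc: "continuous_on (sphere 0 s) Y"
    by (rule continuous_on_subset[OF holomorphic_on_imp_continuous_on[OF Yh]]) (use sS s in auto)
  have inner: "Y w = cint s (\<lambda>t. Y t * ker (\<Psi> w) t)" if w: "w \<in> S" "cmod w < 1" for w
  proof -
    have wr: "\<rho> < cmod w" using SA(1)[OF w(1)] alpha by auto
    have z: "\<Psi> w \<in> G" using Psi_inside wr w by auto
    have "Y w = X b (\<phi> (\<Psi> w))" using h_Psi wr w by (simp add: Y_def)
    also have "\<dots> = cint 1 (\<lambda>t. Y t * ker (\<Psi> w) t)"
      using interior_Cauchy[OF z Xh s0] by (simp add: Y_def ker_def)
    also have "\<dots> = cint s (\<lambda>t. Y t * ker (\<Psi> w) t)"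
    proof (rule cint_eq[symmetric])
      show "open (S \<inter> {t. cmod w < cmod t})" by (intro open_Int S open_ring)
      have "ker (\<Psi> w) holomorphic_on ({t. cmod w < cmod t} \<inter> UNIV)"
        by (rule ker_holomorphic) (use wr Psi_eq_iff in auto)
      then show "(\<lambda>t. Y t * ker (\<Psi> w) t) holomorphic_on (S \<inter> {t. cmod w < cmod t})"
        by (intro holomorphic_intros holomorphic_on_subset[OF Yh]) (auto intro: holomorphic_on_subset)
    qed (use s sS w in auto)
    finally show ?thesis .
  qed
  have bdry: "Y w = cint s (\<lambda>t. Y t * ker (\<Psi> w) t)" if w: "cmod w = 1" for w
  proof -
    have wA: "w \<in> S" using sS w s by auto
    have near: "\<forall>\<^sub>F t in at_left 1. a < t \<and> t < (1::real)"
      by (subst eventually_at_left[of a]) (use a in auto)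
    have in_S: "of_real t * w \<in> S \<and> cmod (of_real t * w) < 1" if "a < t" "t < 1" for t :: real
      using that w a by (auto simp: S_def norm_mult intro: less_trans[OF _ a1])
    have cY: "isCont Y (of_real 1 * w)"
      using holomorphic_on_imp_continuous_on[OF Yh] S wA by (simp add: continuous_on_eq_continuous_at)
    have "((\<lambda>t. Y (of_real t * w)) \<longlongrightarrow> Y (of_real 1 * w)) (at_left 1)"
      by (intro isCont_tendsto_compose[OF cY] tendsto_intros)
    then have L1: "((\<lambda>t. Y (of_real t * w)) \<longlongrightarrow> Y w) (at_left 1)" by simp
    have "((\<lambda>t. \<Psi> (of_real t * w)) \<longlongrightarrow> \<Psi> (of_real 1 * w)) (at_left 1)"
      by (intro isCont_tendsto_compose[OF isCont_Psi] tendsto_intros) (use w rho in auto)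
    then have P: "((\<lambda>t. \<Psi> (of_real t * w)) \<longlongrightarrow> \<Psi> w) (at_left 1)" by simp
    \<comment> \<open>\<open>\<Psi> w\<close> lies on \<open>L\<close>; the representation reaches
      it along a radius, from points of \<open>G\<close>.\<close>
    have "((\<lambda>u. cint s (\<lambda>t. Y t * ker (\<Psi> (of_real u * w)) t)) \<longlongrightarrow> cint s (\<lambda>t. Y t * ker (\<Psi> w) t)) (at_left 1)"
    proof (rule continuous_on_tendsto_compose[OF ker_integral_continuous[OF s(1) Yc] P])
      show "\<Psi> w \<in> clG" using w Psi_sphere by (auto simp: clG_def)
      show "\<forall>\<^sub>F u in at_left 1. \<Psi> (of_real u * w) \<in> clG"
        using near
      proof (rule eventually_mono)
        fix t assume "a < t \<and> t < 1"
        then have "of_real t * w \<in> S" "cmod (of_real t * w) < 1" using in_S by auto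
        then have "\<Psi> (of_real t * w) \<in> G" using Psi_inside SA(1) alpha by force
        then show "\<Psi> (of_real t * w) \<in> clG" by (simp add: clG_def)
      qed
    qed
    moreover have "\<forall>\<^sub>F u in at_left 1. cint s (\<lambda>t. Y t * ker (\<Psi> (of_real u * w)) t) = Y (of_real u * w)"
      using near by (rule eventually_mono) (use inner in_S in auto)
    ultimately have "((\<lambda>t. Y (of_real t * w)) \<longlongrightarrow> cint s (\<lambda>t. Y t * ker (\<Psi> w) t)) (at_left 1)"
      by (rule Lim_transform_eventually)
    then show ?thesis using L1 tendsto_unique trivial_limit_at_left_real by blast
  qed
  have "bounded (Y ` sphere 0 s)" by (intro compact_imp_bounded compact_continuous_image Yc compact_sphere)
  then obtain BY where BY: "BY > 0" "\<And>t. cmod t = s \<Longrightarrow> cmod (Y t) \<le> BY"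
    unfolding bounded_pos by (metis image_eqI mem_sphere_0)
  obtain C1 where C1: "0 \<le> C1" "\<And>z m. z \<in> clG \<Longrightarrow> cmod (poly (faber m) z) \<le> C1 * r ^ m"
    using faber_bound_clG[OF r(1)] by blast
  have x_eq: "x_coeff b m = cint s (\<lambda>t. Y t / t ^ Suc m)" for m
  proof -
    have "(\<lambda>t. Y t / t ^ Suc m) holomorphic_on S"
      using Yh a by (intro holomorphic_intros) (auto simp: S_def)
    from cint_eq[OF S this, of 1 s] show ?thesis using s sS by (simp add: x_coeff_def Y_def)
  qed
  have x_le: "cmod (x_coeff b m) \<le> BY / s ^ m" for m
  proof -
    have "cmod (cint s (\<lambda>t. Y t / t ^ Suc m)) \<le> (BY / s ^ Suc m) * s"
    proof (rule cint_bound)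
      show "continuous_on (sphere 0 s) (\<lambda>t. Y t / t ^ Suc m)" using s by (intro continuous_intros Yc) auto
      show "cmod (Y t / t ^ Suc m) \<le> BY / s ^ Suc m" if "cmod t = s" for t
        using BY(2)[OF that] that s by (auto simp: norm_divide norm_power norm_mult intro!: divide_right_mono)
    qed (use s in auto)
    then show ?thesis unfolding x_eq using s by simp
  qed
  have "(\<lambda>m. x_coeff b m * poly (faber m) (\<Psi> w)) sums X b (h w) \<and>
        (\<forall>m. cmod (x_coeff b m * poly (faber m) (\<Psi> w)) \<le> (BY * C1) * (r / s) ^ m)" if w: "cmod w = 1" for w
  proof
    have z: "\<Psi> w \<in> clG" using w Psi_sphere by (auto simp: clG_def)
    have "(\<lambda>m. cint s (\<lambda>t. Y t * (poly (faber m) (\<Psi> w) / t ^ Suc m))) sums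
          cint s (\<lambda>t. \<Sum>m. Y t * (poly (faber m) (\<Psi> w) / t ^ Suc m))"
    proof (rule cint_suminf)
      show "continuous_on (sphere 0 s) (\<lambda>t. Y t * (poly (faber m) (\<Psi> w) / t ^ Suc m))" for m
        using s by (intro continuous_intros Yc) auto
      show "cmod (Y t * (poly (faber m) (\<Psi> w) / t ^ Suc m)) \<le> (BY * C1) * (r / s) ^ m" if t: "cmod t = s" for m t
      proof -
        have "cmod (Y t * (poly (faber m) (\<Psi> w) / t ^ Suc m)) = cmod (Y t) * (cmod (poly (faber m) (\<Psi> w)) / s ^ Suc m)"
          using t by (simp add: norm_mult norm_divide norm_power)
        also have "\<dots> \<le> BY * (C1 * r ^ m / s ^ m)"
          using BY t C1(2)[OF z, of m] s C1(1) r
          by (intro mult_mono frac_le power_increasing) auto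
        finally show ?thesis by (simp add: power_divide)
      qed
      show "summable (\<lambda>m. (BY * C1) * (r / s) ^ m)"
        by (intro summable_mult summable_geometric) (use r s in auto)
    qed (use s in auto)
    also have "cint s (\<lambda>t. \<Sum>m. Y t * (poly (faber m) (\<Psi> w) / t ^ Suc m)) = cint s (\<lambda>t. Y t * ker (\<Psi> w) t)"
    proof (rule cint_cong)
      fix t assume t: "cmod t = s"
      have "(\<lambda>m. Y t * (poly (faber m) (\<Psi> w) / t ^ Suc m)) sums (Y t * ker (\<Psi> w) t)"
        by (intro sums_mult ker_expansion) (use t s clG(2)[OF z] in auto)
      then show "(\<Sum>m. Y t * (poly (faber m) (\<Psi> w) / t ^ Suc m)) = Y t * ker (\<Psi> w) t"
        by (rule sums_unique[symmetric])
    qed (use s in auto)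
    also have "\<dots> = X b (h w)" using bdry[OF w] by (simp add: Y_def)
    also have "(\<lambda>m. cint s (\<lambda>t. Y t * (poly (faber m) (\<Psi> w) / t ^ Suc m))) = (\<lambda>m. x_coeff b m * poly (faber m) (\<Psi> w))"
    proof
      fix m
      have "cint s (\<lambda>t. Y t * (poly (faber m) (\<Psi> w) / t ^ Suc m)) = cint s (\<lambda>t. poly (faber m) (\<Psi> w) * (Y t / t ^ Suc m))"
        by (simp add: mult_ac)
      also have "\<dots> = poly (faber m) (\<Psi> w) * cint s (\<lambda>t. Y t / t ^ Suc m)"
        by (rule cint_cmult) (use s in \<open>auto intro!: continuous_intros Yc\<close>)
      finally show "cint s (\<lambda>t. Y t * (poly (faber m) (\<Psi> w) / t ^ Suc m)) = x_coeff b m * poly (faber m) (\<Psi> w)"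
        unfolding x_eq by (simp only: mult.commute)
    qed
    finally show "(\<lambda>m. x_coeff b m * poly (faber m) (\<Psi> w)) sums X b (h w)" .
    show "\<forall>m. cmod (x_coeff b m * poly (faber m) (\<Psi> w)) \<le> (BY * C1) * (r / s) ^ m"
    proof
      fix m
      have "cmod (x_coeff b m * poly (faber m) (\<Psi> w)) \<le> (BY / s ^ m) * (C1 * r ^ m)"
        unfolding norm_mult using x_le[of m] C1(2)[OF z, of m] BY s by (intro mult_mono) auto
      then show "cmod (x_coeff b m * poly (faber m) (\<Psi> w)) \<le> (BY * C1) * (r / s) ^ m"
        by (simp add: power_divide)
    qed
  qed
  moreover have "0 \<le> r / s" "r / s < 1" using r s by auto
  ultimately show ?thesis by blast
qed

definition "e_coeff z j = cint 1 (\<lambda>w. w ^ j / (h w - \<phi> z))"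

lemma cnj_X: assumes "cmod w = 1" "cmod b < 1" shows "cnj (X b (h w)) = 1 / (h w - b)"
proof -
  have n: "cmod (h w) = 1" using h_norm(1) in_A(1)[OF assms(1)] assms(1) by simp
  then have "h w \<noteq> b" using assms(2) by auto
  then have "h w - b \<noteq> 0" by simp
  have "cnj (X b (h w)) = (1 / h w) / (1 - (1 / h w) * b)"
    unfolding X_def by (simp only: complex_cnj_divide complex_cnj_diff complex_cnj_one
        complex_cnj_mult complex_cnj_cnj cnj_h(1)[OF assms(1)])
  also have "1 - (1 / h w) * b = (h w - b) / h w" using cnj_h(2)[OF assms(1)] by (simp add: field_simps)
  finally show ?thesis using cnj_h(2)[OF assms(1)] by simp
qed

text \<open>Origin of the shift from \<open>Suc j\<close> to \<open>j\<close>: conjugation turns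
  \<open>1 / w ^ (j + 2)\<close> into \<open>w ^ (j + 2)\<close>, and \<open>cnj_cint\<close>
  contributes \<open>1 / w\<^sup>2\<close>.\<close>

lemma cnj_x_coeff: assumes "z \<in> G" shows "cnj (x_coeff (\<phi> z) (Suc j)) = e_coeff z j"
  unfolding x_coeff_def e_coeff_def cnj_cint[OF zero_less_one]
proof (rule cint_cong)
  fix w :: complex assume w: "cmod w = 1"
  then have "w \<noteq> 0" by auto
  moreover have "cnj w = 1 / w"
    using w \<open>w \<noteq> 0\<close> by (metis complex_norm_square nonzero_eq_divide_eq mult.commute of_real_1 power_one)
  ultimately show "cnj (X (\<phi> z) (h w) / w ^ Suc (Suc j)) * of_real (1\<^sup>2) / w\<^sup>2 = w ^ j / (h w - \<phi> z)"
    using cnj_X[OF w phi_ball[OF assms]] by (simp add: power_divide power2_eq_square)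
qed simp

lemma continuous_Psi_sphere: "\<rho> < r \<Longrightarrow> continuous_on (sphere 0 r) \<Psi>" "\<rho> < r \<Longrightarrow> continuous_on (sphere 0 r) (deriv \<Psi>)"
  by (auto intro!: continuous_on_subset[OF holomorphic_on_imp_continuous_on[OF Psi(1)]]
       continuous_on_subset[OF holomorphic_on_imp_continuous_on[OF deriv_Psi_holomorphic]])

text \<open>The kernel in \<open>poly_eq_cint\<close> is the conjugate of \<open>X\<close>; its
  Faber series is integrated term by term, and each integral is an area inner product by
  \<open>area_inner_pderiv\<close>. The constant Faber polynomial drops out, since its derivative is
  0; hence the index shift.\<close>

theorem poly_expansion:
  assumes z: "z \<in> G"
  shows "(\<lambda>j. e_coeff z j * area_inner G p (pderiv (faber (Suc j)))) sums (poly p z / deriv \<phi> z)"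
proof -
  define b where "b = \<phi> z"
  have b: "cmod b < 1" using phi_ball[OF z] by (simp add: b_def)
  obtain C q where q: "0 \<le> q" "q < 1"
    and ex: "\<And>w. cmod w = 1 \<Longrightarrow> (\<lambda>m. x_coeff b m * poly (faber m) (\<Psi> w)) sums X b (h w)"
    and bd: "\<And>w m. cmod w = 1 \<Longrightarrow> cmod (x_coeff b m * poly (faber m) (\<Psi> w)) \<le> C * q ^ m"
    using X_expansion[OF b] by blast
  define g where "g = (\<lambda>w. poly p (\<Psi> w) * deriv \<Psi> w)"
  have gc: "continuous_on (sphere 0 1) g"
    unfolding g_def using rho by (intro continuous_intros continuous_Psi_sphere) auto
  then have "bounded (g ` sphere 0 1)" by (intro compact_imp_bounded compact_continuous_image compact_sphere)
  then obtain Bg where Bg: "Bg > 0" "\<And>t. cmod t = 1 \<Longrightarrow> cmod (g t) \<le> Bg"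
    unfolding bounded_pos by (metis image_eqI mem_sphere_0)
  have "(\<lambda>m. cint 1 (\<lambda>w. g w * cnj (x_coeff b m * poly (faber m) (\<Psi> w)))) sums
        cint 1 (\<lambda>w. \<Sum>m. g w * cnj (x_coeff b m * poly (faber m) (\<Psi> w)))"
  proof (rule cint_suminf)
    show "continuous_on (sphere 0 1) (\<lambda>w. g w * cnj (x_coeff b m * poly (faber m) (\<Psi> w)))" for m
      using rho by (intro continuous_intros gc continuous_Psi_sphere) auto
    show "cmod (g t * cnj (x_coeff b m * poly (faber m) (\<Psi> t))) \<le> Bg * (C * q ^ m)" if t: "cmod t = 1" for m t
      unfolding norm_mult[of "g t"] complex_mod_cnj using Bg bd[OF t, of m] t by (intro mult_mono) auto
    show "summable (\<lambda>m. Bg * (C * q ^ m))"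
      by (intro summable_mult summable_geometric) (use q in auto)
  qed simp
  also have "cint 1 (\<lambda>w. \<Sum>m. g w * cnj (x_coeff b m * poly (faber m) (\<Psi> w))) = cint 1 (\<lambda>w. g w / (h w - b))"
  proof (rule cint_cong)
    fix w :: complex assume w: "cmod w = 1"
    have "(\<lambda>m. cnj (x_coeff b m * poly (faber m) (\<Psi> w))) sums cnj (X b (h w))"
      using ex[OF w] by (simp only: sums_cnj)
    then have "(\<lambda>m. g w * cnj (x_coeff b m * poly (faber m) (\<Psi> w))) sums (g w * (1 / (h w - b)))"
      unfolding cnj_X[OF w b] by (rule sums_mult)
    then show "(\<Sum>m. g w * cnj (x_coeff b m * poly (faber m) (\<Psi> w))) = g w / (h w - b)"
      by (simp add: sums_unique[symmetric])
  qed simp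
  also have "\<dots> = poly p z / deriv \<phi> z"
    using poly_eq_cint[OF z, of p] deriv_phi_nonzero[OF z] by (simp add: g_def b_def)
  also have "(\<lambda>m. cint 1 (\<lambda>w. g w * cnj (x_coeff b m * poly (faber m) (\<Psi> w))))
      = (\<lambda>m. cnj (x_coeff b m) * area_inner G p (pderiv (faber m)))"
  proof
    fix m
    have "cint 1 (\<lambda>w. g w * cnj (x_coeff b m * poly (faber m) (\<Psi> w))) = cint 1 (\<lambda>w. cnj (x_coeff b m) * (g w * cnj (poly (faber m) (\<Psi> w))))"
      by (simp add: mult_ac)
    also have "\<dots> = cnj (x_coeff b m) * cint 1 (\<lambda>w. g w * cnj (poly (faber m) (\<Psi> w)))"
      by (rule cint_cmult) (use rho in \<open>auto intro!: continuous_intros gc continuous_Psi_sphere\<close>)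
    finally show "cint 1 (\<lambda>w. g w * cnj (x_coeff b m * poly (faber m) (\<Psi> w))) = cnj (x_coeff b m) * area_inner G p (pderiv (faber m))"
      by (simp add: area_inner_pderiv g_def)
  qed
  finally have S: "(\<lambda>m. cnj (x_coeff b m) * area_inner G p (pderiv (faber m))) sums (poly p z / deriv \<phi> z)" .
  have "pderiv (faber 0) = 0" using faber(1)[of 0] by (simp add: pderiv_eq_0_iff)
  then have "area_inner G p (pderiv (faber 0)) = 0" by (simp add: area_inner_def)
  then have "(\<lambda>j. cnj (x_coeff b (Suc j)) * area_inner G p (pderiv (faber (Suc j)))) sums (poly p z / deriv \<phi> z)"
    using S by (subst sums_Suc_iff) simp
  then show ?thesis using cnj_x_coeff[OF z] by (simp add: b_def)
qed

end

section \<open>Orthogonality and the coefficients of the expansion\<close>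

lemma set_integrable_bounded_open:
  assumes "open D" "bounded D" "continuous_on UNIV (f :: complex \<Rightarrow> complex)"
  shows "set_integrable lborel D f"
proof -
  obtain M where "\<forall>z\<in>D. cmod z \<le> M" using assms(2) unfolding bounded_iff by blast
  then have M: "D \<subseteq> cball 0 M" by auto
  have "set_integrable lborel (cball 0 M) f"
    by (rule borel_integrable_compact[OF compact_cball, folded set_integrable_def])
       (rule continuous_on_subset[OF assms(3) subset_UNIV])
  then show ?thesis by (rule set_integrable_subset) (use assms(1) M in auto)
qed

context curve
begin

lemma area_inner_add: "area_inner G p (q + r) = area_inner G p q + area_inner G p r"
proof -
  have i: "set_integrable lborel G (\<lambda>z. poly p z * cnj (poly q z))" for q
    by (rule set_integrable_bounded_open) (auto intro!: curve_facts continuous_intros)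
  have "(LINT z:G|lborel. poly p z * cnj (poly (q + r) z))
      = (LINT z:G|lborel. poly p z * cnj (poly q z) + poly p z * cnj (poly r z))"
    by (simp add: distrib_left)
  also have "\<dots> = (LINT z:G|lborel. poly p z * cnj (poly q z)) + (LINT z:G|lborel. poly p z * cnj (poly r z))"
    by (rule set_integral_add) (rule i)+
  finally show ?thesis by (simp add: area_inner_def add_divide_distrib)
qed

lemma area_inner_smult: "area_inner G p (smult c q) = cnj c * area_inner G p q"
proof -
  have "(LINT z:G|lborel. poly p z * cnj (poly (smult c q) z)) = (LINT z:G|lborel. cnj c * (poly p z * cnj (poly q z)))"
    by (simp add: mult_ac)
  also have "\<dots> = cnj c * (LINT z:G|lborel. poly p z * cnj (poly q z))" by (rule set_integral_mult_right)
  finally show ?thesis by (simp add: area_inner_def)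
qed

end

locale curve_ops = curve +
  fixes p :: "nat \<Rightarrow> complex poly"
  assumes ops: "orthonormal_polys L p"
begin

lemma p_lead: "\<exists>c::real. c > 0 \<and> lead_coeff (p n) = of_real c"
  using ops unfolding orthonormal_polys_def by blast

lemma p_degree: "degree (p n) = n"
  and p_inner: "area_inner G (p n) (p m) = (if n = m then 1 else 0)"
  using ops by (auto simp: orthonormal_polys_def area_inner_def)

definition "lead_p n = Re (lead_coeff (p n))"

lemma lead_p: "lead_p n > 0" "lead_coeff (p n) = of_real (lead_p n)"
  using p_lead[of n] by (auto simp: lead_p_def)

text \<open>Induction on the degree, removing the leading term by a multiple of \<open>p d\<close>.
  The disjunct \<open>q = 0\<close> is there because \<open>degree 0 = 0\<close>, so for
  \<open>n = 0\<close> the degree condition would miss the zero polynomial.\<close>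

lemma p_orthogonal:
  assumes "q = 0 \<or> degree q < n" shows "area_inner G (p n) q = 0"
  using assms
proof (induction "degree q" arbitrary: q rule: less_induct)
  case less
  show ?case
  proof (cases "q = 0")
    case True then show ?thesis by (simp add: area_inner_def)
  next
    case False
    define d where "d = degree q"
    define c where "c = lead_coeff q / lead_coeff (p d)"
    have dn: "d < n" using less.prems False by (simp add: d_def)
    have l: "lead_coeff (p d) \<noteq> 0" using lead_p[of d] by simp
    define r where "r = q - smult c (p d)"
    have "coeff r d = 0" using l by (simp add: r_def c_def d_def p_degree)
    moreover have "degree r \<le> d" unfolding r_def
      by (rule degree_diff_le) (auto simp: d_def p_degree intro: order.trans[OF degree_smult_le])
    ultimately have r: "r = 0 \<or> degree r < d"
      by (metis le_neq_implies_less leading_coeff_0_iff)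
    have "area_inner G (p n) r = 0"
    proof (cases "r = 0")
      case True then show ?thesis by (simp add: area_inner_def)
    next
      case False
      then show ?thesis using r dn by (intro less.hyps) (auto simp: d_def)
    qed
    moreover have "q = smult c (p d) + r" by (simp add: r_def)
    ultimately show ?thesis using p_inner[of n d] dn
      by (simp add: area_inner_add area_inner_smult)
  qed
qed

text \<open>The index \<open>j\<close> of \<open>d\<close> and \<open>e_coeff\<close> belongs to the Faber polynomial of degree \<open>j + 1\<close>.\<close>

definition "d n j = area_inner G (p n) (pderiv (faber (Suc j)))"
text \<open>The leading coefficient of \<open>bdry n\<close> at infinity, as \<open>bdry_lim\<close>
  shows.\<close>

definition "lc n = lead_p n * cap ^ Suc n"

lemma lc_pos: "lc n > 0" using lead_p cap by (simp add: lc_def)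

lemma d_below: "j < n \<Longrightarrow> d n j = 0"
  unfolding d_def by (rule p_orthogonal) (simp add: degree_pderiv faber)

text \<open>The derivative of the Faber polynomial of degree \<open>n + 1\<close> is a multiple of
  \<open>p n\<close> plus lower terms, which are orthogonal to \<open>p n\<close>; the multiple is
  the ratio of leading coefficients.\<close>

lemma d_diagonal: "d n n = of_real (real (n + 1) / lc n)"
proof -
  define c where "c = complex_of_real (real (n + 1) / lc n)"
  define q where "q = pderiv (faber (Suc n))"
  define r where "r = q - smult c (p n)"
  have dq: "degree q = n" by (simp add: q_def degree_pderiv faber)
  have "coeff q n = of_nat (Suc n) * lead_coeff (faber (Suc n))"
    by (simp add: q_def coeff_pderiv faber(1))
  then have cq: "coeff q n = of_nat (Suc n) / of_real cap ^ Suc n" by (simp add: faber(2) del: power_Suc of_nat_Suc)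
  have cp: "coeff (p n) n = of_real (lead_p n)" using lead_p(2)[of n] by (simp add: p_degree)
  have "coeff r n = 0"
    using lead_p[of n] cap by (simp add: r_def cq cp c_def lc_def divide_simps del: power_Suc)
  moreover have "degree r \<le> n" unfolding r_def
    by (rule degree_diff_le) (auto simp: dq p_degree intro: order.trans[OF degree_smult_le])
  ultimately have r: "r = 0 \<or> degree r < n"
    by (metis le_neq_implies_less leading_coeff_0_iff)
  have "q = smult c (p n) + r" by (simp add: r_def)
  then have "d n n = cnj c * area_inner G (p n) (p n) + area_inner G (p n) r"
    unfolding d_def q_def[symmetric] by (simp add: area_inner_add area_inner_smult)
  then show ?thesis using p_inner[of n n] p_orthogonal[OF r] by (simp add: c_def)
qed

definition "bdry n = (\<lambda>w. poly (p n) (\<Psi> w) * deriv \<Psi> w)"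

lemma bdry_holomorphic: "bdry n holomorphic_on {w. \<rho> < cmod w}"
  unfolding bdry_def by (intro holomorphic_intros Psi deriv_Psi_holomorphic)

lemma poly_Psi_lim:
  assumes "degree q \<le> n"
  shows "((\<lambda>w. poly q (\<Psi> w) / w ^ n) \<longlongrightarrow> coeff q n * of_real cap ^ n) at_infinity"
  using assms
proof (induction n arbitrary: q)
  case 0
  then obtain a where "q = [:a:]" using degree_eq_zeroE by auto
  then show ?case by simp
next
  case (Suc n)
  obtain a q' where q: "q = pCons a q'" by (cases q)
  have "degree q' \<le> n" using Suc.prems q by (cases "q' = 0") auto
  then have IH: "((\<lambda>w. poly q' (\<Psi> w) / w ^ n) \<longlongrightarrow> coeff q' n * of_real cap ^ n) at_infinity" by (rule Suc.IH)
  have "((\<lambda>w. a * (1 / w) ^ Suc n + (\<Psi> w / w) * (poly q' (\<Psi> w) / w ^ n)) \<longlongrightarrow>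
      a * 0 ^ Suc n + of_real cap * (coeff q' n * of_real cap ^ n)) at_infinity"
    by (intro tendsto_intros tendsto_inverse_at_infinity cap IH)
  then show ?case unfolding q by (simp add: power_divide add_divide_distrib mult_ac)
qed

lemma bdry_lim: "((\<lambda>w. bdry n w / w ^ n) \<longlongrightarrow> of_real (lc n)) at_infinity"
proof -
  have "((\<lambda>w. (poly (p n) (\<Psi> w) / w ^ n) * deriv \<Psi> w) \<longlongrightarrow> (coeff (p n) n * of_real cap ^ n) * of_real cap) at_infinity"
    by (intro tendsto_intros poly_Psi_lim deriv_Psi_lim) (simp add: p_degree)
  moreover have "coeff (p n) n = of_real (lead_p n)" using lead_p(2)[of n] by (simp add: p_degree)
  ultimately show ?thesis by (simp add: bdry_def lc_def mult_ac)
qed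

text \<open>\<open>bdry n w\<close> grows like \<open>w ^ n\<close>, so after division by
  \<open>w ^ Suc j\<close> with \<open>n \<le> j\<close> a term in \<open>1 / w\<close> survives
  only for \<open>j = n\<close>.\<close>

lemma bdry_coeff: "n \<le> j \<Longrightarrow> cint 1 (\<lambda>w. bdry n w / w ^ Suc j) = (if j = n then of_real (lc n) else 0)"
proof (rule cint_at_infinity[of _ \<rho>])
  assume j: "n \<le> j"
  show "(\<lambda>w. bdry n w / w ^ Suc j) holomorphic_on {w. \<rho> < cmod w}"
    using rho by (intro holomorphic_intros bdry_holomorphic) auto
  have "((\<lambda>w. (bdry n w / w ^ n) * (1 / w) ^ (j - n)) \<longlongrightarrow> of_real (lc n) * 0 ^ (j - n)) at_infinity"
    by (intro tendsto_intros bdry_lim tendsto_inverse_at_infinity)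
  then have 1: "((\<lambda>w. (bdry n w / w ^ n) * (1 / w) ^ (j - n)) \<longlongrightarrow> (if j = n then of_real (lc n) else 0)) at_infinity"
    using j by (auto simp: power_0_left split: if_splits)
  show "((\<lambda>w. w * (bdry n w / w ^ Suc j)) \<longlongrightarrow> (if j = n then of_real (lc n) else 0)) at_infinity"
  proof (rule Lim_transform_eventually[OF 1], rule eventually_mono[OF eventually_norm_gt[of 0]])
    fix w :: complex assume "0 < cmod w"
    then have w: "w \<noteq> 0" by auto
    have "w ^ j = w ^ n * w ^ (j - n)" using j by (simp flip: power_add)
    then show "(bdry n w / w ^ n) * (1 / w) ^ (j - n) = w * (bdry n w / w ^ Suc j)"
      using w by (simp add: power_divide)
  qed
qed (use rho in auto)

text \<open>On the circle the conjugate of the Faber polynomial of degree \<open>m\<close> is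
  \<open>1 / w ^ m\<close> plus the reflected remainder. The first part picks a Laurent coefficient
  of \<open>bdry n\<close>. The second is holomorphic down to \<open>|w| = r\<close>, where
  \<open>\<Psi>\<close> takes values in \<open>G\<close> and the \<open>p n\<close> are bounded
  uniformly in \<open>n\<close>, while the remainder is evaluated at modulus \<open>1 / r\<close>
  and is \<open>O(r ^ m)\<close>.\<close>

lemma d_close:
  obtains C r where "0 \<le> C" "0 < r" "r < 1"
    "\<And>n j. n \<le> j \<Longrightarrow> cmod (d n j - (if j = n then of_real (lc n) else 0)) \<le> C * r ^ j"
proof -
  define r where "r = (1 + \<rho>) / 2"
  have r: "\<rho> < r" "0 < r" "r < 1" using rho by (auto simp: r_def)
  have r1: "1 < 1 / r" using r by simp
  obtain C1 where C1: "0 \<le> C1" "\<And>m w. cmod w = 1 / r \<Longrightarrow> cmod (poly (faber m) (\<Psi> w) - w ^ m) \<le> C1 * r ^ m"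
    using faber_remainder_bound[of r "1 / r"] r r1 by (metis less_trans)
  have K: "compact (\<Psi> ` sphere 0 r)" "\<Psi> ` sphere 0 r \<subseteq> G"
    using continuous_Psi_sphere(1)[OF r(1)] Psi_inside r by (auto intro!: compact_continuous_image)
  obtain C2 where C2: "\<And>p z. area_inner G p p = 1 \<Longrightarrow> z \<in> \<Psi> ` sphere 0 r \<Longrightarrow> cmod (poly p z) \<le> C2"
    using pointwise_bound[OF K] by blast
  have "bounded (deriv \<Psi> ` sphere 0 r)"
    by (intro compact_imp_bounded compact_continuous_image continuous_Psi_sphere r compact_sphere)
  then obtain C3 where C3: "C3 > 0" "\<And>t. cmod t = r \<Longrightarrow> cmod (deriv \<Psi> t) \<le> C3"
    unfolding bounded_pos by (metis image_eqI mem_sphere_0)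
  have "cmod (poly (p 0) (\<Psi> (of_real r))) \<le> C2" using C2[of "p 0"] p_inner[of 0 0] r by auto
  then have C20: "0 \<le> C2" using norm_ge_zero order_trans by blast
  have bb: "cmod (bdry n t) \<le> C2 * C3" if "cmod t = r" for n t
    unfolding bdry_def norm_mult using C2[of "p n" "\<Psi> t"] p_inner[of n n] C3 that C20
    by (intro mult_mono) auto
  show thesis
  proof (rule that[of "C2 * C3 * C1" r])
    fix n j :: nat assume nj: "n \<le> j"
    define m where "m = Suc j"
    define Rm where "Rm = (\<lambda>w. poly (faber m) (\<Psi> w) - w ^ m)"
    define S where "S = {w::complex. w \<noteq> 0 \<and> \<rho> * cmod w < 1}"
    define T where "T = {w. \<rho> < cmod w} \<inter> S"
    have "open S" unfolding S_def by (intro open_Collect_conj open_Collect_less open_Collect_neq continuous_intros)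
    then have T: "open T" unfolding T_def by (intro open_Int open_ring)
    have Rh: "Rm holomorphic_on {w. \<rho> < cmod w}" unfolding Rm_def by (intro holomorphic_intros Psi)
    have Rs: "(\<lambda>w. cnj (Rm (1 / cnj w))) holomorphic_on T"
      by (rule holomorphic_inversion_cnj[OF Rh open_ring(1)]) (auto simp: T_def S_def norm_divide pos_less_divide_eq)
    have inT: "w \<in> T" if "r \<le> cmod w" "cmod w \<le> 1" for w
      using that r rho_mult_less[of w] by (auto simp: T_def S_def)
    have hT: "(\<lambda>w. bdry n w * cnj (Rm (1 / cnj w))) holomorphic_on T"
      by (intro holomorphic_on_mult Rs holomorphic_on_subset[OF bdry_holomorphic]) (auto simp: T_def)
    have cT: "continuous_on (sphere 0 x) (\<lambda>w. bdry n w * cnj (Rm (1 / cnj w)))" if "r \<le> x" "x \<le> 1" for x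
      by (rule continuous_on_subset[OF holomorphic_on_imp_continuous_on[OF hT]]) (use inT that in auto)
    have "d n j = cint 1 (\<lambda>w. bdry n w * cnj (poly (faber m) (\<Psi> w)))"
      unfolding d_def m_def bdry_def area_inner_pderiv ..
    also have "\<dots> = cint 1 (\<lambda>w. bdry n w / w ^ m + bdry n w * cnj (Rm (1 / cnj w)))"
    proof (rule cint_cong)
      fix w :: complex assume w: "cmod w = 1"
      then have w0: "w \<noteq> 0" by auto
      have cw: "cnj w = 1 / w"
        using w w0 by (metis complex_norm_square nonzero_eq_divide_eq mult.commute of_real_1 power_one)
      then have "1 / cnj w = w" by simp
      moreover have "cnj (poly (faber m) (\<Psi> w)) = 1 / w ^ m + cnj (Rm w)"
        using cw by (simp add: Rm_def power_divide)
      ultimately show "bdry n w * cnj (poly (faber m) (\<Psi> w)) = bdry n w / w ^ m + bdry n w * cnj (Rm (1 / cnj w))"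
        by (simp add: distrib_left)
    qed simp
    also have "\<dots> = cint 1 (\<lambda>w. bdry n w / w ^ m) + cint 1 (\<lambda>w. bdry n w * cnj (Rm (1 / cnj w)))"
      by (rule cint_add) (use cT r rho in
        \<open>auto intro!: continuous_intros continuous_on_subset[OF holomorphic_on_imp_continuous_on[OF bdry_holomorphic]]\<close>)
    also have "cint 1 (\<lambda>w. bdry n w / w ^ m) = (if j = n then of_real (lc n) else 0)"
      unfolding m_def using nj by (rule bdry_coeff)
    also have "cint 1 (\<lambda>w. bdry n w * cnj (Rm (1 / cnj w))) = cint r (\<lambda>w. bdry n w * cnj (Rm (1 / cnj w)))"
      by (rule cint_eq[OF T hT]) (use r inT in auto)
    finally have "cmod (d n j - (if j = n then of_real (lc n) else 0)) = cmod (cint r (\<lambda>w. bdry n w * cnj (Rm (1 / cnj w))))"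
      by simp
    also have "\<dots> \<le> ((C2 * C3) * (C1 * r ^ m)) * r"
    proof (rule cint_bound)
      fix w assume w: "cmod w = r"
      have "cmod (Rm (1 / cnj w)) \<le> C1 * r ^ m" unfolding Rm_def by (rule C1(2)) (simp add: norm_divide w)
      then show "cmod (bdry n w * cnj (Rm (1 / cnj w))) \<le> (C2 * C3) * (C1 * r ^ m)"
        unfolding norm_mult complex_mod_cnj using bb[OF w] C20 C3 by (intro mult_mono) auto
    qed (use r cT in auto)
    also have "\<dots> = (C2 * C3 * C1) * r ^ j * (r * r)" by (simp add: m_def mult_ac)
    also have "\<dots> \<le> (C2 * C3 * C1) * r ^ j * 1"
      using C20 C3 C1 r mult_mono[of r 1 r 1] by (intro mult_left_mono) auto
    finally show "cmod (d n j - (if j = n then of_real (lc n) else 0)) \<le> C2 * C3 * C1 * r ^ j" by simp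
  qed (use r C20 C3 C1 in auto)
qed

text \<open>\<open>d n n\<close> times \<open>lc n\<close> is exactly \<open>n + 1\<close>, and by
  \<open>d_close\<close> the two factors are close. Their geometric mean \<open>sqrt (n + 1)\<close>
  lies between them and so is at least as close to \<open>d n n\<close> as \<open>lc n\<close>
  is.\<close>

lemma d_bounds:
  obtains C r where "0 \<le> C" "0 < r" "r < 1" "\<And>n j. n < j \<Longrightarrow> cmod (d n j) \<le> C * r ^ j"
    "\<And>n. cmod (d n n - of_real (sqrt (real n + 1))) \<le> C * r ^ n"
proof -
  obtain C r where C: "0 \<le> C" "0 < r" "r < 1"
    and b: "\<And>n j. n \<le> j \<Longrightarrow> cmod (d n j - (if j = n then of_real (lc n) else 0)) \<le> C * r ^ j"
    using d_close by blast
  have 1: "cmod (d n j) \<le> C * r ^ j" if "n < j" for n j using b[of n j] that by simp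
  have 2: "cmod (d n n - of_real (sqrt (real n + 1))) \<le> C * r ^ n" for n
  proof -
    define x where "x = real (n + 1) / lc n"
    define a where "a = lc n"
    define s where "s = sqrt (real n + 1)"
    have a: "a > 0" and s: "s > 0" using lc_pos by (auto simp: a_def s_def)
    have ss: "s * s = real (n + 1)" by (simp add: s_def)
    have dx: "d n n = of_real x" unfolding x_def by (rule d_diagonal)
    have xa: "x * a = s * s" unfolding ss x_def a_def using lc_pos[of n] by simp
    have "cmod (of_real (x - a)) \<le> C * r ^ n" using b[of n n] by (simp add: dx a_def)
    then have ax: "\<bar>x - a\<bar> \<le> C * r ^ n" by (simp only: norm_of_real)
    have "\<bar>x - s\<bar> \<le> \<bar>x - a\<bar>"
    proof (cases "s \<le> x")
      case True
      have "a \<le> s"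
      proof (rule ccontr)
        assume "\<not> a \<le> s"
        then have "s * s < x * a" using True s a by (intro mult_le_less_imp_less) auto
        then show False using xa by simp
      qed
      then show ?thesis using True by simp
    next
      case False
      have "s \<le> a"
      proof (rule ccontr)
        assume "\<not> s \<le> a"
        then have "x * a < s * s" using False s a by (intro mult_strict_mono) auto
        then show False using xa by simp
      qed
      then show ?thesis using False by simp
    qed
    then have "cmod (of_real (x - s)) \<le> C * r ^ n" using ax by (simp only: norm_of_real)
    then show ?thesis by (simp add: dx s_def)
  qed
  show thesis by (rule that[OF C 1 2])
qed

lemma p_expansion:
  assumes "z \<in> G"
  shows "(\<lambda>j. e_coeff z (j + n) * d n (j + n)) sums (poly (p n) z / deriv \<phi> z)"
proof -
  have S: "(\<lambda>j. e_coeff z j * d n j) sums (poly (p n) z / deriv \<phi> z)"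
    unfolding d_def by (rule poly_expansion[OF assms])
  have "(\<Sum>j<n. e_coeff z j * d n j) = 0" by (rule sum.neutral) (simp add: d_below)
  then show ?thesis using S by (subst sums_iff_shift) simp
qed

end

section \<open>Decay of the expansion coefficients\<close>

text \<open>A point near the closed ring is compared with its radial projection onto the nearer
  bounding circle.\<close>

lemma closed_ring_in_open:
  assumes U: "open U" "{w::complex. \<tau> \<le> cmod w \<and> cmod w \<le> s} \<subseteq> U" and t: "0 < \<tau>" "\<tau> \<le> s"
  obtains a b where "0 \<le> a" "a < \<tau>" "s < b" "{w. a < cmod w \<and> cmod w < b} \<subseteq> U"
proof -
  define K where "K = {w::complex. \<tau> \<le> cmod w \<and> cmod w \<le> s}"
  have "K = cball 0 s - ball 0 \<tau>" by (auto simp: K_def)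
  then have cK: "compact K" by (simp add: compact_diff)
  have "complex_of_real \<tau> \<in> K" using t by (simp add: K_def)
  then have ne: "K \<noteq> {}" by blast
  have KU: "K \<subseteq> U" using U(2) by (simp add: K_def)
  obtain e where e: "e > 0" "{w. infdist w K \<le> e} \<subseteq> U"
    using compact_in_open_separated[OF ne cK U(1) KU] by blast
  have near: "w \<in> U" if x: "x \<in> K" "dist w x \<le> e" for w x
    using infdist_le[OF x(1), of w] x(2) e by auto
  have proj: "w \<in> U" if w: "w \<noteq> 0" and c: "\<tau> \<le> c" "c \<le> s" "\<bar>cmod w - c\<bar> \<le> e" for w c
  proof (rule near[of "of_real (c / cmod w) * w"])
    have "cmod (of_real (c / cmod w) * w) = c" using w c t by (simp add: norm_mult norm_divide)
    then show "of_real (c / cmod w) * w \<in> K" using c by (simp add: K_def)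
    have "w - of_real (c / cmod w) * w = of_real (1 - c / cmod w) * w" by (simp add: algebra_simps)
    then have "dist w (of_real (c / cmod w) * w) = \<bar>1 - c / cmod w\<bar> * cmod w"
      by (simp only: dist_norm norm_mult norm_of_real)
    also have "\<dots> = \<bar>(1 - c / cmod w) * cmod w\<bar>" by (simp add: abs_mult)
    also have "(1 - c / cmod w) * cmod w = cmod w - c" using w by (simp add: left_diff_distrib)
    finally show "dist w (of_real (c / cmod w) * w) \<le> e" using c by simp
  qed
  define a where "a = max 0 (\<tau> - e)"
  have "w \<in> U" if w: "a < cmod w" "cmod w < s + e" for w
  proof -
    have w0: "w \<noteq> 0" using w by (auto simp: a_def)
    consider "cmod w < \<tau>" | "\<tau> \<le> cmod w" "cmod w \<le> s" | "s < cmod w" by linarith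
    then show ?thesis
    proof cases
      case 1 then show ?thesis using w t by (intro proj[OF w0, of \<tau>]) (auto simp: a_def)
    next
      case 2 then show ?thesis using U by auto
    next
      case 3 then show ?thesis using w t by (intro proj[OF w0, of s]) auto
    qed
  qed
  then show thesis using that[of a "s + e"] t e by (auto simp: a_def)
qed

text \<open>Points of analyticity form the natural open domain for moving contours when a function
  such as \<open>recip\<close> is known to be analytic only point by point.\<close>

lemma analytic_at_open: "open {w. f analytic_on {w}}"
proof (rule openI)
  fix w assume "w \<in> {w. f analytic_on {w}}"
  then obtain S where S: "open S" "w \<in> S" "f holomorphic_on S" by (auto simp: analytic_at)
  then have "S \<subseteq> {w. f analytic_on {w}}" by (auto simp: analytic_at)
  then show "\<exists>e>0. ball w e \<subseteq> {w. f analytic_on {w}}" using S by (meson openE order_trans)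
qed

lemma analytic_at_holomorphic: "f holomorphic_on {w. f analytic_on {w}}"
  by (rule analytic_imp_holomorphic) (simp add: analytic_on_analytic_at[of f "{w. f analytic_on {w}}"])

context curve
begin

definition "dom_h = {w. \<mu> < cmod w \<and> \<rho> * cmod w < 1}"
definition "nonpole = {w \<in> dom_h. \<not> is_pole h w}"
text \<open>Removing singularities first gives \<open>1 / (h - b)\<close> its limit 0 at the poles of \<open>h\<close>, where \<open>h\<close> itself
  has the value 0. At solutions of \<open>h w = b\<close> the value is the junk \<open>inverse 0\<close>.\<close>

definition "recip b w = inverse (remove_sings (\<lambda>w. h w - b) w)"

lemma dom_h_open: "open dom_h"
  unfolding dom_h_def by (intro open_Collect_conj open_Collect_less continuous_intros)

lemma h_dom: "h nicely_meromorphic_on dom_h" using h_nice by (simp add: dom_h_def)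

lemma in_dom_h: "\<mu> < cmod w \<Longrightarrow> cmod w \<le> 1 \<Longrightarrow> w \<in> dom_h"
  using rho_mult_less by (simp add: dom_h_def)

lemma h_analytic: "w \<in> nonpole \<Longrightarrow> h analytic_on {w}"
  using nicely_meromorphic_on_imp_analytic_at[OF h_dom] by (auto simp: nonpole_def)

lemma nonpole_circle: assumes "cmod w = 1" shows "w \<in> nonpole"
  using not_is_pole_holomorphic[OF A_open in_A(1)[OF assms] hA(1)] in_dom_h[of w] assms mu_le_rho rho
  by (auto simp: nonpole_def)

lemma h_circle: "cmod w = 1 \<Longrightarrow> cmod (h w) = 1"
  using h_norm(1) in_A(1) by blast

lemma solutions_iff: "w \<in> solutions L \<psi> \<phi> z \<longleftrightarrow> cmod w < 1 \<and> w \<in> nonpole \<and> h w = \<phi> z"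
  using in_dom_h[of w] by (auto simp: solutions_def nonpole_def dom_h_def)

lemma h_minus_meromorphic: "(\<lambda>w. h w - b) meromorphic_on dom_h"
  using h_dom unfolding nicely_meromorphic_on_def by (intro meromorphic_intros) auto

lemma recip_nonpole:
  assumes w: "w \<in> nonpole" "h w \<noteq> b"
  shows "recip b analytic_on {w}" "recip b w = 1 / (h w - b)"
proof -
  have an: "(\<lambda>w. h w - b) analytic_on {w}" using h_analytic[OF w(1)] by (intro analytic_intros)
  then show "recip b w = 1 / (h w - b)" by (simp add: recip_def inverse_eq_divide)
  have an': "(\<lambda>x. inverse (h x - b)) analytic_on {w}"
    using w(2) by (intro analytic_intros h_analytic[OF w(1)]) auto
  have ev: "\<forall>\<^sub>F x in nhds w. recip b x = inverse (h x - b)"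
    using eventually_remove_sings_eq_nhds[OF an] by (rule eventually_mono) (simp add: recip_def)
  show "recip b analytic_on {w}" using an' unfolding analytic_at_cong[OF ev refl] .
qed

lemma recip_pole:
  assumes w: "w \<in> dom_h" "is_pole h w"
  shows "recip b analytic_on {w}" "recip b w = 0"
proof -
  have p: "is_pole (\<lambda>w. h w - b) w"
    using w(2) by (simp add: is_pole_minus_const_iff)
  have m: "(\<lambda>w. h w - b) meromorphic_on {w}"
    using meromorphic_on_subset[OF h_minus_meromorphic] w(1) by blast
  then show "recip b w = 0" using p by (simp add: recip_def)
  have pr: "is_pole (remove_sings (\<lambda>w. h w - b)) w"
    using p m is_pole_remove_sings_iff by (metis insertI1 meromorphic_on_isolated_singularity)
  have nm: "recip b nicely_meromorphic_on {w}"
    unfolding recip_def using m by (intro nicely_meromorphic_on_inverse remove_sings_nicely_meromorphic)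
  \<comment> \<open>A pole before inversion is an isolated zero after it, so \<open>recip b\<close>
    has a finite limit at \<open>w\<close> and hence no pole.\<close>
  have "isolated_zero (recip b) w" using pr unfolding recip_def isolated_zero_inverse_iff .
  then have "recip b \<midarrow>w\<rightarrow> 0" by (simp add: isolated_zero_def)
  then have "\<not> is_pole (recip b) w"
    unfolding is_pole_def using not_tendsto_and_filterlim_at_infinity trivial_limit_at by blast
  then show "recip b analytic_on {w}" using nicely_meromorphic_on_imp_analytic_at[OF nm] by simp
qed

lemma recip_analytic: "w \<in> dom_h \<Longrightarrow> (w \<in> nonpole \<Longrightarrow> h w \<noteq> b) \<Longrightarrow> recip b analytic_on {w}"
  using recip_nonpole recip_pole by (cases "is_pole h w") (auto simp: nonpole_def)

lemma e_coeff_recip: assumes z: "z \<in> G" shows "e_coeff z j = cint 1 (\<lambda>w. w ^ j * recip (\<phi> z) w)"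
  unfolding e_coeff_def
proof (rule cint_cong)
  fix w :: complex assume w: "cmod w = 1"
  have "h w \<noteq> \<phi> z" using h_circle[OF w] phi_ball[OF z] by auto
  then show "w ^ j / (h w - \<phi> z) = w ^ j * recip (\<phi> z) w"
    using recip_nonpole(2)[OF nonpole_circle[OF w]] by simp
qed simp

lemma recip_analytic_ring:
  assumes z: "z \<in> G" and t: "\<mu> \<le> \<tau>" and ns: "\<And>w. w \<in> solutions L \<psi> \<phi> z \<Longrightarrow> cmod w \<le> \<tau>"
    and w: "\<tau> < cmod w" "cmod w \<le> 1"
  shows "recip (\<phi> z) analytic_on {w}"
proof (rule recip_analytic)
  show "w \<in> dom_h" using in_dom_h t w by auto
  show "h w \<noteq> \<phi> z" if "w \<in> nonpole"
  proof
    assume e: "h w = \<phi> z"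
    have "cmod w \<noteq> 1" using e h_circle[of w] phi_ball[OF z] by auto
    then have "w \<in> solutions L \<psi> \<phi> z" using that e w by (simp add: solutions_iff)
    then show False using ns w by force
  qed
qed

text \<open>Moving the circle from 1 down to any \<open>\<tau>\<close> above all solutions meets no
  singularity, and on it the integrand is \<open>O(\<tau> ^ j)\<close>.\<close>

lemma e_coeff_upper:
  assumes z: "z \<in> G" and t: "\<mu> \<le> \<tau>0" and ns: "\<And>w. w \<in> solutions L \<psi> \<phi> z \<Longrightarrow> cmod w \<le> \<tau>0"
    and tau: "\<tau>0 < \<tau>" "\<tau> < 1"
  obtains C where "0 \<le> C" "\<And>j. cmod (e_coeff z j) \<le> C * \<tau> ^ j"
proof -
  define N where "N = recip (\<phi> z)"
  define U where "U = {w. N analytic_on {w}}"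
  have t0: "0 < \<tau>" using tau t mu_nonneg by linarith
  have U: "open U" "N holomorphic_on U" unfolding U_def by (rule analytic_at_open analytic_at_holomorphic)+
  have inU: "w \<in> U" if "\<tau> \<le> cmod w" "cmod w \<le> 1" for w
    unfolding U_def N_def using recip_analytic_ring[OF z t ns] that tau by auto
  have cN: "continuous_on (sphere 0 \<tau>) N"
    by (rule continuous_on_subset[OF holomorphic_on_imp_continuous_on[OF U(2)]]) (use inU tau in auto)
  then have "bounded (N ` sphere 0 \<tau>)" by (intro compact_imp_bounded compact_continuous_image compact_sphere)
  then obtain B where B: "B > 0" "\<And>w. cmod w = \<tau> \<Longrightarrow> cmod (N w) \<le> B"
    unfolding bounded_pos by (metis image_eqI mem_sphere_0)
  show thesis
  proof (rule that[of "B * \<tau>"])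
    show "0 \<le> B * \<tau>" using B t0 by simp
    fix j
    have "e_coeff z j = cint 1 (\<lambda>w. w ^ j * N w)" unfolding N_def by (rule e_coeff_recip[OF z])
    also have "\<dots> = cint \<tau> (\<lambda>w. w ^ j * N w)"
      by (rule cint_eq[OF U(1)]) (use U inU t0 tau in \<open>auto intro!: holomorphic_intros\<close>)
    also have "cmod \<dots> \<le> (\<tau> ^ j * B) * \<tau>"
      by (rule cint_bound[OF _ t0])
         (use B t0 cN in \<open>auto intro!: continuous_intros mult_left_mono simp: norm_mult norm_power\<close>)
    finally show "cmod (e_coeff z j) \<le> B * \<tau> * \<tau> ^ j" by (simp add: mult_ac)
  qed
qed

text \<open>The negative part of the Laurent expansion of \<open>1 / (h - \<phi> z)\<close> is the power series in \<open>1 / w\<close> with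
  coefficients \<open>e_coeff z j\<close>, and its positive part is holomorphic in the whole disc.\<close>

lemma e_coeff_continuation:
  assumes z: "z \<in> G" and s: "0 < \<sigma>" "\<sigma> < 1" and ev: "\<forall>\<^sub>F j in sequentially. cmod (e_coeff z j) \<le> C * \<sigma> ^ j"
  obtains k t where "k holomorphic_on {w. \<sigma> < cmod w \<and> cmod w < 1}" "\<alpha> \<le> t" "t < 1"
    "\<And>w. t < cmod w \<Longrightarrow> cmod w < 1 \<Longrightarrow> h w \<noteq> \<phi> z \<and> k w = 1 / (h w - \<phi> z)"
proof -
  define b where "b = \<phi> z"
  have b: "cmod b < 1" using phi_ball[OF z] by (simp add: b_def)
  have "open (A \<inter> h -` (- {b}))"
    by (rule continuous_open_preimage[OF holomorphic_on_imp_continuous_on[OF hA(1)] A_open]) auto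
  moreover have "sphere 0 1 \<subseteq> A \<inter> h -` (- {b})"
    using h_circle b in_A(1) by auto
  ultimately obtain a where a: "0 < a" "a < 1" and asub: "{w. a < cmod w \<and> cmod w < 1 / a} \<subseteq> A \<inter> h -` (- {b})"
    by (rule ring_in_open)
  have a1: "1 < 1 / a" using a by simp
  define N where "N = (\<lambda>w. 1 / (h w - b))"
  define S where "S = {w. a < cmod w \<and> cmod w < 1 / a}"
  have S: "open S" unfolding S_def by (rule open_ring)
  have NS: "N holomorphic_on S"
    unfolding N_def using asub by (intro holomorphic_intros holomorphic_on_subset[OF hA(1)]) (auto simp: S_def)
  have cN: "continuous_on (sphere 0 r) N" if "a < r" "r \<le> 1" for r
    by (rule continuous_on_subset[OF holomorphic_on_imp_continuous_on[OF NS]])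
       (use that a1 in \<open>auto simp: S_def\<close>)
  have sm: "summable (\<lambda>m. e_coeff z m * y ^ m)" if y: "cmod y < 1 / \<sigma>" for y
  proof (rule summable_comparison_test_ev)
    show "summable (\<lambda>m. C * (\<sigma> * cmod y) ^ m)"
      by (intro summable_mult summable_geometric) (use y s in \<open>simp add: field_simps\<close>)
    show "\<forall>\<^sub>F m in sequentially. norm (e_coeff z m * y ^ m) \<le> C * (\<sigma> * cmod y) ^ m"
      using ev by (rule eventually_mono)
        (simp add: norm_mult norm_power power_mult_distrib mult_right_mono mult.assoc[symmetric])
  qed
  define M where "M = (\<lambda>y. \<Sum>m. e_coeff z m * y ^ m)"
  have M: "M holomorphic_on ball 0 (1 / \<sigma>)"
    by (rule power_series_holomorphic[of 0 _ "e_coeff z"]) (use sm in \<open>auto simp: M_def intro: summable_sums\<close>)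
  define D where "D = {w. \<sigma> < cmod w \<and> cmod w < 1}"
  have D0: "w \<noteq> 0 \<and> cmod (1 / w) < 1 / \<sigma>" if "w \<in> D" for w
  proof -
    have "\<sigma> < cmod w" using that by (simp add: D_def)
    moreover from this have w0: "0 < cmod w" using s by linarith
    ultimately have "1 / cmod w < 1 / \<sigma>" using s by (intro divide_strict_left_mono mult_pos_pos) auto
    then show ?thesis using w0 by (auto simp: norm_divide)
  qed
  have "(M \<circ> (\<lambda>w. 1 / w)) holomorphic_on D"
    by (rule holomorphic_on_compose_gen[OF _ M]) (use D0 in \<open>auto intro!: holomorphic_intros\<close>)
  then have M1: "(\<lambda>w. M (1 / w)) holomorphic_on D" by (simp add: o_def)
  define k where "k = (\<lambda>w. cint 1 (\<lambda>x. N x / (x - w)) + M (1 / w) / w)"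
  have "(\<lambda>w. cint 1 (\<lambda>x. N x / (x - w))) holomorphic_on D"
    by (rule holomorphic_on_subset[OF cint_kernel_holomorphic]) (use cN a in \<open>auto simp: D_def\<close>)
  then have kD: "k holomorphic_on D" unfolding k_def using M1 D0 by (intro holomorphic_intros) auto
  \<comment> \<open>Above \<open>t\<close> three things hold together: \<open>w\<close> is in the
    ring where \<open>h\<close> is injective (\<open>\<alpha>\<close>), \<open>h w\<close> differs
    from \<open>\<phi> z\<close> (\<open>a\<close>), and the series in \<open>1 / w\<close>
    converges (\<open>\<sigma>\<close>).\<close>
  define t where "t = max \<alpha> (max a \<sigma>)"
  have t: "\<alpha> \<le> t" "a \<le> t" "\<sigma> \<le> t" "t < 1" using alpha a s by (auto simp: t_def)
  have kN: "h w \<noteq> b \<and> k w = 1 / (h w - b)" if w: "t < cmod w" "cmod w < 1" for w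
  proof -
    have wS: "w \<in> S" using w t a1 by (auto simp: S_def)
    define r where "r = (a + cmod w) / 2"
    have r: "a < r" "r < cmod w" "0 < r" using w t a by (auto simp: r_def)
    have "(\<lambda>m. cint r (\<lambda>x. x ^ m * N x) / w ^ Suc m) sums (- cint r (\<lambda>x. N x / (x - w)))"
      by (rule cint_geometric) (use r w cN in auto)
    moreover have "cint r (\<lambda>x. x ^ m * N x) = e_coeff z m" for m
    proof -
      have hol: "(\<lambda>x. x ^ m * N x) holomorphic_on S" by (intro holomorphic_intros NS)
      have "e_coeff z m = cint 1 (\<lambda>x. x ^ m * N x)" by (simp add: e_coeff_def N_def b_def)
      also have "\<dots> = cint r (\<lambda>x. x ^ m * N x)"
        by (rule cint_eq[OF S hol]) (use r w a1 in \<open>auto simp: S_def\<close>)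
      finally show ?thesis by simp
    qed
    ultimately have 1: "(\<lambda>m. e_coeff z m / w ^ Suc m) sums (- cint r (\<lambda>x. N x / (x - w)))" by simp
    have wD: "w \<in> D" using w t by (auto simp: D_def)
    have "(\<lambda>m. e_coeff z m * (1 / w) ^ m) sums M (1 / w)"
      unfolding M_def using sm D0[OF wD] by (intro summable_sums) auto
    then have "(\<lambda>m. e_coeff z m * (1 / w) ^ m / w) sums (M (1 / w) / w)" by (rule sums_divide)
    then have 2: "(\<lambda>m. e_coeff z m / w ^ Suc m) sums (M (1 / w) / w)" by (simp add: power_divide mult.commute)
    have "N w = cint 1 (\<lambda>x. N x / (x - w)) - cint r (\<lambda>x. N x / (x - w))"
      by (rule cint_annulus_Cauchy[of N a "1 / a"]) (use NS r w a a1 in \<open>auto simp: S_def\<close>)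
    also have "\<dots> = k w" using sums_unique2[OF 1 2] by (simp add: k_def)
    finally have "k w = N w" by simp
    moreover have "h w \<noteq> b" using asub wS by (auto simp: S_def)
    ultimately show ?thesis by (simp add: N_def)
  qed
  show thesis by (rule that[OF kD[unfolded D_def] t(1,4)]) (use kN in \<open>auto simp: b_def\<close>)
qed

text \<open>The function \<open>k\<close> of \<open>e_coeff_continuation\<close> would be finite at
  \<open>\<omega>\<close>. The identity \<open>(h w - \<phi> z) * k w = 1\<close>, valid near the
  circle, persists up to \<open>\<omega>\<close>, where the left side is 0.\<close>

lemma slow_decay_solution:
  assumes z: "z \<in> G" and s: "0 < \<sigma>" and w: "\<omega> \<in> solutions L \<psi> \<phi> z" "\<sigma> < cmod \<omega>"
    and ev: "\<forall>\<^sub>F j in sequentially. cmod (e_coeff z j) \<le> C * \<sigma> ^ j"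
  shows False
proof -
  have w1: "cmod \<omega> < 1" "\<omega> \<in> nonpole" "h \<omega> = \<phi> z" using w(1) by (auto simp: solutions_iff)
  obtain k t where k: "k holomorphic_on {w. \<sigma> < cmod w \<and> cmod w < 1}" and t: "\<alpha> \<le> t" "t < 1"
    and kh: "\<And>w. t < cmod w \<Longrightarrow> cmod w < 1 \<Longrightarrow> h w \<noteq> \<phi> z \<and> k w = 1 / (h w - \<phi> z)"
    by (rule e_coeff_continuation[OF z s _ ev]) (use w w1 in auto)
  \<comment> \<open>\<open>k\<close> is defined above \<open>\<sigma>\<close> and \<open>h\<close>
    only above \<open>\<mu>\<close>; the identity is followed where both exist.\<close>
  define c where "c = max \<sigma> \<mu>"
  define D where "D = {w. c < cmod w \<and> cmod w < 1}"
  have D: "open D" "connected D" unfolding D_def by (rule open_ring connected_ring)+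
  have Dd: "D \<subseteq> dom_h" using in_dom_h by (auto simp: D_def c_def)
  have wD: "\<omega> \<in> D" using w w1 by (auto simp: D_def c_def nonpole_def dom_h_def)
  have kD: "k holomorphic_on D" by (rule holomorphic_on_subset[OF k]) (auto simp: D_def c_def)
  define P where "P = (\<lambda>w. (h w - \<phi> z) * k w)"
  have "P meromorphic_on D"
    unfolding P_def using kD D Dd
    by (intro meromorphic_intros meromorphic_on_subset[OF h_minus_meromorphic] analytic_on_imp_meromorphic_on)
       (auto simp: analytic_on_open)
  then have nm: "remove_sings P nicely_meromorphic_on D" by (rule remove_sings_nicely_meromorphic)
  define t' where "t' = max t c"
  have "c < 1" using w w1 mu_le_rho rho by (auto simp: c_def)
  then have t': "t' < 1" "t \<le> t'" "c \<le> t'" using t by (auto simp: t'_def)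
  have P1: "remove_sings P x = 1" if "x \<in> {w. t' < cmod w \<and> cmod w < 1}" for x
  proof (rule remove_sings_eqI)
    have "\<forall>\<^sub>F y in at x. y \<in> {w. t' < cmod w \<and> cmod w < 1}"
      by (rule eventually_at_in_open'[OF open_ring(2) that])
    then have "\<forall>\<^sub>F y in at x. P y = 1"
      by (rule eventually_mono) (use kh t' in \<open>auto simp: P_def\<close>)
    then show "P \<midarrow>x\<rightarrow> 1" by (rule tendsto_eventually)
  qed
  have mem: "complex_of_real ((1 + t') / 2) \<in> {w. t' < cmod w \<and> cmod w < 1}"
  proof -
    have "0 \<le> t'" using t' t alpha by linarith
    then have "cmod (of_real ((1 + t') / 2)) = (1 + t') / 2" unfolding norm_of_real by simp
    then show ?thesis using t' by simp
  qed
  have sub: "{w. t' < cmod w \<and> cmod w < 1} \<subseteq> D" using t' by (auto simp: D_def)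
  have ne: "{w. t' < cmod w \<and> cmod w < 1} \<noteq> {}" using mem by blast
  have one: "(\<lambda>_. 1) nicely_meromorphic_on D" by (rule nicely_meromorphic_on_const)
  have "remove_sings P \<omega> = 1"
    by (rule nicely_meromorphic_unique[OF nm one D open_ring(2)[of t' 1] sub ne P1 wD])
  moreover have "P analytic_on {\<omega>}"
    unfolding P_def using h_analytic[OF w1(2)] kD D wD
    by (intro analytic_intros) (auto simp: analytic_at)
  then have "remove_sings P \<omega> = P \<omega>" by simp
  ultimately show False using w1 by (simp add: P_def)
qed

text \<open>Here there need not be a solution to run into. Instead \<open>1 / k + \<phi> z\<close>
  is meromorphic above \<open>\<sigma>\<close> and equals \<open>h\<close> near the circle, so
  \<open>h\<close> would continue below \<open>\<mu>\<close>.\<close>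

lemma slow_decay_mu:
  assumes z: "z \<in> G" and s: "0 < \<sigma>" "\<sigma> < \<mu>"
    and ev: "\<forall>\<^sub>F j in sequentially. cmod (e_coeff z j) \<le> C * \<sigma> ^ j"
  shows False
proof -
  obtain k t where k: "k holomorphic_on {w. \<sigma> < cmod w \<and> cmod w < 1}" and t: "\<alpha> \<le> t" "t < 1"
    and kh: "\<And>w. t < cmod w \<Longrightarrow> cmod w < 1 \<Longrightarrow> h w \<noteq> \<phi> z \<and> k w = 1 / (h w - \<phi> z)"
    by (rule e_coeff_continuation[OF z s(1) _ ev]) (use s mu_le_rho rho in auto)
  define q where "q = remove_sings (\<lambda>w. inverse (k w) + \<phi> z)"
  have "(\<lambda>w. inverse (k w) + \<phi> z) meromorphic_on {w. \<sigma> < cmod w \<and> cmod w < 1}"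
    using k open_ring(2) by (intro meromorphic_intros analytic_on_imp_meromorphic_on) (auto simp: analytic_on_open)
  then have qm: "q nicely_meromorphic_on {w. \<sigma> < cmod w \<and> cmod w < 1}"
    unfolding q_def by (rule remove_sings_nicely_meromorphic)
  define R where "R = {w. \<rho> < cmod w \<and> cmod w < 1}"
  have R: "open R" "connected R" unfolding R_def by (rule open_ring connected_ring)+
  have qh: "q x = h x" if x: "x \<in> {w. t < cmod w \<and> cmod w < 1}" for x
  proof -
    have xA: "x \<in> A" using x t in_A(2) by auto
    have "\<forall>\<^sub>F y in at x. y \<in> {w. t < cmod w \<and> cmod w < 1}"
      by (rule eventually_at_in_open'[OF open_ring(2) x])
    then have ev: "\<forall>\<^sub>F y in at x. h y = inverse (k y) + \<phi> z"
      by (rule eventually_mono) (use kh in auto)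
    have "isCont h x" using holomorphic_on_imp_continuous_on[OF hA(1)] A_open xA
      by (simp add: continuous_on_eq_continuous_at)
    then have "h \<midarrow>x\<rightarrow> h x" by (simp add: isCont_def)
    then have "(\<lambda>w. inverse (k w) + \<phi> z) \<midarrow>x\<rightarrow> h x" using ev by (rule Lim_transform_eventually)
    then show ?thesis unfolding q_def by (rule remove_sings_eqI)
  qed
  have mem: "complex_of_real ((1 + t) / 2) \<in> {w. t < cmod w \<and> cmod w < 1}"
  proof -
    have "0 \<le> t" using t alpha by linarith
    then have "cmod (of_real ((1 + t) / 2)) = (1 + t) / 2" unfolding norm_of_real by simp
    then show ?thesis using t by simp
  qed
  have sub: "{w. t < cmod w \<and> cmod w < 1} \<subseteq> R" using t alpha by (auto simp: R_def)
  have ne: "{w. t < cmod w \<and> cmod w < 1} \<noteq> {}" using mem by blast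
  have qR: "q nicely_meromorphic_on R"
    by (rule nicely_meromorphic_on_subset[OF qm]) (use s mu_le_rho in \<open>auto simp: R_def\<close>)
  have hR: "h nicely_meromorphic_on R"
    by (rule nicely_meromorphic_on_subset[OF h_dom]) (use mu_le_rho in_dom_h in \<open>auto simp: R_def\<close>)
  have "q w = h w" if "\<rho> < cmod w" "cmod w < 1" for w
    by (rule nicely_meromorphic_unique[OF qR hR R open_ring(2)[of t 1] sub ne qh])
      (use that in \<open>auto simp: R_def\<close>)
  then have "\<mu> \<le> \<sigma>" using mu_least_inner[of \<sigma> q] s qm by auto
  then show False using s by simp
qed

end

section \<open>Largest solutions and the limit of n-th roots\<close>

lemma root_le: assumes "0 < n" "x \<le> y ^ n" "0 \<le> y" shows "root n x \<le> y"
  using real_root_le_mono[OF assms(1,2)] real_root_power_cancel[OF assms(1,3)] by simp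

lemma eventually_linear_times_geometric_le:
  assumes t: "0 \<le> t" "t < (s::real)"
  shows "\<forall>\<^sub>F n in sequentially. C * (real n + 1) * t ^ n \<le> s ^ n"
proof -
  have s: "0 < s" using t by simp
  define x where "x = t / s"
  have x: "0 \<le> x" "x < 1" using t s by (auto simp: x_def)
  have "(\<lambda>n. real n * x ^ n) \<longlonglongrightarrow> 0" using x by (intro powser_times_n_limit_0) simp
  moreover have "(\<lambda>n. x ^ n) \<longlonglongrightarrow> 0" using x by (intro LIMSEQ_power_zero) simp
  ultimately have "(\<lambda>n. C * (real n * x ^ n + x ^ n)) \<longlonglongrightarrow> C * (0 + 0)"
    by (intro tendsto_mult_left tendsto_add)
  then have "\<forall>\<^sub>F n in sequentially. C * (real n * x ^ n + x ^ n) < 1"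
    by (rule order_tendstoD) simp
  then show ?thesis
  proof (rule eventually_mono)
    fix n assume "C * (real n * x ^ n + x ^ n) < 1"
    then have "C * (real n * x ^ n + x ^ n) * s ^ n \<le> 1 * s ^ n" using s by (intro mult_right_mono) auto
    moreover have "x ^ n * s ^ n = t ^ n" using s by (simp add: x_def power_divide)
    ultimately show "C * (real n + 1) * t ^ n \<le> s ^ n" by (simp add: algebra_simps)
  qed
qed

context curve
begin

text \<open>Poles belong to this set too, because near a pole \<open>h\<close> is large and avoids
  \<open>b\<close>. Removing it from a closed ring leaves a compact set of solutions, which yields
  largest solutions and their stability.\<close>

lemma nonsolution_open: "open {w \<in> dom_h. w \<in> nonpole \<longrightarrow> h w \<noteq> b}"
proof (rule openI)
  fix w assume "w \<in> {w \<in> dom_h. w \<in> nonpole \<longrightarrow> h w \<noteq> b}"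
  then have w: "w \<in> dom_h" "w \<in> nonpole \<Longrightarrow> h w \<noteq> b" by auto
  have "\<forall>\<^sub>F x in nhds w. x \<in> nonpole \<longrightarrow> h x \<noteq> b"
  proof (cases "w \<in> nonpole")
    case True
    then have "isCont h w" by (rule analytic_at_imp_isCont[OF h_analytic])
    then have "h \<midarrow>w\<rightarrow> h w" by (simp add: isCont_def)
    then have "\<forall>\<^sub>F x in at w. h x \<noteq> b" using w(2)[OF True] by (rule tendsto_imp_eventually_ne)
    then show ?thesis using w(2)[OF True] by (auto simp: eventually_at_filter elim: eventually_mono)
  next
    case False
    then have "is_pole h w" using w by (auto simp: nonpole_def)
    then have "\<forall>\<^sub>F x in at w. h x \<noteq> b"
      unfolding is_pole_def using filterlim_at_infinity_imp_eventually_ne by blast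
    then show ?thesis using False by (auto simp: eventually_at_filter elim: eventually_mono)
  qed
  moreover have "\<forall>\<^sub>F x in nhds w. x \<in> dom_h" using dom_h_open w(1) by (rule eventually_nhds_in_open)
  ultimately have "\<forall>\<^sub>F x in nhds w. x \<in> {w \<in> dom_h. w \<in> nonpole \<longrightarrow> h w \<noteq> b}"
    by eventually_elim auto
  then show "\<exists>e>0. ball w e \<subseteq> {w \<in> dom_h. w \<in> nonpole \<longrightarrow> h w \<noteq> b}"
    unfolding eventually_nhds_metric by (auto simp: dist_commute subset_iff)
qed

text \<open>Solutions of modulus at least \<open>|w0|\<close> form a compact set: nonsolutions are
  open, and no solution lies on the unit circle, where \<open>|h| = 1 > |\<phi> z|\<close>.\<close>

lemma largest_exists: assumes z: "z \<in> Sigma_all L \<psi> \<phi>" shows "\<exists>\<omega>. \<omega> \<in> largest_solutions L \<psi> \<phi> z"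
proof -
  have zG: "z \<in> G" using z by (simp add: Sigma_all_def)
  obtain w0 where w0: "w0 \<in> solutions L \<psi> \<phi> z" using z by (auto simp: Sigma_all_def)
  then have w0': "cmod w0 < 1" "\<mu> < cmod w0" by (auto simp: solutions_iff nonpole_def dom_h_def)
  define K where "K = {w. cmod w0 \<le> cmod w \<and> cmod w \<le> 1} - {w \<in> dom_h. w \<in> nonpole \<longrightarrow> h w \<noteq> \<phi> z}"
  have "K = cball 0 1 - (ball 0 (cmod w0) \<union> {w \<in> dom_h. w \<in> nonpole \<longrightarrow> h w \<noteq> \<phi> z})"
    by (auto simp: K_def)
  then have K: "compact K" using compact_diff[OF compact_cball open_Un[OF open_ball nonsolution_open]] by simp
  have sol: "w \<in> K \<longleftrightarrow> w \<in> solutions L \<psi> \<phi> z \<and> cmod w0 \<le> cmod w" for w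
  proof
    assume "w \<in> K"
    then have w: "cmod w0 \<le> cmod w" "cmod w \<le> 1" "w \<in> nonpole" "h w = \<phi> z"
      using in_dom_h[of w] w0' by (auto simp: K_def)
    then have "cmod w \<noteq> 1" using h_circle[of w] phi_ball[OF zG] by auto
    then show "w \<in> solutions L \<psi> \<phi> z \<and> cmod w0 \<le> cmod w" using w by (simp add: solutions_iff)
  qed (auto simp: K_def solutions_iff)
  have "w0 \<in> K" using w0 sol by simp
  then obtain \<omega> where w: "\<omega> \<in> K" "\<And>v. v \<in> K \<Longrightarrow> cmod v \<le> cmod \<omega>"
    using continuous_attains_sup[OF K, of cmod] by (auto intro: continuous_intros)
  have "cmod v \<le> cmod \<omega>" if "v \<in> solutions L \<psi> \<phi> z" for v
  proof (cases "cmod w0 \<le> cmod v")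
    case True then show ?thesis using w(2) that sol by blast
  next
    case False then show ?thesis using w(1) sol by force
  qed
  then show ?thesis using w(1) sol by (auto simp: largest_solutions_def)
qed

lemma radius_solution:
  assumes "z \<in> Sigma_all L \<psi> \<phi>"
  obtains \<omega> where "\<omega> \<in> solutions L \<psi> \<phi> z" "cmod \<omega> = radius L \<psi> \<phi> z"
    "\<And>v. v \<in> solutions L \<psi> \<phi> z \<Longrightarrow> cmod v \<le> radius L \<psi> \<phi> z"
proof -
  define \<omega> where "\<omega> = (SOME \<omega>. \<omega> \<in> largest_solutions L \<psi> \<phi> z)"
  have "\<omega> \<in> largest_solutions L \<psi> \<phi> z" unfolding \<omega>_def using largest_exists[OF assms] by (rule someI_ex)
  moreover have "cmod \<omega> = radius L \<psi> \<phi> z" using assms by (simp add: radius_def \<omega>_def)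
  ultimately show thesis by (intro that[of \<omega>]) (auto simp: largest_solutions_def)
qed

lemma radius_bounds:
  assumes "z \<in> G"
  shows "\<mu> \<le> radius L \<psi> \<phi> z" "radius L \<psi> \<phi> z < 1"
    "\<And>v. v \<in> solutions L \<psi> \<phi> z \<Longrightarrow> cmod v \<le> radius L \<psi> \<phi> z"
proof -
  have "\<mu> \<le> radius L \<psi> \<phi> z \<and> radius L \<psi> \<phi> z < 1 \<and>
    (\<forall>v \<in> solutions L \<psi> \<phi> z. cmod v \<le> radius L \<psi> \<phi> z)"
  proof (cases "z \<in> Sigma_all L \<psi> \<phi>")
    case True
    show ?thesis
      by (rule radius_solution[OF True]) (force simp: solutions_iff nonpole_def dom_h_def)
  next
    case False
    then show ?thesis using mu_le_rho rho assms by (auto simp: radius_def Sigma_all_def)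
  qed
  then show "\<mu> \<le> radius L \<psi> \<phi> z" "radius L \<psi> \<phi> z < 1"
    "\<And>v. v \<in> solutions L \<psi> \<phi> z \<Longrightarrow> cmod v \<le> radius L \<psi> \<phi> z" by auto
qed

lemma slow_decay:
  assumes z: "z \<in> G" and s: "0 < \<sigma>" "\<sigma> < radius L \<psi> \<phi> z"
    and ev: "\<forall>\<^sub>F j in sequentially. cmod (e_coeff z j) \<le> C * \<sigma> ^ j"
  shows False
proof (cases "z \<in> Sigma_all L \<psi> \<phi>")
  case True
  obtain \<omega> where w: "\<omega> \<in> solutions L \<psi> \<phi> z" "cmod \<omega> = radius L \<psi> \<phi> z"
    by (rule radius_solution[OF True])
  show False by (rule slow_decay_solution[OF z s(1) w(1) _ ev]) (use w s in simp)
next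
  case False
  then have "radius L \<psi> \<phi> z = \<mu>" by (simp add: radius_def)
  then show False using slow_decay_mu[OF z s(1) _ ev] s by simp
qed

end

context curve_ops
begin

text \<open>Besides the factor \<open>q ^ n\<close> of \<open>e_coeff\<close>, every term after the
  first carries \<open>r ^ n\<close> from \<open>d\<close>. This gain makes the tail negligible
  against the diagonal term in both parts of the theorem.\<close>

lemma expansion_tail:
  assumes z: "z \<in> G" and r: "0 \<le> C" "0 < r" "r < 1"
    and d: "\<And>j. n < j \<Longrightarrow> cmod (d n j) \<le> C * r ^ j"
    and e: "\<And>j. cmod (e_coeff z j) \<le> K * q ^ j" and q: "0 \<le> q" "q \<le> 1" and K: "0 \<le> K"
  shows "cmod (poly (p n) z / deriv \<phi> z - e_coeff z n * d n n) \<le> K * C / (1 - r) * (q * r) ^ n"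
proof -
  have S: "(\<lambda>j. e_coeff z (j + n) * d n (j + n)) sums (poly (p n) z / deriv \<phi> z)" by (rule p_expansion[OF z])
  have T: "(\<lambda>j. e_coeff z (Suc j + n) * d n (Suc j + n)) sums (poly (p n) z / deriv \<phi> z - e_coeff z n * d n n)"
    using S by (subst sums_Suc_iff) simp
  have b: "cmod (e_coeff z (Suc j + n) * d n (Suc j + n)) \<le> K * C * (q * r) ^ n * r ^ j" for j
  proof -
    have "cmod (e_coeff z (Suc j + n) * d n (Suc j + n)) \<le> (K * q ^ (Suc j + n)) * (C * r ^ (Suc j + n))"
      unfolding norm_mult by (intro mult_mono e d) (use K q in auto)
    also have "\<dots> \<le> (K * q ^ n) * (C * (r ^ j * r ^ n))"
      by (intro mult_mono mult_left_mono power_decreasing)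
        (use K q r in \<open>auto simp: power_add[symmetric] intro!: power_decreasing\<close>)
    finally show ?thesis by (simp add: power_mult_distrib mult_ac)
  qed
  have g: "(\<lambda>j. K * C * (q * r) ^ n * r ^ j) sums (K * C * (q * r) ^ n * (1 / (1 - r)))"
    using r by (intro sums_mult geometric_sums) simp
  have "cmod (\<Sum>j. e_coeff z (Suc j + n) * d n (Suc j + n)) \<le> (\<Sum>j. K * C * (q * r) ^ n * r ^ j)"
    by (rule norm_suminf_le[OF b sums_summable[OF g]])
  then show ?thesis unfolding sums_unique[OF T, symmetric] sums_unique[OF g, symmetric] by (simp add: mult_ac)
qed

lemma limsup_upper:
  assumes z: "z \<in> G"
  shows "limsup (\<lambda>n. ereal (root n (cmod (poly (p n) z)))) \<le> ereal (radius L \<psi> \<phi> z)"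
  unfolding Limsup_le_iff
proof (intro allI impI)
  fix y :: ereal assume "ereal (radius L \<psi> \<phi> z) < y"
  then obtain y' where y': "radius L \<psi> \<phi> z < y'" "ereal y' < y" using ereal_dense2 by force
  \<comment> \<open>Capped below 1, since \<open>e_coeff_upper\<close> works inside the unit circle;
    \<open>t\<close> lies strictly between \<open>radius\<close> and \<open>s\<close>, so that the
    factor \<open>real n + 1\<close> can be absorbed.\<close>
  define s where "s = min y' ((radius L \<psi> \<phi> z + 1) / 2)"
  have "s \<le> (radius L \<psi> \<phi> z + 1) / 2" unfolding s_def by (rule min.cobounded2)
  then have s: "radius L \<psi> \<phi> z < s" "s < 1" "s \<le> y'"
    using y' radius_bounds(2)[OF z] by (auto simp: s_def)
  define t where "t = (radius L \<psi> \<phi> z + s) / 2"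
  have t: "radius L \<psi> \<phi> z < t" "t < s" using s by (auto simp: t_def)
  have t0: "0 < t" using t radius_bounds[OF z] mu_nonneg by linarith
  have t1: "t < 1" using t s by simp
  obtain K where K: "0 \<le> K" "\<And>j. cmod (e_coeff z j) \<le> K * t ^ j"
    using e_coeff_upper[OF z radius_bounds(1)[OF z] radius_bounds(3)[OF z] t(1) t1] by metis
  obtain C r where C: "0 \<le> C" "0 < r" "r < 1" and d: "\<And>n j. n < j \<Longrightarrow> cmod (d n j) \<le> C * r ^ j"
    and dn: "\<And>n. cmod (d n n - of_real (sqrt (real n + 1))) \<le> C * r ^ n" by (rule d_bounds) blast
  define B where "B = cmod (deriv \<phi> z) * (K * (1 + C) + K * C / (1 - r))"
  have "cmod (poly (p n) z) \<le> B * (real n + 1) * t ^ n" for n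
  proof -
    have "sqrt (real n + 1) \<le> real n + 1" by (rule real_le_lsqrt) (auto simp: power2_eq_square)
    moreover have "cmod (d n n) \<le> cmod (d n n - of_real (sqrt (real n + 1))) + cmod (of_real (sqrt (real n + 1)))"
      using norm_triangle_ineq2[of "d n n" "of_real (sqrt (real n + 1))"] by linarith
    moreover have "C * r ^ n \<le> C * (real n + 1)"
      using C power_le_one[of r n] by (intro mult_left_mono) auto
    moreover have "cmod (of_real (sqrt (real n + 1))) = sqrt (real n + 1)" by simp
    ultimately have dd: "cmod (d n n) \<le> (1 + C) * (real n + 1)"
      using dn[of n] by (simp add: algebra_simps)
    have "cmod (poly (p n) z / deriv \<phi> z) \<le> cmod (poly (p n) z / deriv \<phi> z - e_coeff z n * d n n) + cmod (e_coeff z n * d n n)"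
      using norm_triangle_ineq2[of "poly (p n) z / deriv \<phi> z" "e_coeff z n * d n n"] by linarith
    also have "\<dots> \<le> K * C / (1 - r) * (t * r) ^ n + (K * t ^ n) * ((1 + C) * (real n + 1))"
      using expansion_tail[OF z C d K(2) _ _ K(1)] t0 t1 K dd
      by (intro add_mono) (auto simp: norm_mult intro!: mult_mono)
    also have "K * C / (1 - r) * (t * r) ^ n \<le> K * C / (1 - r) * (t ^ n * (real n + 1))"
      using C K t0 power_le_one[of r n]
      by (intro mult_left_mono) (auto simp: power_mult_distrib intro!: mult_left_mono)
    finally have "cmod (poly (p n) z / deriv \<phi> z) \<le> (K * (1 + C) + K * C / (1 - r)) * ((real n + 1) * t ^ n)"
      by (simp add: algebra_simps)
    moreover have "cmod (poly (p n) z) = cmod (deriv \<phi> z) * cmod (poly (p n) z / deriv \<phi> z)"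
      using deriv_phi_nonzero[OF z] by (simp add: norm_divide)
    ultimately show ?thesis unfolding B_def mult.assoc by (simp add: mult_left_mono)
  qed
  then have "\<forall>\<^sub>F n in sequentially. cmod (poly (p n) z) \<le> s ^ n"
    using eventually_linear_times_geometric_le[OF _ t(2), of B] t0
    by (auto elim!: eventually_mono intro: order_trans)
  then show "\<forall>\<^sub>F n in sequentially. ereal (root n (cmod (poly (p n) z))) < y"
    using eventually_gt_at_top[of 0]
  proof eventually_elim
    case (elim n)
    have "root n (cmod (poly (p n) z)) \<le> s" using elim t t0 by (intro root_le) auto
    then have "ereal (root n (cmod (poly (p n) z))) \<le> ereal y'" using s by simp
    then show ?case using y'(2) by (rule le_less_trans)
  qed
qed

text \<open>If \<open>|p_n(z)|\<close> were eventually below \<open>s ^ n\<close> with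
  \<open>s\<close> less than \<open>radius\<close>, then, as \<open>|d n n|\<close> is bounded below
  and the tail has a small base too, \<open>expansion_tail\<close> could be solved for
  \<open>e_coeff z n\<close>, giving a decay that \<open>slow_decay\<close> forbids.\<close>

lemma limsup_lower:
  assumes z: "z \<in> G"
  shows "ereal (radius L \<psi> \<phi> z) \<le> limsup (\<lambda>n. ereal (root n (cmod (poly (p n) z))))"
proof (rule ccontr)
  define r0 where "r0 = radius L \<psi> \<phi> z"
  define X where "X = (\<lambda>n. ereal (root n (cmod (poly (p n) z))))"
  assume "\<not> ereal (radius L \<psi> \<phi> z) \<le> limsup (\<lambda>n. ereal (root n (cmod (poly (p n) z))))"
  then have "limsup X < ereal r0" by (simp add: r0_def X_def)
  then obtain s where s: "limsup X < ereal s" "s < r0" using ereal_dense2 by force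
  have "0 \<le> limsup X" by (rule le_Limsup) (auto simp: X_def intro!: always_eventually real_root_ge_zero)
  then have "ereal 0 < ereal s" using s(1) by (simp add: zero_ereal_def[symmetric] del: ereal_less)
  then have s0: "0 < s" by simp
  have "\<forall>\<^sub>F n in sequentially. X n < ereal s" using s(1) by (rule Limsup_lessD)
  then have ev1: "\<forall>\<^sub>F n in sequentially. cmod (poly (p n) z) \<le> s ^ n"
    using eventually_gt_at_top[of 0]
  proof eventually_elim
    case (elim n)
    then have "root n (cmod (poly (p n) z)) \<le> s" by (simp add: X_def)
    then have "root n (cmod (poly (p n) z)) ^ n \<le> s ^ n" using elim by (intro power_mono) auto
    then show ?case using elim by simp
  qed
  have r0: "\<mu> \<le> r0" "r0 < 1" using radius_bounds[OF z] by (auto simp: r0_def)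
  have rp: "0 < r0" using s s0 by simp
  obtain C r where C: "0 \<le> C" "0 < r" "r < 1" and d: "\<And>n j. n < j \<Longrightarrow> cmod (d n j) \<le> C * r ^ j"
    and dn: "\<And>n. cmod (d n n - of_real (sqrt (real n + 1))) \<le> C * r ^ n" by (rule d_bounds) blast
  \<comment> \<open>\<open>t\<close> has to exceed \<open>r0\<close> for the upper estimate of
    \<open>e_coeff\<close>, yet satisfy \<open>t * r < r0\<close> so that the tail stays below the
    critical rate.\<close>
  have "r0 < r0 / r" using C rp by (simp add: field_simps)
  then obtain t where t: "r0 < t" "t < 1" "t < r0 / r" using dense[of r0 "min 1 (r0 / r)"] r0 by auto
  then have tr: "t * r < r0" using C by (simp add: field_simps)
  have t0: "0 < t" using t rp by simp
  obtain K where K: "0 \<le> K" "\<And>j. cmod (e_coeff z j) \<le> K * t ^ j"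
    using e_coeff_upper[OF z r0(1)[unfolded r0_def] radius_bounds(3)[OF z] t(1)[unfolded r0_def] t(2)] by metis
  define \<sigma> where "\<sigma> = max s (t * r)"
  have sg: "0 < \<sigma>" "\<sigma> < r0" "s \<le> \<sigma>" "t * r \<le> \<sigma>" using s s0 tr by (auto simp: \<sigma>_def)
  define B where "B = 2 * (1 / cmod (deriv \<phi> z) + K * C / (1 - r))"
  have "(\<lambda>n. C * r ^ n) \<longlonglongrightarrow> C * 0" using C by (intro tendsto_mult_left LIMSEQ_power_zero) simp
  then have "\<forall>\<^sub>F n in sequentially. C * r ^ n < 1 / 2" by (rule order_tendstoD) simp
  then have "\<forall>\<^sub>F n in sequentially. cmod (e_coeff z n) \<le> B * \<sigma> ^ n"
    using ev1
  proof eventually_elim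
    case (elim n)
    have "1 \<le> sqrt (real n + 1)" by simp
    moreover have "cmod (of_real (sqrt (real n + 1))) = sqrt (real n + 1)" by simp
    moreover have "cmod (of_real (sqrt (real n + 1))) - cmod (d n n) \<le> cmod (d n n - of_real (sqrt (real n + 1)))"
      unfolding norm_minus_commute[of "d n n"] by (rule norm_triangle_ineq2)
    ultimately have dd: "1 / 2 \<le> cmod (d n n)" using dn[of n] elim(1) by linarith
    have "cmod (e_coeff z n) * (1 / 2) \<le> cmod (e_coeff z n * d n n)"
      unfolding norm_mult using dd by (intro mult_left_mono) auto
    also have "\<dots> \<le> cmod (poly (p n) z / deriv \<phi> z) + cmod (poly (p n) z / deriv \<phi> z - e_coeff z n * d n n)"
      using norm_triangle_ineq2[of "e_coeff z n * d n n" "poly (p n) z / deriv \<phi> z"]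
      unfolding norm_minus_commute[of "e_coeff z n * d n n"] by linarith
    also have "\<dots> \<le> 1 / cmod (deriv \<phi> z) * \<sigma> ^ n + K * C / (1 - r) * \<sigma> ^ n"
    proof (rule add_mono)
      have "cmod (poly (p n) z) \<le> \<sigma> ^ n" using elim(2) power_mono[OF sg(3), of n] s0 by simp
      then show "cmod (poly (p n) z / deriv \<phi> z) \<le> 1 / cmod (deriv \<phi> z) * \<sigma> ^ n"
        by (simp add: norm_divide divide_right_mono)
      have "K * C / (1 - r) * (t * r) ^ n \<le> K * C / (1 - r) * \<sigma> ^ n"
        using K C sg t0 by (intro mult_left_mono power_mono) auto
      then show "cmod (poly (p n) z / deriv \<phi> z - e_coeff z n * d n n) \<le> K * C / (1 - r) * \<sigma> ^ n"
        using expansion_tail[OF z C d K(2) _ _ K(1), of n] t0 t by simp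
    qed
    finally show ?case by (simp add: B_def algebra_simps)
  qed
  then show False using slow_decay[OF z sg(1)] sg(2) by (simp add: r0_def)
qed

end

section \<open>Simple solutions of largest modulus\<close>

context curve
begin

text \<open>\<open>|recip b w| \<le> M\<close> means \<open>|h w - b| \<ge> 1 / M\<close> off the
  poles; moving \<open>b\<close> by less than half of that at most doubles the bound. At poles of
  \<open>h\<close> the value of \<open>recip\<close> is 0 for every \<open>b\<close>.\<close>

lemma recip_perturb:
  assumes w: "w \<in> dom_h" "w \<in> nonpole \<Longrightarrow> h w \<noteq> b" and M: "cmod (recip b w) \<le> M" "0 < M"
    and b': "cmod (b' - b) < 1 / (2 * M)"
  shows "w \<in> nonpole \<Longrightarrow> h w \<noteq> b'" "cmod (recip b' w) \<le> 2 * M"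
proof -
  have *: "h w \<noteq> b' \<and> cmod (recip b' w) \<le> 2 * M" if n: "w \<in> nonpole"
  proof -
    have "1 / cmod (h w - b) \<le> M" using recip_nonpole(2)[OF n w(2)[OF n]] M(1) by (simp add: norm_divide)
    then have "1 / M \<le> cmod (h w - b)" using M(2) w(2)[OF n] by (simp add: field_simps)
    moreover have "cmod (h w - b) - cmod (b' - b) \<le> cmod (h w - b')"
      using norm_triangle_ineq2[of "h w - b" "b' - b"] by simp
    moreover have "1 / M - 1 / (2 * M) = 1 / (2 * M)" by (simp add: field_simps)
    ultimately have g: "1 / (2 * M) \<le> cmod (h w - b')" using b' by linarith
    moreover have p: "0 < 1 / (2 * M)" using M by simp
    ultimately have ne: "h w \<noteq> b'" by auto
    have "1 / cmod (h w - b') \<le> 2 * M" using g M(2) ne by (simp add: field_simps)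
    then show ?thesis using recip_nonpole(2)[OF n ne] ne by (simp add: norm_divide)
  qed
  then show "w \<in> nonpole \<Longrightarrow> h w \<noteq> b'" by blast
  show "cmod (recip b' w) \<le> 2 * M"
    using * recip_pole(2)[OF w(1), of b'] w(1) M(2) by (cases "is_pole h w") (auto simp: nonpole_def)
qed

text \<open>The closed ring from \<open>|\<omega>0|\<close> to 1 is covered by the open set of
  nonsolutions and a disc on which \<open>h\<close> is injective. Compactness extends the cover to a
  ring reaching below \<open>|\<omega>0|\<close>, so \<open>\<omega>0\<close> stays the only
  solution down to some \<open>\<tau>\<close>.\<close>

lemma largest_isolated:
  assumes w0: "\<omega>0 \<in> dom_h" "\<omega>0 \<in> nonpole" "cmod \<omega>0 < 1" "deriv h \<omega>0 \<noteq> 0"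
    and mx: "\<And>v. v \<in> nonpole \<Longrightarrow> h v = h \<omega>0 \<Longrightarrow> cmod v \<le> 1 \<Longrightarrow> cmod \<omega>0 \<le> cmod v \<Longrightarrow> v = \<omega>0"
  obtains \<tau> S where "\<mu> < \<tau>" "\<tau> < cmod \<omega>0"
    "\<forall>v. v \<in> nonpole \<longrightarrow> h v = h \<omega>0 \<longrightarrow> cmod v \<le> 1 \<longrightarrow> \<tau> \<le> cmod v \<longrightarrow> v = \<omega>0"
    "open S" "\<omega>0 \<in> S" "h holomorphic_on S" "inj_on h S"
proof -
  obtain S0 where S0: "open S0" "\<omega>0 \<in> S0" "h holomorphic_on S0"
    using h_analytic[OF w0(2)] by (auto simp: analytic_at)
  obtain e where e: "0 < e" "ball \<omega>0 e \<subseteq> S0" "inj_on h (ball \<omega>0 e)"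
    by (rule has_complex_derivative_locally_injective[OF S0(3,2,1) w0(4)])
  define U where "U = {w \<in> dom_h. w \<in> nonpole \<longrightarrow> h w \<noteq> h \<omega>0} \<union> ball \<omega>0 e"
  have U: "open U" unfolding U_def by (intro open_Un nonsolution_open open_ball)
  have m: "\<mu> < cmod \<omega>0" using w0(1) by (simp add: dom_h_def)
  have sub: "{w. cmod \<omega>0 \<le> cmod w \<and> cmod w \<le> 1} \<subseteq> U"
  proof
    fix w assume "w \<in> {w. cmod \<omega>0 \<le> cmod w \<and> cmod w \<le> 1}"
    then have w: "cmod \<omega>0 \<le> cmod w" "cmod w \<le> 1" by auto
    then have "w \<in> dom_h" using in_dom_h m by simp
    then show "w \<in> U" using mx[OF _ _ w(2,1)] e(1) by (auto simp: U_def)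
  qed
  have p: "0 < cmod \<omega>0" using m mu_nonneg by linarith
  have le: "cmod \<omega>0 \<le> 1" using w0(3) by simp
  obtain a b where a: "0 \<le> a" "a < cmod \<omega>0" "1 < b" "{w. a < cmod w \<and> cmod w < b} \<subseteq> U"
    by (rule closed_ring_in_open[OF U sub p le])
  define \<tau> where "\<tau> = (max a \<mu> + cmod \<omega>0) / 2"
  have t: "a < \<tau>" "\<mu> < \<tau>" "\<tau> < cmod \<omega>0" using a m by (auto simp: \<tau>_def)
  have "v = \<omega>0" if v: "v \<in> nonpole" "h v = h \<omega>0" "cmod v \<le> 1" "\<tau> \<le> cmod v" for v
  proof -
    have "v \<in> U" using a(3,4) v t by auto
    then have "v \<in> ball \<omega>0 e" using v by (auto simp: U_def)
    then show ?thesis using inj_onD[OF e(3) v(2)] e(1) by simp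
  qed
  then have "\<forall>v. v \<in> nonpole \<longrightarrow> h v = h \<omega>0 \<longrightarrow> cmod v \<le> 1 \<longrightarrow> \<tau> \<le> cmod v \<longrightarrow> v = \<omega>0" by blast
  then show thesis
    by (rule that[OF t(2,3) _ open_ball _ _ e(3)]) (use e holomorphic_on_subset[OF S0(3)] in auto)
qed

text \<open>The residue of \<open>w\<^sup>j / (h w - b)\<close> at the simple solution \<open>\<omega>\<close> gives the leading term.\<close>

lemma recip_residue:
  assumes S: "open S" "\<omega> \<in> S" "h holomorphic_on S" "inj_on h S" "S \<subseteq> {w. \<tau> < cmod w \<and> cmod w < 1}"
    and t: "\<mu> < \<tau>" and an: "\<And>w. \<tau> \<le> cmod w \<Longrightarrow> cmod w \<le> 1 \<Longrightarrow> w \<notin> S \<Longrightarrow> recip (h \<omega>) analytic_on {w}"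
    and M: "\<And>w. cmod w = \<tau> \<Longrightarrow> cmod (recip (h \<omega>) w) \<le> M"
  shows "cmod (cint 1 (\<lambda>w. w ^ j * recip (h \<omega>) w) - \<omega> ^ j / deriv h \<omega>) \<le> M * \<tau> ^ j"
proof -
  define b where "b = h \<omega>"
  have t0: "0 < \<tau>" using t mu_nonneg by linarith
  have w: "\<tau> < cmod \<omega>" "cmod \<omega> < 1" using S by auto
  have Sdom: "S \<subseteq> dom_h" using S(5) t in_dom_h by fastforce
  have Snp: "S \<subseteq> nonpole" using Sdom not_is_pole_holomorphic[OF S(1) _ S(3)] by (auto simp: nonpole_def)
  have dn: "deriv h \<omega> \<noteq> 0" by (rule holomorphic_injective_imp_regular[OF S(3,1,4,2)])
  define Q where "Q = (\<lambda>w. if w = \<omega> then deriv h \<omega> else (h w - h \<omega>) / (w - \<omega>))"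
  have Q: "Q holomorphic_on S" unfolding Q_def by (rule pole_lemma_open[OF S(3,1)])
  have Qn: "Q x \<noteq> 0" if "x \<in> S" for x
    using dn inj_onD[OF S(4) _ that S(2)] by (auto simp: Q_def)
  \<comment> \<open>\<open>recip b w\<close> times \<open>w - \<omega>\<close> with the pole filled.
    The value at \<open>\<omega>\<close> is the residue, and Cauchy's formula for the ring between
    \<open>\<tau>\<close> and 1 extracts it.\<close>
  define F where "F = (\<lambda>w. if w = \<omega> then 1 / deriv h \<omega> else (w - \<omega>) * recip b w)"
  have FS: "F x = 1 / Q x" if x: "x \<in> S" for x
  proof (cases "x = \<omega>")
    case False
    have "h x \<noteq> b" using inj_onD[OF S(4) _ x S(2)] False by (auto simp: b_def)
    then show ?thesis using False recip_nonpole(2)[of x b] Snp x by (auto simp: F_def Q_def b_def)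
  qed (simp add: F_def Q_def)
  have "(\<lambda>x. 1 / Q x) holomorphic_on S" using Q Qn by (intro holomorphic_intros)
  then have F1: "F holomorphic_on S" using FS by (simp cong: holomorphic_cong)
  have Fan: "F analytic_on {x}" if x: "\<tau> \<le> cmod x" "cmod x \<le> 1" for x
  proof (cases "x \<in> S")
    case True
    then show ?thesis using F1 S(1) by (auto simp: analytic_at)
  next
    case False
    then have "x \<noteq> \<omega>" using S(2) by auto
    then have "\<forall>\<^sub>F y in nhds x. y \<noteq> \<omega>" by (rule t1_space_nhds)
    then have ev: "\<forall>\<^sub>F y in nhds x. F y = (y - \<omega>) * recip b y"
      by (rule eventually_mono) (simp add: F_def)
    have "(\<lambda>y. (y - \<omega>) * recip b y) analytic_on {x}"
      using an[OF x False] unfolding b_def by (intro analytic_intros)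
    then show ?thesis unfolding analytic_at_cong[OF ev refl] .
  qed
  define U where "U = {x. F analytic_on {x}}"
  have U: "open U" "F holomorphic_on U" unfolding U_def by (rule analytic_at_open analytic_at_holomorphic)+
  have sub: "{w. \<tau> \<le> cmod w \<and> cmod w \<le> 1} \<subseteq> U" using Fan by (auto simp: U_def)
  have "\<tau> \<le> 1" using w by simp
  then obtain a c where a: "0 \<le> a" "a < \<tau>" "1 < c" "{w. a < cmod w \<and> cmod w < c} \<subseteq> U"
    by (rule closed_ring_in_open[OF U(1) sub t0])
  have "(\<lambda>w. w ^ j * F w) holomorphic_on {w. a < cmod w \<and> cmod w < c}"
    by (intro holomorphic_intros holomorphic_on_subset[OF U(2) a(4)])
  from cint_annulus_Cauchy[OF this a(1,2) w a(3)]
  have C: "\<omega> ^ j * F \<omega> = cint 1 (\<lambda>t. t ^ j * F t / (t - \<omega>)) - cint \<tau> (\<lambda>t. t ^ j * F t / (t - \<omega>))" .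
  have c1: "cint 1 (\<lambda>t. t ^ j * F t / (t - \<omega>)) = cint 1 (\<lambda>w. w ^ j * recip b w)"
    by (rule cint_cong) (use w in \<open>auto simp: F_def\<close>)
  have ct: "cint \<tau> (\<lambda>t. t ^ j * F t / (t - \<omega>)) = cint \<tau> (\<lambda>w. w ^ j * recip b w)"
    by (rule cint_cong) (use w t0 in \<open>auto simp: F_def\<close>)
  have "isCont (recip b) x" if "cmod x = \<tau>" for x
  proof (rule analytic_at_imp_isCont)
    have "x \<notin> S" using S(5) that by auto
    then show "recip b analytic_on {x}" unfolding b_def using an that w by simp
  qed
  then have cN: "continuous_on (sphere 0 \<tau>) (recip b)" by (intro continuous_at_imp_continuous_on) simp
  have "cmod (cint \<tau> (\<lambda>w. w ^ j * recip b w)) \<le> (\<tau> ^ j * M) * \<tau>"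
    by (rule cint_bound[OF _ t0])
       (use M t0 cN in \<open>auto intro!: continuous_intros mult_left_mono simp: norm_mult norm_power b_def\<close>)
  also have "\<dots> \<le> (\<tau> ^ j * M) * 1"
  proof (rule mult_left_mono)
    have "cmod (complex_of_real \<tau>) = \<tau>" using t0 by simp
    then have "0 \<le> M" using M norm_ge_zero order_trans by blast
    then show "0 \<le> \<tau> ^ j * M" using t0 by simp
  qed (use w in simp)
  also have "cint \<tau> (\<lambda>w. w ^ j * recip b w) = cint 1 (\<lambda>w. w ^ j * recip b w) - \<omega> ^ j / deriv h \<omega>"
    using C unfolding c1 ct by (simp add: F_def algebra_simps)
  finally show ?thesis by (simp add: b_def mult.commute)
qed

lemma cint_recip_bound:
  assumes b: "cmod b < 1" and M: "\<And>w. cmod w = 1 \<Longrightarrow> cmod (recip b w) \<le> M"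
  shows "cmod (cint 1 (recip b)) \<le> M"
proof -
  have "isCont (recip b) x" if "cmod x = 1" for x
    by (rule analytic_at_imp_isCont[OF recip_nonpole(1)[OF nonpole_circle[OF that]]])
      (use h_circle[OF that] b in auto)
  then have "continuous_on (sphere 0 1) (recip b)" by (intro continuous_at_imp_continuous_on) simp
  from cint_bound[OF this _ M] show ?thesis by simp
qed

text \<open>All constants are uniform for \<open>z\<close> in a neighbourhood \<open>V\<close>, so
  that a compact set can be covered later. The number \<open>D\<close> is
  \<open>1 / deriv h \<omega>\<close> at the largest solution \<open>\<omega>\<close>, the residue
  in the leading term of \<open>e_coeff\<close>.\<close>

lemma Sigma_one_local:
  assumes z0: "z0 \<in> Sigma_one L \<psi> \<phi>"
  obtains V \<tau> \<tau>' M where "open V" "z0 \<in> V" "V \<subseteq> G" "0 < \<tau>" "\<tau> < \<tau>'" "0 < M"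
    "\<And>z. z \<in> V \<Longrightarrow> \<exists>D. \<tau>' < cmod (Phi L \<psi> \<phi> z) \<and> cmod (Phi L \<psi> \<phi> z) < 1 \<and>
       deriv (Phi L \<psi> \<phi>) z = deriv \<phi> z * D \<and> cmod D \<le> M \<and>
       (\<forall>j. cmod (e_coeff z j - D * Phi L \<psi> \<phi> z ^ j) \<le> M * \<tau> ^ j)"
proof -
  define b0 where "b0 = \<phi> z0"
  have zG: "z0 \<in> G" using z0 by (simp add: Sigma_one_def Sigma_all_def)
  obtain \<omega>0 where lo: "largest_solutions L \<psi> \<phi> z0 = {\<omega>0}" and mult: "has_multiplicity h \<omega>0 1"
    using z0 by (auto simp: Sigma_one_def)
  have dn: "deriv h \<omega>0 \<noteq> 0" using mult by (simp add: has_multiplicity_def)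
  have "\<omega>0 \<in> largest_solutions L \<psi> \<phi> z0" using lo by simp
  then have s0: "\<omega>0 \<in> solutions L \<psi> \<phi> z0" and mx: "\<And>v. v \<in> solutions L \<psi> \<phi> z0 \<Longrightarrow> cmod v \<le> cmod \<omega>0"
    by (auto simp: largest_solutions_def)
  have w0: "cmod \<omega>0 < 1" "\<omega>0 \<in> nonpole" "h \<omega>0 = b0" "\<omega>0 \<in> dom_h"
    using s0 by (auto simp: solutions_iff b0_def nonpole_def)
  have uni: "v = \<omega>0" if v: "v \<in> nonpole" "h v = h \<omega>0" "cmod v \<le> 1" "cmod \<omega>0 \<le> cmod v" for v
  proof -
    have hv: "h v = \<phi> z0" using v w0 by (simp add: b0_def)
    then have "cmod v \<noteq> 1" using h_circle[of v] phi_ball[OF zG] by auto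
    then have vs: "v \<in> solutions L \<psi> \<phi> z0" using v hv by (simp add: solutions_iff)
    have "cmod u \<le> cmod v" if "u \<in> solutions L \<psi> \<phi> z0" for u using mx[OF that] v(4) by linarith
    then have "v \<in> largest_solutions L \<psi> \<phi> z0" using vs by (simp add: largest_solutions_def)
    then show ?thesis using lo by simp
  qed
  obtain \<tau> S0 where tm: "\<mu> < \<tau>" "\<tau> < cmod \<omega>0"
    and iso: "\<forall>v. v \<in> nonpole \<longrightarrow> h v = h \<omega>0 \<longrightarrow> cmod v \<le> 1 \<longrightarrow> \<tau> \<le> cmod v \<longrightarrow> v = \<omega>0"
    and S0: "open S0" "\<omega>0 \<in> S0" "h holomorphic_on S0" "inj_on h S0"
    by (rule largest_isolated[OF w0(4,2,1) dn uni])
  \<comment> \<open>Largest solutions for nearby \<open>z\<close> are kept above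
    \<open>\<tau>'\<close>, while errors are of order \<open>\<tau> ^ j\<close>; the gap yields the
    rate \<open>\<tau> / \<tau>' < 1\<close>.\<close>
  define \<tau>' where "\<tau>' = (\<tau> + cmod \<omega>0) / 2"
  have t: "0 < \<tau>" "\<tau> < \<tau>'" "\<tau>' < cmod \<omega>0" using tm mu_nonneg by (auto simp: \<tau>'_def)
  define S where "S = S0 \<inter> {w. \<tau>' < cmod w \<and> cmod w < 1}"
  have S: "open S" "\<omega>0 \<in> S" "h holomorphic_on S" "inj_on h S"
    "S \<subseteq> {w. \<tau>' < cmod w \<and> cmod w < 1}"
    unfolding S_def using S0 t w0 holomorphic_on_subset[OF S0(3)] inj_on_subset[OF S0(4)]
    by (auto intro!: open_Int open_ring)
  have S5: "S \<subseteq> {w. \<tau> < cmod w \<and> cmod w < 1}" using S(5) t by auto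
  \<comment> \<open>On \<open>K\<close>, the closed ring without the neighbourhood \<open>S\<close>
    of \<open>\<omega>0\<close>, there are no solutions for \<open>z0\<close>, and by
    \<open>recip_perturb\<close> none for \<open>z\<close> near \<open>z0\<close>.\<close>
  define K where "K = cball 0 1 - (ball 0 \<tau> \<union> S)"
  have K: "compact K" unfolding K_def by (rule compact_diff[OF compact_cball open_Un[OF open_ball S(1)]])
  have Kd: "w \<in> dom_h" if "w \<in> K" for w using that tm in_dom_h by (auto simp: K_def)
  have Kn: "h w \<noteq> b0" if "w \<in> K" "w \<in> nonpole" for w
    using iso that(2,1) S(2) w0(3) by (auto simp: K_def)
  have "isCont (recip b0) w" if "w \<in> K" for w
    by (rule analytic_at_imp_isCont[OF recip_analytic[OF Kd[OF that] Kn[OF that]]])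
  then have "continuous_on K (recip b0)" by (intro continuous_at_imp_continuous_on) simp
  then have "bounded (recip b0 ` K)" using K by (intro compact_imp_bounded compact_continuous_image)
  then obtain M where M: "M > 0" "\<And>w. w \<in> K \<Longrightarrow> cmod (recip b0 w) \<le> M"
    unfolding bounded_pos by (metis image_eqI)
  obtain k where k: "k holomorphic_on (h ` S)" "\<And>w. w \<in> S \<Longrightarrow> deriv h w * deriv k (h w) = 1"
    "\<And>w. w \<in> S \<Longrightarrow> k (h w) = w"
    using holomorphic_has_inverse[OF S(3,1,4)] by metis
  have hS: "open (h ` S)" by (rule open_mapping_thm3[OF S(3,1,4)])
  \<comment> \<open>Membership in \<open>h\<close> followed by \<open>S\<close> provides a solution
    in \<open>S\<close>; membership in the ball keeps \<open>K\<close> free of others.\<close>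
  define W where "W = h ` S \<inter> ball b0 (1 / (2 * M))"
  have W: "open W" "b0 \<in> W" using hS S(2) w0(3) M(1) by (auto simp: W_def)
  define V where "V = G \<inter> \<phi> -` W"
  have V: "open V" unfolding V_def
    by (rule continuous_open_preimage[OF holomorphic_on_imp_continuous_on[OF phi(1)] curve_facts(4) W(1)])
  have zV: "z0 \<in> V" using zG W by (simp add: V_def b0_def)
  have sol: "k (\<phi> z) \<in> S \<and> h (k (\<phi> z)) = \<phi> z" if "z \<in> V" for z
    using that k(3) by (auto simp: V_def W_def)
  have Kb: "h w \<noteq> \<phi> z" if "z \<in> V" "w \<in> K" "w \<in> nonpole" for z w
    using recip_perturb(1)[OF Kd[OF that(2)] Kn[OF that(2)] M(2)[OF that(2)] M(1), of "\<phi> z"] that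
    by (auto simp: V_def W_def dist_norm norm_minus_commute)
  have Kc: "cmod (recip (\<phi> z) w) \<le> 2 * M" if "z \<in> V" "w \<in> K" for z w
    using recip_perturb(2)[OF Kd[OF that(2)] Kn[OF that(2)] M(2)[OF that(2)] M(1), of "\<phi> z"] that
    by (auto simp: V_def W_def dist_norm norm_minus_commute)
  have Snp: "w \<in> nonpole" if "w \<in> S" for w
  proof -
    have "w \<in> dom_h" using that S5 tm in_dom_h[of w] by auto
    then show ?thesis using not_is_pole_holomorphic[OF S(1) that S(3)] by (simp add: nonpole_def)
  qed
  have Ph: "Phi L \<psi> \<phi> z = k (\<phi> z)" if zV: "z \<in> V" for z
  proof -
    have w: "k (\<phi> z) \<in> S" "h (k (\<phi> z)) = \<phi> z" using sol[OF zV] by auto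
    have ws: "k (\<phi> z) \<in> solutions L \<psi> \<phi> z" using w Snp S5 by (auto simp: solutions_iff)
    have un: "v = k (\<phi> z)" if v: "v \<in> solutions L \<psi> \<phi> z" "cmod (k (\<phi> z)) \<le> cmod v" for v
    proof -
      have v': "cmod v < 1" "v \<in> nonpole" "h v = \<phi> z" using v(1) by (auto simp: solutions_iff)
      have "\<tau> < cmod v" using v(2) w(1) S5 by fastforce
      then have "v \<in> S" using Kb[OF zV _ v'(2)] v' by (auto simp: K_def)
      then show ?thesis using k(3)[of v] v'(3) by simp
    qed
    have "cmod v \<le> cmod (k (\<phi> z))" if "v \<in> solutions L \<psi> \<phi> z" for v
      using un[OF that] by (cases "cmod (k (\<phi> z)) \<le> cmod v") auto
    then have "largest_solutions L \<psi> \<phi> z = {k (\<phi> z)}"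
      using ws un unfolding largest_solutions_def by blast
    then show ?thesis by (simp add: Phi_def)
  qed
  have dPh: "deriv (Phi L \<psi> \<phi>) z = deriv \<phi> z * (1 / deriv h (k (\<phi> z)))" if zV: "z \<in> V" for z
  proof -
    have zG: "z \<in> G" and zW: "\<phi> z \<in> h ` S" using zV by (auto simp: V_def W_def)
    have "\<forall>\<^sub>F x in nhds z. x \<in> V" by (rule eventually_nhds_in_open[OF V zV])
    then have "\<forall>\<^sub>F x in nhds z. Phi L \<psi> \<phi> x = (k \<circ> \<phi>) x" by (rule eventually_mono) (simp add: Ph)
    then have "deriv (Phi L \<psi> \<phi>) z = deriv (k \<circ> \<phi>) z" by (rule deriv_cong_ev) simp
    also have "\<dots> = deriv k (\<phi> z) * deriv \<phi> z"
      using holomorphic_on_imp_differentiable_at[OF phi(1) curve_facts(4) zG]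
        holomorphic_on_imp_differentiable_at[OF k(1) hS zW] by (rule deriv_chain)
    also have "deriv k (\<phi> z) = 1 / deriv h (k (\<phi> z))"
    proof -
      have 1: "deriv h (k (\<phi> z)) * deriv k (\<phi> z) = 1"
        using k(2)[of "k (\<phi> z)"] sol[OF zV] by simp
      then have "deriv h (k (\<phi> z)) \<noteq> 0" by auto
      then show ?thesis using 1 by (simp add: nonzero_eq_divide_eq mult.commute)
    qed
    finally show ?thesis by simp
  qed
  show thesis
  proof (rule that[OF V zV _ t(1,2), of "4 * M"])
    show "V \<subseteq> G" by (auto simp: V_def)
    show "0 < 4 * M" using M by simp
    fix z assume zV: "z \<in> V"
    define \<omega> where "\<omega> = k (\<phi> z)"
    have w: "\<omega> \<in> S" "h \<omega> = \<phi> z" using sol[OF zV] by (auto simp: \<omega>_def)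
    have zG: "z \<in> G" using zV by (simp add: V_def)
    have est: "cmod (e_coeff z j - \<omega> ^ j / deriv h \<omega>) \<le> 2 * M * \<tau> ^ j" for j
      unfolding e_coeff_recip[OF zG] w(2)[symmetric]
    proof (rule recip_residue[OF S(1) w(1) S(3,4) S5 tm(1)])
      fix x :: complex
      assume x: "\<tau> \<le> cmod x" "cmod x \<le> 1" "x \<notin> S"
      then have "x \<in> K" by (simp add: K_def)
      then show "recip (h \<omega>) analytic_on {x}" unfolding w(2) by (intro recip_analytic Kd Kb[OF zV])
    next
      fix x :: complex assume "cmod x = \<tau>"
      then have "x \<in> K" using S5 t w0 tm by (auto simp: K_def)
      then show "cmod (recip (h \<omega>) x) \<le> 2 * M" unfolding w(2) by (rule Kc[OF zV])
    qed
    \<comment> \<open>Origin of \<open>4 * M\<close>: by the case \<open>j = 0\<close>, the residue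
      differs by at most \<open>2 * M\<close> from \<open>e_coeff z 0\<close>, which is itself at
      most \<open>2 * M\<close>.\<close>
    have "cmod (e_coeff z 0) \<le> 2 * M"
    proof -
      have "x \<in> K" if "cmod x = 1" for x using that S5 tm w0 by (auto simp: K_def)
      then have "cmod (cint 1 (recip (\<phi> z))) \<le> 2 * M"
        by (intro cint_recip_bound Kc[OF zV]) (use phi_ball[OF zG] in simp)
      then show ?thesis unfolding e_coeff_recip[OF zG] by simp
    qed
    moreover have "cmod (1 / deriv h \<omega>) \<le> cmod (e_coeff z 0) + cmod (e_coeff z 0 - 1 / deriv h \<omega>)"
      using norm_triangle_ineq2[of "1 / deriv h \<omega>" "e_coeff z 0"]
      unfolding norm_minus_commute[of "1 / deriv h \<omega>"] by linarith
    ultimately have D: "cmod (1 / deriv h \<omega>) \<le> 4 * M" using est[of 0] by simp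
    show "\<exists>D. \<tau>' < cmod (Phi L \<psi> \<phi> z) \<and> cmod (Phi L \<psi> \<phi> z) < 1 \<and>
       deriv (Phi L \<psi> \<phi>) z = deriv \<phi> z * D \<and> cmod D \<le> 4 * M \<and>
       (\<forall>j. cmod (e_coeff z j - D * Phi L \<psi> \<phi> z ^ j) \<le> 4 * M * \<tau> ^ j)"
    proof (intro exI[of _ "1 / deriv h \<omega>"] conjI allI)
      show "\<tau>' < cmod (Phi L \<psi> \<phi> z)" "cmod (Phi L \<psi> \<phi> z) < 1"
        using S(5) w(1) by (auto simp: Ph[OF zV] \<omega>_def)
      show "deriv (Phi L \<psi> \<phi>) z = deriv \<phi> z * (1 / deriv h \<omega>)" using dPh[OF zV] by (simp add: \<omega>_def)
      show "cmod (1 / deriv h \<omega>) \<le> 4 * M" by (rule D)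
      fix j
      have "2 * M * \<tau> ^ j \<le> 4 * M * \<tau> ^ j" using M t by (intro mult_right_mono) auto
      then show "cmod (e_coeff z j - 1 / deriv h \<omega> * Phi L \<psi> \<phi> z ^ j) \<le> 4 * M * \<tau> ^ j"
        using est[of j] by (simp add: Ph[OF zV] \<omega>_def)
    qed
  qed
qed

end

context curve_ops
begin

text \<open>After division three errors remain: \<open>e_coeff\<close> against its residue term,
  with ratio at most \<open>\<tau> / \<tau>'\<close>; \<open>d n n\<close> against
  \<open>sqrt (n + 1)\<close>, with ratio \<open>r\<close>; and the tail, again with ratio
  \<open>r\<close>. The factor \<open>deriv \<phi> z\<close> is kept in the bound and estimated only
  once a compact set is fixed.\<close>

lemma asymptotics_local:
  assumes z0: "z0 \<in> Sigma_one L \<psi> \<phi>"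
  obtains V \<delta> C where "open V" "z0 \<in> V" "0 < \<delta>" "\<delta> < 1" "0 \<le> C"
    "\<And>n z. z \<in> V \<Longrightarrow> cmod (poly (p n) z / (of_real (sqrt (real n + 1)) * Phi L \<psi> \<phi> z ^ n) - deriv (Phi L \<psi> \<phi>) z)
        \<le> cmod (deriv \<phi> z) * C * \<delta> ^ n"
proof -
  obtain V \<tau> \<tau>' M where V: "open V" "z0 \<in> V" "V \<subseteq> G" and t: "0 < \<tau>" "\<tau> < \<tau>'" and M: "0 < M"
    and ex: "\<And>z. z \<in> V \<Longrightarrow> \<exists>D. \<tau>' < cmod (Phi L \<psi> \<phi> z) \<and> cmod (Phi L \<psi> \<phi> z) < 1 \<and>
       deriv (Phi L \<psi> \<phi>) z = deriv \<phi> z * D \<and> cmod D \<le> M \<and>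
       (\<forall>j. cmod (e_coeff z j - D * Phi L \<psi> \<phi> z ^ j) \<le> M * \<tau> ^ j)"
    by (rule Sigma_one_local[OF z0]) blast
  obtain C r where C: "0 \<le> C" "0 < r" "r < 1" and d: "\<And>n j. n < j \<Longrightarrow> cmod (d n j) \<le> C * r ^ j"
    and dn: "\<And>n. cmod (d n n - of_real (sqrt (real n + 1))) \<le> C * r ^ n" by (rule d_bounds) blast
  define \<delta> where "\<delta> = max r (\<tau> / \<tau>')"
  have "\<tau> / \<tau>' < 1" using t by (simp add: field_simps)
  then have del: "0 < \<delta>" "\<delta> < 1" "r \<le> \<delta>" "\<tau> / \<tau>' \<le> \<delta>" using C t by (auto simp: \<delta>_def)
  define B where "B = M * (1 + C) + M * C + 2 * M * C / (1 - r)"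
  have B: "0 \<le> B" using M C by (simp add: B_def)
  have main: "cmod (poly (p n) z / (of_real (sqrt (real n + 1)) * Phi L \<psi> \<phi> z ^ n) - deriv (Phi L \<psi> \<phi>) z)
        \<le> cmod (deriv \<phi> z) * B * \<delta> ^ n" if zV: "z \<in> V" for n z
  proof -
    define \<omega> where "\<omega> = Phi L \<psi> \<phi> z"
    have zG: "z \<in> G" using zV V by blast
    obtain D where w: "\<tau>' < cmod \<omega>" "cmod \<omega> < 1" and D: "deriv (Phi L \<psi> \<phi>) z = deriv \<phi> z * D" "cmod D \<le> M"
      and e: "\<And>j. cmod (e_coeff z j - D * \<omega> ^ j) \<le> M * \<tau> ^ j"
      using ex[OF zV] unfolding \<omega>_def by blast
    have w0: "0 < cmod \<omega>" using w t by linarith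
    then have wn: "\<omega> \<noteq> 0" by auto
    \<comment> \<open>The tail is estimated with the base \<open>|\<omega>|\<close> belonging to
      this \<open>z\<close>, so that division by \<open>\<omega> ^ n\<close> leaves exactly
      \<open>r ^ n\<close>.\<close>
    have eb: "cmod (e_coeff z j) \<le> (2 * M) * cmod \<omega> ^ j" for j
    proof -
      have "cmod (e_coeff z j) \<le> cmod (e_coeff z j - D * \<omega> ^ j) + cmod (D * \<omega> ^ j)"
        using norm_triangle_ineq2[of "e_coeff z j" "D * \<omega> ^ j"] by linarith
      also have "\<dots> \<le> M * cmod \<omega> ^ j + M * cmod \<omega> ^ j"
      proof (rule add_mono)
        have "M * \<tau> ^ j \<le> M * cmod \<omega> ^ j" using M t w by (intro mult_left_mono power_mono) auto
        then show "cmod (e_coeff z j - D * \<omega> ^ j) \<le> M * cmod \<omega> ^ j" using e[of j] by linarith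
        show "cmod (D * \<omega> ^ j) \<le> M * cmod \<omega> ^ j"
          unfolding norm_mult norm_power using D by (intro mult_right_mono) auto
      qed
      finally show ?thesis by simp
    qed
    define s where "s = complex_of_real (sqrt (real n + 1))"
    have s1: "1 \<le> cmod s" "s \<noteq> 0" by (auto simp: s_def)
    define T where "T = poly (p n) z / deriv \<phi> z - e_coeff z n * d n n"
    have T: "cmod T \<le> 2 * M * C / (1 - r) * (cmod \<omega> * r) ^ n"
      unfolding T_def by (rule expansion_tail[OF zG C d eb]) (use M w w0 in auto)
    have dphi: "deriv \<phi> z \<noteq> 0" by (rule deriv_phi_nonzero[OF zG])
    have pT: "poly (p n) z = deriv \<phi> z * (e_coeff z n * d n n + T)" using dphi by (simp add: T_def)
    have split: "(e_coeff z n * d n n + T) / (s * \<omega> ^ n) - D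
        = (e_coeff z n - D * \<omega> ^ n) / \<omega> ^ n * (d n n / s) + D * ((d n n - s) / s) + T / (s * \<omega> ^ n)"
      using s1 wn by (simp add: field_simps)
    have id: "poly (p n) z / (s * \<omega> ^ n) - deriv (Phi L \<psi> \<phi>) z =
       deriv \<phi> z * ((e_coeff z n - D * \<omega> ^ n) / \<omega> ^ n * (d n n / s) + D * ((d n n - s) / s) + T / (s * \<omega> ^ n))"
      unfolding split[symmetric] D(1) pT by (simp add: right_diff_distrib)
    have le1: "cmod ((d n n - s) / s) \<le> C * r ^ n"
    proof -
      have "cmod (d n n - s) / cmod s \<le> cmod (d n n - s) / 1"
        using s1 by (intro divide_left_mono) auto
      then show ?thesis using dn[of n] by (simp add: norm_divide s_def)
    qed
    have r1: "C * r ^ n \<le> C" using C power_le_one[of r n] mult_left_le[of "r ^ n" C] by simp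
    have "d n n / s = 1 + (d n n - s) / s" using s1 by (simp add: field_simps)
    then have "cmod (d n n / s) \<le> cmod 1 + cmod ((d n n - s) / s)" by (metis norm_triangle_ineq)
    then have le2: "cmod (d n n / s) \<le> 1 + C" using le1 r1 by simp
    have rd: "r ^ n \<le> \<delta> ^ n" using C del by (intro power_mono) auto
    have a1: "cmod ((e_coeff z n - D * \<omega> ^ n) / \<omega> ^ n * (d n n / s)) \<le> M * \<delta> ^ n * (1 + C)"
      unfolding norm_mult
    proof (rule mult_mono[OF _ le2])
      have "cmod ((e_coeff z n - D * \<omega> ^ n) / \<omega> ^ n) \<le> M * \<tau> ^ n / cmod \<omega> ^ n"
        unfolding norm_divide norm_power using e[of n] by (intro divide_right_mono) auto
      also have "\<dots> = M * (\<tau> / cmod \<omega>) ^ n" by (simp add: power_divide)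
      also have "\<tau> / cmod \<omega> \<le> \<tau> / \<tau>'" using w t w0 by (intro divide_left_mono) auto
      then have "\<tau> / cmod \<omega> \<le> \<delta>" using del by linarith
      then have "M * (\<tau> / cmod \<omega>) ^ n \<le> M * \<delta> ^ n" using M t w0 by (intro mult_left_mono power_mono) auto
      finally show "cmod ((e_coeff z n - D * \<omega> ^ n) / \<omega> ^ n) \<le> M * \<delta> ^ n" .
    qed (use M del in auto)
    have a2: "cmod (D * ((d n n - s) / s)) \<le> M * (C * \<delta> ^ n)"
    proof -
      have "C * r ^ n \<le> C * \<delta> ^ n" using rd C by (intro mult_left_mono) auto
      then show ?thesis unfolding norm_mult using D le1 M by (intro mult_mono) auto
    qed
    have a3: "cmod (T / (s * \<omega> ^ n)) \<le> 2 * M * C / (1 - r) * \<delta> ^ n"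
    proof -
      have "cmod (T / (s * \<omega> ^ n)) = cmod T / cmod \<omega> ^ n / cmod s"
        by (simp add: norm_divide norm_mult norm_power)
      also have "\<dots> \<le> cmod T / cmod \<omega> ^ n / 1" using s1 by (intro divide_left_mono) auto
      also have "\<dots> \<le> 2 * M * C / (1 - r) * (cmod \<omega> * r) ^ n / cmod \<omega> ^ n"
        using divide_right_mono[OF T, of "cmod \<omega> ^ n"] by simp
      also have "\<dots> = 2 * M * C / (1 - r) * r ^ n" using w0 by (simp add: power_mult_distrib)
      also have "\<dots> \<le> 2 * M * C / (1 - r) * \<delta> ^ n" using rd M C by (intro mult_left_mono) auto
      finally show ?thesis .
    qed
    have "cmod ((e_coeff z n - D * \<omega> ^ n) / \<omega> ^ n * (d n n / s) + D * ((d n n - s) / s) + T / (s * \<omega> ^ n))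
      \<le> M * \<delta> ^ n * (1 + C) + M * (C * \<delta> ^ n) + 2 * M * C / (1 - r) * \<delta> ^ n"
      by (intro norm_triangle_le add_mono a1 a2 a3)
    also have "\<dots> = B * \<delta> ^ n" by (simp add: B_def algebra_simps)
    finally show ?thesis
      unfolding \<omega>_def[symmetric] s_def[symmetric] id norm_mult mult.assoc by (rule mult_left_mono) simp
  qed
  show thesis by (rule that[OF V(1,2) del(1,2) B main])
qed

lemma asymptotics_compact:
  assumes E: "compact E" "E \<subseteq> Sigma_one L \<psi> \<phi>"
  shows "\<exists>\<delta>::real. 0 < \<delta> \<and> \<delta> < 1 \<and> (\<exists>C::real. \<forall>n. \<forall>z\<in>E.
    cmod (poly (p n) z / (of_real (sqrt (real n + 1)) * Phi L \<psi> \<phi> z ^ n) - deriv (Phi L \<psi> \<phi>) z) \<le> C * \<delta> ^ n)"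
proof -
  define X where "X = (\<lambda>n z. cmod (poly (p n) z / (of_real (sqrt (real n + 1)) * Phi L \<psi> \<phi> z ^ n)
    - deriv (Phi L \<psi> \<phi>) z))"
  have "\<exists>V \<delta> C. open V \<and> x \<in> V \<and> 0 < \<delta> \<and> \<delta> < 1 \<and> 0 \<le> C \<and>
      (\<forall>n. \<forall>z\<in>V. X n z \<le> cmod (deriv \<phi> z) * C * \<delta> ^ n)" if x: "x \<in> E" for x
  proof -
    have "x \<in> Sigma_one L \<psi> \<phi>" using E x by blast
    then show ?thesis by (rule asymptotics_local) (unfold X_def, blast)
  qed
  then obtain V \<delta> C where V: "\<And>x. x \<in> E \<Longrightarrow> open (V x) \<and> x \<in> V x \<and> 0 < \<delta> x \<and> \<delta> x < 1 \<and> 0 \<le> C x \<and>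
      (\<forall>n. \<forall>z\<in>V x. X n z \<le> cmod (deriv \<phi> z) * C x * \<delta> x ^ n)" by metis
  have oV: "open (V x)" if "x \<in> E" for x using V[OF that] by blast
  have cV: "E \<subseteq> (\<Union>x\<in>E. V x)" using V by blast
  obtain F where F: "F \<subseteq> E" "finite F" "E \<subseteq> (\<Union>x\<in>F. V x)"
    by (rule compactE_image[OF E(1) oV cV])
  have EG: "E \<subseteq> G" using E(2) by (auto simp: Sigma_one_def Sigma_all_def)
  have "deriv \<phi> holomorphic_on G" by (rule holomorphic_deriv[OF phi(1) curve_facts(4)])
  then have "continuous_on E (deriv \<phi>)" using EG by (meson holomorphic_on_imp_continuous_on continuous_on_subset)
  then have "bounded (deriv \<phi> ` E)" using E(1) by (intro compact_imp_bounded compact_continuous_image)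
  then obtain B where B: "B > 0" "\<And>z. z \<in> E \<Longrightarrow> cmod (deriv \<phi> z) \<le> B"
    unfolding bounded_pos by (metis image_eqI)
  \<comment> \<open>The value 1 / 2 keeps the maximum defined when \<open>E\<close>, and with it
    \<open>F\<close>, is empty.\<close>
  define q where "q = Max (insert (1 / 2) (\<delta> ` F))"
  have "q \<in> insert (1 / 2) (\<delta> ` F)" unfolding q_def by (rule Max_in) (use F in auto)
  then have q: "0 < q" "q < 1" using V F(1) by auto
  have qx: "\<delta> x \<le> q" if "x \<in> F" for x unfolding q_def by (rule Max_ge) (use F that in auto)
  have "X n z \<le> (B * sum C F) * q ^ n" if z: "z \<in> E" for n z
  proof -
    obtain x where x: "x \<in> F" "z \<in> V x" using F(3) z by blast
    have xE: "x \<in> E" using x F by blast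
    have "C x \<le> sum C F" by (rule member_le_sum) (use x F V in auto)
    then have "cmod (deriv \<phi> z) * C x * \<delta> x ^ n \<le> B * sum C F * q ^ n"
      using B(1) B(2)[OF z] V[OF xE] q qx[OF x(1)] by (intro mult_mono power_mono mult_nonneg_nonneg) auto
    moreover have "X n z \<le> cmod (deriv \<phi> z) * C x * \<delta> x ^ n" using V[OF xE] x(2) by blast
    ultimately show ?thesis by linarith
  qed
  then show ?thesis using q unfolding X_def by blast
qed

end

theorem theorem1:
  fixes L :: "complex set" and p :: "nat \<Rightarrow> complex poly" and \<psi> \<phi> :: "complex \<Rightarrow> complex"
  assumes "analytic_jordan_curve L"
    and "orthonormal_polys L p"
    and "exterior_map L \<psi>"
    and "interior_map L \<phi>"
  shows "(\<forall>E. compact E \<and> E \<subseteq> Sigma_one L \<psi> \<phi> \<longrightarrow>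
            (\<exists>\<delta>::real. 0 < \<delta> \<and> \<delta> < 1 \<and>
              (\<exists>C::real. \<forall>\<^sub>F n in sequentially. \<forall>z\<in>E.
                 norm (poly (p n) z / (of_real (sqrt (real n + 1)) * Phi L \<psi> \<phi> z ^ n)
                       - deriv (Phi L \<psi> \<phi>) z) \<le> C * \<delta> ^ n)))
       \<and> (\<forall>z \<in> inside L.
            limsup (\<lambda>n. ereal (root n (norm (poly (p n) z)))) = ereal (radius L \<psi> \<phi> z))"
proof -
  interpret curve_ops L \<psi> \<phi> p using assms by unfold_locales
  show ?thesis
  proof (intro conjI allI impI ballI)
    fix E assume E: "compact E \<and> E \<subseteq> Sigma_one L \<psi> \<phi>"
    obtain \<delta> C :: real where "0 < \<delta>" "\<delta> < 1" "\<forall>n. \<forall>z\<in>E.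
        cmod (poly (p n) z / (of_real (sqrt (real n + 1)) * Phi L \<psi> \<phi> z ^ n) - deriv (Phi L \<psi> \<phi>) z) \<le> C * \<delta> ^ n"
      using asymptotics_compact E by blast
    then show "\<exists>\<delta>::real. 0 < \<delta> \<and> \<delta> < 1 \<and>
              (\<exists>C::real. \<forall>\<^sub>F n in sequentially. \<forall>z\<in>E.
                 norm (poly (p n) z / (of_real (sqrt (real n + 1)) * Phi L \<psi> \<phi> z ^ n)
                       - deriv (Phi L \<psi> \<phi>) z) \<le> C * \<delta> ^ n)"
      by (intro exI[of _ \<delta>] conjI exI[of _ C] always_eventually)
  next
    fix z assume "z \<in> inside L"
    then show "limsup (\<lambda>n. ereal (root n (norm (poly (p n) z)))) = ereal (radius L \<psi> \<phi> z)"
      using limsup_upper limsup_lower by (intro antisym) auto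
  qed
qed

end
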